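(* Let $\Omega$, $\{\mathcal T_h\}_{h>0}$, $\mathcal N_h$, $Q_h$, $\boldsymbol U_h$, $i_{Q_h}$, $\boldsymbol i_{\boldsymbol U_h}$, $(\cdot,\cdot)_h$, $\|\cdot\|_h$, $\gamma>0$, $\alpha\ge0$ be as in the context. Assume in addition that $\mathcal T_h$ has the property: if $\boldsymbol v_h\in\boldsymbol U_h$ with $|\boldsymbol v_h(\boldsymbol a)|\ge1$ for all $\boldsymbol a\in\mathcal N_h$, then $\|\nabla\,\boldsymbol i_{\boldsymbol U_h}(\boldsymbol v_h/|\boldsymbol v_h|)\|\le\|\nabla\boldsymbol v_h\|$. Let $\boldsymbol u_0\in\boldsymbol H^1(\Omega)=(H^1(\Omega))^M$ with $|\boldsymbol u_0|=1$ a.e. in $\Omega$, and let $\boldsymbol u_h^0=\boldsymbol u_{0h}\in\boldsymbol U_h$ satisfy $|\boldsymbol u_{0h}(\boldsymbol a)|=1$ for all $\boldsymbol a\in\mathcal N_h$ and $\|\nabla\boldsymbol u_{0h}\|\le\|\nabla\boldsymbol u_0\|$. Let $T>0$, $N\ge1$ an integer, $k=T/N$, and let $(\boldsymbol u_h^{n+1},q_h^{n+1})\in\boldsymbol U_h\times Q_h$, $n=0,\dots,N-1$, solve, with $\delta_t\boldsymbol u_h^{n+1}=(\boldsymbol u_h^{n+1}-\boldsymbol u_h^n)/k$, $$(\delta_t\boldsymbol u_h^{n+1},\bar{\boldsymbol u}_h)_h+\gamma(\nabla\boldsymbol u_h^{n+1},\nabla\bar{\boldsymbol u}_h)+\gamma\Big(q_h^{n+1},i_{Q_h}\Big(\frac{\boldsymbol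 u_h^n}{|\boldsymbol u_h^n|}\cdot\bar{\boldsymbol u}_h\Big)\Big)+\alpha(\boldsymbol u_h^n\times\delta_t\boldsymbol u_h^{n+1},\bar{\boldsymbol u}_h)_h=0,$$ $$(i_{Q_h}(\boldsymbol u_h^n\cdot\delta_t\boldsymbol u_h^{n+1}),\bar q_h)=0,$$ for all $(\bar{\boldsymbol u}_h,\bar q_h)\in\boldsymbol U_h\times Q_h$. Then, for every $m\in\{0,\dots,N-1\}$, $$\sum_{n=0}^m k\Big(\|\delta_t\boldsymbol u_h^{n+1}\|_h^2+\frac{\gamma k}{2}\|\nabla\delta_t\boldsymbol u_h^{n+1}\|^2\Big)+\frac{\gamma}{2}\|\nabla\boldsymbol u_h^{m+1}\|^2=\frac{\gamma}{2}\|\nabla\boldsymbol u_h^0\|^2 .$$ Moreover, the Lagrange multiplier satisfies $$\max_{n=1,\dots,N}\|q_h^n\|_{(H^1(\Omega)\cap L^\infty(\Omega))'}\le C\,(1+\|\nabla\boldsymbol u_h^0\|)\,\|\nabla\boldsymbol u_h^0\|,$$ where $C>0$ is a constant independent of $h$ and $k$.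
   Context: $M\in\{2,3\}$; $\Omega\subset\mathbb R^M$ is a bounded domain with polygonal/polyhedral Lipschitz boundary; $\{\mathcal T_h\}_{h>0}$ is a shape-regular, quasi-uniform family of triangulations of $\overline\Omega$ into triangles ($M=2$) or tetrahedra ($M=3$), $h=\max_{K\in\mathcal T_h}\operatorname{diam}K$; $\mathcal N_h$ is the set of all nodes (vertices) of $\mathcal T_h$. $X_h=\{v_h\in C^0(\overline\Omega): v_h|_K \text{ is a polynomial of degree}\le 1\ \forall K\in\mathcal T_h\}$ with nodal (Lagrange) basis $\{\varphi_{\boldsymbol a}\}_{\boldsymbol a\in\mathcal N_h}$; $Q_h=X_h$, $\boldsymbol U_h=(X_h)^M$. $i_{Q_h}$ and $\boldsymbol i_{\boldsymbol U_h}$ are nodal interpolation into $Q_h$ and $\boldsymbol U_h$: $i(f)=\sum_{\boldsymbol a}f(\boldsymbol a)\varphi_{\boldsymbol a}$; they only use nodal values, so $i_{Q_h}(\frac{\boldsymbol v_h}{|\boldsymbol v_h|}\cdot\boldsymbol w_h)=\sum_{\boldsymbol a}\frac{\boldsymbol v_h(\boldsymbol a)}{|\boldsymbol v_h(\boldsymbol a)|}\cdot\boldsymbol w_h(\boldsymbol a)\varphi_{\boldsymbol a}$ and $\boldsymbol i_{\boldsymbol U_h}(\boldsymbol v_h/|\boldsymbol v_h|)=\sum_{\boldsymbol a}\frac{\boldsymbol v_h(\boldsymbol a)}{|\boldsymbol v_h(\boldsymbol a)|}\varphi_{\boldsymbol a}$ make sense whenever $\boldsymbol v_h$ is nonzero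 at all nodes. $(\cdot,\cdot)$ and $\|\cdot\|$ are the $L^2(\Omega)$ inner product and norm (for scalars, vectors, matrices). The lumped product is $(\boldsymbol v,\boldsymbol w)_h=\int_\Omega i_{Q_h}(\boldsymbol v\cdot\boldsymbol w)=\sum_{\boldsymbol a\in\mathcal N_h}\boldsymbol v(\boldsymbol a)\cdot\boldsymbol w(\boldsymbol a)\int_\Omega\varphi_{\boldsymbol a}$, with norm $\|\boldsymbol v\|_h=\sqrt{(\boldsymbol v,\boldsymbol v)_h}$. $\gamma>0$ and $\alpha\ge0$ are real constants; if $M=2$ then $\alpha=0$ (the cross-product term is absent). For $q_h\in Q_h$, $$\|q_h\|_{(H^1(\Omega)\cap L^\infty(\Omega))'}=\sup_{q\in H^1(\Omega)\cap L^\infty(\Omega)\setminus\{0\}}\frac{(q_h,q)}{\|\nabla q\|+\|q\|_{L^\infty(\Omega)}} .$$ *)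

theory Defs
  imports "HOL-Analysis.Analysis" "HOL-Probability.Essential_Supremum"
begin

section \<open>Function spaces on a domain\<close>

definition l2_inner ::
    "(real^'n) set \<Rightarrow> (real^'n \<Rightarrow> 'b::real_inner) \<Rightarrow> (real^'n \<Rightarrow> 'b) \<Rightarrow> real" where
  "l2_inner \<Omega> f g = (\<integral>x. f x \<bullet> g x \<partial>lebesgue_on \<Omega>)"

definition l2_norm :: "(real^'n) set \<Rightarrow> (real^'n \<Rightarrow> 'b::real_inner) \<Rightarrow> real" where
  "l2_norm \<Omega> f = sqrt (l2_inner \<Omega> f f)"

definition L2 :: "(real^'n) set \<Rightarrow> (real^'n \<Rightarrow> 'b::euclidean_space) set" where
  "L2 \<Omega> = {f \<in> borel_measurable (lebesgue_on \<Omega>). integrable (lebesgue_on \<Omega>) (\<lambda>x. (norm (f x))\<^sup>2)}"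

definition Linf :: "(real^'n) set \<Rightarrow> (real^'n \<Rightarrow> real) set" where
  "Linf \<Omega> = {f \<in> borel_measurable (lebesgue_on \<Omega>). esssup (lebesgue_on \<Omega>) (\<lambda>x. ereal \<bar>f x\<bar>) < \<infinity>}"

definition linf_norm :: "(real^'n) set \<Rightarrow> (real^'n \<Rightarrow> real) \<Rightarrow> real" where
  "linf_norm \<Omega> f = real_of_ereal (esssup (lebesgue_on \<Omega>) (\<lambda>x. ereal \<bar>f x\<bar>))"

definition partial_deriv :: "'n \<Rightarrow> (real^'n \<Rightarrow> real) \<Rightarrow> real^'n \<Rightarrow> real" where
  "partial_deriv i f x = frechet_derivative f (at x) (axis i 1)"

primrec C_k :: "nat \<Rightarrow> (real^'n \<Rightarrow> real) \<Rightarrow> bool" where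
  "C_k 0 f \<longleftrightarrow> continuous_on UNIV f"
| "C_k (Suc k) f \<longleftrightarrow> (\<forall>x. f differentiable (at x)) \<and> (\<forall>i. C_k k (partial_deriv i f))"

definition test_functions :: "(real^'n) set \<Rightarrow> (real^'n \<Rightarrow> real) set" where
  "test_functions \<Omega> =
     {\<phi>. (\<forall>k. C_k k \<phi>) \<and> (\<exists>S. compact S \<and> S \<subseteq> \<Omega> \<and> (\<forall>x. x \<notin> S \<longrightarrow> \<phi> x = 0))}"

definition loc_integrable :: "(real^'n) set \<Rightarrow> (real^'n \<Rightarrow> 'b::euclidean_space) \<Rightarrow> bool" where
  "loc_integrable \<Omega> f \<longleftrightarrow> (\<forall>S. compact S \<and> S \<subseteq> \<Omega> \<longrightarrow> set_integrable lebesgue S f)"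

definition has_weak_gradient ::
    "(real^'n) set \<Rightarrow> (real^'n \<Rightarrow> real) \<Rightarrow> (real^'n \<Rightarrow> real^'n) \<Rightarrow> bool" where
  "has_weak_gradient \<Omega> v G \<longleftrightarrow> loc_integrable \<Omega> v \<and> loc_integrable \<Omega> G \<and>
     (\<forall>\<phi>\<in>test_functions \<Omega>. \<forall>i.
        l2_inner \<Omega> v (partial_deriv i \<phi>) = - l2_inner \<Omega> (\<lambda>x. G x $ i) \<phi>)"

text \<open>The weak gradient is unique only up to null sets; \<open>SOME\<close> picks a representative, which
  does not affect any of the integrals below. The same gradient is used for Sobolev functions
  and for finite element functions.\<close>

definition wgrad :: "(real^'n) set \<Rightarrow> (real^'n \<Rightarrow> real) \<Rightarrow> real^'n \<Rightarrow> real^'n" where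
  "wgrad \<Omega> v = (SOME G. has_weak_gradient \<Omega> v G)"

text \<open>The inner product on \<open>real^'n^'n\<close> is the Frobenius product, so \<^const>\<open>l2_inner\<close> and
  \<^const>\<open>l2_norm\<close> apply to these matrix fields as they stand.\<close>

definition wgrad_vec :: "(real^'n) set \<Rightarrow> (real^'n \<Rightarrow> real^'n) \<Rightarrow> real^'n \<Rightarrow> real^'n^'n" where
  "wgrad_vec \<Omega> v x = (\<chi> i. wgrad \<Omega> (\<lambda>y. v y $ i) x)"

definition H1 :: "(real^'n) set \<Rightarrow> (real^'n \<Rightarrow> real) set" where
  "H1 \<Omega> = {v \<in> L2 \<Omega>. \<exists>G\<in>L2 \<Omega>. has_weak_gradient \<Omega> v G}"

definition H1_vec :: "(real^'n) set \<Rightarrow> (real^'n \<Rightarrow> real^'n) set" where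
  "H1_vec \<Omega> = {v. \<forall>i. (\<lambda>x. v x $ i) \<in> H1 \<Omega>}"

text \<open>The supremum is taken in the extended reals. Elements of \<open>H1 \<Omega> \<inter> Linf \<Omega>\<close> are classes
  modulo null sets, so nonzero means not almost everywhere zero.\<close>

definition dual_norm :: "(real^'n) set \<Rightarrow> (real^'n \<Rightarrow> real) \<Rightarrow> ereal" where
  "dual_norm \<Omega> p =
     (SUP q \<in> {q \<in> H1 \<Omega> \<inter> Linf \<Omega>. \<not> (AE x in lebesgue_on \<Omega>. q x = 0)}.
        ereal (l2_inner \<Omega> p q / (l2_norm \<Omega> (wgrad \<Omega> q) + linf_norm \<Omega> q)))"


section \<open>Domains and triangulations\<close>

text \<open>Near each boundary point, \<open>\<Omega>\<close> is the part below the graph of a Lipschitz function over the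
  hyperplane orthogonal to some unit vector \<open>d\<close>.\<close>

definition lipschitz_boundary :: "(real^'n) set \<Rightarrow> bool" where
  "lipschitz_boundary \<Omega> \<longleftrightarrow>
     (\<forall>x\<in>frontier \<Omega>. \<exists>d r L. \<exists>g :: real^'n \<Rightarrow> real.
        norm d = 1 \<and> r > 0 \<and> L-lipschitz_on {z. z \<bullet> d = 0} g \<and>
        \<Omega> \<inter> ball x r = {y \<in> ball x r. y \<bullet> d < g (y - (y \<bullet> d) *\<^sub>R d)})"

definition polyhedral_boundary :: "(real^'n) set \<Rightarrow> bool" where
  "polyhedral_boundary \<Omega> \<longleftrightarrow>
     (\<exists>F. finite F \<and> (\<forall>P\<in>F. polytope P \<and> aff_dim P = int CARD('n) - 1) \<and> frontier \<Omega> = \<Union>F)"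

definition polyhedral_lipschitz_domain :: "(real^'n) set \<Rightarrow> bool" where
  "polyhedral_lipschitz_domain \<Omega> \<longleftrightarrow>
     \<Omega> \<noteq> {} \<and> open \<Omega> \<and> connected \<Omega> \<and> bounded \<Omega> \<and> polyhedral_boundary \<Omega> \<and> lipschitz_boundary \<Omega>"

definition is_mesh :: "(real^'n) set \<Rightarrow> (real^'n) set set \<Rightarrow> bool" where
  "is_mesh \<Omega> \<T> \<longleftrightarrow> triangulation \<T> \<and> (\<forall>K\<in>\<T>. int CARD('n) simplex K) \<and> \<Union>\<T> = closure \<Omega>"

definition in_diameter :: "(real^'n) set \<Rightarrow> real" where
  "in_diameter K = Sup {2 * r | r x. r \<ge> 0 \<and> cball x r \<subseteq> K}"

text \<open>Families of meshes are indexed by the mesh sizes in a set \<open>\<H>\<close> of positive reals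
  (a bounded domain has no mesh of arbitrarily large size).\<close>

definition mesh_family :: "(real^'n) set \<Rightarrow> real set \<Rightarrow> (real \<Rightarrow> (real^'n) set set) \<Rightarrow> bool" where
  "mesh_family \<Omega> \<H> \<T> \<longleftrightarrow>
     (\<forall>h\<in>\<H>. h > 0 \<and> is_mesh \<Omega> (\<T> h) \<and> h = Max (diameter ` \<T> h))"

definition shape_regular :: "real set \<Rightarrow> (real \<Rightarrow> (real^'n) set set) \<Rightarrow> bool" where
  "shape_regular \<H> \<T> \<longleftrightarrow>
     (\<exists>\<sigma>>0. \<forall>h\<in>\<H>. \<forall>K\<in>\<T> h. diameter K \<le> \<sigma> * in_diameter K)"

definition quasi_uniform :: "real set \<Rightarrow> (real \<Rightarrow> (real^'n) set set) \<Rightarrow> bool" where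
  "quasi_uniform \<H> \<T> \<longleftrightarrow> (\<exists>c>0. \<forall>h\<in>\<H>. \<forall>K\<in>\<T> h. c * h \<le> diameter K)"


section \<open>Finite element spaces\<close>

definition nodes :: "(real^'n) set set \<Rightarrow> (real^'n) set" where
  "nodes \<T> = {a. \<exists>K\<in>\<T>. a extreme_point_of K}"

text \<open>Functions on the closed domain \<open>\<Union>\<T>\<close> are represented by their extension by zero.\<close>

definition X_h :: "(real^'n) set set \<Rightarrow> (real^'n \<Rightarrow> real) set" where
  "X_h \<T> = {v. continuous_on (\<Union>\<T>) v \<and> (\<forall>K\<in>\<T>. \<exists>b c. \<forall>x\<in>K. v x = b \<bullet> x + c) \<and>
              (\<forall>x. x \<notin> \<Union>\<T> \<longrightarrow> v x = 0)}"

definition U_h :: "(real^'n) set set \<Rightarrow> (real^'n \<Rightarrow> real^'n) set" where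
  "U_h \<T> = {v. \<forall>i. (\<lambda>x. v x $ i) \<in> X_h \<T>}"

definition nodal_basis :: "(real^'n) set set \<Rightarrow> real^'n \<Rightarrow> real^'n \<Rightarrow> real" where
  "nodal_basis \<T> a = (THE v. v \<in> X_h \<T> \<and> (\<forall>b\<in>nodes \<T>. v b = (if b = a then 1 else 0)))"

definition nodal_interp ::
    "(real^'n) set set \<Rightarrow> (real^'n \<Rightarrow> 'b::real_vector) \<Rightarrow> real^'n \<Rightarrow> 'b" where
  "nodal_interp \<T> f x = (\<Sum>a\<in>nodes \<T>. nodal_basis \<T> a x *\<^sub>R f a)"

definition lumped_inner ::
    "(real^'n) set \<Rightarrow> (real^'n) set set \<Rightarrow> (real^'n \<Rightarrow> real^'n) \<Rightarrow> (real^'n \<Rightarrow> real^'n) \<Rightarrow> real" where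
  "lumped_inner \<Omega> \<T> v w = (\<integral>x. nodal_interp \<T> (\<lambda>y. v y \<bullet> w y) x \<partial>lebesgue_on \<Omega>)"

definition lumped_norm ::
    "(real^'n) set \<Rightarrow> (real^'n) set set \<Rightarrow> (real^'n \<Rightarrow> real^'n) \<Rightarrow> real" where
  "lumped_norm \<Omega> \<T> v = sqrt (lumped_inner \<Omega> \<T> v v)"

text \<open>At a zero of \<open>v\<close> the value is \<open>0\<close> by the convention \<open>inverse 0 = 0\<close>.\<close>

definition normalized :: "(real^'n \<Rightarrow> real^'n) \<Rightarrow> real^'n \<Rightarrow> real^'n" where
  "normalized v x = v x /\<^sub>R norm (v x)"

definition gradient_decreasing :: "(real^'n) set \<Rightarrow> (real^'n) set set \<Rightarrow> bool" where
  "gradient_decreasing \<Omega> \<T> \<longleftrightarrow>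
     (\<forall>v\<in>U_h \<T>. (\<forall>a\<in>nodes \<T>. norm (v a) \<ge> 1) \<longrightarrow>
        l2_norm \<Omega> (wgrad_vec \<Omega> (nodal_interp \<T> (normalized v))) \<le> l2_norm \<Omega> (wgrad_vec \<Omega> v))"


section \<open>The scheme\<close>

text \<open>The space dimension is the cardinality of an arbitrary finite index type \<open>'n\<close>. In dimension
  three, a bijection \<open>e :: 3 \<Rightarrow> 'n\<close> names the coordinate axes in the order used by the cross
  product; for \<open>'n = 3\<close> and \<open>e = id\<close> this is \<^const>\<open>cross3\<close>.\<close>

definition cross_axes :: "(3 \<Rightarrow> 'n) \<Rightarrow> real^'n \<Rightarrow> real^'n \<Rightarrow> real^'n" where
  "cross_axes e v w = (\<chi> i. cross3 (\<chi> j. v $ e j) (\<chi> j. w $ e j) $ inv e i)"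

lemma cross_axes_id: "cross_axes id v w = cross3 v w"
  by (simp add: cross_axes_def)

definition delta_t :: "real \<Rightarrow> (nat \<Rightarrow> real^'n \<Rightarrow> real^'n) \<Rightarrow> nat \<Rightarrow> real^'n \<Rightarrow> real^'n" where
  "delta_t k u n x = (u n x - u (n - 1) x) /\<^sub>R k"

definition scheme_solution ::
    "(real^'n) set \<Rightarrow> (real^'n) set set \<Rightarrow> (3 \<Rightarrow> 'n) \<Rightarrow> real \<Rightarrow> real \<Rightarrow> real \<Rightarrow> nat \<Rightarrow>
     (nat \<Rightarrow> real^'n \<Rightarrow> real^'n) \<Rightarrow> (nat \<Rightarrow> real^'n \<Rightarrow> real) \<Rightarrow> bool" where
  "scheme_solution \<Omega> \<T> e \<gamma> \<alpha> k N u q \<longleftrightarrow>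
     (\<forall>n<N. u (n + 1) \<in> U_h \<T> \<and> q (n + 1) \<in> X_h \<T> \<and>
        (\<forall>w\<in>U_h \<T>.
           lumped_inner \<Omega> \<T> (delta_t k u (n + 1)) w
           + \<gamma> * l2_inner \<Omega> (wgrad_vec \<Omega> (u (n + 1))) (wgrad_vec \<Omega> w)
           + \<gamma> * l2_inner \<Omega> (q (n + 1)) (nodal_interp \<T> (\<lambda>x. normalized (u n) x \<bullet> w x))
           + \<alpha> * lumped_inner \<Omega> \<T> (\<lambda>x. cross_axes e (u n x) (delta_t k u (n + 1) x)) w = 0) \<and>
        (\<forall>p\<in>X_h \<T>.
           l2_inner \<Omega> (nodal_interp \<T> (\<lambda>x. u n x \<bullet> delta_t k u (n + 1) x)) p = 0))"

end

theory Submission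
  imports Defs
begin

text \<open>At the nodes the second equation makes the increment orthogonal to the old value. Hence testing
  with the increment removes the multiplier and the cross product and gives the energy identity, and
  the nodal lengths cannot decrease. For the multiplier, let \<open>p\<close> be the \<open>L2\<close> projection of \<open>q\<close> and test
  with the interpolant \<open>w\<close> of \<open>p\<close> times the normalized old value: the lumped terms vanish nodally, so
  \<open>(q_h, q) = (q_h, p) = - (\<nabla> u, \<nabla> w)\<close>. The gradient of \<open>w\<close> is controlled once the \<open>L2\<close> projection is
  stable in the maximum norm (decay of the Neumann series of the mass matrix) and in \<open>H1\<close> (compare with
  the interpolant of averages over balls, with a Poincare inequality that holds up to the boundary
  because of the cone condition).\<close>

section \<open>Smooth test functions\<close>

text \<open>The dual norm tests the multiplier with functions outside the discrete space, while the
  scheme tests it only with discrete ones; hence the projection. The test field is a product: the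
  gradient of the normalized old value is known only in L2, so the other factor \<open>p\<close>
  must be bounded in the maximum norm, and the gradient of \<open>p\<close> must be in L2 as well.
  This explains the pairing of \<open>H1\<close> with \<open>Linf\<close> and the factor
  \<open>1 + E\<close> beside \<open>E\<close>, where \<open>E\<close> is the initial gradient norm:
  one \<open>E\<close> comes from the new value, the other from the normalized old value through
  \<open>gradient_decreasing\<close>, which applies because nodal lengths stay at least 1. The
  obstacle is uniformity in the mesh. Shape regularity and quasi-uniformity are condensed into one
  ratio \<rho>: every simplex contains a ball of radius \<rho> h. Volume counts do the rest. Meshes
  too coarse for the boundary charts are covered by an inverse estimate, since 1/h is bounded for
  them. As \<open>wgrad\<close> is chosen by \<open>SOME\<close>, weak gradients must be unique
  almost everywhere before the gradients of discrete functions can be computed; the smooth bumps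
  serve this purpose.\<close>

lemma partial_deriv_eqI:
  assumes "(f has_derivative f') (at x)"
  shows "partial_deriv i f x = f' (axis i 1)"
  using frechet_derivative_at[OF assms] by (simp add: partial_deriv_def)

lemma has_derivative_partial_deriv:
  fixes f :: "real^'n \<Rightarrow> real"
  assumes "f differentiable (at x)"
  shows "(f has_derivative (\<lambda>v. \<Sum>i\<in>UNIV. v $ i * partial_deriv i f x)) (at x)"
proof -
  let ?D = "frechet_derivative f (at x)"
  have d: "(f has_derivative ?D) (at x)"
    using assms frechet_derivative_works by blast
  then have l: "linear ?D" by (rule has_derivative_linear)
  have "?D v = (\<Sum>i\<in>UNIV. v $ i * partial_deriv i f x)" for v
  proof -
    have "?D v = ?D (\<Sum>i\<in>UNIV. v $ i *\<^sub>R axis i 1)"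
      by (metis (no_types, lifting) basis_expansion scalar_mult_eq_scaleR sum.cong)
    then show ?thesis
      by (simp add: linear_sum[OF l] linear_cmul[OF l] partial_deriv_def)
  qed
  then have "?D = (\<lambda>v. \<Sum>i\<in>UNIV. v $ i * partial_deriv i f x)" by blast
  with d show ?thesis by simp
qed

lemma C_k_Suc_imp: "C_k (Suc k) f \<Longrightarrow> C_k k f"
proof (induction k arbitrary: f)
  case 0
  then show ?case
    by (auto intro!: differentiable_imp_continuous_on simp: differentiable_on_def)
next
  case (Suc k)
  then have "C_k k (partial_deriv i f)" for i by (metis C_k.simps(2))
  with Suc.prems show ?case by simp
qed

lemma C_k_const [simp]: "C_k k (\<lambda>x::real^'n. c)"
proof (induction k arbitrary: c)
  case (Suc k)
  have "partial_deriv i (\<lambda>x::real^'n. c) = (\<lambda>x. 0)" for i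
    by (rule ext, subst partial_deriv_eqI[OF has_derivative_const]) simp
  with Suc.IH show ?case by (simp del: C_k.simps(1))
qed simp

lemma C_k_add: "C_k k f \<Longrightarrow> C_k k g \<Longrightarrow> C_k k (\<lambda>x. f x + g x)"
proof (induction k arbitrary: f g)
  case 0
  then show ?case by (auto intro: continuous_intros)
next
  case (Suc k)
  have "partial_deriv i (\<lambda>x. f x + g x) = (\<lambda>x. partial_deriv i f x + partial_deriv i g x)" for i
    using Suc.prems
    by (intro ext, subst partial_deriv_eqI[OF has_derivative_add])
       (auto simp: frechet_derivative_works partial_deriv_def)
  with Suc show ?case by auto
qed

lemma C_k_mult: "C_k k f \<Longrightarrow> C_k k g \<Longrightarrow> C_k k (\<lambda>x. f x * g x)"
proof (induction k arbitrary: f g)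
  case 0
  then show ?case by (auto intro: continuous_intros)
next
  case (Suc k)
  have eq: "partial_deriv i (\<lambda>x. f x * g x) =
      (\<lambda>x. f x * partial_deriv i g x + partial_deriv i f x * g x)" for i
    using Suc.prems
    by (intro ext, subst partial_deriv_eqI[OF has_derivative_mult])
       (auto simp: frechet_derivative_works partial_deriv_def)
  have "C_k k f" "C_k k g"
    using Suc.prems C_k_Suc_imp by blast+
  then have "C_k k (partial_deriv i (\<lambda>x. f x * g x))" for i
    using Suc unfolding eq by (intro C_k_add) auto
  with Suc.prems show ?case by auto
qed

lemma C_k_prod: "(\<And>i. i \<in> I \<Longrightarrow> C_k k (f i)) \<Longrightarrow> C_k k (\<lambda>x. \<Prod>i\<in>I. f i x)"
  by (induction I rule: infinite_finite_induct) (auto intro: C_k_mult)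

lemma partial_deriv_translate:
  assumes "f differentiable (at (x - v))"
  shows "partial_deriv i (\<lambda>x. f (x - v)) x = partial_deriv i f (x - v)"
proof -
  have "(f has_derivative frechet_derivative f (at (x - v))) (at (x - v))"
    using assms frechet_derivative_works by blast
  moreover have "((\<lambda>x. x - v) has_derivative (\<lambda>h. h)) (at x)"
    by (auto intro!: derivative_eq_intros)
  ultimately have "((\<lambda>x. f (x - v)) has_derivative (\<lambda>h. frechet_derivative f (at (x - v)) h)) (at x)"
    using has_derivative_compose by blast
  from partial_deriv_eqI[OF this] show ?thesis by (simp add: partial_deriv_def)
qed

lemma C_k_translate: "C_k k (f :: real^'n \<Rightarrow> real) \<Longrightarrow> C_k k (\<lambda>x. f (x - v))"
proof (induction k arbitrary: f)
  case 0
  then show ?case unfolding C_k.simps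
    by (intro continuous_on_compose2[of UNIV f "UNIV::(real^'n) set" "\<lambda>x. x - v"] continuous_intros) auto
next
  case (Suc k)
  have "partial_deriv i (\<lambda>x. f (x - v)) = (\<lambda>x. partial_deriv i f (x - v))" for i
    using Suc.prems by (intro ext partial_deriv_translate) simp
  moreover have "(\<lambda>x. f (x - v)) differentiable (at x)" for x
    using Suc.prems
    by (intro differentiable_compose[of f "\<lambda>x. x - v"] differentiable_diff differentiable_ident
          differentiable_const) auto
  ultimately show ?case using Suc by auto
qed

text \<open>The functions \<open>exp (- 1 / t) / t ^ m\<close>, cut off at zero, form a family
  closed under differentiation up to linear combinations, so smoothness of all orders follows by one
  induction over all \<open>m\<close>.\<close>

definition flat_exp :: "nat \<Rightarrow> real \<Rightarrow> real" where
  "flat_exp m t = (if t \<le> 0 then 0 else exp (- 1 / t) / t ^ m)"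

lemma flat_exp_nonneg: "flat_exp m t \<ge> 0"
  by (simp add: flat_exp_def)

lemma flat_exp_le_1: "flat_exp 0 t \<le> 1"
  by (simp add: flat_exp_def)

text \<open>In the variable \<open>s = 1 / t\<close> this is the decay of
  \<open>s ^ m / exp s\<close> at infinity.\<close>

lemma flat_exp_tendsto_0: "(flat_exp m \<longlongrightarrow> 0) (at_right 0)"
proof -
  have "((\<lambda>t. inverse t ^ m / exp (inverse t)) \<longlongrightarrow> 0) (at_right (0::real))"
    by (rule filterlim_compose[OF tendsto_power_div_exp_0 filterlim_inverse_at_top_right])
  then show ?thesis
    by (rule Lim_transform_eventually)
       (auto simp: eventually_at_filter flat_exp_def field_simps exp_minus divide_simps)
qed

text \<open>Only the origin needs care. There the right difference quotient of
  \<open>flat_exp m\<close> is \<open>flat_exp (m + 1)\<close>, which tends to zero, and the left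
  one vanishes.\<close>

lemma DERIV_flat_exp:
  "(flat_exp m has_real_derivative (flat_exp (m + 2) t - m * flat_exp (m + 1) t)) (at t)"
proof -
  consider "t > 0" | "t < 0" | "t = 0" by linarith
  then show ?thesis
  proof cases
    case 1
    have "((\<lambda>t. exp (- 1 / t) * inverse (t ^ m)) has_real_derivative
        (flat_exp (m + 2) t - m * flat_exp (m + 1) t)) (at t)"
    proof (cases m)
      case 0
      with 1 show ?thesis
        by (auto intro!: derivative_eq_intros simp: flat_exp_def field_simps power2_eq_square)
    next
      case (Suc j)
      with 1 show ?thesis
        by (auto intro!: derivative_eq_intros simp: flat_exp_def divide_simps)
           (cases j; simp add: algebra_simps)
    qed
    then show ?thesis
    proof (rule DERIV_cong_ev[THEN iffD2, OF refl _ refl, rotated])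
      show "\<forall>\<^sub>F x in nhds t. flat_exp m x = exp (- 1 / x) * inverse (x ^ m)"
        using eventually_nhds_in_open[of "{0<..}" t] 1
        by (auto elim!: eventually_mono simp: flat_exp_def divide_simps)
    qed
  next
    case 2
    have "((\<lambda>t. 0) has_real_derivative (flat_exp (m + 2) t - m * flat_exp (m + 1) t)) (at t)"
      using 2 by (simp add: flat_exp_def)
    then show ?thesis
    proof (rule DERIV_cong_ev[THEN iffD2, OF refl _ refl, rotated])
      show "\<forall>\<^sub>F x in nhds t. flat_exp m x = 0"
        using eventually_nhds_in_open[of "{..<0}" t] 2
        by (auto elim!: eventually_mono simp: flat_exp_def)
    qed
  next
    case 3
    have "((\<lambda>h. (flat_exp m (0 + h) - flat_exp m 0) / h) \<longlongrightarrow> 0) (at_right 0)"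
      by (rule Lim_transform_eventually[OF flat_exp_tendsto_0[of "Suc m"]])
         (auto simp: eventually_at_filter flat_exp_def)
    moreover have "((\<lambda>h. (flat_exp m (0 + h) - flat_exp m 0) / h) \<longlongrightarrow> 0) (at_left 0)"
      by (rule Lim_transform_eventually[OF tendsto_const])
         (auto simp: eventually_at_filter flat_exp_def)
    ultimately have "((\<lambda>h. (flat_exp m (0 + h) - flat_exp m 0) / h) \<longlongrightarrow> 0) (at 0)"
      by (rule filterlim_split_at_real[rotated])
    with 3 show ?thesis by (simp add: DERIV_def flat_exp_def)
  qed
qed

text \<open>\<open>m\<close> stays arbitrary in the induction, since a derivative involves the
  members \<open>m + 1\<close> and \<open>m + 2\<close>. The affine argument admits both signs of
  \<open>s\<close>, for the two opposite faces of a box.\<close>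

lemma C_k_flat_exp: "C_k k (\<lambda>x::real^'n. flat_exp m (s * x $ i + c))"
proof (induction k arbitrary: m)
  case 0
  have "continuous_on UNIV (flat_exp m)"
    using DERIV_flat_exp by (meson DERIV_isCont continuous_at_imp_continuous_on)
  then show ?case unfolding C_k.simps
    by (intro continuous_on_compose2[of UNIV "flat_exp m" "UNIV::(real^'n) set" "\<lambda>x. s * x $ i + c"]
        continuous_intros) auto
next
  case (Suc k)
  let ?f = "\<lambda>x::real^'n. flat_exp m (s * x $ i + c)"
  have d: "(?f has_derivative (\<lambda>h. (s * h $ i) *
       (flat_exp (m + 2) (s * x $ i + c) - m * flat_exp (m + 1) (s * x $ i + c)))) (at x)" for x
  proof -
    have "((\<lambda>x. s * x $ i + c) has_derivative (\<lambda>h. s * h $ i + 0)) (at x)"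
      by (intro has_derivative_add has_derivative_mult_right has_derivative_const
          bounded_linear_imp_has_derivative bounded_linear_vec_nth)
    from has_derivative_compose[OF this DERIV_flat_exp[unfolded has_field_derivative_def]]
    show ?thesis by (simp add: mult.commute)
  qed
  have p: "partial_deriv j ?f = (\<lambda>x. (s * axis j 1 $ i) * flat_exp (m + 2) (s * x $ i + c)
      + (- (s * axis j 1 $ i) * m) * flat_exp (m + 1) (s * x $ i + c))" for j
    by (rule ext, subst partial_deriv_eqI[OF d]) (simp add: algebra_simps)
  have "C_k k (partial_deriv j ?f)" for j
    unfolding p by (intro C_k_add C_k_mult C_k_const Suc.IH)
  moreover have "?f differentiable (at x)" for x
    using d differentiable_def by blast
  ultimately show ?case by simp
qed

text \<open>Each factor vanishes beyond one face of the box and tends to 1 inside as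
  \<open>N\<close> grows. The sequence approximates the indicator of the open box boundedly and
  takes the place of mollification.\<close>

definition box_bump :: "real^'n \<Rightarrow> real^'n \<Rightarrow> nat \<Rightarrow> real^'n \<Rightarrow> real" where
  "box_bump a b N x =
     (\<Prod>i\<in>UNIV. flat_exp 0 (N * (x $ i - a $ i)) * flat_exp 0 (N * (b $ i - x $ i)))"

lemma box_bump_smooth: "C_k k (box_bump a b N)"
proof -
  have "box_bump a b N = (\<lambda>x. \<Prod>i\<in>UNIV. flat_exp 0 (real N * x $ i + (- real N * a $ i))
      * flat_exp 0 ((- real N) * x $ i + real N * b $ i))"
    by (rule ext) (simp add: box_bump_def algebra_simps)
  then show ?thesis
    by (simp only:) (intro C_k_prod C_k_mult C_k_flat_exp)
qed

lemma box_bump_bounds: "0 \<le> box_bump a b N x" "box_bump a b N x \<le> 1"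
  unfolding box_bump_def
  by (auto intro!: prod_nonneg prod_le_1 mult_nonneg_nonneg mult_le_one flat_exp_nonneg flat_exp_le_1)

lemma box_bump_outside: "x \<notin> cbox a b \<Longrightarrow> box_bump a b N x = 0"
proof -
  assume "x \<notin> cbox a b"
  then obtain i where "x $ i < a $ i \<or> b $ i < x $ i"
    by (auto simp: mem_box_cart not_le)
  then have "flat_exp 0 (N * (x $ i - a $ i)) * flat_exp 0 (N * (b $ i - x $ i)) = 0"
    by (auto simp: flat_exp_def mult_le_0_iff)
  then show ?thesis
    by (auto simp: box_bump_def prod_zero_iff)
qed

lemma box_bump_test: "cbox a b \<subseteq> E \<Longrightarrow> box_bump a b N \<in> test_functions E"
  unfolding test_functions_def
  by (auto simp: box_bump_smooth intro!: exI[of _ "cbox a b"] box_bump_outside)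

lemma flat_exp_limit:
  assumes "t > 0" shows "(\<lambda>N. flat_exp 0 (real N * t)) \<longlonglongrightarrow> 1"
proof -
  have "filterlim (\<lambda>N. real N * t) at_top sequentially"
    using assms by (intro filterlim_at_top_mult_tendsto_pos[OF tendsto_const _ filterlim_real_sequentially])
  then have "(\<lambda>N. exp (- 1 / (real N * t))) \<longlonglongrightarrow> exp 0"
    by (intro tendsto_exp real_tendsto_divide_at_top[OF tendsto_const])
  then have "(\<lambda>N. exp (- 1 / (real N * t))) \<longlonglongrightarrow> 1" by simp
  moreover have "\<forall>\<^sub>F N in sequentially. exp (- 1 / (real N * t)) = flat_exp 0 (real N * t)"
    using eventually_gt_at_top[of 0]
    by eventually_elim (use assms in \<open>auto simp: flat_exp_def mult_le_0_iff\<close>)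
  ultimately show ?thesis by (rule Lim_transform_eventually)
qed

text \<open>On the faces one factor is exactly zero for every \<open>N\<close>, so the convergence
  holds at every point and not only almost everywhere.\<close>

lemma box_bump_limit:
  fixes x :: "real^'n"
  shows "(\<lambda>N. box_bump a b N x) \<longlonglongrightarrow> indicator (box a b) x"
proof (cases "x \<in> box a b")
  case True
  then have "(\<lambda>N. box_bump a b N x) \<longlonglongrightarrow> (\<Prod>i\<in>(UNIV::'n set). 1 * 1)"
    unfolding box_bump_def
    by (intro tendsto_prod, intro tendsto_mult flat_exp_limit) (auto simp: mem_box_cart)
  with True show ?thesis by simp
next
  case False
  then obtain i where "x $ i \<le> a $ i \<or> b $ i \<le> x $ i"
    by (auto simp: mem_box_cart not_less)
  then have "flat_exp 0 (N * (x $ i - a $ i)) * flat_exp 0 (N * (b $ i - x $ i)) = 0" for N :: nat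
    by (auto simp: flat_exp_def mult_le_0_iff)
  then have "box_bump a b N x = 0" for N
    unfolding box_bump_def by (subst prod_zero_iff) auto
  with False show ?thesis by simp
qed

section \<open>The fundamental lemma and uniqueness of weak gradients\<close>

lemma integral_lebesgue_on_eq:
  fixes f :: "real^'n \<Rightarrow> 'b::{banach, second_countable_topology}"
  assumes "open E"
  shows "(\<integral>x. f x \<partial>lebesgue_on E) = (\<integral>x. indicator E x *\<^sub>R f x \<partial>lebesgue)"
  using assms by (subst integral_restrict_space) auto

lemma integrable_lebesgue_on_iff:
  fixes f :: "real^'n \<Rightarrow> 'b::{banach, second_countable_topology}"
  assumes "open E"
  shows "integrable (lebesgue_on E) f \<longleftrightarrow> integrable lebesgue (\<lambda>x. indicator E x *\<^sub>R f x)"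
  using assms by (subst integrable_restrict_space) auto

lemma C_k_continuous: "C_k k f \<Longrightarrow> continuous_on UNIV f"
  by (induction k) (use C_k_Suc_imp in auto)

lemma test_functions_continuous: "\<phi> \<in> test_functions E \<Longrightarrow> continuous_on UNIV \<phi>"
  using C_k_continuous by (auto simp: test_functions_def)

lemma test_functions_differentiable: "\<phi> \<in> test_functions E \<Longrightarrow> \<phi> differentiable (at x)"
  using C_k.simps(2)[of 0 \<phi>] by (auto simp: test_functions_def simp del: C_k.simps)

lemma partial_deriv_zero_outside:
  assumes "open U" "x \<in> U" "\<And>y. y \<in> U \<Longrightarrow> f y = 0"
  shows "partial_deriv i f x = 0"
proof -
  have "(f has_derivative (\<lambda>h. 0)) (at x)"
    by (rule has_derivative_transform_within_open[OF has_derivative_const[of 0] assms(1,2)])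
       (simp add: assms(3))
  then show ?thesis by (simp add: partial_deriv_eqI)
qed

lemma partial_deriv_test:
  assumes "\<phi> \<in> test_functions E"
  shows "partial_deriv i \<phi> \<in> test_functions E"
proof -
  obtain S where S: "compact S" "S \<subseteq> E" "\<And>x. x \<notin> S \<Longrightarrow> \<phi> x = 0"
    using assms by (auto simp: test_functions_def)
  have "C_k k (partial_deriv i \<phi>)" for k
    using assms C_k.simps(2)[of k \<phi>] by (auto simp: test_functions_def simp del: C_k.simps)
  moreover have "partial_deriv i \<phi> x = 0" if "x \<notin> S" for x
    using S that by (intro partial_deriv_zero_outside[of "- S"]) (auto intro: compact_imp_closed)
  ultimately show ?thesis using S by (auto simp: test_functions_def)
qed

lemma test_functions_translate:
  assumes "\<phi> \<in> test_functions E" "\<And>x. x \<in> E \<Longrightarrow> x + v \<in> E'"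
  shows "(\<lambda>x. \<phi> (x - v)) \<in> test_functions E'"
proof -
  obtain S where S: "compact S" "S \<subseteq> E" "\<And>x. x \<notin> S \<Longrightarrow> \<phi> x = 0"
    using assms by (auto simp: test_functions_def)
  have "compact ((\<lambda>x. x + v) ` S)"
    using S(1) by (intro compact_continuous_image continuous_intros)
  moreover have "(\<lambda>x. x + v) ` S \<subseteq> E'" using S assms(2) by auto
  moreover have "\<phi> (x - v) = 0" if "x \<notin> (\<lambda>x. x + v) ` S" for x
  proof (rule S(3))
    show "x - v \<notin> S" using that by (metis diff_add_cancel imageI)
  qed
  ultimately show ?thesis
    using assms(1) C_k_translate unfolding test_functions_def by blast
qed

lemma test_function_bounded:
  fixes \<phi> :: "real^'n \<Rightarrow> real"
  assumes "\<phi> \<in> test_functions E"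
  obtains B where "B > 0" "\<And>x. \<bar>\<phi> x\<bar> \<le> B"
proof -
  obtain S where S: "compact S" "S \<subseteq> E" "\<And>x. x \<notin> S \<Longrightarrow> \<phi> x = 0"
    using assms by (auto simp: test_functions_def)
  have "compact (\<phi> ` S)"
    using S(1) test_functions_continuous[OF assms]
    by (intro compact_continuous_image) (auto intro: continuous_on_subset)
  then have "bounded (\<phi> ` S)" by (rule compact_imp_bounded)
  then obtain B where B: "B > 0" "\<And>y. y \<in> \<phi> ` S \<Longrightarrow> norm y \<le> B"
    unfolding bounded_pos by blast
  have "\<bar>\<phi> x\<bar> \<le> B" for x
    using B S(3)[of x] by (cases "x \<in> S") auto
  with B(1) that show thesis by blast
qed

lemma continuous_borel_lebesgue:
  fixes f :: "real^'n \<Rightarrow> real"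
  shows "continuous_on UNIV f \<Longrightarrow> f \<in> borel_measurable lebesgue"
  by (rule measurable_completion) (simp add: borel_measurable_continuous_onI)

text \<open>A test function is bounded and vanishes off a compact set, on which \<open>f\<close> is
  integrable.\<close>

lemma loc_integrable_mult_integrable:
  fixes f :: "real^'n \<Rightarrow> real"
  assumes "open E" "loc_integrable E f" "\<phi> \<in> test_functions E"
  shows "integrable (lebesgue_on E) (\<lambda>x. f x * \<phi> x)"
proof -
  obtain S where S: "compact S" "S \<subseteq> E" "\<And>x. x \<notin> S \<Longrightarrow> \<phi> x = 0"
    using assms by (auto simp: test_functions_def)
  obtain B where B: "\<And>x. \<bar>\<phi> x\<bar> \<le> B" using test_function_bounded[OF assms(3)] by blast
  have f: "integrable lebesgue (\<lambda>x. indicator S x *\<^sub>R f x)"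
    using assms(2) S by (auto simp: loc_integrable_def set_integrable_def)
  have \<phi>: "\<phi> \<in> borel_measurable lebesgue"
    using test_functions_continuous[OF assms(3)] by (rule continuous_borel_lebesgue)
  have le: "norm ((indicator S x *\<^sub>R f x) * \<phi> x) \<le> norm (B * (indicator S x *\<^sub>R f x))" for x
  proof -
    have "\<bar>\<phi> x\<bar> \<le> \<bar>B\<bar>" using B[of x] by linarith
    then have "\<bar>indicator S x *\<^sub>R f x\<bar> * \<bar>\<phi> x\<bar> \<le> \<bar>indicator S x *\<^sub>R f x\<bar> * \<bar>B\<bar>"
      by (intro mult_left_mono) simp_all
    then show ?thesis by (simp only: real_norm_def abs_mult mult.commute)
  qed
  have "integrable lebesgue (\<lambda>x. (indicator S x *\<^sub>R f x) * \<phi> x)"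
  proof (rule Bochner_Integration.integrable_bound)
    show "integrable lebesgue (\<lambda>x. B * (indicator S x *\<^sub>R f x))"
      using f by (rule integrable_mult_right)
    show "(\<lambda>x. (indicator S x *\<^sub>R f x) * \<phi> x) \<in> borel_measurable lebesgue"
      using borel_measurable_integrable[OF f] \<phi> by (rule borel_measurable_times)
  qed (rule AE_I2, rule le)
  moreover have "(\<lambda>x. (indicator S x *\<^sub>R f x) * \<phi> x) = (\<lambda>x. indicator E x *\<^sub>R (f x * \<phi> x))"
  proof
    show "(indicator S x *\<^sub>R f x) * \<phi> x = indicator E x *\<^sub>R (f x * \<phi> x)" for x
      using S by (cases "x \<in> S") (auto simp: indicator_def)
  qed
  ultimately show ?thesis
    by (simp only: integrable_lebesgue_on_iff[OF assms(1)])
qed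

text \<open>Dominated convergence along \<open>box_bump a b N\<close>; the absolute value of
  \<open>f\<close> on the closed box is the integrable majorant.\<close>

lemma loc_integrable_box_integral_0:
  fixes f :: "real^'n \<Rightarrow> real"
  assumes "open E" "loc_integrable E f" "cbox a b \<subseteq> E"
    and "\<And>\<phi>. \<phi> \<in> test_functions E \<Longrightarrow> l2_inner E f \<phi> = 0"
  shows "(\<integral>x. indicator (box a b) x * f x \<partial>lebesgue) = 0"
proof -
  let ?F = "\<lambda>x. indicator (cbox a b) x * f x"
  have F: "integrable lebesgue ?F"
    using assms(2,3) by (auto simp: loc_integrable_def set_integrable_def)
  have [measurable]: "box_bump a b N \<in> borel_measurable lebesgue" for N
    using test_functions_continuous[OF box_bump_test[OF assms(3)]] by (rule continuous_borel_lebesgue)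
  have [measurable]: "?F \<in> borel_measurable lebesgue" using F by auto
  have [measurable]: "box a b \<in> sets lebesgue" by simp
  have "(\<lambda>N. \<integral>x. box_bump a b N x * ?F x \<partial>lebesgue)
      \<longlonglongrightarrow> (\<integral>x. indicator (box a b) x * ?F x \<partial>lebesgue)"
  proof (rule integral_dominated_convergence[where w="\<lambda>x. \<bar>?F x\<bar>"])
    show "AE x in lebesgue. (\<lambda>N. box_bump a b N x * ?F x) \<longlonglongrightarrow> indicator (box a b) x * ?F x"
      by (intro AE_I2 tendsto_mult box_bump_limit tendsto_const)
    show "AE x in lebesgue. norm (box_bump a b N x * ?F x) \<le> \<bar>?F x\<bar>" for N
      using box_bump_bounds[of a b N] by (intro AE_I2) (auto simp: abs_mult intro!: mult_left_le_one_le)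
  next
    show "integrable lebesgue (\<lambda>x. \<bar>?F x\<bar>)" using F by simp
  qed measurable
  moreover have "(\<integral>x. box_bump a b N x * ?F x \<partial>lebesgue) = 0" for N
  proof -
    have eq: "box_bump a b N x * ?F x = indicator E x *\<^sub>R (f x \<bullet> box_bump a b N x)" for x
      using box_bump_outside[of x a b N] assms(3) by (auto simp: indicator_def)
    show ?thesis
      using assms(4)[OF box_bump_test[OF assms(3), of N]]
      by (simp only: eq l2_inner_def integral_lebesgue_on_eq[OF assms(1)])
  qed
  moreover have "indicator (box a b) x * ?F x = indicator (box a b) x * f x" for x
    using box_subset_cbox by (auto simp: indicator_def)
  ultimately show ?thesis by (simp only: LIMSEQ_const_iff)
qed

text \<open>Lebesgue differentiation: at almost every point \<open>F\<close> is the limit of its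
  means over shrinking cubes, and these means are all zero.\<close>

lemma AE_zero_if_box_integrals_zero:
  fixes F :: "'a::euclidean_space \<Rightarrow> real"
  assumes "integrable lebesgue F"
    and "\<And>a b. (\<integral>x. indicator (box a b) x * F x \<partial>lebesgue) = 0"
  shows "AE x in lebesgue. F x = 0"
proof -
  have int: "integral (cbox a b) F = 0" for a b
  proof -
    have "set_integrable lebesgue (box a b) F"
      using assms(1) unfolding set_integrable_def by (intro integrable_mult_indicator) auto
    then have "integral (box a b) F = (\<integral>x. indicator (box a b) x * F x \<partial>lebesgue)"
      using set_lebesgue_integral_eq_integral(2)[of "box a b" F] by (simp add: set_lebesgue_integral_def)
    then show ?thesis using assms(2) by (simp add: integral_open_interval)
  qed
  have "F integrable_on UNIV"
    using assms(1) by (rule integrable_on_lebesgue)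
  then have "F integrable_on cbox a b" for a b
    by (rule integrable_on_subcbox) simp
  then obtain N where N: "negligible N"
    "\<And>x e. \<lbrakk>x \<notin> N; 0 < e\<rbrakk> \<Longrightarrow> \<exists>d>0. \<forall>h. 0 < h \<and> h < d \<longrightarrow>
        norm (integral (cbox x (x + h *\<^sub>R One)) F /\<^sub>R h ^ DIM('a) - F x) < e"
    using integrable_ccontinuous_explicit[of F] by blast
  have "F x = 0" if "x \<notin> N" for x
  proof (rule ccontr)
    assume "F x \<noteq> 0"
    then obtain d where "d > 0" "\<forall>h. 0 < h \<and> h < d \<longrightarrow>
        norm (integral (cbox x (x + h *\<^sub>R One)) F /\<^sub>R h ^ DIM('a) - F x) < \<bar>F x\<bar>"
      using N(2)[OF \<open>x \<notin> N\<close>, of "\<bar>F x\<bar>"] by auto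
    moreover obtain h where "0 < h" "h < d" using dense[OF \<open>d > 0\<close>] by blast
    ultimately show False by (auto simp: int)
  qed
  then show ?thesis
    using N(1) by (intro AE_I'[of N]) (auto simp: negligible_iff_null_sets)
qed

text \<open>The claim localizes to countably many closed boxes that fill \<open>E\<close>. On one of
  them \<open>f\<close> is cut off to an integrable function, whose integral over any open box is
  again an integral of \<open>f\<close> over an open box within \<open>E\<close>.\<close>

theorem fundamental_lemma:
  fixes f :: "real^'n \<Rightarrow> real"
  assumes "open E" "loc_integrable E f"
    and "\<And>\<phi>. \<phi> \<in> test_functions E \<Longrightarrow> l2_inner E f \<phi> = 0"
  shows "AE x in lebesgue. x \<in> E \<longrightarrow> f x = 0"
proof -
  obtain \<D> where D: "countable \<D>" "\<D> \<subseteq> Pow E" "\<And>X. X \<in> \<D> \<Longrightarrow> \<exists>a b. X = cbox a b" "\<Union>\<D> = E"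
    using open_countable_Union_open_cbox[OF assms(1)] by blast
  have "AE x in lebesgue. x \<in> X \<longrightarrow> f x = 0" if "X \<in> \<D>" for X
  proof -
    obtain a b where ab: "X = cbox a b" using D(3)[OF \<open>X \<in> \<D>\<close>] by blast
    have sub: "cbox a b \<subseteq> E" using D(2) that ab by auto
    let ?F = "\<lambda>x. indicator (cbox a b) x * f x"
    have "(\<integral>x. indicator (box c d) x * ?F x \<partial>lebesgue) = 0" for c d
    proof -
      \<comment> \<open>The intersection of two open boxes is an open box, with corners given by
        coordinatewise maximum and minimum; this covers the empty intersection too.\<close>
      obtain c' d' where cd: "box c d \<inter> box a b = box c' d'" "cbox c' d' \<subseteq> cbox a b"
      proof -
        define c' where "c' = (\<chi> i. max (c $ i) (a $ i))"
        define d' where "d' = (\<chi> i. min (d $ i) (b $ i))"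
        have "box c d \<inter> box a b = box c' d'" "cbox c' d' \<subseteq> cbox a b"
          by (auto simp: mem_box_cart c'_def d'_def)
        then show ?thesis using that by blast
      qed
      \<comment> \<open>The two integrands can differ only on the faces of \<open>cbox a b\<close>,
        a null set.\<close>
      have "AE x in lebesgue. indicator (box c d) x * ?F x = indicator (box c' d') x * f x"
      proof (rule AE_I')
        show "cbox a b - box a b \<in> null_sets lebesgue"
          using negligible_frontier_interval by (simp add: negligible_iff_null_sets)
        show "{x \<in> space lebesgue. indicator (box c d) x * ?F x \<noteq> indicator (box c' d') x * f x}
            \<subseteq> cbox a b - box a b"
          unfolding cd(1)[symmetric] using box_subset_cbox[of a b] by (auto simp: indicator_def split: if_splits)
      qed
      then have "(\<integral>x. indicator (box c d) x * ?F x \<partial>lebesgue) = (\<integral>x. indicator (box c' d') x * f x \<partial>lebesgue)"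
      proof (rule integral_cong_AE[rotated 2])
        have "integrable lebesgue ?F"
          using assms(2) sub by (auto simp: loc_integrable_def set_integrable_def)
        then have F: "?F \<in> borel_measurable lebesgue" by simp
        then show "(\<lambda>x. indicator (box c d) x * ?F x) \<in> borel_measurable lebesgue"
          by (intro borel_measurable_times borel_measurable_indicator F) simp
        have eq: "indicator (box c' d') x * f x = indicator (box c' d') x * ?F x" for x
          using cd box_subset_cbox[of c' d'] by (auto simp: indicator_def)
        show "(\<lambda>x. indicator (box c' d') x * f x) \<in> borel_measurable lebesgue"
          unfolding eq by (intro borel_measurable_times borel_measurable_indicator F) simp
      qed
      also have "\<dots> = 0"
        using loc_integrable_box_integral_0[OF assms(1,2) _ assms(3), of c' d'] cd(2) sub by auto
      finally show ?thesis .
    qed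
    moreover have "integrable lebesgue ?F"
      using assms(2) sub by (auto simp: loc_integrable_def set_integrable_def)
    ultimately have "AE x in lebesgue. ?F x = 0"
      by (intro AE_zero_if_box_integrals_zero) auto
    then show ?thesis by eventually_elim (auto simp: ab indicator_def)
  qed
  then have "AE x in lebesgue. \<forall>X\<in>\<D>. x \<in> X \<longrightarrow> f x = 0"
    unfolding AE_ball_countable[OF D(1)] by blast
  then show ?thesis
    by eventually_elim (use D(4) in blast)
qed

lemma loc_integrable_diff:
  "loc_integrable E f \<Longrightarrow> loc_integrable E g \<Longrightarrow> loc_integrable E (\<lambda>x. f x - g x)"
  by (auto simp: loc_integrable_def)

lemma loc_integrable_nth:
  assumes "loc_integrable E (G :: real^'n \<Rightarrow> real^'n)"
  shows "loc_integrable E (\<lambda>x. G x $ i)"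
  unfolding loc_integrable_def set_integrable_def
proof (intro allI impI)
  fix S assume "compact S \<and> S \<subseteq> E"
  then have "integrable lebesgue (\<lambda>x. indicator S x *\<^sub>R G x)"
    using assms by (auto simp: loc_integrable_def set_integrable_def)
  then have "integrable lebesgue (\<lambda>x. (indicator S x *\<^sub>R G x) $ i)"
    by (rule integrable_bounded_linear[OF bounded_linear_vec_nth])
  then show "integrable lebesgue (\<lambda>x. indicator S x *\<^sub>R G x $ i)" by simp
qed

text \<open>The difference of two weak gradients integrates to zero against every test function,
  component by component.\<close>

theorem weak_gradient_unique:
  assumes "open \<Omega>" "has_weak_gradient \<Omega> v G" "has_weak_gradient \<Omega> v H"
  shows "AE x in lebesgue. x \<in> \<Omega> \<longrightarrow> G x = H x"
proof -
  have "AE x in lebesgue. x \<in> \<Omega> \<longrightarrow> G x $ i - H x $ i = 0" for i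
  proof (rule fundamental_lemma[OF assms(1)])
    have l: "loc_integrable \<Omega> (\<lambda>x. G x $ i)" "loc_integrable \<Omega> (\<lambda>x. H x $ i)"
      using assms by (auto simp: has_weak_gradient_def intro: loc_integrable_nth)
    then show "loc_integrable \<Omega> (\<lambda>x. G x $ i - H x $ i)"
      by (rule loc_integrable_diff)
    fix \<phi> :: "real^'a \<Rightarrow> real" assume \<phi>: "\<phi> \<in> test_functions \<Omega>"
    have "l2_inner \<Omega> (\<lambda>x. G x $ i - H x $ i) \<phi> = l2_inner \<Omega> (\<lambda>x. G x $ i) \<phi> - l2_inner \<Omega> (\<lambda>x. H x $ i) \<phi>"
      unfolding l2_inner_def inner_real_def
      using loc_integrable_mult_integrable[OF assms(1) l(1) \<phi>] loc_integrable_mult_integrable[OF assms(1) l(2) \<phi>]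
      by (subst Bochner_Integration.integral_diff[symmetric]) (auto simp: algebra_simps)
    also have "\<dots> = 0"
      using assms \<phi> unfolding has_weak_gradient_def by (metis cancel_comm_monoid_add_class.diff_cancel neg_equal_iff_equal)
    finally show "l2_inner \<Omega> (\<lambda>x. G x $ i - H x $ i) \<phi> = 0" .
  qed
  then have "AE x in lebesgue. \<forall>i\<in>UNIV. x \<in> \<Omega> \<longrightarrow> G x $ i - H x $ i = 0"
    by (intro AE_finite_allI) auto
  then show ?thesis by eventually_elim (simp add: vec_eq_iff)
qed

text \<open>Once some weak gradient exists, the value picked by \<open>SOME\<close> is one too, so
  uniqueness lets any known gradient replace it under integrals.\<close>

lemma wgrad_AE_eq:
  assumes "open \<Omega>" "has_weak_gradient \<Omega> v G"
  shows "AE x in lebesgue_on \<Omega>. wgrad \<Omega> v x = G x"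
proof -
  have "has_weak_gradient \<Omega> v (wgrad \<Omega> v)"
    unfolding wgrad_def by (rule someI[where P="has_weak_gradient \<Omega> v"]) (rule assms(2))
  from weak_gradient_unique[OF assms(1) this assms(2)] show ?thesis
    using assms(1) by (simp add: AE_restrict_space_iff)
qed

section \<open>Piecewise affine functions on a mesh\<close>

lemma affine_agree_on_hull:
  fixes b b' :: "'a::euclidean_space"
  assumes "x \<in> convex hull S" "\<And>a. a \<in> S \<Longrightarrow> b \<bullet> a + c = b' \<bullet> a + c'"
  shows "b \<bullet> x + c = b' \<bullet> x + c'"
proof -
  have eq: "{x. b \<bullet> x + c = b' \<bullet> x + c'} = {x. (b - b') \<bullet> x = c' - c}"
    by (auto simp: inner_diff_left)
  have "convex hull S \<subseteq> {x. b \<bullet> x + c = b' \<bullet> x + c'}"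
    unfolding eq using assms(2) by (intro hull_minimal convex_hyperplane) (auto simp: inner_diff_left algebra_simps)
  with assms(1) show ?thesis by auto
qed

lemma affine_le_on_hull:
  fixes b :: "'a::euclidean_space"
  assumes "x \<in> convex hull S" "\<And>a. a \<in> S \<Longrightarrow> b \<bullet> a + c \<le> m"
  shows "b \<bullet> x + c \<le> m"
proof -
  have eq: "{x. b \<bullet> x + c \<le> m} = {x. b \<bullet> x \<le> m - c}" by auto
  have "convex hull S \<subseteq> {x. b \<bullet> x + c \<le> m}"
    unfolding eq using assms(2) by (intro hull_minimal convex_halfspace_le) (auto simp: le_diff_eq)
  with assms(1) show ?thesis by auto
qed

text \<open>Differences to one fixed vertex are linearly independent and so carry a linear
  functional with prescribed values; its adjoint at \<open>1\<close> represents it as an inner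
  product.\<close>

lemma affine_interpolation:
  fixes C :: "'a::euclidean_space set" and f :: "'a \<Rightarrow> real"
  assumes "\<not> affine_dependent C"
  shows "\<exists>b c. \<forall>a\<in>C. b \<bullet> a + c = f a"
proof (cases "C = {}")
  case False
  then obtain a0 where a0: "a0 \<in> C" by blast
  have indep: "independent ((\<lambda>x. x - a0) ` (C - {a0}))"
    using assms affine_dependent_iff_dependent2[OF a0] by simp
  obtain g where g: "linear g" "\<And>y. y \<in> (\<lambda>x. x - a0) ` (C - {a0}) \<Longrightarrow> g y = f (y + a0) - f a0"
    using linear_independent_extend[OF indep, of "\<lambda>y. f (y + a0) - f a0"] by blast
  have "g x = adjoint g 1 \<bullet> x" for x
    using adjoint_works[OF g(1), of x 1] by (simp add: inner_commute)
  then have "adjoint g 1 \<bullet> a + (f a0 - g a0) = f a" if "a \<in> C" for a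
    using that g(2)[of "a - a0"] linear_diff[OF g(1), of a a0] linear_0[OF g(1)]
    by (cases "a = a0") (auto simp: algebra_simps)
  then show ?thesis by blast
qed auto

definition verts :: "(real^'n) set \<Rightarrow> (real^'n) set" where
  "verts K = {a. a extreme_point_of K}"

locale mesh =
  fixes \<Omega> :: "(real^'n) set" and \<T> :: "(real^'n) set set"
  assumes mesh: "is_mesh \<Omega> \<T>"
begin

lemma finite_mesh: "finite \<T>" and
  face_mesh: "K \<in> \<T> \<Longrightarrow> K' \<in> \<T> \<Longrightarrow> (K \<inter> K') face_of K" and
  simplex_mesh: "K \<in> \<T> \<Longrightarrow> int CARD('n) simplex K" and
  Union_mesh: "\<Union>\<T> = closure \<Omega>"
  using mesh by (auto simp: is_mesh_def triangulation_def)

lemma simplex_verts: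
  assumes "K \<in> \<T>"
  shows "\<not> affine_dependent (verts K)" "finite (verts K)" "card (verts K) = CARD('n) + 1"
    "K = convex hull verts K"
proof -
  obtain C where C: "\<not> affine_dependent C" "int (card C) = int CARD('n) + 1" "K = convex hull C" "finite C"
    using simplex_mesh[OF assms] aff_independent_finite unfolding simplex_def by blast
  have "verts K = C"
    using extreme_point_of_convex_hull_affine_independent[OF C(1)] C(3) by (auto simp: verts_def)
  then show "\<not> affine_dependent (verts K)" "finite (verts K)" "card (verts K) = CARD('n) + 1"
    "K = convex hull verts K"
    using C by auto
qed

lemma convex_mesh: "K \<in> \<T> \<Longrightarrow> convex K" and compact_mesh: "K \<in> \<T> \<Longrightarrow> compact K"
  using simplex_verts(2,4) by (metis convex_convex_hull, metis finite_imp_compact_convex_hull)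

lemma verts_subset: "verts K \<subseteq> K"
  by (auto simp: verts_def extreme_point_of_def)

lemma verts_nonempty: "K \<in> \<T> \<Longrightarrow> verts K \<noteq> {}"
  using simplex_verts(3) by fastforce

lemma nodes_eq: "nodes \<T> = (\<Union>K\<in>\<T>. verts K)"
  by (auto simp: nodes_def verts_def)

lemma verts_node: "K \<in> \<T> \<Longrightarrow> a \<in> verts K \<Longrightarrow> a \<in> nodes \<T>"
  by (auto simp: nodes_eq)

lemma verts_in: "a \<in> verts K \<Longrightarrow> a \<in> K"
  using verts_subset by blast

lemma finite_nodes: "finite (nodes \<T>)"
  unfolding nodes_eq using finite_mesh simplex_verts(2) by auto

text \<open>Conformity excludes hanging nodes: a node of a neighbour that lies in \<open>K\<close>
  is extreme in the common part, which is a face of \<open>K\<close>, and extreme points of a face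
  are extreme in the whole.\<close>

lemma nodes_Int:
  assumes "K \<in> \<T>" shows "nodes \<T> \<inter> K = verts K"
proof
  show "verts K \<subseteq> nodes \<T> \<inter> K" using assms verts_subset by (auto simp: nodes_eq)
  show "nodes \<T> \<inter> K \<subseteq> verts K"
  proof
    fix a assume "a \<in> nodes \<T> \<inter> K"
    then obtain K' where K': "K' \<in> \<T>" "a extreme_point_of K'" "a \<in> K" "a \<in> K'"
      using verts_subset by (auto simp: nodes_eq verts_def)
    then have "a extreme_point_of (K \<inter> K')"
      by (auto simp: extreme_point_of_def)
    then have "a extreme_point_of K"
      using face_mesh[OF assms K'(1)] extreme_point_of_face by blast
    then show "a \<in> verts K" by (simp add: verts_def)
  qed
qed

lemma X_h_affine:
  assumes "v \<in> X_h \<T>" "K \<in> \<T>"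
  obtains b c where "\<And>x. x \<in> K \<Longrightarrow> v x = b \<bullet> x + c"
  using assms unfolding X_h_def by blast

lemma X_h_outside: "v \<in> X_h \<T> \<Longrightarrow> x \<notin> \<Union>\<T> \<Longrightarrow> v x = 0"
  by (auto simp: X_h_def)

lemma X_h_eqI:
  assumes "v \<in> X_h \<T>" "w \<in> X_h \<T>" "\<And>a. a \<in> nodes \<T> \<Longrightarrow> v a = w a"
  shows "v = w"
proof
  fix x
  show "v x = w x"
  proof (cases "x \<in> \<Union>\<T>")
    case True
    then obtain K where K: "K \<in> \<T>" "x \<in> K" by blast
    obtain b c where v: "\<And>x. x \<in> K \<Longrightarrow> v x = b \<bullet> x + c" using X_h_affine[OF assms(1) K(1)] by blast
    obtain b' c' where w: "\<And>x. x \<in> K \<Longrightarrow> w x = b' \<bullet> x + c'" using X_h_affine[OF assms(2) K(1)] by blast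
    have "b \<bullet> x + c = b' \<bullet> x + c'"
    proof (rule affine_agree_on_hull[of x "verts K"])
      show "x \<in> convex hull verts K" using K simplex_verts(4) by blast
      show "b \<bullet> a + c = b' \<bullet> a + c'" if "a \<in> verts K" for a
        using v[OF verts_in[OF that]] w[OF verts_in[OF that]] assms(3)[OF verts_node[OF K(1) that]] by simp
    qed
    then show ?thesis using v w K by simp
  next
    case False
    then show ?thesis using X_h_outside[OF assms(1) False] X_h_outside[OF assms(2) False] by simp
  qed
qed

text \<open>Affine interpolation on each simplex glues to a continuous function, because the
  intersection of two simplices is the hull of its extreme points and these are vertices of
  both.\<close>

lemma X_h_exists: "\<exists>v\<in>X_h \<T>. \<forall>a\<in>nodes \<T>. v a = f a"
proof -
  have "\<forall>K\<in>\<T>. \<exists>b c. \<forall>a\<in>verts K. b \<bullet> a + c = f a"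
    using simplex_verts(1) affine_interpolation by blast
  then obtain b c where bc: "\<And>K a. K \<in> \<T> \<Longrightarrow> a \<in> verts K \<Longrightarrow> b K \<bullet> a + c K = f a"
    by metis
  have agree: "b K \<bullet> x + c K = b K' \<bullet> x + c K'" if "K \<in> \<T>" "K' \<in> \<T>" "x \<in> K" "x \<in> K'" for K K' x
  proof (rule affine_agree_on_hull[of x "verts (K \<inter> K')"])
    have "convex (K \<inter> K')" "compact (K \<inter> K')"
      using that convex_mesh compact_mesh convex_Int compact_Int by blast+
    then have "K \<inter> K' = convex hull verts (K \<inter> K')"
      unfolding verts_def by (intro Krein_Milman_Minkowski)
    then show "x \<in> convex hull verts (K \<inter> K')" using that by blast
    fix a assume "a \<in> verts (K \<inter> K')"
    then have "a \<in> verts K" "a \<in> verts K'"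
      using face_mesh[OF that(1,2)] face_mesh[OF that(2,1)] extreme_point_of_face
      by (auto simp: verts_def Int_commute)
    then show "b K \<bullet> a + c K = b K' \<bullet> a + c K'" using bc that by simp
  qed
  \<comment> \<open>Any simplex containing \<open>x\<close> will do, since \<open>agree\<close>
    makes the value independent of the choice.\<close>
  define \<kappa> where "\<kappa> x = (SOME K. K \<in> \<T> \<and> x \<in> K)" for x
  have \<kappa>: "\<kappa> x \<in> \<T>" "x \<in> \<kappa> x" if "x \<in> \<Union>\<T>" for x
    using that someI_ex[of "\<lambda>K. K \<in> \<T> \<and> x \<in> K"] by (auto simp: \<kappa>_def)
  define v where "v x = (if x \<in> \<Union>\<T> then b (\<kappa> x) \<bullet> x + c (\<kappa> x) else 0)" for x
  have v: "v x = b K \<bullet> x + c K" if "K \<in> \<T>" "x \<in> K" for x K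
    using agree[OF that(1) \<kappa>(1) that(2) \<kappa>(2)] that by (auto simp: v_def)
  have "continuous_on (\<Union>K\<in>\<T>. K) v"
  proof (rule continuous_on_closed_Union[OF finite_mesh])
    show "closed K" if "K \<in> \<T>" for K using that compact_mesh compact_imp_closed by blast
    show "continuous_on K v" if "K \<in> \<T>" for K
    proof (rule continuous_on_eq)
      show "continuous_on K (\<lambda>x. b K \<bullet> x + c K)" by (intro continuous_intros)
    qed (use v that in simp)
  qed
  then have "v \<in> X_h \<T>"
    using v by (auto simp: X_h_def v_def)
  moreover have "v a = f a" if "a \<in> nodes \<T>" for a
  proof -
    obtain K where "K \<in> \<T>" "a \<in> verts K" using \<open>a \<in> nodes \<T>\<close> by (auto simp: nodes_eq)
    then show ?thesis using v[OF _ verts_in] bc by simp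
  qed
  ultimately show ?thesis by blast
qed

text \<open>Existence and uniqueness of a discrete function with given nodal values justify the
  definite description.\<close>

lemma nodal_basis:
  assumes "a \<in> nodes \<T>"
  shows nodal_basis_X_h: "nodal_basis \<T> a \<in> X_h \<T>"
    and nodal_basis_node: "b \<in> nodes \<T> \<Longrightarrow> nodal_basis \<T> a b = (if b = a then 1 else 0)"
proof -
  have "\<exists>!v. v \<in> X_h \<T> \<and> (\<forall>b\<in>nodes \<T>. v b = (if b = a then 1 else 0))"
  proof (rule ex_ex1I)
    show "\<exists>v. v \<in> X_h \<T> \<and> (\<forall>b\<in>nodes \<T>. v b = (if b = a then 1 else 0))"
      using X_h_exists[of "\<lambda>b. if b = a then 1 else 0"] by blast
  next
    fix v w assume "v \<in> X_h \<T> \<and> (\<forall>b\<in>nodes \<T>. v b = (if b = a then 1 else 0))"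
      "w \<in> X_h \<T> \<and> (\<forall>b\<in>nodes \<T>. w b = (if b = a then 1 else 0))"
    then show "v = w" by (intro X_h_eqI) auto
  qed
  from theI'[OF this] show "nodal_basis \<T> a \<in> X_h \<T>"
    "b \<in> nodes \<T> \<Longrightarrow> nodal_basis \<T> a b = (if b = a then 1 else 0)"
    unfolding nodal_basis_def by auto
qed

section \<open>Linear operations, nodal interpolation and the partition of unity\<close>

lemma X_h_add:
  assumes "v \<in> X_h \<T>" "w \<in> X_h \<T>" shows "(\<lambda>x. v x + w x) \<in> X_h \<T>"
proof -
  have "\<exists>b c. \<forall>x\<in>K. v x + w x = b \<bullet> x + c" if K: "K \<in> \<T>" for K
  proof -
    obtain b c where v: "\<And>x. x \<in> K \<Longrightarrow> v x = b \<bullet> x + c" using X_h_affine[OF assms(1) K] by blast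
    obtain b' c' where w: "\<And>x. x \<in> K \<Longrightarrow> w x = b' \<bullet> x + c'" using X_h_affine[OF assms(2) K] by blast
    have "\<forall>x\<in>K. v x + w x = (b + b') \<bullet> x + (c + c')"
      using v w by (simp add: inner_add_left)
    then show ?thesis by blast
  qed
  then show ?thesis
    using assms by (auto simp: X_h_def intro: continuous_intros)
qed

lemma X_h_cmult:
  assumes "v \<in> X_h \<T>" shows "(\<lambda>x. r * v x) \<in> X_h \<T>"
proof -
  have "\<exists>b c. \<forall>x\<in>K. r * v x = b \<bullet> x + c" if K: "K \<in> \<T>" for K
  proof -
    obtain b c where v: "\<And>x. x \<in> K \<Longrightarrow> v x = b \<bullet> x + c" using X_h_affine[OF assms K] by blast
    have "\<forall>x\<in>K. r * v x = (r *\<^sub>R b) \<bullet> x + r * c"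
      using v by (simp add: algebra_simps)
    then show ?thesis by blast
  qed
  then show ?thesis
    using assms by (auto simp: X_h_def intro: continuous_intros)
qed

lemma X_h_zero: "(\<lambda>x. 0) \<in> X_h \<T>"
  by (auto simp: X_h_def intro!: exI[of _ 0])

lemma X_h_sum: "(\<And>i. i \<in> I \<Longrightarrow> f i \<in> X_h \<T>) \<Longrightarrow> (\<lambda>x. \<Sum>i\<in>I. f i x) \<in> X_h \<T>"
proof (induction I rule: infinite_finite_induct)
  case (insert i I)
  then show ?case using X_h_add[of "f i" "\<lambda>x. \<Sum>i\<in>I. f i x"] by simp
qed (simp_all add: X_h_zero)

lemma nodal_interp_node:
  "a \<in> nodes \<T> \<Longrightarrow> nodal_interp \<T> f a = f a"
  unfolding nodal_interp_def using finite_nodes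
  by (subst sum.remove[of _ a]) (auto simp: nodal_basis_node split: if_splits intro!: sum.neutral)

lemma nodal_interp_X_h: "nodal_interp \<T> (f :: real^'n \<Rightarrow> real) \<in> X_h \<T>"
proof -
  have "nodal_interp \<T> f = (\<lambda>x. \<Sum>a\<in>nodes \<T>. f a * nodal_basis \<T> a x)"
    by (rule ext) (simp add: nodal_interp_def mult.commute)
  then show ?thesis
    using X_h_sum[of "nodes \<T>" "\<lambda>a x. f a * nodal_basis \<T> a x"] X_h_cmult nodal_basis_X_h by simp
qed

lemma nodal_interp_nth: "nodal_interp \<T> (f :: real^'n \<Rightarrow> real^'n) x $ i = nodal_interp \<T> (\<lambda>y. f y $ i) x"
  by (simp add: nodal_interp_def)

lemma nodal_interp_U_h: "nodal_interp \<T> (f :: real^'n \<Rightarrow> real^'n) \<in> U_h \<T>"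
  unfolding U_h_def using nodal_interp_X_h by (simp add: nodal_interp_nth)

lemma nodal_interp_id: "v \<in> X_h \<T> \<Longrightarrow> nodal_interp \<T> v = v"
  by (rule X_h_eqI[OF nodal_interp_X_h]) (auto simp: nodal_interp_node)

lemma nodal_interp_cong:
  "(\<And>a. a \<in> nodes \<T> \<Longrightarrow> f a = g a) \<Longrightarrow> nodal_interp \<T> f = nodal_interp \<T> g"
  by (rule ext) (simp add: nodal_interp_def)

lemma nodal_interp_zero: "(\<And>a. a \<in> nodes \<T> \<Longrightarrow> f a = 0) \<Longrightarrow> nodal_interp \<T> f = (\<lambda>x. 0)"
  by (rule ext) (simp add: nodal_interp_def)

lemma X_h_expand: "v \<in> X_h \<T> \<Longrightarrow> v x = (\<Sum>a\<in>nodes \<T>. v a * nodal_basis \<T> a x)"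
  using fun_cong[OF nodal_interp_id, of v x] by (simp add: nodal_interp_def mult.commute)

text \<open>All vertices of \<open>K\<close> differ from \<open>a\<close>, so the affine piece on
  \<open>K\<close> vanishes at every vertex and hence on the hull.\<close>

lemma nodal_basis_zero:
  assumes "a \<in> nodes \<T>" "K \<in> \<T>" "a \<notin> K" "x \<in> K"
  shows "nodal_basis \<T> a x = 0"
proof -
  obtain b c where v: "\<And>x. x \<in> K \<Longrightarrow> nodal_basis \<T> a x = b \<bullet> x + c"
    using X_h_affine[OF nodal_basis_X_h[OF assms(1)] assms(2)] by blast
  have "b \<bullet> x + c = 0 \<bullet> x + 0"
  proof (rule affine_agree_on_hull[of x "verts K"])
    show "x \<in> convex hull verts K" using assms simplex_verts(4) by blast
    show "b \<bullet> a' + c = 0 \<bullet> a' + 0" if "a' \<in> verts K" for a'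
      using v[OF verts_in[OF that]] nodal_basis_node[OF assms(1) verts_node[OF assms(2) that]]
        verts_in[OF that] assms(3) by (auto split: if_splits)
  qed
  then show ?thesis using v assms(4) by simp
qed

lemma nodal_basis_nonneg:
  assumes "a \<in> nodes \<T>"
  shows "nodal_basis \<T> a x \<ge> 0"
proof (cases "x \<in> \<Union>\<T>")
  case True
  then obtain K where K: "K \<in> \<T>" "x \<in> K" by blast
  obtain b c where v: "\<And>x. x \<in> K \<Longrightarrow> nodal_basis \<T> a x = b \<bullet> x + c"
    using X_h_affine[OF nodal_basis_X_h[OF assms(1)] K(1)] by blast
  have "(- b) \<bullet> x + (- c) \<le> 0"
  proof (rule affine_le_on_hull[of x "verts K"])
    show "x \<in> convex hull verts K" using K simplex_verts(4) by blast
    show "(- b) \<bullet> a' + (- c) \<le> 0" if "a' \<in> verts K" for a'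
      using v[OF verts_in[OF that]] nodal_basis_node[OF assms(1) verts_node[OF K(1) that]]
      by (auto split: if_splits)
  qed
  then show ?thesis using v K by simp
next
  case False
  then show ?thesis using X_h_outside[OF nodal_basis_X_h[OF assms] False] by simp
qed

text \<open>The constant 1, extended by zero, is itself a discrete function; its nodal expansion is
  the partition of unity.\<close>

lemma nodal_basis_sum:
  assumes "K \<in> \<T>" "x \<in> K"
  shows "(\<Sum>a\<in>nodes \<T>. nodal_basis \<T> a x) = 1" "(\<Sum>a\<in>verts K. nodal_basis \<T> a x) = 1"
proof -
  have "(\<lambda>x. if x \<in> \<Union>\<T> then 1 else 0 :: real) \<in> X_h \<T>"
  proof -
    have "continuous_on (\<Union>\<T>) (\<lambda>x. if x \<in> \<Union>\<T> then 1 else 0 :: real)"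
      by (rule continuous_on_eq[of _ "\<lambda>x. 1"]) auto
    moreover have "\<exists>b c. \<forall>x\<in>K. (if x \<in> \<Union>\<T> then 1 else 0 :: real) = b \<bullet> x + c" if "K \<in> \<T>" for K
      using that by (intro exI[of _ 0] exI[of _ 1]) auto
    ultimately show ?thesis unfolding X_h_def by simp
  qed
  from X_h_expand[OF this, of x] assms
  have "1 = (\<Sum>a\<in>nodes \<T>. (if a \<in> \<Union>\<T> then 1 else 0) * nodal_basis \<T> a x)"
    by (simp split: if_splits)
  also have "\<dots> = (\<Sum>a\<in>nodes \<T>. nodal_basis \<T> a x)"
    using verts_subset by (intro sum.cong) (auto simp: nodes_eq)
  finally show *: "(\<Sum>a\<in>nodes \<T>. nodal_basis \<T> a x) = 1" by simp
  have "(\<Sum>a\<in>verts K. nodal_basis \<T> a x) = (\<Sum>a\<in>nodes \<T>. nodal_basis \<T> a x)"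
    using nodes_Int[OF assms(1)] finite_nodes nodal_basis_zero assms
    by (intro sum.mono_neutral_left) auto
  with * show "(\<Sum>a\<in>verts K. nodal_basis \<T> a x) = 1" by simp
qed

lemma X_h_expand_verts:
  assumes "v \<in> X_h \<T>" "K \<in> \<T>" "x \<in> K"
  shows "v x = (\<Sum>a\<in>verts K. v a * nodal_basis \<T> a x)"
proof -
  have "(\<Sum>a\<in>verts K. v a * nodal_basis \<T> a x) = (\<Sum>a\<in>nodes \<T>. v a * nodal_basis \<T> a x)"
    using nodes_Int[OF assms(2)] finite_nodes nodal_basis_zero assms
    by (intro sum.mono_neutral_left) auto
  then show ?thesis using X_h_expand[OF assms(1), of x] by simp
qed

lemma X_h_bounded:
  assumes "v \<in> X_h \<T>"
  obtains B where "B > 0" "\<And>x. \<bar>v x\<bar> \<le> B"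
proof -
  have "compact (\<Union>\<T>)" using finite_mesh compact_mesh by (intro compact_Union) auto
  moreover have "continuous_on (\<Union>\<T>) v" using assms by (simp add: X_h_def)
  ultimately have "bounded (v ` \<Union>\<T>)" using compact_continuous_image compact_imp_bounded by blast
  then obtain B where B: "B > 0" "\<And>y. y \<in> v ` \<Union>\<T> \<Longrightarrow> norm y \<le> B"
    unfolding bounded_pos by blast
  have "\<bar>v x\<bar> \<le> B" for x
    using B X_h_outside[OF assms, of x] by (cases "x \<in> \<Union>\<T>") auto
  with B(1) that show thesis by blast
qed

lemma X_h_measurable:
  assumes "v \<in> X_h \<T>"
  shows "v \<in> borel_measurable borel"
proof -
  have c: "closed (\<Union>\<T>)"
    using Union_mesh by simp
  have "(\<lambda>x. indicator (\<Union>\<T>) x *\<^sub>R v x) \<in> borel_measurable borel"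
    using assms c by (intro borel_measurable_continuous_on_indicator) (auto simp: X_h_def)
  moreover have "(\<lambda>x. indicator (\<Union>\<T>) x *\<^sub>R v x) = v"
    using X_h_outside[OF assms] by (auto simp: fun_eq_iff indicator_def)
  ultimately show ?thesis by simp
qed

lemma U_h_nth: "v \<in> U_h \<T> \<Longrightarrow> (\<lambda>x. v x $ i) \<in> X_h \<T>"
  by (simp add: U_h_def)

end

section \<open>Weak gradients of piecewise affine functions\<close>

lemma integrable_bounded_indicator:
  fixes f :: "'a::euclidean_space \<Rightarrow> 'b::{banach, second_countable_topology}"
  assumes "f \<in> borel_measurable lebesgue" "S \<in> lmeasurable" "\<And>x. x \<in> S \<Longrightarrow> norm (f x) \<le> B"
  shows "integrable lebesgue (\<lambda>x. indicator S x *\<^sub>R f x)"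
  using assms fmeasurableD2[OF assms(2)]
  by (intro integrableI_bounded_set_indicator[where B=B]) (auto simp: fmeasurableD less_top)

lemma integrable_lborel_bounded:
  fixes f :: "'a::euclidean_space \<Rightarrow> real"
  assumes "f \<in> borel_measurable borel" "\<And>x. \<bar>f x\<bar> \<le> B" "\<And>x. R < norm x \<Longrightarrow> f x = 0"
  shows "integrable lborel f"
proof -
  have "integrable lborel (\<lambda>x. indicator (cball 0 R) x *\<^sub>R f x)"
    using assms(1,2) emeasure_lborel_cball_finite[of 0 R]
    by (intro integrableI_bounded_set_indicator[where B=B]) auto
  moreover have "(\<lambda>x. indicator (cball 0 R) x *\<^sub>R f x) = f"
    using assms(3) by (auto simp: fun_eq_iff indicator_def not_le)
  ultimately show ?thesis by simp
qed

lemma integral_lborel_shift: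
  fixes f :: "'a::euclidean_space \<Rightarrow> 'b::{banach, second_countable_topology}"
  assumes "f \<in> borel_measurable borel"
  shows "(\<integral>x. f (x + c) \<partial>lborel) = (\<integral>x. f x \<partial>lborel)"
proof -
  have "(\<integral>x. f x \<partial>lborel) = (\<integral>x. f x \<partial>distr lborel borel ((+) c))"
    by (simp only: lborel_distr_plus)
  also have "\<dots> = (\<integral>x. f (c + x) \<partial>lborel)"
    using assms by (intro integral_distr) auto
  finally show ?thesis by (simp add: add.commute)
qed

lemma integrable_lborel_shift:
  fixes f :: "'a::euclidean_space \<Rightarrow> 'b::{banach, second_countable_topology}"
  assumes "integrable lborel f"
  shows "integrable lborel (\<lambda>x. f (x + c))"
proof -
  have "integrable (distr lborel borel ((+) c)) f"
    using assms by (simp only: lborel_distr_plus)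
  then have "integrable lborel (\<lambda>x. f (c + x))"
    using assms by (subst (asm) integrable_distr_eq) auto
  then show ?thesis by (simp add: add.commute)
qed

text \<open>The increments run through a sequence so that dominated convergence for sequences
  applies.\<close>

lemma difference_quotient_tendsto:
  fixes w :: "'a::real_normed_vector \<Rightarrow> real"
  assumes "(w has_derivative D) (at x)"
  shows "(\<lambda>n. (w (x + (1 / real (Suc n)) *\<^sub>R d) - w x) / (1 / real (Suc n))) \<longlonglongrightarrow> D d"
proof -
  have "((\<lambda>t. x + t *\<^sub>R d) has_derivative (\<lambda>t. t *\<^sub>R d)) (at 0)"
    by (auto intro!: derivative_eq_intros)
  then have "((\<lambda>t. w (x + t *\<^sub>R d)) has_derivative (\<lambda>t. D (t *\<^sub>R d))) (at 0)"
    using assms by (intro has_derivative_compose[of "\<lambda>t. x + t *\<^sub>R d" _ _ _ w D]) simp_all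
  then have "((\<lambda>t. w (x + t *\<^sub>R d)) has_real_derivative D d) (at 0)"
    using linear_cmul[OF has_derivative_linear[OF assms]]
    by (simp add: has_field_derivative_def mult_commute_abs)
  then have "((\<lambda>t. (w (x + t *\<^sub>R d) - w x) / t) \<longlongrightarrow> D d) (at 0)"
    by (simp add: DERIV_def)
  moreover have "filterlim (\<lambda>n. 1 / real (Suc n)) (at 0) sequentially"
    unfolding filterlim_at using LIMSEQ_inverse_real_of_nat by (simp add: inverse_eq_divide)
  ultimately show ?thesis by (rule filterlim_compose)
qed

text \<open>The difference quotients of \<open>w\<close> have integral zero by translation invariance, and they
  converge boundedly to the derivative.\<close>

lemma lipschitz_integral_derivative_zero:
  fixes w g :: "'a::euclidean_space \<Rightarrow> real"
  assumes [measurable]: "w \<in> borel_measurable borel" "g \<in> borel_measurable borel"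
    and lip: "\<And>x y. \<bar>w x - w y\<bar> \<le> L * norm (x - y)"
    and supp: "\<And>x. R < norm x \<Longrightarrow> w x = 0"
    and deriv: "AE x in lborel. \<exists>D. (w has_derivative D) (at x) \<and> D d = g x"
  shows "(\<integral>x. g x \<partial>lborel) = 0"
proof -
  define t where "t n = 1 / real (Suc n)" for n
  define q where "q n x = (w (x + t n *\<^sub>R d) - w x) / t n" for n x
  have t: "0 < t n" "t n \<le> 1" for n by (auto simp: t_def)
  have [measurable]: "q n \<in> borel_measurable borel" for n
    unfolding q_def by measurable
  obtain b :: 'a where "b \<in> Basis" using nonempty_Basis by blast
  then have b: "norm b = 1" by simp
  have "0 \<le> L * norm (b - 0)" using lip[of b 0] by linarith
  then have L: "L \<ge> 0" using b by simp
  \<comment> \<open>A Lipschitz function that vanishes beyond radius \<open>R\<close> is bounded by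
    comparison with a point of norm \<open>\<bar>R\<bar> + 1\<close>, where it is zero.\<close>
  define B where "B = L * (\<bar>R\<bar> + (\<bar>R\<bar> + 1))"
  have "\<bar>w x\<bar> \<le> B" for x
  proof (cases "R < norm x")
    case True
    then show ?thesis using supp L by (simp add: B_def)
  next
    case False
    define y where "y = (\<bar>R\<bar> + 1) *\<^sub>R b"
    have y: "norm y = \<bar>R\<bar> + 1" by (simp add: y_def b)
    then have "w y = 0" by (intro supp) simp
    then have "\<bar>w x\<bar> \<le> L * norm (x - y)" using lip[of x y] by simp
    also have "norm (x - y) \<le> \<bar>R\<bar> + (\<bar>R\<bar> + 1)"
      using norm_triangle_ineq4[of x y] y False by linarith
    finally show ?thesis using L by (simp add: B_def mult_left_mono)
  qed
  then have w_int: "integrable lborel w"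
    using supp by (intro integrable_lborel_bounded[of w B R]) auto
  have q0: "(\<integral>x. q n x \<partial>lborel) = 0" for n
    unfolding q_def using w_int integrable_lborel_shift[OF w_int] integral_lborel_shift[of w]
    by (simp add: Bochner_Integration.integral_diff)
  \<comment> \<open>All shifts have length at most \<open>norm d\<close>, so the quotients live in a
    ball enlarged by that much.\<close>
  define W where "W x = indicator (cball 0 (\<bar>R\<bar> + norm d)) x *\<^sub>R (L * norm d)" for x :: 'a
  have "(\<lambda>n. \<integral>x. q n x \<partial>lborel) \<longlonglongrightarrow> (\<integral>x. g x \<partial>lborel)"
  proof (rule integral_dominated_convergence[where w=W])
    show "g \<in> borel_measurable lborel" "q n \<in> borel_measurable lborel" for n by simp_all
    show "integrable lborel W"
      unfolding W_def by (intro integrable_lborel_bounded[of _ "L * norm d" "\<bar>R\<bar> + norm d"])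
        (auto simp: indicator_def L)
    show "AE x in lborel. (\<lambda>n. q n x) \<longlonglongrightarrow> g x"
      using deriv
    proof eventually_elim
      case (elim x)
      then obtain D where "(w has_derivative D) (at x)" "D d = g x" by blast
      then show ?case unfolding q_def t_def using difference_quotient_tendsto[of w D x d] by simp
    qed
    show "AE x in lborel. norm (q n x) \<le> W x" for n
    proof (rule AE_I2)
      fix x :: 'a
      show "norm (q n x) \<le> W x"
      proof (cases "norm x \<le> \<bar>R\<bar> + norm d")
        case True
        have "\<bar>w (x + t n *\<^sub>R d) - w x\<bar> \<le> L * norm (t n *\<^sub>R d)"
          using lip[of "x + t n *\<^sub>R d" x] by simp
        then have "norm (q n x) \<le> L * norm d"
          using t[of n] by (simp add: q_def abs_divide divide_le_eq mult.assoc mult.commute[of "norm d"])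
        with True show ?thesis by (simp add: W_def)
      next
        case False
        have "norm (t n *\<^sub>R d) \<le> norm d"
          using t[of n] by (simp add: mult_left_le_one_le)
        then have "norm x - norm d \<le> norm (x + t n *\<^sub>R d)"
          using norm_triangle_ineq4[of "x + t n *\<^sub>R d" "t n *\<^sub>R d"] by simp
        then have "R < norm (x + t n *\<^sub>R d)" "R < norm x" using False norm_ge_zero[of d] by linarith+
        then show ?thesis using supp L by (simp add: q_def W_def)
      qed
    qed
  qed
  then show ?thesis by (simp add: q0 LIMSEQ_const_iff)
qed

lemma test_function_lipschitz:
  fixes \<phi> :: "real^'n \<Rightarrow> real"
  assumes "\<phi> \<in> test_functions E"
  obtains L where "L \<ge> 0" "\<And>x y. \<bar>\<phi> x - \<phi> y\<bar> \<le> L * norm (x - y)"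
proof -
  have "\<exists>B. \<forall>x. \<bar>partial_deriv i \<phi> x\<bar> \<le> B" for i
    using test_function_bounded[OF partial_deriv_test[OF assms]] by metis
  then obtain B where B: "\<And>i x. \<bar>partial_deriv i \<phi> x\<bar> \<le> B i" by metis
  have B0: "0 \<le> B i" for i using B[of i 0] by linarith
  have "norm (\<phi> x - \<phi> y) \<le> (\<Sum>i\<in>UNIV. B i) * norm (x - y)" for x y
  proof (rule differentiable_bound[of UNIV \<phi> "\<lambda>x v. \<Sum>i\<in>UNIV. v $ i * partial_deriv i \<phi> x"])
    show "(\<phi> has_derivative (\<lambda>v. \<Sum>i\<in>UNIV. v $ i * partial_deriv i \<phi> x)) (at x within UNIV)" for x
      using has_derivative_partial_deriv[OF test_functions_differentiable[OF assms]] by simp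
    show "onorm (\<lambda>v. \<Sum>i\<in>UNIV. v $ i * partial_deriv i \<phi> x) \<le> (\<Sum>i\<in>UNIV. B i)" for x
    proof (rule onorm_le)
      fix v :: "real^'n"
      have "norm (\<Sum>i\<in>UNIV. v $ i * partial_deriv i \<phi> x) \<le> (\<Sum>i\<in>UNIV. norm v * B i)"
      proof (rule sum_norm_le)
        fix i
        show "norm (v $ i * partial_deriv i \<phi> x) \<le> norm v * B i"
          unfolding real_norm_def abs_mult using component_le_norm_cart[of v i] B[of i x]
          by (intro mult_mono) auto
      qed
      then show "norm (\<Sum>i\<in>UNIV. v $ i * partial_deriv i \<phi> x) \<le> (\<Sum>i\<in>UNIV. B i) * norm v"
        by (simp add: sum_distrib_left mult.commute)
    qed
  qed auto
  moreover have "0 \<le> (\<Sum>i\<in>UNIV. B i)" using B0 by (intro sum_nonneg) auto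
  ultimately show thesis using that by simp
qed

section \<open>Elementwise slopes and integration by parts\<close>

locale fem = mesh \<Omega> \<T> for \<Omega> :: "(real^'n) set" and \<T> +
  assumes open_dom: "open \<Omega>" and bounded_dom: "bounded \<Omega>" and negligible_bd: "negligible (frontier \<Omega>)"
begin

text \<open>Existence of a slope is enough at this stage; uniqueness follows later from the ball
  contained in each simplex.\<close>

definition elem_grad :: "(real^'n \<Rightarrow> real) \<Rightarrow> (real^'n) set \<Rightarrow> real^'n" where
  "elem_grad v K = (SOME b. \<exists>c. \<forall>x\<in>K. v x = b \<bullet> x + c)"

text \<open>Interiors of distinct simplices are disjoint, so at most one summand is active; the
  field is Borel and zero on all faces.\<close>

definition pw_grad :: "(real^'n \<Rightarrow> real) \<Rightarrow> real^'n \<Rightarrow> real^'n" where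
  "pw_grad v x = (\<Sum>K\<in>\<T>. indicator (interior K) x *\<^sub>R elem_grad v K)"

lemma elem_grad:
  assumes "v \<in> X_h \<T>" "K \<in> \<T>"
  obtains c where "\<And>x. x \<in> K \<Longrightarrow> v x = elem_grad v K \<bullet> x + c"
proof -
  have "\<exists>b c. \<forall>x\<in>K. v x = b \<bullet> x + c" using assms by (auto simp: X_h_def)
  from someI_ex[OF this] that show thesis unfolding elem_grad_def by blast
qed

text \<open>Two simplices meet in a common face, and a proper face misses the interior. In the
  nested case \<open>K'\<close> is a proper face of \<open>K\<close> while its interior lies in that
  of \<open>K\<close>, so this interior is empty.\<close>

lemma disjoint_interiors:
  assumes "K \<in> \<T>" "K' \<in> \<T>" "K \<noteq> K'"
  shows "K \<inter> interior K' = {}"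
proof (cases "K \<inter> K' = K'")
  case False
  then have "(K \<inter> K') \<inter> interior K' = {}"
    using face_of_disjoint_interior[of "K' \<inter> K" K'] face_mesh[OF assms(2,1)] by (simp add: Int_commute)
  then show ?thesis using interior_subset by blast
next
  case True
  then have "K' face_of K" using face_mesh[OF assms(1,2)] by simp
  then have "K' \<inter> interior K = {}" using face_of_disjoint_interior assms(3) by blast
  then have "interior K' \<inter> interior K = {}" using interior_subset by blast
  moreover have "interior K' \<subseteq> interior K" using True by (intro interior_mono) auto
  ultimately show ?thesis by auto
qed

lemma pw_grad_eq:
  assumes "K \<in> \<T>" "x \<in> interior K"
  shows "pw_grad v x = elem_grad v K"
proof -
  have "pw_grad v x = (\<Sum>K'\<in>{K}. indicator (interior K') x *\<^sub>R elem_grad v K')"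
    unfolding pw_grad_def
  proof (rule sum.mono_neutral_right)
    show "\<forall>K'\<in>\<T> - {K}. indicator (interior K') x *\<^sub>R elem_grad v K' = 0"
    proof
      fix K' assume "K' \<in> \<T> - {K}"
      then have "x \<notin> interior K'" using disjoint_interiors[OF assms(1), of K'] assms(2) interior_subset by blast
      then show "indicator (interior K') x *\<^sub>R elem_grad v K' = 0" by simp
    qed
  qed (use finite_mesh assms in auto)
  then show ?thesis using assms by simp
qed

lemma pw_grad_measurable: "pw_grad v \<in> borel_measurable borel"
  unfolding pw_grad_def by (intro borel_measurable_sum borel_measurable_scaleR borel_measurable_indicator) auto

lemma pw_grad_bounded: "norm (pw_grad v x) \<le> (\<Sum>K\<in>\<T>. norm (elem_grad v K))"
  unfolding pw_grad_def by (intro sum_norm_le) (auto simp: indicator_def)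

lemma AE_interior: "AE x in lborel. x \<notin> frontier \<Omega> \<and> (\<forall>K\<in>\<T>. x \<notin> frontier K)"
proof (rule AE_conjI)
  have fr: "AE x in lborel. x \<notin> S" if "negligible S" "closed S" for S :: "(real^'n) set"
  proof -
    have "S \<in> null_sets lborel"
      using that by (metis borel_closed negligible_iff_null_sets null_sets_completion_iff sets_lborel)
    then show ?thesis by (rule AE_not_in)
  qed
  show "AE x in lborel. x \<notin> frontier \<Omega>" using fr negligible_bd by auto
  have "\<forall>K\<in>\<T>. AE x in lborel. x \<notin> frontier K"
    using fr negligible_convex_frontier convex_mesh by auto
  then show "AE x in lborel. \<forall>K\<in>\<T>. x \<notin> frontier K"
    using finite_mesh by (intro AE_finite_allI) auto
qed

lemma interior_elem:
  assumes "x \<in> \<Omega>" "\<forall>K\<in>\<T>. x \<notin> frontier K"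
  obtains K where "K \<in> \<T>" "x \<in> interior K"
proof -
  have "x \<in> \<Union>\<T>" using assms(1) Union_mesh closure_subset by blast
  then obtain K where K: "K \<in> \<T>" "x \<in> K" by blast
  then have "x \<in> interior K" using assms(2) closure_subset by (auto simp: frontier_def)
  with K that show thesis by blast
qed

text \<open>The extension of \<open>v\<close> by zero may jump at the boundary, but the product
  vanishes off \<Omega>. It is Lipschitz on each simplex, where \<open>v\<close> is affine, and a
  segment is covered by finitely many closed pieces along which Lipschitz bounds glue.\<close>

lemma X_h_test_lipschitz:
  assumes v: "v \<in> X_h \<T>" and \<phi>: "\<phi> \<in> test_functions \<Omega>"
  obtains L where "L \<ge> 0" "\<And>x y. \<bar>v x * \<phi> x - v y * \<phi> y\<bar> \<le> L * norm (x - y)"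
proof -
  obtain Bv where Bv: "Bv > 0" "\<And>x. \<bar>v x\<bar> \<le> Bv" using X_h_bounded[OF v] by blast
  obtain B where B: "B > 0" "\<And>x. \<bar>\<phi> x\<bar> \<le> B" using test_function_bounded[OF \<phi>] by blast
  obtain M where M: "M \<ge> 0" "\<And>x y. \<bar>\<phi> x - \<phi> y\<bar> \<le> M * norm (x - y)"
    using test_function_lipschitz[OF \<phi>] by blast
  define L where "L = Bv * M + B * (\<Sum>K\<in>\<T>. norm (elem_grad v K))"
  have L0: "L \<ge> 0" unfolding L_def using Bv(1) B(1) M(1) by (intro add_nonneg_nonneg mult_nonneg_nonneg sum_nonneg) auto
  \<comment> \<open>The complement of the domain gets the index \<open>{}\<close>, which by
    \<open>K0\<close> is not a simplex.\<close>
  define F where "F K = (if K \<in> \<T> then K else - \<Omega>)" for K :: "(real^'n) set"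
  have K0: "{} \<notin> \<T>" using verts_nonempty verts_subset by blast
  have piece: "\<bar>v x * \<phi> x - v y * \<phi> y\<bar> \<le> L * norm (x - y)" if "x \<in> F K" "y \<in> F K" for x y K
  proof (cases "K \<in> \<T>")
    case True
    obtain c where c: "\<And>x. x \<in> K \<Longrightarrow> v x = elem_grad v K \<bullet> x + c" using elem_grad[OF v True] by blast
    have xy: "x \<in> K" "y \<in> K" using that True by (auto simp: F_def)
    have "\<bar>v x - v y\<bar> = \<bar>elem_grad v K \<bullet> (x - y)\<bar>"
      using c xy by (simp add: inner_diff_right)
    also have "\<dots> \<le> norm (elem_grad v K) * norm (x - y)" by (rule Cauchy_Schwarz_ineq2)
    also have "\<dots> \<le> (\<Sum>K\<in>\<T>. norm (elem_grad v K)) * norm (x - y)"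
      using True finite_mesh by (intro mult_right_mono member_le_sum) auto
    finally have vv: "\<bar>v x - v y\<bar> \<le> (\<Sum>K\<in>\<T>. norm (elem_grad v K)) * norm (x - y)" .
    have "v x * \<phi> x - v y * \<phi> y = v x * (\<phi> x - \<phi> y) + \<phi> y * (v x - v y)"
      by (simp add: algebra_simps)
    then have "\<bar>v x * \<phi> x - v y * \<phi> y\<bar> \<le> \<bar>v x\<bar> * \<bar>\<phi> x - \<phi> y\<bar> + \<bar>\<phi> y\<bar> * \<bar>v x - v y\<bar>"
      by (metis abs_mult abs_triangle_ineq)
    also have "\<dots> \<le> Bv * (M * norm (x - y)) + B * ((\<Sum>K\<in>\<T>. norm (elem_grad v K)) * norm (x - y))"
      using Bv B M vv by (intro add_mono mult_mono) auto
    finally show ?thesis by (simp add: L_def algebra_simps)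
  next
    case False
    then have "x \<notin> \<Omega>" "y \<notin> \<Omega>" using that by (auto simp: F_def)
    then have "\<phi> x = 0" "\<phi> y = 0" using \<phi> by (auto simp: test_functions_def)
    then show ?thesis using L0 by simp
  qed
  have "\<bar>v x * \<phi> x - v y * \<phi> y\<bar> \<le> L * norm (x - y)" for x y
  proof -
    define line where "line t = x + t *\<^sub>R (y - x)" for t :: real
    have line: "norm (line s - line t) = dist s t * norm (x - y)" for s t
      unfolding line_def by (simp add: dist_norm norm_minus_commute flip: scaleR_left_diff_distrib)
    have "(L * norm (x - y))-lipschitz_on {0..1} (\<lambda>t. v (line t) * \<phi> (line t))"
    proof (rule lipschitz_on_closed_Union[where I="insert {} \<T>" and U="\<lambda>K. {t. line t \<in> F K}"])
      fix K
      show "(L * norm (x - y))-lipschitz_on {t. line t \<in> F K} (\<lambda>t. v (line t) * \<phi> (line t))"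
      proof (rule lipschitz_onI)
        fix s t assume "s \<in> {t. line t \<in> F K}" "t \<in> {t. line t \<in> F K}"
        then have "\<bar>v (line s) * \<phi> (line s) - v (line t) * \<phi> (line t)\<bar> \<le> L * norm (line s - line t)"
          using piece by simp
        then show "dist (v (line s) * \<phi> (line s)) (v (line t) * \<phi> (line t)) \<le> L * norm (x - y) * dist s t"
          by (simp add: line dist_real_def mult_ac)
      qed (use L0 in simp)
      have "closed (F K)"
        using open_dom compact_mesh compact_imp_closed by (auto simp: F_def)
      moreover have "continuous_on UNIV line" unfolding line_def by (intro continuous_intros)
      ultimately have "closed (line -` F K)" by (simp add: continuous_closed_vimage continuous_on_eq_continuous_at)
      then show "closed {t. line t \<in> F K}" by (simp add: vimage_def)
    next
      show "{0..1} \<subseteq> (\<Union>K\<in>insert {} \<T>. {t. line t \<in> F K})"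
      proof
        fix t :: real
        have "line t \<in> \<Union>\<T> \<or> line t \<notin> \<Omega>" using Union_mesh closure_subset by blast
        then show "t \<in> (\<Union>K\<in>insert {} \<T>. {t. line t \<in> F K})" using K0 by (auto simp: F_def)
      qed
    qed (use finite_mesh L0 in auto)
    from lipschitz_onD[OF this, of 0 1] show ?thesis
      by (simp add: line_def dist_real_def)
  qed
  with L0 that show thesis by blast
qed

text \<open>By the product rule the integrand is almost everywhere the derivative of the Lipschitz
  function \<open>v x * \<phi> x\<close> in direction \<open>axis i 1\<close>.\<close>

lemma X_h_integration_by_parts:
  assumes v: "v \<in> X_h \<T>" and \<phi>: "\<phi> \<in> test_functions \<Omega>"
  shows "(\<integral>x. v x * partial_deriv i \<phi> x + pw_grad v x $ i * \<phi> x \<partial>lborel) = 0"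
proof -
  obtain L where L: "L \<ge> 0" "\<And>x y. \<bar>v x * \<phi> x - v y * \<phi> y\<bar> \<le> L * norm (x - y)"
    using X_h_test_lipschitz[OF v \<phi>] by blast
  obtain R where R: "\<And>x. x \<in> \<Omega> \<Longrightarrow> norm x \<le> R"
    using bounded_dom unfolding bounded_iff by blast
  have out: "\<phi> x = 0" "partial_deriv i \<phi> x = 0" if "x \<notin> \<Omega>" for x
    using \<phi> partial_deriv_test[OF \<phi>] that by (auto simp: test_functions_def)
  have [measurable]: "v \<in> borel_measurable borel" "\<phi> \<in> borel_measurable borel"
    "partial_deriv i \<phi> \<in> borel_measurable borel" "pw_grad v \<in> borel_measurable borel"
    using X_h_measurable[OF v] test_functions_continuous[OF \<phi>]
      test_functions_continuous[OF partial_deriv_test[OF \<phi>]] pw_grad_measurable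
      borel_measurable_continuous_onI by blast+
  have [measurable]: "(\<lambda>x. pw_grad v x $ i) \<in> borel_measurable borel"
    using pw_grad_measurable
    by (rule borel_measurable_continuous_on[rotated]) (rule continuous_on_component[OF continuous_on_id])
  show ?thesis
  proof (rule lipschitz_integral_derivative_zero[where L=L and R=R and w="\<lambda>x. v x * \<phi> x" and d="axis i 1"])
    show "\<bar>v x * \<phi> x - v y * \<phi> y\<bar> \<le> L * norm (x - y)" for x y by (rule L)
    show "v x * \<phi> x = 0" if "R < norm x" for x
      using R[of x] that out(1)[of x] by fastforce
    show "AE x in lborel. \<exists>D. ((\<lambda>x. v x * \<phi> x) has_derivative D) (at x) \<and>
        D (axis i 1) = v x * partial_deriv i \<phi> x + pw_grad v x $ i * \<phi> x"
      using AE_interior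
    proof eventually_elim
      case (elim x)
      show ?case
      proof (cases "x \<in> \<Omega>")
        case True
        then obtain K where K: "K \<in> \<T>" "x \<in> interior K" using interior_elem elim by blast
        obtain c where c: "\<And>x. x \<in> K \<Longrightarrow> v x = elem_grad v K \<bullet> x + c" using elem_grad[OF v K(1)] by blast
        have "((\<lambda>x. elem_grad v K \<bullet> x + c) has_derivative (\<lambda>h. elem_grad v K \<bullet> h)) (at x)"
          by (auto intro!: derivative_eq_intros)
        then have dv: "(v has_derivative (\<lambda>h. elem_grad v K \<bullet> h)) (at x)"
          by (rule has_derivative_transform_within_open[OF _ open_interior K(2)])
             (metis c interior_subset subsetD)
        have d\<phi>: "(\<phi> has_derivative frechet_derivative \<phi> (at x)) (at x)"
          using test_functions_differentiable[OF \<phi>] frechet_derivative_works by blast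
        show ?thesis
          by (rule exI, rule conjI[OF has_derivative_mult[OF dv d\<phi>]])
             (simp add: partial_deriv_def inner_axis pw_grad_eq[OF K])
      next
        case False
        then have x: "x \<in> - closure \<Omega>" using elim interior_subset by (auto simp: frontier_def)
        have "((\<lambda>x. v x * \<phi> x) has_derivative (\<lambda>h. 0)) (at x)"
          by (rule has_derivative_transform_within_open[OF has_derivative_const[of 0] _ x])
             (use out closure_subset in auto)
        then show ?thesis using out[OF False] by auto
      qed
    qed
  qed measurable
qed

lemma integrable_bounded_dom:
  fixes f :: "real^'n \<Rightarrow> 'b::{banach, second_countable_topology}"
  assumes "f \<in> borel_measurable borel" "\<And>x. norm (f x) \<le> B"
  shows "integrable (lebesgue_on \<Omega>) f"
  unfolding integrable_lebesgue_on_iff[OF open_dom]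
  using assms bounded_dom open_dom
  by (intro integrable_bounded_indicator[where B=B]) (auto intro: lmeasurable_open measurable_completion)

theorem X_h_has_weak_gradient:
  assumes v: "v \<in> X_h \<T>"
  shows "has_weak_gradient \<Omega> v (pw_grad v)"
  unfolding has_weak_gradient_def
proof (intro conjI ballI allI)
  obtain B where B: "\<And>x. \<bar>v x\<bar> \<le> B" using X_h_bounded[OF v] by blast
  show "loc_integrable \<Omega> v"
    unfolding loc_integrable_def set_integrable_def using B X_h_measurable[OF v]
    by (intro allI impI integrable_bounded_indicator[where B=B]) (auto intro: lmeasurable_compact measurable_completion)
  show "loc_integrable \<Omega> (pw_grad v)"
    unfolding loc_integrable_def set_integrable_def using pw_grad_bounded pw_grad_measurable
    by (intro allI impI integrable_bounded_indicator[where B="\<Sum>K\<in>\<T>. norm (elem_grad v K)"])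
       (auto intro: lmeasurable_compact measurable_completion)
  fix \<phi> :: "real^'n \<Rightarrow> real" and i assume \<phi>: "\<phi> \<in> test_functions \<Omega>"
  have out: "\<phi> x = 0" "partial_deriv i \<phi> x = 0" if "x \<notin> \<Omega>" for x
    using \<phi> partial_deriv_test[OF \<phi>] that by (auto simp: test_functions_def)
  have i1: "integrable (lebesgue_on \<Omega>) (\<lambda>x. v x * partial_deriv i \<phi> x)"
    by (rule loc_integrable_mult_integrable[OF open_dom \<open>loc_integrable \<Omega> v\<close> partial_deriv_test[OF \<phi>]])
  have i2: "integrable (lebesgue_on \<Omega>) (\<lambda>x. pw_grad v x $ i * \<phi> x)"
    by (rule loc_integrable_mult_integrable[OF open_dom loc_integrable_nth[OF \<open>loc_integrable \<Omega> (pw_grad v)\<close>] \<phi>])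
  have [measurable]: "v \<in> borel_measurable borel" "\<phi> \<in> borel_measurable borel"
    "partial_deriv i \<phi> \<in> borel_measurable borel" "pw_grad v \<in> borel_measurable borel"
    using X_h_measurable[OF v] test_functions_continuous[OF \<phi>]
      test_functions_continuous[OF partial_deriv_test[OF \<phi>]] pw_grad_measurable
      borel_measurable_continuous_onI by blast+
  have [measurable]: "(\<lambda>x. pw_grad v x $ i) \<in> borel_measurable borel"
    using pw_grad_measurable
    by (rule borel_measurable_continuous_on[rotated]) (rule continuous_on_component[OF continuous_on_id])
  have "l2_inner \<Omega> v (partial_deriv i \<phi>) + l2_inner \<Omega> (\<lambda>x. pw_grad v x $ i) \<phi>
      = (\<integral>x. v x * partial_deriv i \<phi> x + pw_grad v x $ i * \<phi> x \<partial>lebesgue_on \<Omega>)"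
    unfolding l2_inner_def inner_real_def by (rule Bochner_Integration.integral_add[OF i1 i2, symmetric])
  also have "\<dots> = (\<integral>x. indicator \<Omega> x *\<^sub>R (v x * partial_deriv i \<phi> x + pw_grad v x $ i * \<phi> x) \<partial>lebesgue)"
    by (rule integral_lebesgue_on_eq[OF open_dom])
  also have "\<dots> = (\<integral>x. v x * partial_deriv i \<phi> x + pw_grad v x $ i * \<phi> x \<partial>lebesgue)"
    using out by (intro Bochner_Integration.integral_cong) (auto simp: indicator_def)
  also have "\<dots> = (\<integral>x. v x * partial_deriv i \<phi> x + pw_grad v x $ i * \<phi> x \<partial>lborel)"
    by (rule integral_completion) measurable
  also have "\<dots> = 0" by (rule X_h_integration_by_parts[OF v \<phi>])
  finally show "l2_inner \<Omega> v (partial_deriv i \<phi>) = - l2_inner \<Omega> (\<lambda>x. pw_grad v x $ i) \<phi>" by simp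
qed

lemma wgrad_X_h: "v \<in> X_h \<T> \<Longrightarrow> AE x in lebesgue_on \<Omega>. wgrad \<Omega> v x = pw_grad v x"
  by (rule wgrad_AE_eq[OF open_dom X_h_has_weak_gradient])

end

section \<open>Local estimates on simplices\<close>

lemma measure_cball:
  fixes c :: "real^'n"
  assumes "r \<ge> 0"
  shows "measure lebesgue (cball c r) = unit_ball_vol CARD('n) * r ^ CARD('n)"
  using content_cball[OF assms, of c] by simp

lemma integrable_indicator_lmeasurable:
  "S \<in> lmeasurable \<Longrightarrow> integrable lebesgue (indicat_real S)"
  by (simp add: lmeasurable_iff_integrable)

text \<open>The variance of \<open>c\<close> under the weights \<open>w\<close> is
  nonnegative.\<close>

lemma convex_combination_square:
  fixes w c :: "'a \<Rightarrow> real"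
  assumes "finite I" "\<And>i. i \<in> I \<Longrightarrow> w i \<ge> 0" "(\<Sum>i\<in>I. w i) = 1"
  shows "(\<Sum>i\<in>I. w i * c i)\<^sup>2 \<le> (\<Sum>i\<in>I. w i * (c i)\<^sup>2)"
proof -
  define m where "m = (\<Sum>i\<in>I. w i * c i)"
  have "0 \<le> (\<Sum>i\<in>I. w i * (c i - m)\<^sup>2)"
    using assms by (intro sum_nonneg) auto
  also have "\<dots> = (\<Sum>i\<in>I. w i * (c i)\<^sup>2 - 2 * m * (w i * c i) + m\<^sup>2 * w i)"
    by (intro sum.cong) (auto simp: power2_eq_square algebra_simps)
  also have "\<dots> = (\<Sum>i\<in>I. w i * (c i)\<^sup>2) - 2 * m * m + m\<^sup>2 * 1"
    by (simp add: sum.distrib sum_subtractf m_def assms(3) flip: sum_distrib_left)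
  finally show ?thesis by (simp add: m_def power2_eq_square)
qed

context fem
begin

definition vol :: "(real^'n) set \<Rightarrow> real" where
  "vol K = measure lebesgue K"

text \<open>Up to the factor \<open>CARD('n) + 1\<close> this is the integral of the nodal basis
  function at \<open>a\<close>, that is, the lumped mass.\<close>

definition node_mass :: "real^'n \<Rightarrow> real" where
  "node_mass a = (\<Sum>K\<in>{K\<in>\<T>. a \<in> verts K}. vol K)"

lemma lmeasurable_mesh: "K \<in> \<T> \<Longrightarrow> K \<in> lmeasurable"
  by (simp add: compact_mesh lmeasurable_compact)

lemma vol_nonneg: "vol K \<ge> 0"
  by (simp add: vol_def)

text \<open>Interiors of simplices are disjoint, and their faces and the boundary of the domain are
  null sets.\<close>

lemma AE_indicator_dom: "AE x in lebesgue. indicator \<Omega> x = (\<Sum>K\<in>\<T>. indicator K x :: real)"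
proof -
  have "AE x in lborel. indicator \<Omega> x = (\<Sum>K\<in>\<T>. indicator K x :: real)"
    using AE_interior
  proof eventually_elim
    case (elim x)
    show ?case
    proof (cases "x \<in> \<Omega>")
      case True
      then obtain K where K: "K \<in> \<T>" "x \<in> interior K" using interior_elem elim by blast
      have "(\<Sum>K\<in>\<T>. indicator K x :: real) = (\<Sum>K'\<in>{K}. indicator K' x)"
      proof (rule sum.mono_neutral_right)
        show "\<forall>K'\<in>\<T> - {K}. indicator K' x = (0::real)"
        proof
          fix K' assume "K' \<in> \<T> - {K}"
          then have "x \<notin> K'" using disjoint_interiors[of K' K] K by auto
          then show "indicator K' x = (0::real)" by simp
        qed
      qed (use finite_mesh K in auto)
      moreover have "x \<in> K" using K interior_subset by blast
      ultimately show ?thesis using True by simp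
    next
      case False
      then have "x \<notin> closure \<Omega>" using elim interior_subset by (auto simp: frontier_def)
      then have "x \<notin> K" if "K \<in> \<T>" for K using Union_mesh that by auto
      then show ?thesis using False by simp
    qed
  qed
  then show ?thesis by (rule AE_completion)
qed

lemma sum_indicator_le_1: "AE x in lebesgue. (\<Sum>K\<in>\<T>. indicator K x :: real) \<le> 1"
  using AE_indicator_dom by eventually_elim (metis indicator_le_1)

text \<open>Simplices overlap only in null sets. The counting of nodes and simplices rests on this
  comparison.\<close>

lemma sum_vol_le:
  assumes "S \<in> lmeasurable"
  shows "(\<Sum>K\<in>{K\<in>\<T>. K \<subseteq> S}. vol K) \<le> measure lebesgue S"
proof -
  let ?I = "{K\<in>\<T>. K \<subseteq> S}"
  note int = integrable_indicator_lmeasurable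
  have "(\<Sum>K\<in>?I. vol K) = (\<integral>x. (\<Sum>K\<in>?I. indicator K x) \<partial>lebesgue)"
    using int lmeasurable_mesh by (subst Bochner_Integration.integral_sum) (auto simp: vol_def)
  also have "\<dots> \<le> (\<integral>x. indicator S x \<partial>lebesgue)"
  proof (rule integral_mono_AE)
    show "integrable lebesgue (\<lambda>x. \<Sum>K\<in>?I. indicat_real K x)"
      using int lmeasurable_mesh by (intro Bochner_Integration.integrable_sum) auto
    show "AE x in lebesgue. (\<Sum>K\<in>?I. indicat_real K x) \<le> indicator S x"
      using sum_indicator_le_1
    proof eventually_elim
      case (elim x)
      have "(\<Sum>K\<in>?I. indicat_real K x) \<le> (\<Sum>K\<in>\<T>. indicator K x)"
        using finite_mesh by (intro sum_mono2) auto
      moreover have "(\<Sum>K\<in>?I. indicat_real K x) = 0" if "x \<notin> S"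
        using that by (intro sum.neutral) (auto simp: indicator_def)
      ultimately show ?case using elim by (cases "x \<in> S") auto
    qed
  qed (rule int[OF assms])
  finally show ?thesis by simp
qed

text \<open>Double counting of the pairs of a simplex and one of its vertices.\<close>

lemma sum_verts_eq:
  "(\<Sum>K\<in>\<T>. vol K * (\<Sum>a\<in>verts K. f a)) = (\<Sum>a\<in>nodes \<T>. node_mass a * f a)"
proof -
  have "(\<Sum>K\<in>\<T>. vol K * (\<Sum>a\<in>verts K. f a)) = (\<Sum>K\<in>\<T>. \<Sum>a\<in>{a\<in>nodes \<T>. a \<in> verts K}. vol K * f a)"
    using verts_node by (intro sum.cong refl) (auto simp: sum_distrib_left intro!: sum.cong)
  also have "\<dots> = (\<Sum>a\<in>nodes \<T>. \<Sum>K\<in>{K\<in>\<T>. a \<in> verts K}. vol K * f a)"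
    by (rule sum.swap_restrict[OF finite_mesh finite_nodes])
  finally show ?thesis by (simp add: node_mass_def sum_distrib_right)
qed

lemma integrable_elem:
  fixes f :: "real^'n \<Rightarrow> real"
  assumes f: "integrable (lebesgue_on \<Omega>) f" and K: "K \<in> \<T>" and m: "f \<in> borel_measurable lebesgue"
  shows "integrable lebesgue (\<lambda>x. indicator K x * f x)"
proof -
  have 1: "integrable lebesgue (\<lambda>x. indicator K x *\<^sub>R (indicator \<Omega> x *\<^sub>R f x))"
    using lmeasurable_mesh[OF K] f[unfolded integrable_lebesgue_on_iff[OF open_dom]]
    by (rule integrable_mult_indicator[OF fmeasurableD])
  have 2: "AE x in lebesgue. indicator K x *\<^sub>R (indicator \<Omega> x *\<^sub>R f x) = indicator K x * f x"
    using AE_completion[OF AE_interior]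
  proof eventually_elim
    case (elim x)
    have "x \<in> \<Omega>" if "x \<in> K"
    proof -
      have "x \<in> closure \<Omega>" using that K Union_mesh by blast
      then show ?thesis using elim interior_eq[of \<Omega>] open_dom by (auto simp: frontier_def)
    qed
    then show ?case by (auto simp: indicator_def)
  qed
  have 3: "(\<lambda>x. indicator K x * f x) \<in> borel_measurable lebesgue"
    using lmeasurable_mesh[OF K] m
    by (intro borel_measurable_times borel_measurable_indicator) (auto simp: fmeasurableD)
  show ?thesis by (rule integrable_cong_AE_imp[OF 1 3 2])
qed

lemma integral_dom_eq_sum:
  fixes f :: "real^'n \<Rightarrow> real"
  assumes f: "integrable (lebesgue_on \<Omega>) f" and m: "f \<in> borel_measurable lebesgue"
  shows "(\<integral>x. f x \<partial>lebesgue_on \<Omega>) = (\<Sum>K\<in>\<T>. \<integral>x. indicator K x * f x \<partial>lebesgue)"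
proof -
  have "(\<integral>x. f x \<partial>lebesgue_on \<Omega>) = (\<integral>x. indicator \<Omega> x *\<^sub>R f x \<partial>lebesgue)"
    by (rule integral_lebesgue_on_eq[OF open_dom])
  also have "\<dots> = (\<integral>x. (\<Sum>K\<in>\<T>. indicator K x * f x) \<partial>lebesgue)"
  proof (rule integral_cong_AE)
    show "(\<lambda>x. indicator \<Omega> x *\<^sub>R f x) \<in> borel_measurable lebesgue"
      using m open_dom by (intro borel_measurable_scaleR borel_measurable_indicator) auto
    show "(\<lambda>x. \<Sum>K\<in>\<T>. indicator K x * f x) \<in> borel_measurable lebesgue"
      using integrable_elem[OF f _ m] by (intro borel_measurable_sum borel_measurable_integrable)
    show "AE x in lebesgue. indicator \<Omega> x *\<^sub>R f x = (\<Sum>K\<in>\<T>. indicator K x * f x)"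
      using AE_indicator_dom by eventually_elim (simp flip: sum_distrib_right)
  qed
  also have "\<dots> = (\<Sum>K\<in>\<T>. \<integral>x. indicator K x * f x \<partial>lebesgue)"
    using integrable_elem[OF f _ m] by (rule Bochner_Integration.integral_sum)
  finally show ?thesis .
qed

lemma l2_inner_pw_grad:
  "l2_inner \<Omega> (pw_grad v) (pw_grad w) = (\<Sum>K\<in>\<T>. vol K * (elem_grad v K \<bullet> elem_grad w K))"
proof -
  let ?f = "\<lambda>x. pw_grad v x \<bullet> pw_grad w x"
  have m: "?f \<in> borel_measurable borel"
    using pw_grad_measurable by (intro borel_measurable_inner) auto
  have "norm (?f x) \<le> (\<Sum>K\<in>\<T>. norm (elem_grad v K)) * (\<Sum>K\<in>\<T>. norm (elem_grad w K))" for x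
    using pw_grad_bounded[of v x] pw_grad_bounded[of w x]
    by (auto intro!: order_trans[OF Cauchy_Schwarz_ineq2] mult_mono sum_nonneg)
  then have f: "integrable (lebesgue_on \<Omega>) ?f"
    by (rule integrable_bounded_dom[OF m])
  have "l2_inner \<Omega> (pw_grad v) (pw_grad w) = (\<Sum>K\<in>\<T>. \<integral>x. indicator K x * ?f x \<partial>lebesgue)"
    unfolding l2_inner_def using m by (intro integral_dom_eq_sum[OF f]) (simp add: measurable_completion)
  also have "\<dots> = (\<Sum>K\<in>\<T>. \<integral>x. (elem_grad v K \<bullet> elem_grad w K) * indicator K x \<partial>lebesgue)"
  proof (rule sum.cong[OF refl])
    fix K assume K: "K \<in> \<T>"
    show "(\<integral>x. indicator K x * ?f x \<partial>lebesgue) = (\<integral>x. (elem_grad v K \<bullet> elem_grad w K) * indicator K x \<partial>lebesgue)"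
    proof (rule integral_cong_AE)
      show "(\<lambda>x. indicator K x * ?f x) \<in> borel_measurable lebesgue"
        using integrable_elem[OF f K] m by (simp add: measurable_completion)
      show "(\<lambda>x. (elem_grad v K \<bullet> elem_grad w K) * indicator K x) \<in> borel_measurable lebesgue"
        using lmeasurable_mesh[OF K]
        by (intro borel_measurable_times borel_measurable_indicator) (auto simp: fmeasurableD)
      show "AE x in lebesgue. indicator K x * ?f x = (elem_grad v K \<bullet> elem_grad w K) * indicator K x"
        using AE_completion[OF AE_interior]
      proof eventually_elim
        case (elim x)
        have "x \<in> interior K" if "x \<in> K"
          using that elim K closure_subset by (auto simp: frontier_def)
        then show ?case using pw_grad_eq[OF K] by (auto simp: indicator_def)
      qed
    qed
  qed
  also have "\<dots> = (\<Sum>K\<in>\<T>. vol K * (elem_grad v K \<bullet> elem_grad w K))"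
    by (simp add: vol_def mult.commute)
  finally show ?thesis .
qed

lemma X_h_abs_le:
  assumes "v \<in> X_h \<T>" "K \<in> \<T>" "x \<in> K" "\<And>a. a \<in> verts K \<Longrightarrow> \<bar>v a\<bar> \<le> m"
  shows "\<bar>v x\<bar> \<le> m"
proof -
  have "\<bar>v x\<bar> \<le> (\<Sum>a\<in>verts K. \<bar>v a * nodal_basis \<T> a x\<bar>)"
    unfolding X_h_expand_verts[OF assms(1-3)] by (rule sum_abs)
  also have "\<dots> \<le> (\<Sum>a\<in>verts K. m * nodal_basis \<T> a x)"
    using nodal_basis_nonneg[OF verts_node[OF assms(2)]] assms(4)
    by (intro sum_mono) (auto simp: abs_mult intro!: mult_right_mono)
  also have "\<dots> = m" using nodal_basis_sum(2)[OF assms(2,3)] by (simp flip: sum_distrib_left)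
  finally show ?thesis .
qed

lemma X_h_square_integrable:
  assumes "v \<in> X_h \<T>"
  shows "integrable (lebesgue_on \<Omega>) (\<lambda>x. (v x)\<^sup>2)" "(\<lambda>x. (v x)\<^sup>2) \<in> borel_measurable lebesgue"
proof -
  obtain B where B: "B > 0" "\<And>x. \<bar>v x\<bar> \<le> B" using X_h_bounded[OF assms] by blast
  have m: "(\<lambda>x. (v x)\<^sup>2) \<in> borel_measurable borel"
    using X_h_measurable[OF assms] by measurable
  then show "(\<lambda>x. (v x)\<^sup>2) \<in> borel_measurable lebesgue" by (simp add: measurable_completion)
  have "norm ((v x)\<^sup>2) \<le> B\<^sup>2" for x using B(2)[of x] B(1) by (simp add: abs_le_square_iff[symmetric])
  then show "integrable (lebesgue_on \<Omega>) (\<lambda>x. (v x)\<^sup>2)" by (rule integrable_bounded_dom[OF m])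
qed

text \<open>Shrinking the simplex by the factor \<open>1 / 4\<close> towards the vertex with the largest value
  leaves at least half of that value.\<close>

lemma elem_mass_lower:
  assumes v: "v \<in> X_h \<T>" and K: "K \<in> \<T>" and a: "a \<in> verts K"
  shows "vol K * (v a)\<^sup>2 / (4 * 4 ^ CARD('n)) \<le> (\<integral>x. indicator K x * (v x)\<^sup>2 \<partial>lebesgue)"
proof -
  define m where "m = Max ((\<lambda>a. \<bar>v a\<bar>) ` verts K)"
  have fin: "finite ((\<lambda>a. \<bar>v a\<bar>) ` verts K)" "(\<lambda>a. \<bar>v a\<bar>) ` verts K \<noteq> {}"
    using simplex_verts(2)[OF K] a by auto
  have le_m: "\<bar>v b\<bar> \<le> m" if "b \<in> verts K" for b
    unfolding m_def using fin that by (intro Max_ge) auto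
  obtain b where b: "b \<in> verts K" "\<bar>v b\<bar> = m"
    using Max_in[OF fin] by (auto simp: m_def)
  define A where "A = (\<lambda>x. (1/4) *\<^sub>R x + (3/4) *\<^sub>R b) ` K"
  obtain c where c: "\<And>x. x \<in> K \<Longrightarrow> v x = elem_grad v K \<bullet> x + c" using elem_grad[OF v K] by blast
  have AK: "A \<subseteq> K"
    using convexD[OF convex_mesh[OF K], of _ b "1/4" "3/4"] verts_in[OF b(1)] by (auto simp: A_def)
  have "compact A" unfolding A_def
    by (intro compact_continuous_image continuous_intros compact_mesh[OF K])
  then have A: "A \<in> lmeasurable" by (rule lmeasurable_compact)
  have "measure lebesgue A = (1/4) ^ CARD('n) * vol K"
    using measure_lebesgue_affine[of "1/4" "(3/4) *\<^sub>R b" K] by (simp add: A_def vol_def)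
  have low: "m\<^sup>2 / 4 \<le> (v y)\<^sup>2" if "y \<in> A" for y
  proof -
    obtain x where x: "x \<in> K" "y = (1/4) *\<^sub>R x + (3/4) *\<^sub>R b" using \<open>y \<in> A\<close> unfolding A_def by blast
    have "v y = (1/4) * v x + (3/4) * v b"
    proof -
      have "y \<in> K" using AK that by blast
      then show ?thesis
        using c[of y] c[OF x(1)] c[OF verts_in[OF b(1)]] unfolding x(2)
        by (simp add: inner_add_right field_simps)
    qed
    moreover have "\<bar>v x\<bar> \<le> m" using X_h_abs_le[OF v K x(1)] le_m by blast
    ultimately have "m / 2 \<le> \<bar>v y\<bar>" using b(2) by linarith
    then have "(m / 2)\<^sup>2 \<le> \<bar>v y\<bar>\<^sup>2" using b(2) by (intro power_mono) auto
    then show ?thesis by (simp add: power_divide)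
  qed
  have intA: "integrable lebesgue (indicat_real A)"
    using A by (rule integrable_indicator_lmeasurable)
  \<comment> \<open>The factor 4 comes from the square of \<open>m / 2\<close>, the power of 4 from
    the volume of the shrunken simplex.\<close>
  have "vol K * (v a)\<^sup>2 / (4 * 4 ^ CARD('n)) \<le> vol K * m\<^sup>2 / (4 * 4 ^ CARD('n))"
    using power_mono[OF le_m[OF a], of 2] vol_nonneg
    by (intro divide_right_mono mult_left_mono) auto
  also have "\<dots> = (\<integral>x. (m\<^sup>2 / 4) * indicator A x \<partial>lebesgue)"
    using \<open>measure lebesgue A = (1/4) ^ CARD('n) * vol K\<close> by (simp add: power_one_over mult.commute)
  also have "\<dots> \<le> (\<integral>x. indicator K x * (v x)\<^sup>2 \<partial>lebesgue)"
  proof (rule integral_mono)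
    show "integrable lebesgue (\<lambda>x. (m\<^sup>2 / 4) * indicator A x)"
      using intA by (rule integrable_mult_right)
    show "integrable lebesgue (\<lambda>x. indicator K x * (v x)\<^sup>2)"
      by (rule integrable_elem[OF X_h_square_integrable(1)[OF v] K X_h_square_integrable(2)[OF v]])
    show "(m\<^sup>2 / 4) * indicator A x \<le> indicator K x * (v x)\<^sup>2" for x
      using low[of x] AK by (cases "x \<in> A") auto
  qed
  finally show ?thesis .
qed

lemma elem_grad_diff:
  assumes "v \<in> X_h \<T>" "K \<in> \<T>" "x \<in> K" "y \<in> K"
  shows "v x - v y = elem_grad v K \<bullet> (x - y)"
proof -
  obtain c where "\<And>x. x \<in> K \<Longrightarrow> v x = elem_grad v K \<bullet> x + c" using elem_grad[OF assms(1,2)] by blast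
  then show ?thesis using assms by (simp add: inner_diff_right)
qed

text \<open>An affine function attains its extremes over a simplex at vertices; the bound passes
  from vertices to \<open>x\<close> and then to \<open>y\<close>.\<close>

lemma X_h_diff_le:
  assumes v: "v \<in> X_h \<T>" and K: "K \<in> \<T>" "x \<in> K" "y \<in> K"
    and m: "\<And>a b. a \<in> verts K \<Longrightarrow> b \<in> verts K \<Longrightarrow> v a - v b \<le> m"
  shows "v x - v y \<le> m"
proof -
  obtain c where c: "\<And>x. x \<in> K \<Longrightarrow> v x = elem_grad v K \<bullet> x + c" using elem_grad[OF v K(1)] by blast
  have hull: "x \<in> convex hull verts K" "y \<in> convex hull verts K" using K simplex_verts(4) by blast+
  have 1: "elem_grad v K \<bullet> x + c \<le> m + v b" if b: "b \<in> verts K" for b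
  proof (rule affine_le_on_hull[OF hull(1)])
    show "elem_grad v K \<bullet> a + c \<le> m + v b" if "a \<in> verts K" for a
      using m[OF that b] c[OF verts_in[OF that]] by simp
  qed
  have "(- elem_grad v K) \<bullet> y + (- c) \<le> m - v x"
  proof (rule affine_le_on_hull[OF hull(2)])
    show "(- elem_grad v K) \<bullet> a + (- c) \<le> m - v x" if "a \<in> verts K" for a
      using 1[OF that] c[OF verts_in[OF that]] c[OF K(2)] by simp
  qed
  then show ?thesis using c K by simp
qed

end

text \<open>\<open>h\<close> bounds all diameters, and every simplex contains a ball of radius
  \<rho> h. Shape regularity and quasi-uniformity enter the estimates only through this pair, so the
  mesh constants depend on \<rho> and the dimension.\<close>

locale shaped_fem = fem \<Omega> \<T> for \<Omega> :: "(real^'n) set" and \<T> +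
  fixes h \<rho> :: real
  assumes h_pos: "h > 0" and \<rho>_pos: "\<rho> > 0"
    and diam: "\<And>K x y. K \<in> \<T> \<Longrightarrow> x \<in> K \<Longrightarrow> y \<in> K \<Longrightarrow> norm (x - y) \<le> h"
    and inball: "\<And>K. K \<in> \<T> \<Longrightarrow> \<exists>z. cball z (\<rho> * h) \<subseteq> K"
begin

lemma vol_lower: "K \<in> \<T> \<Longrightarrow> unit_ball_vol CARD('n) * (\<rho> * h) ^ CARD('n) \<le> vol K"
proof -
  assume K: "K \<in> \<T>"
  then obtain z where "cball z (\<rho> * h) \<subseteq> K" using inball by blast
  then have "measure lebesgue (cball z (\<rho> * h)) \<le> vol K"
    unfolding vol_def using lmeasurable_mesh[OF K] by (intro measure_mono_fmeasurable) auto
  then show ?thesis using h_pos \<rho>_pos by (simp only: measure_cball mult_nonneg_nonneg less_imp_le)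
qed

lemma elem_subset_cball: "K \<in> \<T> \<Longrightarrow> a \<in> K \<Longrightarrow> K \<subseteq> cball a h"
  using diam by (auto simp: dist_norm)

lemma node_mass_lower:
  assumes "a \<in> nodes \<T>" shows "unit_ball_vol CARD('n) * (\<rho> * h) ^ CARD('n) \<le> node_mass a"
proof -
  obtain K where K: "K \<in> \<T>" "a \<in> verts K" using assms by (auto simp: nodes_eq)
  have "vol K \<le> node_mass a"
    unfolding node_mass_def using K finite_mesh vol_nonneg by (intro member_le_sum) auto
  then show ?thesis using vol_lower[OF K(1)] by linarith
qed

lemma node_mass_upper: "node_mass a \<le> unit_ball_vol CARD('n) * h ^ CARD('n)"
proof -
  have "{K\<in>\<T>. a \<in> verts K} \<subseteq> {K\<in>\<T>. K \<subseteq> cball a h}"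
    using elem_subset_cball verts_in by blast
  then have "node_mass a \<le> (\<Sum>K\<in>{K\<in>\<T>. K \<subseteq> cball a h}. vol K)"
    unfolding node_mass_def using finite_mesh vol_nonneg by (intro sum_mono2) auto
  also have "\<dots> \<le> measure lebesgue (cball a h)" by (intro sum_vol_le) auto
  finally show ?thesis using h_pos by (simp only: measure_cball less_imp_le)
qed

text \<open>Packing by volume: each node has a mass of at least the volume of a ball of radius
  \<rho> h, each simplex counts for at most \<open>CARD('n) + 1\<close> vertices, and the simplices
  involved lie in the ball of radius \<open>(R + 1) * h\<close>.\<close>

lemma card_nodes_cball:
  assumes "R \<ge> 0"
  shows "real (card {b\<in>nodes \<T>. norm (b - x) \<le> R * h}) \<le> real (CARD('n) + 1) * ((R + 1) / \<rho>) ^ CARD('n)"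
proof -
  let ?N = "{b\<in>nodes \<T>. norm (b - x) \<le> R * h}"
  have "unit_ball_vol CARD('n) * (\<rho> * h) ^ CARD('n) * card ?N = (\<Sum>b\<in>?N. unit_ball_vol CARD('n) * (\<rho> * h) ^ CARD('n))" by simp
  also have "\<dots> \<le> (\<Sum>b\<in>?N. node_mass b)" using node_mass_lower by (intro sum_mono) auto
  also have "\<dots> = (\<Sum>b\<in>nodes \<T>. node_mass b * (if b \<in> ?N then 1 else 0))"
    using finite_nodes by (simp add: sum.If_cases Int_def if_distrib cong: if_cong)
  also have "\<dots> = (\<Sum>K\<in>\<T>. vol K * (\<Sum>b\<in>verts K. if b \<in> ?N then 1 else 0))"
    by (rule sum_verts_eq[symmetric])
  also have "\<dots> \<le> (\<Sum>K\<in>\<T>. vol K * (if K \<subseteq> cball x ((R + 1) * h) then real (CARD('n) + 1) else 0))"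
  proof (intro sum_mono mult_left_mono vol_nonneg)
    fix K assume K: "K \<in> \<T>"
    show "(\<Sum>b\<in>verts K. if b \<in> ?N then 1 else 0) \<le> (if K \<subseteq> cball x ((R + 1) * h) then real (CARD('n) + 1) else 0)"
    proof (cases "K \<subseteq> cball x ((R + 1) * h)")
      case True
      have "(\<Sum>b\<in>verts K. if b \<in> ?N then 1 else 0 :: real) \<le> (\<Sum>b\<in>verts K. 1)" by (intro sum_mono) auto
      then show ?thesis using True simplex_verts(3)[OF K] by simp
    next
      case False
      have "b \<notin> ?N" if b: "b \<in> verts K" for b
      proof
        assume "b \<in> ?N"
        have "K \<subseteq> cball x ((R + 1) * h)"
        proof
          fix y assume "y \<in> K"
          then have "norm (y - b) \<le> h" using diam[OF K] verts_in[OF b] by blast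
          then show "y \<in> cball x ((R + 1) * h)"
            using \<open>b \<in> ?N\<close> norm_triangle_ineq[of "y - b" "b - x"]
            by (simp add: dist_norm norm_minus_commute algebra_simps)
        qed
        with False show False by blast
      qed
      then have "(\<Sum>b\<in>verts K. if b \<in> ?N then 1 else 0 :: real) = 0" by (intro sum.neutral) auto
      then show ?thesis using False by (simp only: if_False)
    qed
  qed
  also have "\<dots> = real (CARD('n) + 1) * (\<Sum>K\<in>{K\<in>\<T>. K \<subseteq> cball x ((R + 1) * h)}. vol K)"
    using finite_mesh
    by (simp add: sum_distrib_left sum.If_cases Int_def if_distrib mult.commute cong: if_cong)
  also have "\<dots> \<le> real (CARD('n) + 1) * measure lebesgue (cball x ((R + 1) * h))"
    by (intro mult_left_mono sum_vol_le) auto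
  also have "\<dots> = real (CARD('n) + 1) * (unit_ball_vol CARD('n) * ((R + 1) * h) ^ CARD('n))"
    using assms h_pos by (simp only: measure_cball mult_nonneg_nonneg add_nonneg_nonneg less_imp_le zero_le_one)
  finally have fin_le: "unit_ball_vol CARD('n) * (\<rho> * h) ^ CARD('n) * card ?N
      \<le> real (CARD('n) + 1) * (unit_ball_vol CARD('n) * ((R + 1) * h) ^ CARD('n))" .
  have "(unit_ball_vol CARD('n) * (\<rho> * h) ^ CARD('n)) * card ?N \<le> (unit_ball_vol CARD('n) * (\<rho> * h) ^ CARD('n)) * (real (CARD('n) + 1) * ((R + 1) / \<rho>) ^ CARD('n))"
  proof -
    have "(\<rho> * h) ^ CARD('n) * ((R + 1) / \<rho>) ^ CARD('n) = ((R + 1) * h) ^ CARD('n)"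
      using \<rho>_pos by (simp add: power_mult_distrib power_divide)
    then have "(unit_ball_vol CARD('n) * (\<rho> * h) ^ CARD('n)) * (real (CARD('n) + 1) * ((R + 1) / \<rho>) ^ CARD('n))
        = real (CARD('n) + 1) * (unit_ball_vol CARD('n) * ((R + 1) * h) ^ CARD('n))"
      by (simp only: mult_ac)
    then show ?thesis using fin_le by (simp only:)
  qed
  moreover have "unit_ball_vol CARD('n) * (\<rho> * h) ^ CARD('n) > 0" using unit_ball_vol_pos \<rho>_pos h_pos by simp
  ultimately show ?thesis by (rule mult_left_le_imp_le)
qed

text \<open>Summing the elementwise bound over the vertices costs the factor
  \<open>CARD('n) + 1\<close>. With \<open>mass_upper\<close> this makes the mass matrix comparable
  to the diagonal of node masses.\<close>

lemma mass_lower: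
  assumes "v \<in> X_h \<T>"
  shows "(\<Sum>a\<in>nodes \<T>. node_mass a * (v a)\<^sup>2) \<le> real (CARD('n) + 1) * (4 * 4 ^ CARD('n)) * l2_inner \<Omega> v v"
proof -
  have "(\<Sum>a\<in>nodes \<T>. node_mass a * (v a)\<^sup>2) = (\<Sum>K\<in>\<T>. vol K * (\<Sum>a\<in>verts K. (v a)\<^sup>2))"
    by (rule sum_verts_eq[symmetric])
  also have "\<dots> = (\<Sum>K\<in>\<T>. \<Sum>a\<in>verts K. vol K * (v a)\<^sup>2)" by (simp add: sum_distrib_left)
  also have "\<dots> \<le> (\<Sum>K\<in>\<T>. \<Sum>a\<in>verts K. (4 * 4 ^ CARD('n)) * (\<integral>x. indicator K x * (v x)\<^sup>2 \<partial>lebesgue))"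
    using elem_mass_lower[OF assms] by (intro sum_mono) (simp add: field_simps)
  also have "\<dots> = real (CARD('n) + 1) * (4 * 4 ^ CARD('n)) * (\<Sum>K\<in>\<T>. \<integral>x. indicator K x * (v x)\<^sup>2 \<partial>lebesgue)"
    using simplex_verts(3) by (simp add: sum_distrib_left mult_ac)
  also have "(\<Sum>K\<in>\<T>. \<integral>x. indicator K x * (v x)\<^sup>2 \<partial>lebesgue) = l2_inner \<Omega> v v"
    using integral_dom_eq_sum[OF X_h_square_integrable[OF assms]] by (simp add: l2_inner_def power2_eq_square)
  finally show ?thesis .
qed

text \<open>Jensen's inequality for the nodal expansion at each point.\<close>

lemma mass_upper:
  assumes "v \<in> X_h \<T>"
  shows "l2_inner \<Omega> v v \<le> (\<Sum>a\<in>nodes \<T>. node_mass a * (v a)\<^sup>2)"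
proof -
  have "l2_inner \<Omega> v v = (\<Sum>K\<in>\<T>. \<integral>x. indicator K x * (v x)\<^sup>2 \<partial>lebesgue)"
    using integral_dom_eq_sum[OF X_h_square_integrable[OF assms]] by (simp add: l2_inner_def power2_eq_square)
  also have "\<dots> \<le> (\<Sum>K\<in>\<T>. \<integral>x. (\<Sum>a\<in>verts K. (v a)\<^sup>2) * indicator K x \<partial>lebesgue)"
  proof (intro sum_mono integral_mono)
    fix K x assume K: "K \<in> \<T>"
    show "integrable lebesgue (\<lambda>x. indicator K x * (v x)\<^sup>2)"
      by (rule integrable_elem[OF X_h_square_integrable(1)[OF assms] K X_h_square_integrable(2)[OF assms]])
    show "integrable lebesgue (\<lambda>x. (\<Sum>a\<in>verts K. (v a)\<^sup>2) * indicator K x)"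
      using lmeasurable_mesh[OF K]
      by (intro integrable_mult_right integrable_indicator_lmeasurable)
    show "indicator K x * (v x)\<^sup>2 \<le> (\<Sum>a\<in>verts K. (v a)\<^sup>2) * indicator K x"
    proof (cases "x \<in> K")
      case True
      have "(v x)\<^sup>2 \<le> (\<Sum>a\<in>verts K. nodal_basis \<T> a x * (v a)\<^sup>2)"
        using convex_combination_square[of "verts K" "\<lambda>a. nodal_basis \<T> a x" v] simplex_verts(2)[OF K]
          nodal_basis_nonneg[OF verts_node[OF K]] nodal_basis_sum(2)[OF K True]
          X_h_expand_verts[OF assms K True] by (simp add: mult.commute)
      also have "\<dots> \<le> (\<Sum>a\<in>verts K. 1 * (v a)\<^sup>2)"
      proof (intro sum_mono mult_right_mono)
        fix a assume "a \<in> verts K"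
        then show "nodal_basis \<T> a x \<le> 1"
          using member_le_sum[of a "verts K" "\<lambda>a. nodal_basis \<T> a x"] nodal_basis_sum(2)[OF K True]
            nodal_basis_nonneg[OF verts_node[OF K]] simplex_verts(2)[OF K] by simp
      qed auto
      finally show ?thesis using True by simp
    qed simp
  qed
  also have "\<dots> = (\<Sum>K\<in>\<T>. vol K * (\<Sum>a\<in>verts K. (v a)\<^sup>2))" by (simp add: vol_def mult.commute)
  also have "\<dots> = (\<Sum>a\<in>nodes \<T>. node_mass a * (v a)\<^sup>2)" by (rule sum_verts_eq)
  finally show ?thesis .
qed

text \<open>A discrete substitute for h^2 times the squared gradient norm. It depends on nodal
  values only, so it applies to vector fields, to arbitrary nodal data and to nodal products
  alike.\<close>

definition osc :: "(real^'n \<Rightarrow> 'b::real_normed_vector) \<Rightarrow> real" where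
  "osc f = (\<Sum>K\<in>\<T>. vol K * (\<Sum>a\<in>verts K. \<Sum>b\<in>verts K. (norm (f a - f b))\<^sup>2))"

text \<open>Cross the inscribed ball through its centre along the gradient: over the length
  \<open>2 * \<rho> * h\<close> the affine function grows by exactly slope times length, and by no
  more than the largest difference between vertices.\<close>

lemma elem_grad_le:
  assumes v: "v \<in> X_h \<T>" and K: "K \<in> \<T>"
  shows "(norm (elem_grad v K))\<^sup>2 \<le> (1 / (2 * \<rho> * h))\<^sup>2 * (\<Sum>a\<in>verts K. \<Sum>b\<in>verts K. (v a - v b)\<^sup>2)"
proof -
  define S where "S = (\<Sum>a\<in>verts K. \<Sum>b\<in>verts K. (v a - v b)\<^sup>2)"
  have fin: "finite (verts K)" using simplex_verts(2)[OF K] .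
  have S: "(v a - v b)\<^sup>2 \<le> S" if "a \<in> verts K" "b \<in> verts K" for a b
  proof -
    have "(v a - v b)\<^sup>2 \<le> (\<Sum>b\<in>verts K. (v a - v b)\<^sup>2)" using fin that by (intro member_le_sum) auto
    also have "\<dots> \<le> S" unfolding S_def
      using fin that by (intro member_le_sum[of a _ "\<lambda>a. \<Sum>b\<in>verts K. (v a - v b)\<^sup>2"]) (auto intro: sum_nonneg)
    finally show ?thesis .
  qed
  have S0: "S \<ge> 0" unfolding S_def by (intro sum_nonneg) auto
  obtain z where z: "cball z (\<rho> * h) \<subseteq> K" using inball[OF K] by blast
  define g where "g = elem_grad v K"
  have "norm g * (2 * \<rho> * h) \<le> sqrt S"
  proof (cases "g = 0")
    case False
    define d where "d = (\<rho> * h / norm g) *\<^sub>R g"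
    have "norm d = \<rho> * h" using False h_pos \<rho>_pos by (simp add: d_def)
    then have zd: "z + d \<in> K" "z - d \<in> K" using z by (auto simp: dist_norm subset_iff)
    have "v (z + d) - v (z - d) \<le> sqrt S"
      using S real_le_rsqrt by (intro X_h_diff_le[OF v K zd]) auto
    then have "g \<bullet> ((z + d) - (z - d)) \<le> sqrt S"
      by (simp only: g_def elem_grad_diff[OF v K zd])
    also have "(z + d) - (z - d) = 2 *\<^sub>R d" by (simp add: scaleR_2)
    also have "g \<bullet> (2 *\<^sub>R d) = norm g * (2 * \<rho> * h)"
      using False by (simp add: d_def power2_norm_eq_inner[symmetric] power2_eq_square)
    finally show ?thesis .
  qed (use S0 in simp)
  then have "(norm g * (2 * \<rho> * h))\<^sup>2 \<le> (sqrt S)\<^sup>2"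
    using h_pos \<rho>_pos by (intro power_mono) auto
  then have "(norm g)\<^sup>2 * (2 * \<rho> * h)\<^sup>2 \<le> S" using S0 by (simp add: power_mult_distrib)
  then show ?thesis
    using h_pos \<rho>_pos unfolding g_def S_def[symmetric] by (simp add: power_divide field_simps)
qed

lemma vec_sum_norm_square: "(norm (x :: real^'m))\<^sup>2 = (\<Sum>i\<in>UNIV. (x $ i)\<^sup>2)"
  unfolding power2_norm_eq_inner inner_vec_def by (simp add: power2_eq_square)

text \<open>Together with the converse \<open>osc_le_grad\<close> this turns gradient estimates into
  estimates of nodal differences.\<close>

lemma grad_le_osc:
  assumes "v \<in> X_h \<T>"
  shows "l2_inner \<Omega> (pw_grad v) (pw_grad v) \<le> (1 / (2 * \<rho> * h))\<^sup>2 * osc v"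
proof -
  have "l2_inner \<Omega> (pw_grad v) (pw_grad v) = (\<Sum>K\<in>\<T>. vol K * (norm (elem_grad v K))\<^sup>2)"
    by (simp add: l2_inner_pw_grad power2_norm_eq_inner)
  also have "\<dots> \<le> (\<Sum>K\<in>\<T>. vol K * ((1 / (2 * \<rho> * h))\<^sup>2 * (\<Sum>a\<in>verts K. \<Sum>b\<in>verts K. (v a - v b)\<^sup>2)))"
    using elem_grad_le[OF assms] vol_nonneg by (intro sum_mono mult_left_mono) auto
  also have "\<dots> = (1 / (2 * \<rho> * h))\<^sup>2 * osc v"
    by (simp add: osc_def sum_distrib_left mult.left_commute)
  finally show ?thesis .
qed

lemma osc_le_grad:
  assumes "v \<in> X_h \<T>"
  shows "osc v \<le> (real (CARD('n) + 1) * h)\<^sup>2 * l2_inner \<Omega> (pw_grad v) (pw_grad v)"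
proof -
  have "osc v \<le> (\<Sum>K\<in>\<T>. vol K * ((real (CARD('n) + 1) * h)\<^sup>2 * (norm (elem_grad v K))\<^sup>2))"
    unfolding osc_def
  proof (intro sum_mono mult_left_mono vol_nonneg)
    fix K assume K: "K \<in> \<T>"
    have "(\<Sum>a\<in>verts K. \<Sum>b\<in>verts K. (norm (v a - v b))\<^sup>2)
        \<le> (\<Sum>a\<in>verts K. \<Sum>b\<in>verts K. (norm (elem_grad v K) * h)\<^sup>2)"
    proof (intro sum_mono power_mono)
      fix a b assume ab: "a \<in> verts K" "b \<in> verts K"
      have "norm (v a - v b) \<le> norm (elem_grad v K) * norm (a - b)"
        unfolding elem_grad_diff[OF assms K verts_in[OF ab(1)] verts_in[OF ab(2)]] real_norm_def
        by (rule Cauchy_Schwarz_ineq2)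
      also have "\<dots> \<le> norm (elem_grad v K) * h"
        using diam[OF K verts_in[OF ab(1)] verts_in[OF ab(2)]] by (intro mult_left_mono) auto
      finally show "norm (v a - v b) \<le> norm (elem_grad v K) * h" .
    qed auto
    also have "\<dots> = (real (CARD('n) + 1) * h)\<^sup>2 * (norm (elem_grad v K))\<^sup>2"
      using simplex_verts(3)[OF K] by (simp add: power2_eq_square)
    finally show "(\<Sum>a\<in>verts K. \<Sum>b\<in>verts K. (norm (v a - v b))\<^sup>2)
        \<le> (real (CARD('n) + 1) * h)\<^sup>2 * (norm (elem_grad v K))\<^sup>2" .
  qed
  also have "\<dots> = (real (CARD('n) + 1) * h)\<^sup>2 * l2_inner \<Omega> (pw_grad v) (pw_grad v)"
    by (simp add: l2_inner_pw_grad power2_norm_eq_inner sum_distrib_left mult.left_commute)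
  finally show ?thesis .
qed

end

section \<open>The L2 projection in the maximum norm\<close>

lemma L2_inner_integrable:
  fixes f g :: "real^'n \<Rightarrow> 'b::euclidean_space"
  assumes "f \<in> L2 \<Omega>" "g \<in> L2 \<Omega>"
  shows "integrable (lebesgue_on \<Omega>) (\<lambda>x. f x \<bullet> g x)"
proof (rule Bochner_Integration.integrable_bound)
  show "integrable (lebesgue_on \<Omega>) (\<lambda>x. (norm (f x))\<^sup>2 + (norm (g x))\<^sup>2)"
    using assms by (auto simp: L2_def)
  show "(\<lambda>x. f x \<bullet> g x) \<in> borel_measurable (lebesgue_on \<Omega>)"
    using assms by (intro borel_measurable_inner) (auto simp: L2_def)
  show "AE x in lebesgue_on \<Omega>. norm (f x \<bullet> g x) \<le> norm ((norm (f x))\<^sup>2 + (norm (g x))\<^sup>2)"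
  proof (rule AE_I2)
    fix x
    have "norm (f x \<bullet> g x) \<le> norm (f x) * norm (g x)" by (simp add: Cauchy_Schwarz_ineq2)
    also have "\<dots> \<le> (norm (f x))\<^sup>2 + (norm (g x))\<^sup>2"
      using sum_squares_bound[of "norm (f x)" "norm (g x)"] mult_nonneg_nonneg[of "norm (f x)" "norm (g x)"] 
      by (simp del: mult_nonneg_nonneg)
    finally show "norm (f x \<bullet> g x) \<le> norm ((norm (f x))\<^sup>2 + (norm (g x))\<^sup>2)" by simp
  qed
qed

lemma L2_cmult: "f \<in> L2 \<Omega> \<Longrightarrow> (\<lambda>x. r *\<^sub>R f x) \<in> L2 \<Omega>"
  by (auto simp: L2_def power_mult_distrib)

lemma L2_add:
  fixes f g :: "real^'n \<Rightarrow> 'b::euclidean_space"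
  assumes "f \<in> L2 \<Omega>" "g \<in> L2 \<Omega>"
  shows "(\<lambda>x. f x + g x) \<in> L2 \<Omega>"
proof -
  have "integrable (lebesgue_on \<Omega>) (\<lambda>x. (norm (f x))\<^sup>2 + 2 * (f x \<bullet> g x) + (norm (g x))\<^sup>2)"
    using assms L2_inner_integrable[OF assms]
    by (intro Bochner_Integration.integrable_add integrable_mult_right) (auto simp: L2_def)
  moreover have "(\<lambda>x. (norm (f x))\<^sup>2 + 2 * (f x \<bullet> g x) + (norm (g x))\<^sup>2) = (\<lambda>x. (norm (f x + g x))\<^sup>2)"
    by (rule ext) (simp add: power2_norm_eq_inner inner_add_left inner_add_right inner_commute)
  ultimately show ?thesis using assms by (auto simp: L2_def)
qed

lemma l2_inner_add_left:
  assumes "f \<in> L2 \<Omega>" "g \<in> L2 \<Omega>" "w \<in> L2 \<Omega>"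
  shows "l2_inner \<Omega> (\<lambda>x. f x + g x) w = l2_inner \<Omega> f w + l2_inner \<Omega> g w"
  unfolding l2_inner_def inner_add_left
  using assms by (intro Bochner_Integration.integral_add L2_inner_integrable)

lemma l2_inner_cmult_left: "l2_inner \<Omega> (\<lambda>x. r *\<^sub>R f x) w = r * l2_inner \<Omega> f w"
  by (simp add: l2_inner_def)

lemma l2_inner_commute: "l2_inner \<Omega> f g = l2_inner \<Omega> g f"
  by (simp add: l2_inner_def inner_commute)

lemma l2_inner_nonneg: "l2_inner \<Omega> f f \<ge> 0"
  by (simp add: l2_inner_def)

lemma l2_norm_square: "(l2_norm \<Omega> f)\<^sup>2 = l2_inner \<Omega> f f"
  by (simp add: l2_norm_def l2_inner_nonneg)

lemma l2_norm_nonneg: "l2_norm \<Omega> f \<ge> 0"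
  by (simp add: l2_norm_def l2_inner_nonneg)

lemma l2_inner_diff_left:
  assumes "f \<in> L2 \<Omega>" "g \<in> L2 \<Omega>" "w \<in> L2 \<Omega>"
  shows "l2_inner \<Omega> (\<lambda>x. f x - g x) w = l2_inner \<Omega> f w - l2_inner \<Omega> g w"
  using l2_inner_add_left[OF assms(1) L2_cmult[OF assms(2), of "-1"] assms(3)]
    l2_inner_cmult_left[of \<Omega> "-1" g w] by simp

text \<open>The discriminant argument is carried out by hand, since \<open>l2_inner\<close> is only
  a semidefinite form on a set of functions.\<close>

lemma l2_Cauchy_Schwarz:
  assumes "f \<in> L2 \<Omega>" "g \<in> L2 \<Omega>"
  shows "\<bar>l2_inner \<Omega> f g\<bar> \<le> l2_norm \<Omega> f * l2_norm \<Omega> g"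
proof -
  define A B C where "A = l2_inner \<Omega> f f" and "B = l2_inner \<Omega> f g" and "C = l2_inner \<Omega> g g"
  have quad: "0 \<le> A + 2 * t * B + t\<^sup>2 * C" for t
  proof -
    let ?h = "\<lambda>x. f x + t *\<^sub>R g x"
    note tg = L2_cmult[OF assms(2), of t]
    have "l2_inner \<Omega> ?h ?h = l2_inner \<Omega> f ?h + l2_inner \<Omega> (\<lambda>x. t *\<^sub>R g x) ?h"
      by (rule l2_inner_add_left[OF assms(1) tg L2_add[OF assms(1) tg]])
    also have "l2_inner \<Omega> f ?h = l2_inner \<Omega> ?h f" by (rule l2_inner_commute)
    also have "\<dots> = A + t * B"
      using l2_inner_add_left[OF assms(1) tg assms(1)] l2_inner_commute[of \<Omega> g f]
      by (simp add: l2_inner_cmult_left A_def B_def)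
    also have "l2_inner \<Omega> (\<lambda>x. t *\<^sub>R g x) ?h = t * l2_inner \<Omega> ?h g"
      by (simp add: l2_inner_cmult_left l2_inner_commute)
    also have "l2_inner \<Omega> ?h g = B + t * C"
      using l2_inner_add_left[OF assms(1) tg assms(2)] by (simp add: l2_inner_cmult_left C_def B_def)
    finally show ?thesis
      using l2_inner_nonneg[of \<Omega> ?h] by (simp add: power2_eq_square algebra_simps)
  qed
  have C: "C \<ge> 0" and A: "A \<ge> 0" by (simp_all add: C_def A_def l2_inner_nonneg)
  have "B\<^sup>2 \<le> A * C"
  proof (cases "C = 0")
    case True
    have "B = 0"
    proof (rule ccontr)
      assume "B \<noteq> 0"
      \<comment> \<open>This value of \<open>t\<close> gives \<open>A + 2 * t * B = - 1\<close>,
        against nonnegativity when \<open>C = 0\<close>.\<close>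
      then show False using quad[of "- (A + 1) / (2 * B)"] True by (simp add: field_simps)
    qed
    then show ?thesis using A C by simp
  next
    case False
    then have "0 \<le> C * (A + 2 * (- B / C) * B + (- B / C)\<^sup>2 * C)"
      using C by (intro mult_nonneg_nonneg quad)
    also have "\<dots> = A * C - B\<^sup>2" using False by (simp add: power2_eq_square field_simps)
    finally show ?thesis by simp
  qed
  then have "sqrt (B\<^sup>2) \<le> sqrt (A * C)" by (rule real_sqrt_le_mono)
  then show ?thesis by (simp add: l2_norm_def A_def B_def C_def real_sqrt_mult)
qed

lemma l2_inner_cong_AE:
  fixes f g f' g' :: "real^'n \<Rightarrow> 'b::euclidean_space"
  assumes "f \<in> borel_measurable (lebesgue_on \<Omega>)" "g \<in> borel_measurable (lebesgue_on \<Omega>)"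
    "f' \<in> borel_measurable (lebesgue_on \<Omega>)" "g' \<in> borel_measurable (lebesgue_on \<Omega>)"
    "AE x in lebesgue_on \<Omega>. f x = f' x" "AE x in lebesgue_on \<Omega>. g x = g' x"
  shows "l2_inner \<Omega> f g = l2_inner \<Omega> f' g'"
  unfolding l2_inner_def
proof (rule integral_cong_AE)
  show "AE x in lebesgue_on \<Omega>. f x \<bullet> g x = f' x \<bullet> g' x"
    using assms(5,6) by eventually_elim simp
  show "(\<lambda>x. f x \<bullet> g x) \<in> borel_measurable (lebesgue_on \<Omega>)"
    using assms(1,2) by (rule borel_measurable_inner)
  show "(\<lambda>x. f' x \<bullet> g' x) \<in> borel_measurable (lebesgue_on \<Omega>)"
    using assms(3,4) by (rule borel_measurable_inner)
qed

text \<open>If the Gram matrix \<open>g\<close> couples only points at distance at most \<open>h\<close>, the \<open>j\<close>-th term of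
  the Neumann series of \<open>g\<close> at a point depends only on the data at distance at most \<open>j h\<close> and is
  of size \<open>(1 - c) ^ j\<close> in the Euclidean norm. This gives a maximum norm bound for the inverse.\<close>

locale local_gram =
  fixes V :: "'a::metric_space set" and g :: "'a \<Rightarrow> 'a \<Rightarrow> real" and c h :: real
  assumes fin: "finite V" and sym: "\<And>a b. g a b = g b a" and c: "0 < c" "c < 1" and h_nonneg: "h \<ge> 0"
    and lower: "\<And>x. c * (\<Sum>a\<in>V. (x a)\<^sup>2) \<le> (\<Sum>a\<in>V. \<Sum>b\<in>V. g a b * x a * x b)"
    and upper: "\<And>x. (\<Sum>a\<in>V. \<Sum>b\<in>V. g a b * x a * x b) \<le> (\<Sum>a\<in>V. (x a)\<^sup>2)"
    and local_g: "\<And>a b. a \<in> V \<Longrightarrow> b \<in> V \<Longrightarrow> h < dist a b \<Longrightarrow> g a b = 0"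
begin

text \<open>The defect of the Gram matrix from the identity; the Neumann series sums its
  powers.\<close>

definition R :: "('a \<Rightarrow> real) \<Rightarrow> 'a \<Rightarrow> real" where
  "R x a = x a - (\<Sum>b\<in>V. g a b * x b)"

definition sq :: "('a \<Rightarrow> real) \<Rightarrow> real" where
  "sq x = (\<Sum>a\<in>V. (x a)\<^sup>2)"

text \<open>The bilinear form of \<open>R\<close>; it is symmetric, nonnegative by
  \<open>upper\<close> and at most \<open>1 - c\<close> by \<open>lower\<close>.\<close>

definition form :: "('a \<Rightarrow> real) \<Rightarrow> ('a \<Rightarrow> real) \<Rightarrow> real" where
  "form x y = (\<Sum>a\<in>V. R x a * y a)"

lemma form_self: "form x x = sq x - (\<Sum>a\<in>V. \<Sum>b\<in>V. g a b * x a * x b)"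
  by (simp add: form_def sq_def R_def algebra_simps sum_subtractf power2_eq_square sum_distrib_left)

lemma form_bounds: "0 \<le> form x x" "form x x \<le> (1 - c) * sq x"
  using upper[of x] lower[of x] by (simp_all add: form_self sq_def algebra_simps)

lemma form_sym: "form x y = form y x"
proof -
  have "(\<Sum>a\<in>V. \<Sum>b\<in>V. g a b * x b * y a) = (\<Sum>a\<in>V. \<Sum>b\<in>V. g a b * y b * x a)"
    by (subst sum.swap) (simp add: sym mult_ac)
  then show ?thesis
    by (simp add: form_def R_def algebra_simps sum_subtractf sum_distrib_left)
qed

lemma R_lin: "R (\<lambda>a. x a + t * y a) a = R x a + t * R y a"
  by (simp add: R_def algebra_simps sum.distrib sum_distrib_left)

lemma form_expand: "form (\<lambda>a. x a + t * y a) (\<lambda>a. x a + t * y a) = form x x + 2 * t * form x y + t\<^sup>2 * form y y"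
proof -
  have "form (\<lambda>a. x a + t * y a) (\<lambda>a. x a + t * y a)
      = form x x + t * form x y + t * form y x + t\<^sup>2 * form y y"
    by (simp add: form_def R_lin algebra_simps sum.distrib sum_distrib_left power2_eq_square)
  then show ?thesis by (simp add: form_sym[of y x])
qed

text \<open>Evaluating the nonnegative form at \<open>x - R x / (1 - c)\<close> gives the operator
  bound without diagonalizing \<open>R\<close>.\<close>

lemma R_contraction: "sq (R x) \<le> (1 - c)\<^sup>2 * sq x"
proof -
  let ?r = "1 - c"
  have S: "form x (R x) = sq (R x)" by (simp add: form_def sq_def power2_eq_square)
  have "0 \<le> form (\<lambda>a. x a + (- 1 / ?r) * R x a) (\<lambda>a. x a + (- 1 / ?r) * R x a)"
    by (rule form_bounds)
  also have "\<dots> = form x x + 2 * (- 1 / ?r) * sq (R x) + (- 1 / ?r)\<^sup>2 * form (R x) (R x)"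
    by (simp only: form_expand S)
  also have "\<dots> \<le> ?r * sq x + 2 * (- 1 / ?r) * sq (R x) + (- 1 / ?r)\<^sup>2 * (?r * sq (R x))"
    by (intro add_mono order_refl form_bounds mult_left_mono[OF form_bounds(2)] zero_le_power2)
  also have "\<dots> = ?r * sq x - sq (R x) / ?r"
  proof -
    have "r * S1 + 2 * (- 1 / r) * S2 + (- 1 / r)\<^sup>2 * (r * S2) = r * S1 - S2 / r" if "r \<noteq> 0" for r S1 S2 :: real
      using that by (simp add: power2_eq_square field_simps)
    then show ?thesis using c by simp
  qed
  finally show ?thesis using c by (simp add: power2_eq_square pos_divide_le_eq mult_ac)
qed

lemma R_pow_contraction: "sq ((R ^^ j) x) \<le> ((1 - c) ^ j)\<^sup>2 * sq x"
proof (induction j)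
  case (Suc j)
  have "sq ((R ^^ Suc j) x) \<le> (1 - c)\<^sup>2 * sq ((R ^^ j) x)" using R_contraction by simp
  also have "\<dots> \<le> (1 - c)\<^sup>2 * (((1 - c) ^ j)\<^sup>2 * sq x)" using Suc by (intro mult_left_mono) auto
  finally show ?case by (simp add: power_mult_distrib mult_ac)
qed simp

lemma R_pow_lin: "(R ^^ j) (\<lambda>a. x a + t * y a) = (\<lambda>a. (R ^^ j) x a + t * (R ^^ j) y a)"
proof (induction j)
  case (Suc j)
  show ?case by (rule ext) (simp add: Suc R_lin)
qed simp

text \<open>Each application of \<open>R\<close> reaches only to distance \<open>h\<close>, so data
  beyond distance \<open>j * h\<close> do not influence the \<open>j\<close>-th power at
  \<open>a\<close>.\<close>

lemma R_pow_local:
  assumes "a \<in> V" "\<And>b. b \<in> V \<Longrightarrow> dist b a \<le> j * h \<Longrightarrow> y b = 0"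
  shows "(R ^^ j) y a = 0"
  using assms
proof (induction j arbitrary: a)
  case (Suc j)
  have z: "(R ^^ j) y b = 0" if "b \<in> V" "dist b a \<le> h" for b
  proof (rule Suc.IH[OF that(1)])
    fix b' assume b': "b' \<in> V" "dist b' b \<le> j * h"
    have "dist b' a \<le> real (Suc j) * h"
      using dist_triangle[of b' a b] b' that by (simp add: algebra_simps)
    then show "y b' = 0" using b'(1) by (intro Suc.prems(2))
  qed
  have "g a b * (R ^^ j) y b = 0" if "b \<in> V" for b
    using z[OF that] local_g[OF Suc.prems(1) that] by (cases "dist b a \<le> h") (auto simp: dist_commute)
  then have "(\<Sum>b\<in>V. g a b * (R ^^ j) y b) = 0" by (rule sum.neutral[OF ballI])
  moreover have "(R ^^ j) y a = 0" using z[OF Suc.prems(1)] h_nonneg by simp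
  moreover have "(R ^^ Suc j) y a = (R ^^ j) y a - (\<Sum>b\<in>V. g a b * (R ^^ j) y b)" by (simp add: R_def)
  ultimately show ?case by simp
qed simp

text \<open>Locality allows truncating \<open>y\<close> to a ball. There its Euclidean norm is at
  most \<open>Y\<close> times the root of the number of points, and the contraction supplies the
  geometric factor.\<close>

lemma R_pow_bound:
  assumes a: "a \<in> V" and y: "\<And>b. b \<in> V \<Longrightarrow> \<bar>y b\<bar> \<le> Y"
    and M: "real (card {b\<in>V. dist b a \<le> j * h}) \<le> M\<^sup>2" "M \<ge> 0"
  shows "\<bar>(R ^^ j) y a\<bar> \<le> (1 - c) ^ j * M * Y"
proof -
  let ?B = "{b\<in>V. dist b a \<le> j * h}"
  define y1 where "y1 b = (if b \<in> ?B then y b else 0)" for b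
  have Y: "Y \<ge> 0" using y[OF a] by linarith
  have "(R ^^ j) (\<lambda>b. y b + (- 1) * y1 b) a = 0"
    using a by (rule R_pow_local) (auto simp: y1_def)
  then have eq: "(R ^^ j) y a = (R ^^ j) y1 a" unfolding R_pow_lin[of j y "-1" y1] by simp
  have "((R ^^ j) y1 a)\<^sup>2 \<le> sq ((R ^^ j) y1)"
    unfolding sq_def using fin a by (intro member_le_sum) auto
  also have "\<dots> \<le> ((1 - c) ^ j)\<^sup>2 * sq y1" by (rule R_pow_contraction)
  also have "sq y1 = (\<Sum>b\<in>?B. (y b)\<^sup>2)"
    unfolding sq_def y1_def using fin
    by (intro sum.mono_neutral_cong_right) auto
  also have "((1 - c) ^ j)\<^sup>2 * (\<Sum>b\<in>?B. (y b)\<^sup>2) \<le> ((1 - c) ^ j)\<^sup>2 * (\<Sum>b\<in>?B. Y\<^sup>2)"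
    using y Y by (intro mult_left_mono sum_mono) (simp_all add: abs_le_square_iff[symmetric])
  also have "\<dots> = ((1 - c) ^ j)\<^sup>2 * (card ?B * Y\<^sup>2)" by simp
  also have "\<dots> \<le> ((1 - c) ^ j)\<^sup>2 * (M\<^sup>2 * Y\<^sup>2)"
    using M by (intro mult_left_mono mult_right_mono) auto
  also have "\<dots> = ((1 - c) ^ j * M * Y)\<^sup>2" by (simp add: power_mult_distrib)
  finally have "\<bar>(R ^^ j) y1 a\<bar>\<^sup>2 \<le> ((1 - c) ^ j * M * Y)\<^sup>2" by simp
  moreover have "0 \<le> (1 - c) ^ j * M * Y" using c M(2) Y by simp
  ultimately show ?thesis unfolding eq by (rule power2_le_imp_le)
qed

text \<open>The summability assumption says that geometric decay beats the growth \<open>M j\<close>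
  of the balls. Applying the matrix \<open>g\<close> to the series telescopes, because it is the
  identity minus \<open>R\<close>.\<close>

theorem local_gram_inverse:
  assumes y: "\<And>b. b \<in> V \<Longrightarrow> \<bar>y b\<bar> \<le> Y"
    and M: "\<And>j a. a \<in> V \<Longrightarrow> real (card {b\<in>V. dist b a \<le> real j * h}) \<le> (M j)\<^sup>2" "\<And>j. M j \<ge> 0"
    and summ: "summable (\<lambda>j. (1 - c) ^ j * M j)"
  shows "\<exists>x. (\<forall>a\<in>V. (\<Sum>b\<in>V. g a b * x b) = y a) \<and> (\<forall>a\<in>V. \<bar>x a\<bar> \<le> (\<Sum>j. (1 - c) ^ j * M j) * Y)"
proof -
  define x where "x a = (\<Sum>j. (R ^^ j) y a)" for a
  have bd: "\<bar>(R ^^ j) y a\<bar> \<le> (1 - c) ^ j * M j * Y" if "a \<in> V" for a j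
    using that y M by (intro R_pow_bound) auto
  have sY: "summable (\<lambda>j. (1 - c) ^ j * M j * Y)" using summ by (rule summable_mult2)
  have sabs: "summable (\<lambda>j. \<bar>(R ^^ j) y a\<bar>)" if "a \<in> V" for a
    using sY bd[OF that] by (intro summable_comparison_test'[OF sY]) auto
  have s: "summable (\<lambda>j. (R ^^ j) y a)" if "a \<in> V" for a
    using sabs[OF that] by (rule summable_rabs_cancel)
  have "\<bar>x a\<bar> \<le> (\<Sum>j. (1 - c) ^ j * M j) * Y" if "a \<in> V" for a
  proof -
    have "\<bar>x a\<bar> \<le> (\<Sum>j. \<bar>(R ^^ j) y a\<bar>)" unfolding x_def by (rule summable_rabs[OF sabs[OF that]])
    also have "\<dots> \<le> (\<Sum>j. (1 - c) ^ j * M j * Y)" using bd[OF that] by (intro suminf_le sabs[OF that] sY)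
    also have "\<dots> = (\<Sum>j. (1 - c) ^ j * M j) * Y" by (rule suminf_mult2[OF summ, symmetric])
    finally show ?thesis .
  qed
  moreover have "(\<Sum>b\<in>V. g a b * x b) = y a" if "a \<in> V" for a
  proof -
    have "(\<lambda>j. \<Sum>b\<in>V. g a b * (R ^^ j) y b) sums (\<Sum>b\<in>V. g a b * x b)"
      unfolding x_def by (intro sums_sum sums_mult summable_sums s)
    moreover have "(\<Sum>b\<in>V. g a b * (R ^^ j) y b) = (R ^^ j) y a - (R ^^ Suc j) y a" for j
      by (simp add: R_def)
    moreover have "(\<lambda>j. (R ^^ j) y a - (R ^^ Suc j) y a) sums ((R ^^ 0) y a - 0)"
      by (rule telescope_sums'[OF summable_LIMSEQ_zero[OF s[OF that]]])
    ultimately show ?thesis using sums_unique2 by fastforce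
  qed
  ultimately show ?thesis by blast
qed

end

text \<open>Ratio test with the midpoint of \<open>r\<close> and 1; a polynomial factor does not
  change the limit \<open>r\<close> of the ratios.\<close>

lemma summable_power_times_geometric:
  fixes r :: real
  assumes "0 < r" "r < 1"
  shows "summable (\<lambda>j. r ^ j * (K * (real j + 1) ^ n))"
proof -
  have "(\<lambda>j. (1 + inverse (real (Suc j))) ^ n) \<longlonglongrightarrow> (1 + 0) ^ n"
    by (intro tendsto_intros LIMSEQ_inverse_real_of_nat)
  then have "(\<lambda>j. r * (1 + inverse (real (Suc j))) ^ n) \<longlonglongrightarrow> r * 1"
    by (intro tendsto_mult tendsto_const) simp
  then have "eventually (\<lambda>j. r * (1 + inverse (real (Suc j))) ^ n < (1 + r) / 2) sequentially"
    using assms by (intro order_tendstoD(2)) auto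
  then obtain N where N: "\<And>j. j \<ge> N \<Longrightarrow> r * (1 + inverse (real (Suc j))) ^ n < (1 + r) / 2"
    unfolding eventually_sequentially by blast
  have "summable (\<lambda>j. r ^ j * (real j + 1) ^ n)"
  proof (rule summable_ratio_test[where c="(1 + r) / 2" and N=N])
    show "(1 + r) / 2 < 1" using assms by simp
    fix j assume "N \<le> j"
    have "real (Suc j) + 1 = (1 + inverse (real (Suc j))) * (real j + 1)"
      by (simp add: field_simps)
    then have "norm (r ^ Suc j * (real (Suc j) + 1) ^ n)
        = (r * (1 + inverse (real (Suc j))) ^ n) * (r ^ j * (real j + 1) ^ n)"
      using assms by (simp add: power_mult_distrib abs_mult power_abs)
    also have "\<dots> \<le> (1 + r) / 2 * (r ^ j * (real j + 1) ^ n)"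
      using N[OF \<open>N \<le> j\<close>] assms by (intro mult_right_mono) auto
    finally show "norm (r ^ Suc j * (real (Suc j) + 1) ^ n) \<le> (1 + r) / 2 * norm (r ^ j * (real j + 1) ^ n)"
      using assms by (simp add: abs_mult power_abs)
  qed
  then have "summable (\<lambda>j. K * (r ^ j * (real j + 1) ^ n))" by (rule summable_mult)
  then show ?thesis by (simp add: mult_ac)
qed

text \<open>Lower bound for the mass matrix after scaling by the volume of a ball of radius
  \<open>h\<close>; the cap \<open>1/2\<close> keeps \<open>1 - gram_low n \<rho>\<close>
  positive.\<close>

definition gram_low :: "nat \<Rightarrow> real \<Rightarrow> real" where
  "gram_low n \<rho> = min (1/2) (\<rho> ^ n / (real (n + 1) * (4 * 4 ^ n)))"

text \<open>Adding 1 to \<open>1 / \<rho>\<close> makes the constant at least 1, so it may be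
  replaced by its square in node counts and no roots appear.\<close>

definition patch_const :: "nat \<Rightarrow> real \<Rightarrow> real" where
  "patch_const n \<rho> = real (n + 1) * (1 / \<rho> + 1) ^ n"

text \<open>Sum of the majorant of the Neumann series; it bounds the L2 projection in the maximum
  norm.\<close>

definition proj_const :: "nat \<Rightarrow> real \<Rightarrow> real" where
  "proj_const n \<rho> = (\<Sum>j. (1 - gram_low n \<rho>) ^ j * (patch_const n \<rho> * (real j + 1) ^ n))"

context fem
begin

lemma X_h_L2:
  assumes "v \<in> X_h \<T>" shows "v \<in> L2 \<Omega>"
  using X_h_square_integrable[OF assms] X_h_measurable[OF assms] open_dom
  by (auto simp: L2_def intro!: measurable_restrict_space1 measurable_completion)

lemma pw_grad_L2: "pw_grad v \<in> L2 \<Omega>"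
proof -
  have m: "(\<lambda>x. (norm (pw_grad v x))\<^sup>2) \<in> borel_measurable borel"
    by (intro borel_measurable_power measurable_compose[OF pw_grad_measurable borel_measurable_norm])
  have "norm ((norm (pw_grad v x))\<^sup>2) \<le> (\<Sum>K\<in>\<T>. norm (elem_grad v K))\<^sup>2" for x
    using power_mono[OF pw_grad_bounded[of v x], of 2] by simp
  then have "integrable (lebesgue_on \<Omega>) (\<lambda>x. (norm (pw_grad v x))\<^sup>2)"
    by (rule integrable_bounded_dom[OF m])
  then show ?thesis
    using pw_grad_measurable
    by (auto simp: L2_def intro!: measurable_restrict_space1 measurable_completion)
qed

lemma l2_inner_sum_left:
  assumes "finite I" "\<And>i. i \<in> I \<Longrightarrow> f i \<in> X_h \<T>" "w \<in> L2 \<Omega>"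
  shows "l2_inner \<Omega> (\<lambda>x. \<Sum>i\<in>I. r i * f i x) w = (\<Sum>i\<in>I. r i * l2_inner \<Omega> (f i) w)"
  using assms
proof (induction I rule: finite_induct)
  case empty
  then show ?case by (simp add: l2_inner_def)
next
  case (insert i I)
  have "l2_inner \<Omega> (\<lambda>x. r i * f i x + (\<Sum>i\<in>I. r i * f i x)) w
      = l2_inner \<Omega> (\<lambda>x. r i * f i x) w + l2_inner \<Omega> (\<lambda>x. \<Sum>i\<in>I. r i * f i x) w"
    by (intro l2_inner_add_left insert.prems(2) X_h_L2[OF X_h_cmult] X_h_L2[OF X_h_sum[OF X_h_cmult]] insert.prems(1)) auto
  then show ?case
    using insert l2_inner_cmult_left[of \<Omega> "r i" "f i" w] by simp
qed

lemma l2_inner_expand: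
  assumes "v \<in> X_h \<T>" "w \<in> L2 \<Omega>"
  shows "l2_inner \<Omega> v w = (\<Sum>a\<in>nodes \<T>. v a * l2_inner \<Omega> (nodal_basis \<T> a) w)"
proof -
  have "v = (\<lambda>x. \<Sum>a\<in>nodes \<T>. v a * nodal_basis \<T> a x)" using X_h_expand[OF assms(1)] by blast
  then have "l2_inner \<Omega> v w = l2_inner \<Omega> (\<lambda>x. \<Sum>a\<in>nodes \<T>. v a * nodal_basis \<T> a x) w" by simp
  also have "\<dots> = (\<Sum>a\<in>nodes \<T>. v a * l2_inner \<Omega> (nodal_basis \<T> a) w)"
    using finite_nodes nodal_basis_X_h assms(2) by (rule l2_inner_sum_left)
  finally show ?thesis .
qed

lemma nodal_basis_le_1: "a \<in> nodes \<T> \<Longrightarrow> nodal_basis \<T> a x \<le> 1"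
proof (cases "x \<in> \<Union>\<T>")
  case True
  assume a: "a \<in> nodes \<T>"
  obtain K where K: "K \<in> \<T>" "x \<in> K" using True by blast
  have "nodal_basis \<T> a x \<le> (\<Sum>a\<in>nodes \<T>. nodal_basis \<T> a x)"
    using a finite_nodes nodal_basis_nonneg by (intro member_le_sum) auto
  then show ?thesis using nodal_basis_sum(1)[OF K] by simp
next
  case False
  assume "a \<in> nodes \<T>"
  then show ?thesis using X_h_outside[OF nodal_basis_X_h False] by simp
qed

end

section \<open>The mass matrix of a uniformly shaped mesh\<close>

context shaped_fem
begin

lemma nodal_basis_support:
  assumes "a \<in> nodes \<T>" "nodal_basis \<T> a x \<noteq> 0"
  obtains K where "K \<in> \<T>" "a \<in> K" "x \<in> K"
proof -
  have "x \<in> \<Union>\<T>" using X_h_outside[OF nodal_basis_X_h[OF assms(1)]] assms(2) by blast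
  then obtain K where "K \<in> \<T>" "x \<in> K" by blast
  with nodal_basis_zero[OF assms(1)] assms(2) that show thesis by blast
qed

lemma nodal_basis_support_cball:
  assumes "a \<in> nodes \<T>" "nodal_basis \<T> a x \<noteq> 0"
  shows "norm (x - a) \<le> h"
  using assms by (rule nodal_basis_support) (rule diam)

text \<open>If both basis functions are nonzero at a point, both nodes belong to one simplex and are
  at most \<open>h\<close> apart.\<close>

lemma gram_local:
  assumes "a \<in> nodes \<T>" "b \<in> nodes \<T>" "h < dist a b"
  shows "l2_inner \<Omega> (nodal_basis \<T> a) (nodal_basis \<T> b) = 0"
proof -
  have z: "nodal_basis \<T> a x * nodal_basis \<T> b x = 0" for x
  proof (rule ccontr)
    assume nz: "nodal_basis \<T> a x * nodal_basis \<T> b x \<noteq> 0"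
    then obtain K where K: "K \<in> \<T>" "a \<in> K" "x \<in> K" using nodal_basis_support[OF assms(1), of x] by auto
    have "b \<in> K" using nodal_basis_zero[OF assms(2) K(1) _ K(3)] nz by auto
    then show False using diam[OF K(1,2), of b] assms(3) by (simp add: dist_norm)
  qed
  show ?thesis by (simp only: l2_inner_def inner_real_def z Bochner_Integration.integral_zero)
qed

lemma gram_low: "0 < gram_low CARD('n) \<rho>" "gram_low CARD('n) \<rho> < 1"
  using \<rho>_pos by (auto simp: gram_low_def)

lemma gram_form:
  assumes "v \<in> X_h \<T>"
  shows "l2_inner \<Omega> v v = (\<Sum>a\<in>nodes \<T>. \<Sum>b\<in>nodes \<T>. l2_inner \<Omega> (nodal_basis \<T> a) (nodal_basis \<T> b) * v a * v b)"
proof -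
  have c: "l2_inner \<Omega> (nodal_basis \<T> a) v = l2_inner \<Omega> v (nodal_basis \<T> a)" for a
    by (rule l2_inner_commute)
  have e: "l2_inner \<Omega> v (nodal_basis \<T> a) = (\<Sum>b\<in>nodes \<T>. v b * l2_inner \<Omega> (nodal_basis \<T> b) (nodal_basis \<T> a))"
    if "a \<in> nodes \<T>" for a
    by (rule l2_inner_expand[OF assms X_h_L2[OF nodal_basis_X_h[OF that]]])
  have "l2_inner \<Omega> v v = (\<Sum>a\<in>nodes \<T>. v a * l2_inner \<Omega> (nodal_basis \<T> a) v)"
    by (rule l2_inner_expand[OF assms X_h_L2[OF assms]])
  also have "\<dots> = (\<Sum>a\<in>nodes \<T>. \<Sum>b\<in>nodes \<T>. l2_inner \<Omega> (nodal_basis \<T> a) (nodal_basis \<T> b) * v a * v b)"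
  proof (rule sum.cong[OF refl])
    fix a assume "a \<in> nodes \<T>"
    then show "v a * l2_inner \<Omega> (nodal_basis \<T> a) v
        = (\<Sum>b\<in>nodes \<T>. l2_inner \<Omega> (nodal_basis \<T> a) (nodal_basis \<T> b) * v a * v b)"
      unfolding c e[OF \<open>a \<in> nodes \<T>\<close>] sum_distrib_left
      by (intro sum.cong refl) (simp add: l2_inner_commute[of \<Omega> "nodal_basis \<T> a"])
  qed
  finally show ?thesis .
qed

lemma scale_pos: "unit_ball_vol CARD('n) * h ^ CARD('n) > 0"
  using h_pos by simp

text \<open>All node masses are comparable to the volume of a ball of radius \<open>h\<close>, so a
  multiple of the identity replaces their diagonal. This is where quasi-uniformity acts.\<close>

lemma node_sum_le:
  assumes "v \<in> X_h \<T>"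
  shows "gram_low CARD('n) \<rho> * (unit_ball_vol CARD('n) * h ^ CARD('n)) * (\<Sum>a\<in>nodes \<T>. (v a)\<^sup>2) \<le> l2_inner \<Omega> v v"
    and "l2_inner \<Omega> v v \<le> unit_ball_vol CARD('n) * h ^ CARD('n) * (\<Sum>a\<in>nodes \<T>. (v a)\<^sup>2)"
proof -
  let ?c = "real (CARD('n) + 1) * (4 * 4 ^ CARD('n))" and ?s = "unit_ball_vol CARD('n) * h ^ CARD('n)"
  have "?s * \<rho> ^ CARD('n) * (\<Sum>a\<in>nodes \<T>. (v a)\<^sup>2) = (\<Sum>a\<in>nodes \<T>. unit_ball_vol CARD('n) * (\<rho> * h) ^ CARD('n) * (v a)\<^sup>2)"
    by (simp add: sum_distrib_left power_mult_distrib mult_ac)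
  also have "\<dots> \<le> (\<Sum>a\<in>nodes \<T>. node_mass a * (v a)\<^sup>2)"
    using node_mass_lower by (intro sum_mono mult_right_mono) auto
  also have "\<dots> \<le> ?c * l2_inner \<Omega> v v" by (rule mass_lower[OF assms])
  finally have 1: "?s * \<rho> ^ CARD('n) * (\<Sum>a\<in>nodes \<T>. (v a)\<^sup>2) / ?c \<le> l2_inner \<Omega> v v"
    by (simp add: divide_le_eq mult_ac)
  have "gram_low CARD('n) \<rho> * ?s * (\<Sum>a\<in>nodes \<T>. (v a)\<^sup>2) \<le> \<rho> ^ CARD('n) / ?c * ?s * (\<Sum>a\<in>nodes \<T>. (v a)\<^sup>2)"
    using scale_pos by (intro mult_right_mono) (auto simp: gram_low_def intro: sum_nonneg)
  with 1 show "gram_low CARD('n) \<rho> * ?s * (\<Sum>a\<in>nodes \<T>. (v a)\<^sup>2) \<le> l2_inner \<Omega> v v"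
    by (simp add: mult_ac)
  have "l2_inner \<Omega> v v \<le> (\<Sum>a\<in>nodes \<T>. node_mass a * (v a)\<^sup>2)" by (rule mass_upper[OF assms])
  also have "\<dots> \<le> (\<Sum>a\<in>nodes \<T>. ?s * (v a)\<^sup>2)"
    using node_mass_upper by (intro sum_mono mult_right_mono) auto
  finally show "l2_inner \<Omega> v v \<le> ?s * (\<Sum>a\<in>nodes \<T>. (v a)\<^sup>2)" by (simp add: sum_distrib_left)
qed

text \<open>Dividing by the volume of a ball of radius \<open>h\<close> normalizes the upper bound
  to 1, as \<open>local_gram\<close> requires.\<close>

lemma local_gram_mesh:
  "local_gram (nodes \<T>) (\<lambda>a b. l2_inner \<Omega> (nodal_basis \<T> a) (nodal_basis \<T> b) / (unit_ball_vol CARD('n) * h ^ CARD('n)))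
     (gram_low CARD('n) \<rho>) h"
proof
  let ?s = "unit_ball_vol CARD('n) * h ^ CARD('n)"
  let ?g = "\<lambda>a b. l2_inner \<Omega> (nodal_basis \<T> a) (nodal_basis \<T> b)"
  show "finite (nodes \<T>)" by (rule finite_nodes)
  show "?g a b / ?s = ?g b a / ?s" for a b by (simp add: l2_inner_commute)
  show "0 < gram_low CARD('n) \<rho>" "gram_low CARD('n) \<rho> < 1" by (rule gram_low)+
  show "0 \<le> h" using h_pos by simp
  show "?g a b / ?s = 0" if "a \<in> nodes \<T>" "b \<in> nodes \<T>" "h < dist a b" for a b
    using gram_local[OF that] by simp
  fix x :: "real^'n \<Rightarrow> real"
  obtain v where v: "v \<in> X_h \<T>" "\<And>a. a \<in> nodes \<T> \<Longrightarrow> v a = x a" using X_h_exists[of x] by metis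
  have eq: "(\<Sum>a\<in>nodes \<T>. \<Sum>b\<in>nodes \<T>. ?g a b / ?s * x a * x b) = l2_inner \<Omega> v v / ?s"
    unfolding gram_form[OF v(1)] sum_divide_distrib using v(2) by (intro sum.cong) auto
  have sq: "(\<Sum>a\<in>nodes \<T>. (x a)\<^sup>2) = (\<Sum>a\<in>nodes \<T>. (v a)\<^sup>2)" using v(2) by simp
  show "gram_low CARD('n) \<rho> * (\<Sum>a\<in>nodes \<T>. (x a)\<^sup>2) \<le> (\<Sum>a\<in>nodes \<T>. \<Sum>b\<in>nodes \<T>. ?g a b / ?s * x a * x b)"
    unfolding eq sq using node_sum_le(1)[OF v(1)] scale_pos by (simp add: le_divide_eq mult_ac)
  show "(\<Sum>a\<in>nodes \<T>. \<Sum>b\<in>nodes \<T>. ?g a b / ?s * x a * x b) \<le> (\<Sum>a\<in>nodes \<T>. (x a)\<^sup>2)"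
    unfolding eq sq using node_sum_le(2)[OF v(1)] scale_pos by (simp add: divide_le_eq mult_ac)
qed

text \<open>A basis function is at most 1 and is supported in a ball of radius
  \<open>h\<close>.\<close>

lemma nodal_basis_inner_bound:
  assumes f: "f \<in> L2 \<Omega>" "AE x in lebesgue_on \<Omega>. \<bar>f x\<bar> \<le> Y" and Y: "Y \<ge> 0" and a: "a \<in> nodes \<T>"
  shows "\<bar>l2_inner \<Omega> (nodal_basis \<T> a) f\<bar> \<le> unit_ball_vol CARD('n) * h ^ CARD('n) * Y"
proof -
  let ?I = "\<lambda>x. Y * indicator (cball a h) x"
  have int: "integrable (lebesgue_on \<Omega>) ?I"
    by (rule integrable_bounded_dom[where B=Y]) (auto simp: indicator_def Y)
  have "\<bar>l2_inner \<Omega> (nodal_basis \<T> a) f\<bar> \<le> (\<integral>x. \<bar>nodal_basis \<T> a x * f x\<bar> \<partial>lebesgue_on \<Omega>)"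
    unfolding l2_inner_def inner_real_def by (rule integral_abs_bound)
  also have "\<dots> \<le> (\<integral>x. ?I x \<partial>lebesgue_on \<Omega>)"
  proof (rule integral_mono_AE)
    show "integrable (lebesgue_on \<Omega>) (\<lambda>x. \<bar>nodal_basis \<T> a x * f x\<bar>)"
      using L2_inner_integrable[OF X_h_L2[OF nodal_basis_X_h[OF a]] f(1)] by auto
    show "AE x in lebesgue_on \<Omega>. \<bar>nodal_basis \<T> a x * f x\<bar> \<le> ?I x"
      using f(2)
    proof eventually_elim
      case (elim x)
      show ?case
      proof (cases "nodal_basis \<T> a x = 0")
        case False
        then have "x \<in> cball a h" using nodal_basis_support_cball[OF a] by (simp add: dist_norm norm_minus_commute[of a])
        moreover have "\<bar>nodal_basis \<T> a x\<bar> * \<bar>f x\<bar> \<le> 1 * Y"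
          using elim nodal_basis_nonneg[OF a] nodal_basis_le_1[OF a] by (intro mult_mono) auto
        ultimately show ?thesis by (simp add: abs_mult)
      qed (simp add: Y indicator_def)
    qed
  qed (rule int)
  also have "\<dots> = (\<integral>x. indicator \<Omega> x *\<^sub>R ?I x \<partial>lebesgue)" by (rule integral_lebesgue_on_eq[OF open_dom])
  also have "\<dots> \<le> (\<integral>x. ?I x \<partial>lebesgue)"
  proof (rule integral_mono)
    show "integrable lebesgue (\<lambda>x. indicator \<Omega> x *\<^sub>R ?I x)"
      using int by (simp only: integrable_lebesgue_on_iff[OF open_dom])
    show "integrable lebesgue ?I" by (intro integrable_mult_right integrable_indicator_lmeasurable) auto
  qed (auto simp: indicator_def Y)
  also have "\<dots> = Y * measure lebesgue (cball a h)" by simp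
  also have "\<dots> = unit_ball_vol CARD('n) * h ^ CARD('n) * Y"
    using measure_cball[of h a] h_pos by (simp only: less_imp_le mult_ac)
  finally show ?thesis .
qed

text \<open>The nodal values of the projection solve a system with the Gram matrix, whose right side
  after scaling is at most \<open>Y\<close> at each node.\<close>

theorem L2_projection_bounded:
  assumes f: "f \<in> L2 \<Omega>" "AE x in lebesgue_on \<Omega>. \<bar>f x\<bar> \<le> Y" and Y: "Y \<ge> 0"
  shows "\<exists>p\<in>X_h \<T>. (\<forall>w\<in>X_h \<T>. l2_inner \<Omega> w f = l2_inner \<Omega> w p) \<and>
     (\<forall>a\<in>nodes \<T>. \<bar>p a\<bar> \<le> proj_const CARD('n) \<rho> * Y)"
proof -
  let ?s = "unit_ball_vol CARD('n) * h ^ CARD('n)"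
  let ?g = "\<lambda>a b. l2_inner \<Omega> (nodal_basis \<T> a) (nodal_basis \<T> b)"
  define y where "y a = l2_inner \<Omega> (nodal_basis \<T> a) f / ?s" for a
  interpret G: local_gram "nodes \<T>" "\<lambda>a b. ?g a b / ?s" "gram_low CARD('n) \<rho>" h
    by (rule local_gram_mesh)
  have "\<exists>x. (\<forall>a\<in>nodes \<T>. (\<Sum>b\<in>nodes \<T>. ?g a b / ?s * x b) = y a) \<and>
     (\<forall>a\<in>nodes \<T>. \<bar>x a\<bar> \<le> (\<Sum>j. (1 - gram_low CARD('n) \<rho>) ^ j * (patch_const CARD('n) \<rho> * (real j + 1) ^ CARD('n))) * Y)"
  proof (rule G.local_gram_inverse)
    show "\<bar>y b\<bar> \<le> Y" if "b \<in> nodes \<T>" for b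
      using nodal_basis_inner_bound[OF f Y that] scale_pos by (simp add: y_def abs_divide divide_le_eq mult_ac)
    show "0 \<le> patch_const CARD('n) \<rho> * (real j + 1) ^ CARD('n)" for j
      using \<rho>_pos by (simp add: patch_const_def)
    show "summable (\<lambda>j. (1 - gram_low CARD('n) \<rho>) ^ j * (patch_const CARD('n) \<rho> * (real j + 1) ^ CARD('n)))"
      using gram_low by (intro summable_power_times_geometric) auto
    fix j :: nat and a
    have "real (card {b\<in>nodes \<T>. dist b a \<le> real j * h}) \<le> real (CARD('n) + 1) * ((real j + 1) / \<rho>) ^ CARD('n)"
      unfolding dist_norm by (rule card_nodes_cball) simp
    also have "\<dots> \<le> patch_const CARD('n) \<rho> * (real j + 1) ^ CARD('n)"
    proof -
      have "((real j + 1) / \<rho>) ^ CARD('n) \<le> ((1 / \<rho> + 1) * (real j + 1)) ^ CARD('n)"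
        using \<rho>_pos by (intro power_mono) (auto simp: field_simps)
      then show ?thesis by (simp add: patch_const_def power_mult_distrib mult.assoc)
    qed
    \<comment> \<open>A number that is at least 1 is at most its square.\<close>
    also have "\<dots> \<le> (patch_const CARD('n) \<rho> * (real j + 1) ^ CARD('n))\<^sup>2"
    proof -
      have "1 * 1 \<le> real (CARD('n) + 1) * (1 / \<rho> + 1) ^ CARD('n)"
        using \<rho>_pos by (intro mult_mono one_le_power) auto
      then have "1 * 1 \<le> patch_const CARD('n) \<rho> * (real j + 1) ^ CARD('n)"
        unfolding patch_const_def by (intro mult_mono one_le_power) auto
      then show ?thesis by (intro self_le_power) auto
    qed
    finally show "real (card {b\<in>nodes \<T>. dist b a \<le> real j * h}) \<le> (patch_const CARD('n) \<rho> * (real j + 1) ^ CARD('n))\<^sup>2" .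
  qed
  then obtain x where x: "\<And>a. a \<in> nodes \<T> \<Longrightarrow> (\<Sum>b\<in>nodes \<T>. ?g a b / ?s * x b) = y a"
    "\<And>a. a \<in> nodes \<T> \<Longrightarrow> \<bar>x a\<bar> \<le> proj_const CARD('n) \<rho> * Y"
    unfolding proj_const_def by blast
  obtain p where p: "p \<in> X_h \<T>" "\<And>a. a \<in> nodes \<T> \<Longrightarrow> p a = x a" using X_h_exists[of x] by metis
  have basis: "l2_inner \<Omega> (nodal_basis \<T> a) f = l2_inner \<Omega> (nodal_basis \<T> a) p" if a: "a \<in> nodes \<T>" for a
  proof -
    have "l2_inner \<Omega> (nodal_basis \<T> a) f / ?s = (\<Sum>b\<in>nodes \<T>. p b * ?g b a) / ?s"
      using x(1)[OF a] p(2) unfolding y_def sum_divide_distrib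
      by (subst sum.cong[OF refl, of _ _ "\<lambda>b. ?g a b / ?s * x b"]) (auto simp: l2_inner_commute)
    also have "(\<Sum>b\<in>nodes \<T>. p b * ?g b a) = l2_inner \<Omega> p (nodal_basis \<T> a)"
      by (rule l2_inner_expand[OF p(1) X_h_L2[OF nodal_basis_X_h[OF a]], symmetric])
    finally have "l2_inner \<Omega> (nodal_basis \<T> a) f / ?s = l2_inner \<Omega> (nodal_basis \<T> a) p / ?s"
      by (simp only: l2_inner_commute)
    moreover have "?s \<noteq> 0" using scale_pos by (rule less_imp_neq[THEN not_sym])
    ultimately show ?thesis by (metis divide_cancel_right)
  qed
  have "l2_inner \<Omega> w f = l2_inner \<Omega> w p" if "w \<in> X_h \<T>" for w
    using l2_inner_expand[OF that f(1)] l2_inner_expand[OF that X_h_L2[OF p(1)]] basis by simp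
  with p x show ?thesis by auto
qed

end

section \<open>Translation and Poincare estimates\<close>

abbreviation unit_ind :: "real \<Rightarrow> real" where
  "unit_ind \<equiv> indicator {0..1}"

text \<open>For fixed \<open>s\<close> the integral over \<open>x\<close> is invariant under the
  shift, which leaves a constant on the unit interval.\<close>

lemma segment_integrable:
  fixes g :: "real^'n \<Rightarrow> real" and v :: "real^'n"
  assumes "integrable lborel g"
  shows "integrable (lborel \<Otimes>\<^sub>M lborel) (\<lambda>(s, x). unit_ind s * g (x + s *\<^sub>R v))"
proof (rule lborel_pair.Fubini_integrable)
  have [measurable]: "g \<in> borel_measurable borel" using assms by auto
  show "(\<lambda>(s, x). unit_ind s * g (x + s *\<^sub>R v)) \<in> borel_measurable (lborel \<Otimes>\<^sub>M lborel)"
    by measurable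
  have eq: "(\<integral>x. norm (case (s, x) of (s, x) \<Rightarrow> unit_ind s * g (x + s *\<^sub>R v)) \<partial>lborel)
      = (\<integral>x. \<bar>g x\<bar> \<partial>lborel) * unit_ind s" for s
    using integral_lborel_shift[of "\<lambda>x. \<bar>g x\<bar>" "s *\<^sub>R v"] by (simp add: abs_mult)
  show "integrable lborel (\<lambda>s. \<integral>x. norm (case (s, x) of (s, x) \<Rightarrow> unit_ind s * g (x + s *\<^sub>R v)) \<partial>lborel)"
    unfolding eq by (intro integrable_mult_right integrable_real_indicator) auto
  show "AE s in lborel. integrable lborel (\<lambda>x. case (s, x) of (s, x) \<Rightarrow> unit_ind s * g (x + s *\<^sub>R v))"
    using integrable_lborel_shift[OF assms] by simp
qed

lemma segment_integral:
  fixes g :: "real^'n \<Rightarrow> real" and v :: "real^'n"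
  assumes "integrable lborel g"
  shows "(\<integral>x. (\<integral>s. unit_ind s * g (x + s *\<^sub>R v) \<partial>lborel) \<partial>lborel) = (\<integral>x. g x \<partial>lborel)"
proof -
  have "(\<integral>x. (\<integral>s. unit_ind s * g (x + s *\<^sub>R v) \<partial>lborel) \<partial>lborel)
      = (\<integral>s. (\<integral>x. unit_ind s * g (x + s *\<^sub>R v) \<partial>lborel) \<partial>lborel)"
    by (rule lborel_pair.Fubini_integral[OF segment_integrable[OF assms]])
  also have "\<dots> = (\<integral>s. (\<integral>x. g x \<partial>lborel) * unit_ind s \<partial>lborel)"
    using assms integral_lborel_shift[of g] by (simp add: mult.commute)
  finally show ?thesis by simp
qed

text \<open>On a set of finite measure, 1 plus the square of \<open>f\<close> is an integrable
  majorant.\<close>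

lemma integrable_if_square:
  fixes f :: "'a \<Rightarrow> real"
  assumes m: "f \<in> borel_measurable M" and A: "A \<in> sets M" "emeasure M A < \<infinity>"
    and sq: "integrable M (\<lambda>x. indicator A x * (f x)\<^sup>2)"
  shows "integrable M (\<lambda>x. indicator A x * f x)"
proof (rule Bochner_Integration.integrable_bound)
  show "integrable M (\<lambda>x. indicator A x + indicator A x * (f x)\<^sup>2)"
    using sq A by (intro Bochner_Integration.integrable_add integrable_real_indicator)
  show "(\<lambda>x. indicator A x * f x) \<in> borel_measurable M" using m A by measurable
  have "\<bar>y\<bar> \<le> 1 + y\<^sup>2" for y :: real
    using power2_sum[of "\<bar>y\<bar> - 1" 1] by (cases "\<bar>y\<bar> \<le> 1") (auto simp: power2_eq_square intro: order_trans[OF mult_left_mono[of 1 "\<bar>y\<bar>" "\<bar>y\<bar>", simplified]])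
  then show "AE x in M. norm (indicator A x * f x) \<le> norm (indicator A x + indicator A x * (f x)\<^sup>2)"
    by (intro AE_I2) (auto simp: indicator_def)
qed

text \<open>Jensen's inequality for the mean over \<open>A\<close>, again from a nonnegative
  variance.\<close>

lemma mean_square_le:
  fixes f :: "'a \<Rightarrow> real"
  assumes m: "f \<in> borel_measurable M" and A: "A \<in> sets M" "emeasure M A < \<infinity>" "measure M A > 0"
    and sq: "integrable M (\<lambda>x. indicator A x * (f x)\<^sup>2)"
  shows "((\<integral>x. indicator A x * f x \<partial>M) / measure M A)\<^sup>2 \<le> (\<integral>x. indicator A x * (f x)\<^sup>2 \<partial>M) / measure M A"
proof -
  define \<mu> where "\<mu> = (\<integral>x. indicator A x * f x \<partial>M) / measure M A"
  note i1 = integrable_if_square[OF m A(1,2) sq]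
  have iA: "integrable M (indicat_real A)" using A by (intro integrable_real_indicator)
  have "0 \<le> (\<integral>x. indicator A x * (f x - \<mu>)\<^sup>2 \<partial>M)" by (intro integral_nonneg_AE) auto
  also have "\<dots> = (\<integral>x. (indicator A x * (f x)\<^sup>2 - (2 * \<mu>) * (indicator A x * f x)) + \<mu>\<^sup>2 * indicator A x \<partial>M)"
    by (intro Bochner_Integration.integral_cong) (auto simp: power2_eq_square algebra_simps)
  also have "\<dots> = (\<integral>x. indicator A x * (f x)\<^sup>2 \<partial>M) - (2 * \<mu>) * (\<integral>x. indicator A x * f x \<partial>M) + \<mu>\<^sup>2 * measure M A"
    using i1 sq iA A by (simp add: Bochner_Integration.integral_add Bochner_Integration.integral_diff Int_absorb2 sets.sets_into_space)
  also have "(\<integral>x. indicator A x * f x \<partial>M) = \<mu> * measure M A" using A by (simp add: \<mu>_def)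
  finally have "\<mu>\<^sup>2 * measure M A \<le> (\<integral>x. indicator A x * (f x)\<^sup>2 \<partial>M)"
    by (simp add: power2_eq_square algebra_simps)
  then show ?thesis using A by (simp add: \<mu>_def[symmetric] pos_le_divide_eq)
qed

text \<open>Borel representatives on the whole space make
  \<open>(s, x) \<mapsto> G (x + s *\<^sub>R v)\<close> measurable for the product measure, as
  Fubini's theorem requires.\<close>

locale borel_weak_gradient =
  fixes \<Omega> :: "(real^'n) set" and q :: "real^'n \<Rightarrow> real" and G :: "real^'n \<Rightarrow> real^'n"
  assumes q_meas[measurable]: "q \<in> borel_measurable borel" and G_meas[measurable]: "G \<in> borel_measurable borel"
    and q_sq: "integrable lborel (\<lambda>x. (q x)\<^sup>2)" and G_sq: "integrable lborel (\<lambda>x. (norm (G x))\<^sup>2)"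
    and weak: "\<And>\<phi> i. \<phi> \<in> test_functions \<Omega> \<Longrightarrow>
      (\<integral>x. q x * partial_deriv i \<phi> x \<partial>lborel) = - (\<integral>x. G x $ i * \<phi> x \<partial>lborel)"
begin

section \<open>Integrability on the product of segment and space\<close>

lemma abs_le_square_plus: "\<bar>y * z\<bar> \<le> B * (y\<^sup>2 + 1)" if "\<bar>z\<bar> \<le> B" for y z B :: real
proof -
  have "2 * \<bar>y\<bar> \<le> y\<^sup>2 + 1" using sum_squares_bound[of "\<bar>y\<bar>" 1] by simp
  then have "\<bar>y\<bar> \<le> y\<^sup>2 + 1" using abs_ge_zero[of y] by linarith
  then have "\<bar>y\<bar> * \<bar>z\<bar> \<le> (y\<^sup>2 + 1) * B" using that by (intro mult_mono) auto
  then show ?thesis by (simp add: abs_mult mult.commute)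
qed

lemma integrable_cball: "integrable lborel (indicat_real (cball (0 :: real^'n) R))"
  using emeasure_lborel_cball_finite[of 0 R] by (intro integrable_real_indicator) auto

lemma integrable_q_mult:
  assumes [measurable]: "\<eta> \<in> borel_measurable borel"
    and "\<And>x. \<bar>\<eta> x\<bar> \<le> B" "\<And>x. R < norm x \<Longrightarrow> \<eta> x = 0"
  shows "integrable lborel (\<lambda>x. q (x + v) * \<eta> x)"
proof (rule Bochner_Integration.integrable_bound)
  show "integrable lborel (\<lambda>x. B * ((q (x + v))\<^sup>2 + indicat_real (cball 0 R) x))"
    using integrable_lborel_shift[OF q_sq] integrable_cball
    by (intro integrable_mult_right Bochner_Integration.integrable_add)
  show "AE x in lborel. norm (q (x + v) * \<eta> x) \<le> norm (B * ((q (x + v))\<^sup>2 + indicat_real (cball 0 R) x))"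
  proof (rule AE_I2)
    fix x
    have B: "0 \<le> B" using assms(2)[of x] by linarith
    show "norm (q (x + v) * \<eta> x) \<le> norm (B * ((q (x + v))\<^sup>2 + indicat_real (cball 0 R) x))"
    proof (cases "R < norm x")
      case True
      then show ?thesis using assms(3) by simp
    next
      case False
      then show ?thesis using abs_le_square_plus[OF assms(2), of "q (x + v)" x] B by simp
    qed
  qed
qed measurable

lemma integrable_G_segment:
  assumes [measurable]: "\<eta> \<in> borel_measurable borel"
    and B: "\<And>x. \<bar>\<eta> x\<bar> \<le> B" and R: "\<And>x. R < norm x \<Longrightarrow> \<eta> x = 0"
  shows "integrable (lborel \<Otimes>\<^sub>M lborel) (\<lambda>(s, x). unit_ind s * ((G (x + s *\<^sub>R v) \<bullet> v) * \<eta> x))"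
proof (rule Bochner_Integration.integrable_bound)
  have "integrable (lborel \<Otimes>\<^sub>M lborel) (\<lambda>z. B * norm v * ((case z of (s, x) \<Rightarrow> unit_ind s * (norm (G (x + s *\<^sub>R v)))\<^sup>2)
      + (case z of (s, x) \<Rightarrow> unit_ind s * indicat_real (cball 0 R) (x + s *\<^sub>R 0))))"
    by (intro integrable_mult_right Bochner_Integration.integrable_add segment_integrable[OF G_sq] segment_integrable[OF integrable_cball])
  then show "integrable (lborel \<Otimes>\<^sub>M lborel) (\<lambda>z. B * norm v * ((case z of (s, x) \<Rightarrow> unit_ind s * (norm (G (x + s *\<^sub>R v)))\<^sup>2)
      + (case z of (s, x) \<Rightarrow> unit_ind s * indicat_real (cball 0 R) x)))" by simp
  show "(\<lambda>(s, x). unit_ind s * ((G (x + s *\<^sub>R v) \<bullet> v) * \<eta> x)) \<in> borel_measurable (lborel \<Otimes>\<^sub>M lborel)"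
    by measurable
  show "AE z in lborel \<Otimes>\<^sub>M lborel. norm (case z of (s, x) \<Rightarrow> unit_ind s * ((G (x + s *\<^sub>R v) \<bullet> v) * \<eta> x))
    \<le> norm (B * norm v * ((case z of (s, x) \<Rightarrow> unit_ind s * (norm (G (x + s *\<^sub>R v)))\<^sup>2)
      + (case z of (s, x) \<Rightarrow> unit_ind s * indicat_real (cball 0 R) x)))"
  proof (rule AE_I2)
    fix z :: "real \<times> (real^'n)"
    obtain s x where z: "z = (s, x)" by (cases z)
    have B0: "0 \<le> B" using B[of x] by linarith
    have "\<bar>(G (x + s *\<^sub>R v) \<bullet> v) * \<eta> x\<bar> \<le> B * norm v * ((norm (G (x + s *\<^sub>R v)))\<^sup>2 + indicat_real (cball 0 R) x)"
    proof (cases "R < norm x")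
      case True
      then show ?thesis using R B0 by simp
    next
      case False
      have "\<bar>(G (x + s *\<^sub>R v) \<bullet> v) * \<eta> x\<bar> \<le> (norm (G (x + s *\<^sub>R v)) * norm v) * \<bar>\<eta> x\<bar>"
        unfolding abs_mult by (intro mult_right_mono Cauchy_Schwarz_ineq2) auto
      also have "\<dots> = norm v * \<bar>norm (G (x + s *\<^sub>R v)) * \<eta> x\<bar>" by (simp add: abs_mult)
      also have "\<dots> \<le> norm v * (B * ((norm (G (x + s *\<^sub>R v)))\<^sup>2 + 1))"
        by (intro mult_left_mono abs_le_square_plus B) auto
      finally show ?thesis using False by (simp add: mult_ac)
    qed
    then show "norm (case z of (s, x) \<Rightarrow> unit_ind s * ((G (x + s *\<^sub>R v) \<bullet> v) * \<eta> x))
      \<le> norm (B * norm v * ((case z of (s, x) \<Rightarrow> unit_ind s * (norm (G (x + s *\<^sub>R v)))\<^sup>2)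
      + (case z of (s, x) \<Rightarrow> unit_ind s * indicat_real (cball 0 R) x)))"
      using B0 by (cases "s \<in> {0..1}") (auto simp: z)
  qed
qed

lemma integrable_q_segment:
  assumes [measurable]: "\<psi> \<in> borel_measurable borel"
    and B: "\<And>x. \<bar>\<psi> x\<bar> \<le> B" and R: "\<And>x. R < norm x \<Longrightarrow> \<psi> x = 0"
  shows "integrable (lborel \<Otimes>\<^sub>M lborel) (\<lambda>(s, y). unit_ind s * (q y * \<psi> (y - s *\<^sub>R v)))"
proof (rule Bochner_Integration.integrable_bound)
  let ?R = "R + norm v"
  have "integrable (lborel \<Otimes>\<^sub>M lborel) (\<lambda>z. B * ((case z of (s, x) \<Rightarrow> unit_ind s * (q (x + s *\<^sub>R 0))\<^sup>2)
      + (case z of (s, x) \<Rightarrow> unit_ind s * indicat_real (cball 0 ?R) (x + s *\<^sub>R 0))))"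
    by (intro integrable_mult_right Bochner_Integration.integrable_add segment_integrable[OF q_sq] segment_integrable[OF integrable_cball])
  then show "integrable (lborel \<Otimes>\<^sub>M lborel) (\<lambda>z. B * ((case z of (s, x) \<Rightarrow> unit_ind s * (q x)\<^sup>2)
      + (case z of (s, x) \<Rightarrow> unit_ind s * indicat_real (cball 0 ?R) x)))" by simp
  show "(\<lambda>(s, y). unit_ind s * (q y * \<psi> (y - s *\<^sub>R v))) \<in> borel_measurable (lborel \<Otimes>\<^sub>M lborel)"
    by measurable
  show "AE z in lborel \<Otimes>\<^sub>M lborel. norm (case z of (s, y) \<Rightarrow> unit_ind s * (q y * \<psi> (y - s *\<^sub>R v)))
    \<le> norm (B * ((case z of (s, x) \<Rightarrow> unit_ind s * (q x)\<^sup>2)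
      + (case z of (s, x) \<Rightarrow> unit_ind s * indicat_real (cball 0 ?R) x)))"
  proof (rule AE_I2)
    fix z :: "real \<times> (real^'n)"
    obtain s y where z: "z = (s, y)" by (cases z)
    have B0: "0 \<le> B" using B[of y] by linarith
    have "\<bar>q y * \<psi> (y - s *\<^sub>R v)\<bar> \<le> B * ((q y)\<^sup>2 + indicat_real (cball 0 ?R) y)" if s: "s \<in> {0..1}"
    proof (cases "?R < norm y")
      case True
      have "norm (s *\<^sub>R v) \<le> norm v" using s by (simp add: mult_left_le_one_le)
      then have "R < norm (y - s *\<^sub>R v)" using True norm_triangle_ineq2[of y "s *\<^sub>R v"] by linarith
      then show ?thesis using R B0 by simp
    next
      case False
      then show ?thesis using abs_le_square_plus[OF B, of "q y" "y - s *\<^sub>R v"] by simp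
    qed
    then show "norm (case z of (s, y) \<Rightarrow> unit_ind s * (q y * \<psi> (y - s *\<^sub>R v)))
      \<le> norm (B * ((case z of (s, x) \<Rightarrow> unit_ind s * (q x)\<^sup>2)
      + (case z of (s, x) \<Rightarrow> unit_ind s * indicat_real (cball 0 ?R) x)))"
      using B0 by (cases "s \<in> {0..1}") (auto simp: z)
  qed
qed

text \<open>Fundamental theorem of calculus along the segment from \<open>y\<close> to
  \<open>y - v\<close>; the minus sign of the direction is absorbed by integrating the negative of
  \<phi>.\<close>

lemma test_segment_FTC:
  assumes "\<phi> \<in> test_functions E"
  shows "(\<integral>s. unit_ind s * (\<Sum>i\<in>UNIV. v $ i * partial_deriv i \<phi> (y - s *\<^sub>R v)) \<partial>lborel) = \<phi> y - \<phi> (y - v)"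
proof -
  let ?\<psi> = "\<lambda>x. \<Sum>i\<in>UNIV. v $ i * partial_deriv i \<phi> x"
  have "(\<integral>s. unit_ind s *\<^sub>R ?\<psi> (y - s *\<^sub>R v) \<partial>lborel) = (- \<phi> (y - 1 *\<^sub>R v)) - (- \<phi> (y - 0 *\<^sub>R v))"
  proof (rule integral_FTC_atLeastAtMost[of 0 1 "\<lambda>s. - \<phi> (y - s *\<^sub>R v)"])
    fix s :: real
    have "((\<lambda>s. y - s *\<^sub>R v) has_derivative (\<lambda>h. - (h *\<^sub>R v))) (at s within {0..1})"
      by (auto intro!: derivative_eq_intros)
    then have "((\<lambda>s. \<phi> (y - s *\<^sub>R v)) has_derivative (\<lambda>h. \<Sum>i\<in>UNIV. (- (h *\<^sub>R v)) $ i * partial_deriv i \<phi> (y - s *\<^sub>R v))) (at s within {0..1})"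
      using has_derivative_partial_deriv[OF test_functions_differentiable[OF assms], of "y - s *\<^sub>R v"]
      by (rule has_derivative_compose)
    then have "((\<lambda>s. - \<phi> (y - s *\<^sub>R v)) has_derivative (\<lambda>h. - (\<Sum>i\<in>UNIV. (- (h *\<^sub>R v)) $ i * partial_deriv i \<phi> (y - s *\<^sub>R v)))) (at s within {0..1})"
      by (rule has_derivative_minus)
    then show "((\<lambda>s. - \<phi> (y - s *\<^sub>R v)) has_vector_derivative ?\<psi> (y - s *\<^sub>R v)) (at s within {0..1})"
      unfolding has_vector_derivative_def by (simp add: sum_negf sum_distrib_left mult.assoc)
  next
    have "continuous_on UNIV ?\<psi>"
      using test_functions_continuous[OF partial_deriv_test[OF assms]] by (intro continuous_intros)
    then show "continuous_on {0..1} (\<lambda>s. ?\<psi> (y - s *\<^sub>R v))"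
      by (rule continuous_on_compose2) (auto intro!: continuous_intros)
  qed simp
  then show ?thesis by simp
qed

text \<open>Tested against \<open>\<phi>\<close>, both sides equal the integral of \<open>q\<close> times the derivative of \<open>\<phi>\<close>
  along the segment.\<close>

lemma translation_formula:
  assumes E: "open E" and seg: "\<And>x s. x \<in> E \<Longrightarrow> 0 \<le> s \<Longrightarrow> s \<le> 1 \<Longrightarrow> x + s *\<^sub>R v \<in> \<Omega>"
  shows "AE x in lebesgue. x \<in> E \<longrightarrow> q (x + v) - q x - (\<integral>s. unit_ind s * (G (x + s *\<^sub>R v) \<bullet> v) \<partial>lborel) = 0"
proof (rule fundamental_lemma[OF E])
  define D where "D x = (\<integral>s. unit_ind s * (G (x + s *\<^sub>R v) \<bullet> v) \<partial>lborel)" for x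
  have D_meas[measurable]: "D \<in> borel_measurable borel"
    unfolding D_def by measurable
  have D_int: "integrable lborel (\<lambda>x. D x * \<eta> x)"
    and D_eq: "(\<integral>x. D x * \<eta> x \<partial>lborel) = (\<integral>s. unit_ind s * (\<integral>x. (G (x + s *\<^sub>R v) \<bullet> v) * \<eta> x \<partial>lborel) \<partial>lborel)"
    if "\<eta> \<in> borel_measurable borel" "\<And>x. \<bar>\<eta> x\<bar> \<le> B" "\<And>x. R < norm x \<Longrightarrow> \<eta> x = 0" for \<eta> B R
  proof -
    note I = integrable_G_segment[of \<eta> B R v, OF that]
    have eq: "(\<integral>s. unit_ind s * ((G (x + s *\<^sub>R v) \<bullet> v) * \<eta> x) \<partial>lborel) = D x * \<eta> x" for x
      by (simp add: D_def mult.assoc[symmetric])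
    show "integrable lborel (\<lambda>x. D x * \<eta> x)"
      using lborel_pair.integrable_snd[OF I] unfolding eq .
    show "(\<integral>x. D x * \<eta> x \<partial>lborel) = (\<integral>s. unit_ind s * (\<integral>x. (G (x + s *\<^sub>R v) \<bullet> v) * \<eta> x \<partial>lborel) \<partial>lborel)"
      using lborel_pair.Fubini_integral[OF I] unfolding eq by simp
  qed
  have f_eq: "(\<lambda>x. q (x + v) - q x - (\<integral>s. unit_ind s * (G (x + s *\<^sub>R v) \<bullet> v) \<partial>lborel)) = (\<lambda>x. q (x + v) - q x - D x)"
    by (simp add: D_def)
  have int: "integrable lborel (\<lambda>x. q (x + v) * \<eta> x)" "integrable lborel (\<lambda>x. q x * \<eta> x)" "integrable lborel (\<lambda>x. D x * \<eta> x)"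
    if "\<eta> \<in> borel_measurable borel" "\<And>x. \<bar>\<eta> x\<bar> \<le> B" "\<And>x. R < norm x \<Longrightarrow> \<eta> x = 0" for \<eta> B R
    using integrable_q_mult[of \<eta> B R v, OF that] integrable_q_mult[of \<eta> B R 0, OF that] D_int[OF that] by simp_all
  show "loc_integrable E (\<lambda>x. q (x + v) - q x - (\<integral>s. unit_ind s * (G (x + s *\<^sub>R v) \<bullet> v) \<partial>lborel))"
    unfolding f_eq loc_integrable_def set_integrable_def
  proof (intro allI impI)
    fix S assume S: "compact S \<and> S \<subseteq> E"
    then obtain R where R: "\<And>x. x \<in> S \<Longrightarrow> norm x \<le> R" using compact_imp_bounded bounded_iff by metis
    have m: "indicat_real S \<in> borel_measurable borel"
      using S by (intro borel_measurable_indicator) (auto intro: borel_compact)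
    have "integrable lborel (\<lambda>x. q (x + v) * indicat_real S x - q x * indicat_real S x - D x * indicat_real S x)"
      using int[OF m, of 1 R] R by (intro Bochner_Integration.integrable_diff) (force simp: indicator_def)+
    moreover have "(\<lambda>x. q (x + v) * indicat_real S x - q x * indicat_real S x - D x * indicat_real S x)
        = (\<lambda>x. indicat_real S x *\<^sub>R (q (x + v) - q x - D x))"
      by (rule ext) (simp add: algebra_simps)
    ultimately have "integrable lborel (\<lambda>x. indicat_real S x *\<^sub>R (q (x + v) - q x - D x))" by simp
    then show "integrable lebesgue (\<lambda>x. indicat_real S x *\<^sub>R (q (x + v) - q x - D x))"
      by (subst integrable_completion) auto
  qed
  fix \<phi> :: "real^'n \<Rightarrow> real" assume \<phi>: "\<phi> \<in> test_functions E"
  obtain S where S: "compact S" "S \<subseteq> E" "\<And>x. x \<notin> S \<Longrightarrow> \<phi> x = 0"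
    using \<phi> by (auto simp: test_functions_def)
  obtain R where R: "\<And>x. x \<in> S \<Longrightarrow> norm x \<le> R" using S(1) compact_imp_bounded bounded_iff by metis
  obtain B where B: "\<And>x. \<bar>\<phi> x\<bar> \<le> B" using test_function_bounded[OF \<phi>] by blast
  have \<phi>R: "\<phi> x = 0" if "R < norm x" for x using S(3)[of x] R[of x] that by fastforce
  have \<phi>m[measurable]: "\<phi> \<in> borel_measurable borel"
    using test_functions_continuous[OF \<phi>] by (rule borel_measurable_continuous_onI)
  define \<psi> where "\<psi> x = (\<Sum>i\<in>UNIV. v $ i * partial_deriv i \<phi> x)" for x
  have \<psi>c: "continuous_on UNIV \<psi>"
    unfolding \<psi>_def using test_functions_continuous[OF partial_deriv_test[OF \<phi>]] by (intro continuous_intros)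
  then have \<psi>m[measurable]: "\<psi> \<in> borel_measurable borel" by (rule borel_measurable_continuous_onI)
  have \<psi>0: "\<psi> x = 0" if "x \<notin> S" for x
    unfolding \<psi>_def using S that
    by (auto intro!: sum.neutral partial_deriv_zero_outside[of "- S"] compact_imp_closed)
  have \<psi>R: "\<psi> x = 0" if "R < norm x" for x using \<psi>0[of x] R[of x] that by fastforce
  have "bounded (\<psi> ` S)" using \<psi>c S(1) by (intro compact_imp_bounded compact_continuous_image) (auto intro: continuous_on_subset)
  then obtain B' where B': "B' > 0" "\<And>y. y \<in> \<psi> ` S \<Longrightarrow> norm y \<le> B'" unfolding bounded_pos by blast
  have \<psi>B: "\<bar>\<psi> x\<bar> \<le> B'" for x using B' \<psi>0[of x] by (cases "x \<in> S") auto
  \<comment> \<open>The shifted test function is supported in \<Omega> by the segment condition, so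
    the weak identity applies to it; shifting the integral back restores the original test
    function.\<close>
  have inner: "(\<integral>y. q y * \<psi> (y - s *\<^sub>R v) \<partial>lborel) = - (\<integral>x. (G (x + s *\<^sub>R v) \<bullet> v) * \<phi> x \<partial>lborel)" if s: "s \<in> {0..1}" for s
  proof -
    let ?\<phi>s = "\<lambda>y. \<phi> (y - s *\<^sub>R v)"
    have \<phi>s: "?\<phi>s \<in> test_functions \<Omega>"
      using \<phi> seg s by (intro test_functions_translate) auto
    have pd: "partial_deriv i ?\<phi>s y = partial_deriv i \<phi> (y - s *\<^sub>R v)" for i y
      using test_functions_differentiable[OF \<phi>] by (rule partial_deriv_translate)
    have "\<exists>B. \<forall>x. \<bar>partial_deriv i \<phi> x\<bar> \<le> B" for i
      using test_function_bounded[OF partial_deriv_test[OF \<phi>]] by metis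
    then obtain B1 where B1: "\<And>i x. \<bar>partial_deriv i \<phi> x\<bar> \<le> B1 i" by metis
    have pdm: "(\<lambda>y. partial_deriv i \<phi> (y - s *\<^sub>R v)) \<in> borel_measurable borel" for i
      using test_functions_continuous[OF partial_deriv_test[OF \<phi>]]
      by (intro borel_measurable_continuous_onI continuous_on_compose2[where g="partial_deriv i \<phi>" and t=UNIV and f="\<lambda>y. y - s *\<^sub>R v"]
          continuous_intros) auto
    have nv: "norm (s *\<^sub>R v) \<le> norm v" using s by (simp add: mult_left_le_one_le)
    have out: "y - s *\<^sub>R v \<notin> S" if "R + norm v < norm y" for y
      using R[of "y - s *\<^sub>R v"] that nv norm_triangle_ineq2[of y "s *\<^sub>R v"] by linarith
    have pd0: "partial_deriv i \<phi> (y - s *\<^sub>R v) = 0" if "R + norm v < norm y" for i y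
      using S out[OF that] by (intro partial_deriv_zero_outside[of "- S"]) (auto intro: compact_imp_closed)
    have iq: "integrable lborel (\<lambda>y. q y * partial_deriv i \<phi> (y - s *\<^sub>R v))" for i
      using int(2)[OF pdm, of i "B1 i" "R + norm v"] B1 pd0 by blast
    have Gi: "integrable lborel (\<lambda>y. G y $ i * ?\<phi>s y)" for i
    proof (rule Bochner_Integration.integrable_bound)
      show "integrable lborel (\<lambda>x. B * ((norm (G x))\<^sup>2 + indicat_real (cball 0 (R + norm v)) x))"
        by (intro integrable_mult_right Bochner_Integration.integrable_add G_sq integrable_cball)
      have [measurable]: "(\<lambda>y. G y $ i) \<in> borel_measurable borel"
        using G_meas by (rule borel_measurable_continuous_on[rotated]) (rule continuous_on_component[OF continuous_on_id])
      show "(\<lambda>y. G y $ i * ?\<phi>s y) \<in> borel_measurable lborel" by measurable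
      show "AE y in lborel. norm (G y $ i * ?\<phi>s y) \<le> norm (B * ((norm (G y))\<^sup>2 + indicat_real (cball 0 (R + norm v)) y))"
      proof (rule AE_I2)
        fix y
        have B0: "0 \<le> B" using B[of y] by linarith
        show "norm (G y $ i * ?\<phi>s y) \<le> norm (B * ((norm (G y))\<^sup>2 + indicat_real (cball 0 (R + norm v)) y))"
        proof (cases "R + norm v < norm y")
          case True
          then show ?thesis using S(3)[OF out[OF True]] by simp
        next
          case False
          have "\<bar>G y $ i * ?\<phi>s y\<bar> \<le> \<bar>norm (G y) * ?\<phi>s y\<bar>"
            unfolding abs_mult using component_le_norm_cart[of "G y" i] by (intro mult_right_mono) auto
          also have "\<dots> \<le> B * ((norm (G y))\<^sup>2 + 1)" by (rule abs_le_square_plus[OF B])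
          finally show ?thesis using False B0 by simp
        qed
      qed
    qed
    have "(\<integral>y. q y * \<psi> (y - s *\<^sub>R v) \<partial>lborel) = (\<integral>y. (\<Sum>i\<in>UNIV. v $ i * (q y * partial_deriv i \<phi> (y - s *\<^sub>R v))) \<partial>lborel)"
      by (intro Bochner_Integration.integral_cong) (auto simp: \<psi>_def sum_distrib_left mult_ac)
    also have "\<dots> = (\<Sum>i\<in>UNIV. v $ i * (\<integral>y. q y * partial_deriv i \<phi> (y - s *\<^sub>R v) \<partial>lborel))"
      using iq by (subst Bochner_Integration.integral_sum) auto
    also have "\<dots> = (\<Sum>i\<in>UNIV. v $ i * (- (\<integral>y. G y $ i * ?\<phi>s y \<partial>lborel)))"
      using weak[OF \<phi>s] unfolding pd by simp
    also have "\<dots> = - (\<integral>y. (\<Sum>i\<in>UNIV. v $ i * (G y $ i * ?\<phi>s y)) \<partial>lborel)"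
      using Gi by (subst Bochner_Integration.integral_sum) (auto simp: sum_negf)
    also have "(\<integral>y. (\<Sum>i\<in>UNIV. v $ i * (G y $ i * ?\<phi>s y)) \<partial>lborel) = (\<integral>y. (G y \<bullet> v) * ?\<phi>s y \<partial>lborel)"
      by (intro Bochner_Integration.integral_cong) (auto simp: inner_vec_def sum_distrib_left mult_ac)
    also have "\<dots> = (\<integral>x. (G (x + s *\<^sub>R v) \<bullet> v) * ?\<phi>s (x + s *\<^sub>R v) \<partial>lborel)"
      by (rule integral_lborel_shift[symmetric]) measurable
    finally show ?thesis by simp
  qed
  have "(\<integral>x. q (x + v) * \<phi> x \<partial>lborel) - (\<integral>x. q x * \<phi> x \<partial>lborel) = (\<integral>x. D x * \<phi> x \<partial>lborel)"
  proof -
    have "(\<integral>x. q (x + v) * \<phi> (x + v - v) \<partial>lborel) = (\<integral>y. q y * \<phi> (y - v) \<partial>lborel)"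
      by (rule integral_lborel_shift[of "\<lambda>y. q y * \<phi> (y - v)"]) measurable
    then have s1: "(\<integral>x. q (x + v) * \<phi> x \<partial>lborel) = (\<integral>y. q y * \<phi> (y - v) \<partial>lborel)" by simp
    have i2: "integrable lborel (\<lambda>y. q y * \<phi> (y - v))"
      using integrable_lborel_shift[OF int(1)[OF \<phi>m B \<phi>R], where c="- v"] by simp
    have "(\<integral>x. q (x + v) * \<phi> x \<partial>lborel) - (\<integral>x. q x * \<phi> x \<partial>lborel) = (\<integral>y. q y * \<phi> (y - v) - q y * \<phi> y \<partial>lborel)"
      unfolding s1 using i2 int(2)[OF \<phi>m B \<phi>R] by (rule Bochner_Integration.integral_diff[symmetric])
    also have "\<dots> = (\<integral>y. - (\<integral>s. unit_ind s * (q y * \<psi> (y - s *\<^sub>R v)) \<partial>lborel) \<partial>lborel)"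
    proof (rule Bochner_Integration.integral_cong[OF refl])
      fix y
      have "(\<integral>s. unit_ind s * (q y * \<psi> (y - s *\<^sub>R v)) \<partial>lborel) = (\<integral>s. q y * (unit_ind s * \<psi> (y - s *\<^sub>R v)) \<partial>lborel)"
        by (simp add: mult_ac)
      also have "\<dots> = q y * (\<phi> y - \<phi> (y - v))"
        using test_segment_FTC[OF \<phi>, of v y] unfolding \<psi>_def by simp
      finally show "q y * \<phi> (y - v) - q y * \<phi> y = - (\<integral>s. unit_ind s * (q y * \<psi> (y - s *\<^sub>R v)) \<partial>lborel)"
        by (simp add: algebra_simps)
    qed
    also have "\<dots> = - (\<integral>y. (\<integral>s. unit_ind s * (q y * \<psi> (y - s *\<^sub>R v)) \<partial>lborel) \<partial>lborel)" by simp
    also have "\<dots> = - (\<integral>s. (\<integral>y. unit_ind s * (q y * \<psi> (y - s *\<^sub>R v)) \<partial>lborel) \<partial>lborel)"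
      using lborel_pair.Fubini_integral[OF integrable_q_segment[OF \<psi>m \<psi>B \<psi>R]] by simp
    also have "\<dots> = - (\<integral>s. unit_ind s * (\<integral>y. q y * \<psi> (y - s *\<^sub>R v) \<partial>lborel) \<partial>lborel)" by simp
    also have "\<dots> = - (\<integral>s. - (unit_ind s * (\<integral>x. (G (x + s *\<^sub>R v) \<bullet> v) * \<phi> x \<partial>lborel)) \<partial>lborel)"
    proof -
      have "unit_ind s * (\<integral>y. q y * \<psi> (y - s *\<^sub>R v) \<partial>lborel) = - (unit_ind s * (\<integral>x. (G (x + s *\<^sub>R v) \<bullet> v) * \<phi> x \<partial>lborel))" for s
        using inner[of s] by (cases "s \<in> {0..1}") auto
      then show ?thesis by (simp only:)
    qed
    also have "\<dots> = (\<integral>s. unit_ind s * (\<integral>x. (G (x + s *\<^sub>R v) \<bullet> v) * \<phi> x \<partial>lborel) \<partial>lborel)"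
      by (simp only: Bochner_Integration.integral_minus minus_minus)
    also have "\<dots> = (\<integral>x. D x * \<phi> x \<partial>lborel)" by (rule D_eq[OF \<phi>m B \<phi>R, symmetric])
    finally show ?thesis .
  qed
  then have z: "(\<integral>x. q (x + v) * \<phi> x - q x * \<phi> x - D x * \<phi> x \<partial>lborel) = 0"
    using int[OF \<phi>m B \<phi>R] by (simp add: Bochner_Integration.integral_diff)
  have "l2_inner E (\<lambda>x. q (x + v) - q x - D x) \<phi> = (\<integral>x. indicator E x *\<^sub>R ((q (x + v) - q x - D x) \<bullet> \<phi> x) \<partial>lebesgue)"
    unfolding l2_inner_def by (rule integral_lebesgue_on_eq[OF E])
  also have "\<dots> = (\<integral>x. q (x + v) * \<phi> x - q x * \<phi> x - D x * \<phi> x \<partial>lebesgue)"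
  proof (rule Bochner_Integration.integral_cong[OF refl])
    fix x
    have "x \<in> E \<or> \<phi> x = 0" using S by blast
    then show "indicator E x *\<^sub>R ((q (x + v) - q x - D x) \<bullet> \<phi> x) = q (x + v) * \<phi> x - q x * \<phi> x - D x * \<phi> x"
      by (auto simp: algebra_simps)
  qed
  also have "\<dots> = (\<integral>x. q (x + v) * \<phi> x - q x * \<phi> x - D x * \<phi> x \<partial>lborel)"
    by (rule integral_completion) measurable
  finally show "l2_inner E (\<lambda>x. q (x + v) - q x - (\<integral>s. unit_ind s * (G (x + s *\<^sub>R v) \<bullet> v) \<partial>lborel)) \<phi> = 0"
    unfolding f_eq z .
qed


text \<open>Jensen along the segment, then Fubini. As the segments stay in \<open>W\<close>, only
  the gradient on \<open>W\<close> is counted, which makes the estimate local.\<close>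

lemma translation_estimate:
  assumes E: "open E" and W[measurable]: "W \<in> sets borel" and "W \<subseteq> \<Omega>"
    and seg: "\<And>x s. x \<in> E \<Longrightarrow> 0 \<le> s \<Longrightarrow> s \<le> 1 \<Longrightarrow> x + s *\<^sub>R v \<in> W"
  shows "(\<integral>x. indicator E x * (q (x + v) - q x)\<^sup>2 \<partial>lborel) \<le> (norm v)\<^sup>2 * (\<integral>x. indicator W x * (norm (G x))\<^sup>2 \<partial>lborel)"
proof -
  let ?g = "\<lambda>x. indicator W x * (norm (G x))\<^sup>2"
  let ?\<Gamma> = "\<lambda>x. \<integral>s. unit_ind s * ?g (x + s *\<^sub>R v) \<partial>lborel"
  have [measurable]: "E \<in> sets borel" using E by simp
  have g: "integrable lborel ?g"
    using integrable_mult_indicator[OF _ G_sq, of W] W by simp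
  note sg = segment_integrable[OF g, of v]
  have \<Gamma>: "integrable lborel ?\<Gamma>" by (rule lborel_pair.integrable_snd[OF sg])
  have formula: "AE x in lborel. x \<in> E \<longrightarrow> q (x + v) - q x - (\<integral>s. unit_ind s * (G (x + s *\<^sub>R v) \<bullet> v) \<partial>lborel) = 0"
  proof -
    have "AE x in completion lborel. x \<in> E \<longrightarrow> q (x + v) - q x - (\<integral>s. unit_ind s * (G (x + s *\<^sub>R v) \<bullet> v) \<partial>lborel) = 0"
      using seg \<open>W \<subseteq> \<Omega>\<close> by (intro translation_formula[OF E]) blast
    then show ?thesis by (simp only: AE_completion_iff)
  qed
  have "AE x in lborel. indicator E x * (q (x + v) - q x)\<^sup>2 \<le> (norm v)\<^sup>2 * ?\<Gamma> x"
    using formula lborel_pair.AE_integrable_snd[OF sg]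
  proof eventually_elim
    case (elim x)
    have \<Gamma>0: "0 \<le> ?\<Gamma> x" by (intro integral_nonneg_AE) auto
    show ?case
    proof (cases "x \<in> E")
      case True
      let ?f = "\<lambda>s. G (x + s *\<^sub>R v) \<bullet> v"
      have le: "unit_ind s * (?f s)\<^sup>2 \<le> (norm v)\<^sup>2 * (unit_ind s * ?g (x + s *\<^sub>R v))" for s
      proof (cases "s \<in> {0..1}")
        case s: True
        then have "x + s *\<^sub>R v \<in> W" using seg True by simp
        moreover have "\<bar>?f s\<bar>\<^sup>2 \<le> (norm (G (x + s *\<^sub>R v)) * norm v)\<^sup>2"
          by (intro power_mono Cauchy_Schwarz_ineq2) auto
        ultimately show ?thesis using s by (simp add: power_mult_distrib mult.commute)
      qed simp
      have i: "integrable lborel (\<lambda>s. unit_ind s * (?f s)\<^sup>2)"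
      proof (rule Bochner_Integration.integrable_bound)
        show "integrable lborel (\<lambda>s. (norm v)\<^sup>2 * (unit_ind s * ?g (x + s *\<^sub>R v)))"
          using elim(2) by (rule integrable_mult_right)
        show "AE s in lborel. norm (unit_ind s * (?f s)\<^sup>2) \<le> norm ((norm v)\<^sup>2 * (unit_ind s * ?g (x + s *\<^sub>R v)))"
          using le by (intro AE_I2) (auto simp: abs_mult)
      qed measurable
      have "(q (x + v) - q x)\<^sup>2 = (\<integral>s. unit_ind s * ?f s \<partial>lborel)\<^sup>2" using elim(1) True by simp
      also have "\<dots> \<le> (\<integral>s. unit_ind s * (?f s)\<^sup>2 \<partial>lborel)"
        using mean_square_le[of ?f lborel "{0..1}"] i by simp
      also have "\<dots> \<le> (\<integral>s. (norm v)\<^sup>2 * (unit_ind s * ?g (x + s *\<^sub>R v)) \<partial>lborel)"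
        using i elim(2) le by (intro integral_mono integrable_mult_right) auto
      finally show ?thesis using True by simp
    qed (use \<Gamma>0 in simp)
  qed
  moreover have "AE x in lborel. 0 \<le> (norm v)\<^sup>2 * ?\<Gamma> x" by (intro AE_I2 mult_nonneg_nonneg integral_nonneg_AE) auto
  ultimately have "(\<integral>x. indicator E x * (q (x + v) - q x)\<^sup>2 \<partial>lborel) \<le> (\<integral>x. (norm v)\<^sup>2 * ?\<Gamma> x \<partial>lborel)"
    using \<Gamma> by (intro integral_mono_AE' integrable_mult_right)
  also have "\<dots> = (norm v)\<^sup>2 * (\<integral>x. ?g x \<partial>lborel)" using segment_integral[OF g, of v] by simp
  finally show ?thesis .
qed

text \<open>Jensen compares \<open>q x\<close> with the mean over the ball, and the substitution
  \<open>y = x + v\<close> turns the double integral into translation estimates. Convexity is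
  replaced by the condition that segments from \<open>D\<close> to the ball stay in
  \<open>W\<close>.\<close>

lemma Poincare_ball:
  assumes D: "open D" and r: "r > 0" and W: "W \<in> sets borel" "W \<subseteq> \<Omega>"
    and seg: "\<And>x y s. x \<in> D \<Longrightarrow> y \<in> ball z r \<Longrightarrow> 0 \<le> s \<Longrightarrow> s \<le> 1 \<Longrightarrow> x + s *\<^sub>R (y - x) \<in> W"
    and d: "\<And>x y. x \<in> D \<Longrightarrow> y \<in> ball z r \<Longrightarrow> norm (y - x) \<le> d" "d \<ge> 0"
  shows "(\<integral>x. indicator D x * (q x - (\<integral>y. indicator (ball z r) y * q y \<partial>lborel) / measure lborel (ball z r))\<^sup>2 \<partial>lborel)
    \<le> measure lborel (cball (0 :: real^'n) d) / measure lborel (ball z r) * d\<^sup>2 * (\<integral>x. indicator W x * (norm (G x))\<^sup>2 \<partial>lborel)"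
proof -
  define B where "B = ball z r"
  define m where "m = measure lborel B"
  define c where "c = (\<integral>y. indicator B y * q y \<partial>lborel) / m"
  define I where "I = (\<integral>x. indicator W x * (norm (G x))\<^sup>2 \<partial>lborel)"
  have [measurable]: "D \<in> sets borel" "B \<in> sets borel" using D by (simp_all add: B_def)
  have m: "m > 0" unfolding m_def B_def using content_ball_pos[OF r] by simp
  have Bfin: "emeasure lborel B < \<infinity>" unfolding B_def by (rule emeasure_lborel_ball_finite)
  have I0: "I \<ge> 0" unfolding I_def by (intro integral_nonneg_AE) auto
  have iB: "integrable lborel (indicat_real B)" using Bfin by (intro integrable_real_indicator) auto
  have iq: "integrable lborel (\<lambda>y. indicator B y * q y)"
  proof (rule integrable_if_square)
    show "integrable lborel (\<lambda>y. indicator B y * (q y)\<^sup>2)"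
      using integrable_mult_indicator[OF _ q_sq, of B] by simp
  qed (use Bfin in auto)
  have isq: "integrable lborel (\<lambda>y. indicator B y * (q y - q x)\<^sup>2)" for x
  proof -
    have "integrable lborel (\<lambda>y. indicator B y *\<^sub>R (q y)\<^sup>2 - (2 * q x) * (indicator B y * q y) + (q x)\<^sup>2 * indicator B y)"
      using integrable_mult_indicator[OF _ q_sq, of B] iq iB
      by (intro Bochner_Integration.integrable_add Bochner_Integration.integrable_diff integrable_mult_right) auto
    moreover have "(\<lambda>y. indicator B y *\<^sub>R (q y)\<^sup>2 - (2 * q x) * (indicator B y * q y) + (q x)\<^sup>2 * indicator B y)
        = (\<lambda>y. indicator B y * (q y - q x)\<^sup>2)"
      by (rule ext) (simp add: power2_eq_square algebra_simps)
    ultimately show ?thesis by simp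
  qed
  have jensen: "(q x - c)\<^sup>2 \<le> (\<integral>y. indicator B y * (q y - q x)\<^sup>2 \<partial>lborel) / m" for x
  proof -
    have "(\<integral>y. indicator B y * (q y - q x) \<partial>lborel) = (\<integral>y. indicator B y * q y - q x * indicator B y \<partial>lborel)"
      by (intro Bochner_Integration.integral_cong) (auto simp: algebra_simps)
    also have "\<dots> = c * m - q x * m"
      using iq iB m by (subst Bochner_Integration.integral_diff) (auto simp: c_def m_def)
    finally have "(\<integral>y. indicator B y * (q y - q x) \<partial>lborel) / m = c - q x" using m by (simp add: field_simps)
    then show ?thesis
      using mean_square_le[of "\<lambda>y. q y - q x" lborel B] isq[of x] Bfin m
      by (simp add: m_def power2_commute)
  qed
  have "(\<integral>\<^sup>+x. ennreal (indicator D x * (q x - c)\<^sup>2) \<partial>lborel)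
      \<le> (\<integral>\<^sup>+x. (\<integral>\<^sup>+v. ennreal (1 / m * (indicator D x * indicator B (x + v) * (q (x + v) - q x)\<^sup>2)) \<partial>lborel) \<partial>lborel)"
  proof (rule nn_integral_mono)
    fix x
    have "ennreal (indicator D x * (q x - c)\<^sup>2) \<le> ennreal (indicator D x * ((\<integral>y. indicator B y * (q y - q x)\<^sup>2 \<partial>lborel) / m))"
      using jensen by (intro ennreal_leI mult_left_mono) auto
    also have "\<dots> = ennreal (\<integral>y. 1 / m * (indicator D x * indicator B y * (q y - q x)\<^sup>2) \<partial>lborel)"
      by (simp add: mult.assoc)
    also have "(\<integral>y. 1 / m * (indicator D x * indicator B y * (q y - q x)\<^sup>2) \<partial>lborel)
        = (\<integral>v. 1 / m * (indicator D x * indicator B (v + x) * (q (v + x) - q x)\<^sup>2) \<partial>lborel)"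
      by (rule integral_lborel_shift[symmetric]) measurable
    also have "ennreal (\<integral>v. 1 / m * (indicator D x * indicator B (v + x) * (q (v + x) - q x)\<^sup>2) \<partial>lborel)
        = (\<integral>\<^sup>+v. ennreal (1 / m * (indicator D x * indicator B (x + v) * (q (x + v) - q x)\<^sup>2)) \<partial>lborel)"
    proof (subst nn_integral_eq_integral)
      have "integrable lborel (\<lambda>v. 1 / m * indicator D x * (indicator B (v + x) * (q (v + x) - q x)\<^sup>2))"
        by (intro integrable_mult_right integrable_lborel_shift[OF isq])
      then show "integrable lborel (\<lambda>v. 1 / m * (indicator D x * indicator B (x + v) * (q (x + v) - q x)\<^sup>2))"
        by (simp add: mult_ac add.commute)
      show "AE v in lborel. 0 \<le> 1 / m * (indicator D x * indicator B (x + v) * (q (x + v) - q x)\<^sup>2)"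
        using m by auto
    qed (simp add: add.commute)
    finally show "ennreal (indicator D x * (q x - c)\<^sup>2)
        \<le> (\<integral>\<^sup>+v. ennreal (1 / m * (indicator D x * indicator B (x + v) * (q (x + v) - q x)\<^sup>2)) \<partial>lborel)" .
  qed
  \<comment> \<open>For nonnegative integrals the order may be exchanged without proving
    integrability over the product.\<close>
  also have "\<dots> = (\<integral>\<^sup>+v. (\<integral>\<^sup>+x. ennreal (1 / m * (indicator D x * indicator B (x + v) * (q (x + v) - q x)\<^sup>2)) \<partial>lborel) \<partial>lborel)"
    by (rule lborel_pair.Fubini') measurable
  also have "\<dots> \<le> (\<integral>\<^sup>+v. ennreal (1 / m * (d\<^sup>2 * I) * indicator (cball 0 d) (v :: real^'n)) \<partial>lborel)"
  proof (rule nn_integral_mono)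
    fix v :: "real^'n"
    \<comment> \<open>For a fixed shift only the points of \<open>D\<close> carried into the ball
      contribute; if there is one, then \<open>norm v \<le> d\<close>.\<close>
    define E where "E = D \<inter> (\<lambda>x. x + v) -` B"
    have "open E" unfolding E_def B_def by (intro open_Int D open_vimage) (auto intro: continuous_intros)
    have ind: "indicator D x * indicator B (x + v) = (indicator E x :: real)" for x
      by (auto simp: E_def indicator_def)
    show "(\<integral>\<^sup>+x. ennreal (1 / m * (indicator D x * indicator B (x + v) * (q (x + v) - q x)\<^sup>2)) \<partial>lborel)
      \<le> ennreal (1 / m * (d\<^sup>2 * I) * indicator (cball 0 d) v)"
    proof (cases "E = {}")
      case True
      then show ?thesis unfolding ind by simp
    next
      case False
      then obtain x0 where "x0 \<in> D" "x0 + v \<in> ball z r" by (auto simp: E_def B_def)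
      then have v: "norm v \<le> d" using d(1)[of x0 "x0 + v"] by simp
      have iE: "integrable lborel (\<lambda>x. indicator E x * (q (x + v) - q x)\<^sup>2)"
      proof (rule Bochner_Integration.integrable_bound)
        show "integrable lborel (\<lambda>x. 2 * (q (x + v))\<^sup>2 + 2 * (q x)\<^sup>2)"
          using integrable_lborel_shift[OF q_sq] q_sq by (intro Bochner_Integration.integrable_add integrable_mult_right)
        have [measurable]: "E \<in> sets borel" using \<open>open E\<close> by simp
        show "(\<lambda>x. indicator E x * (q (x + v) - q x)\<^sup>2) \<in> borel_measurable lborel" by measurable
        have "(a - b)\<^sup>2 \<le> 2 * a\<^sup>2 + 2 * b\<^sup>2" for a b :: real
          using zero_le_power2[of "a + b"] by (simp add: power2_eq_square algebra_simps)
        then show "AE x in lborel. norm (indicator E x * (q (x + v) - q x)\<^sup>2) \<le> norm (2 * (q (x + v))\<^sup>2 + 2 * (q x)\<^sup>2)"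
          by (intro AE_I2) (auto simp: indicator_def)
      qed
      have "(\<integral>\<^sup>+x. ennreal (1 / m * (indicator D x * indicator B (x + v) * (q (x + v) - q x)\<^sup>2)) \<partial>lborel)
          = ennreal (\<integral>x. 1 / m * (indicator E x * (q (x + v) - q x)\<^sup>2) \<partial>lborel)"
        unfolding ind using iE m by (intro nn_integral_eq_integral integrable_mult_right) auto
      also have "(\<integral>x. 1 / m * (indicator E x * (q (x + v) - q x)\<^sup>2) \<partial>lborel)
          = 1 / m * (\<integral>x. indicator E x * (q (x + v) - q x)\<^sup>2 \<partial>lborel)" by simp
      also have "ennreal \<dots> \<le> ennreal (1 / m * (d\<^sup>2 * I) * indicator (cball 0 d) v)"
      proof (rule ennreal_leI)
        have "(\<integral>x. indicator E x * (q (x + v) - q x)\<^sup>2 \<partial>lborel) \<le> (norm v)\<^sup>2 * I"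
          unfolding I_def
        proof (rule translation_estimate[OF \<open>open E\<close> W])
          fix x and s :: real assume "x \<in> E" "0 \<le> s" "s \<le> 1"
          then show "x + s *\<^sub>R v \<in> W" using seg[of x "x + v" s] by (simp add: E_def B_def)
        qed
        also have "\<dots> \<le> d\<^sup>2 * I" using v I0 by (intro mult_right_mono power_mono) auto
        finally show "1 / m * (\<integral>x. indicator E x * (q (x + v) - q x)\<^sup>2 \<partial>lborel) \<le> 1 / m * (d\<^sup>2 * I) * indicator (cball 0 d) v"
          using m v by (simp add: divide_right_mono)
      qed
      finally show ?thesis .
    qed
  qed
  also have "\<dots> = ennreal (1 / m * (d\<^sup>2 * I) * measure lborel (cball (0 :: real^'n) d))"
    using integrable_cball[of d] m I0 by (subst nn_integral_eq_integral) (auto intro!: integrable_mult_right)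
  finally have "(\<integral>\<^sup>+x. ennreal (indicator D x * (q x - c)\<^sup>2) \<partial>lborel) \<le> ennreal (1 / m * (d\<^sup>2 * I) * measure lborel (cball (0 :: real^'n) d))" .
  then have "(\<integral>x. indicator D x * (q x - c)\<^sup>2 \<partial>lborel) \<le> 1 / m * (d\<^sup>2 * I) * measure lborel (cball (0 :: real^'n) d)"
    using m I0 by (intro integral_real_bounded) auto
  then show ?thesis unfolding c_def m_def B_def I_def by (simp add: mult_ac)
qed

end

section \<open>Poincare estimates up to a Lipschitz boundary\<close>

lemma borel_measurable_nth:
  fixes G :: "'a \<Rightarrow> real^'n"
  assumes "G \<in> borel_measurable M"
  shows "(\<lambda>x. G x $ i) \<in> borel_measurable M"
  by (rule borel_measurable_continuous_on[OF _ assms]) (intro continuous_intros)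

lemma borel_measurable_vec_lambda:
  fixes f :: "'n::finite \<Rightarrow> 'a \<Rightarrow> real"
  assumes "\<And>i. f i \<in> borel_measurable M"
  shows "(\<lambda>x. \<chi> i. f i x) \<in> borel_measurable M"
proof (rule borel_measurable_euclidean_space[THEN iffD2], rule ballI)
  fix b :: "real^'n" assume "b \<in> Basis"
  then obtain k where "b = axis k 1" by (auto simp: Basis_vec_def)
  then show "(\<lambda>x. (\<chi> i. f i x) \<bullet> b) \<in> borel_measurable M"
    using assms[of k] by (simp add: inner_axis)
qed

lemma L2_indicator_measurable:
  fixes q :: "real^'n \<Rightarrow> real"
  assumes "open \<Omega>" "q \<in> borel_measurable (lebesgue_on \<Omega>)"
  shows "(\<lambda>x. indicator \<Omega> x * q x) \<in> borel_measurable lebesgue"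
  using assms by (subst (asm) borel_measurable_restrict_space_iff) auto

text \<open>Extended by zero, the function and its gradient agree almost everywhere with Borel
  functions, and the weak identity is insensitive to null sets. This gives access to
  \<open>borel_weak_gradient\<close>.\<close>

lemma weak_gradient_borel:
  fixes \<Omega> :: "(real^'n) set"
  assumes \<Omega>: "open \<Omega>" and q: "q \<in> L2 \<Omega>" and G: "G \<in> L2 \<Omega>" and w: "has_weak_gradient \<Omega> q G"
  obtains q' G' where "borel_weak_gradient \<Omega> q' G'"
    "AE x in lebesgue. indicator \<Omega> x * q x = q' x" "AE x in lebesgue. indicator \<Omega> x *\<^sub>R G x = G' x"
proof -
  have qm: "(\<lambda>x. indicator \<Omega> x * q x) \<in> borel_measurable lebesgue"
    using q by (intro L2_indicator_measurable[OF \<Omega>]) (simp add: L2_def)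
  obtain q' where q': "q' \<in> borel_measurable borel" "AE x in lborel. indicator \<Omega> x * q x = q' x"
    using completion_ex_borel_measurable_real[OF qm] by auto
  have "\<exists>g. g \<in> borel_measurable borel \<and> (AE x in lborel. indicator \<Omega> x * G x $ i = g x)" for i
  proof -
    have "(\<lambda>x. indicator \<Omega> x * G x $ i) \<in> borel_measurable lebesgue"
      using G by (intro L2_indicator_measurable[OF \<Omega>] borel_measurable_nth) (simp add: L2_def)
    from completion_ex_borel_measurable_real[OF this] show ?thesis by auto
  qed
  then obtain g where g: "\<And>i. g i \<in> borel_measurable borel" "\<And>i. AE x in lborel. indicator \<Omega> x * G x $ i = g i x" by metis
  define G' where "G' x = (\<chi> i. g i x)" for x
  have G'm: "G' \<in> borel_measurable borel" unfolding G'_def using g(1) by (rule borel_measurable_vec_lambda)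
  have "AE x in lborel. \<forall>i\<in>UNIV. indicator \<Omega> x * G x $ i = g i x"
    using g(2) by (intro AE_finite_allI) auto
  then have aeG0: "AE x in lborel. indicator \<Omega> x *\<^sub>R G x = G' x"
    by eventually_elim (simp add: G'_def vec_eq_iff)
  have aeq: "AE x in lebesgue. indicator \<Omega> x * q x = q' x" and aeG: "AE x in lebesgue. indicator \<Omega> x *\<^sub>R G x = G' x"
    using q'(2) aeG0 by (auto intro: AE_completion)
  have sq: "integrable lborel f'" if "integrable (lebesgue_on \<Omega>) f" "f' \<in> borel_measurable borel"
    "AE x in lebesgue. indicator \<Omega> x *\<^sub>R f x = f' x" for f f' :: "real^'n \<Rightarrow> real"
  proof -
    have "integrable lebesgue f'"
    proof (rule integrable_cong_AE_imp[OF _ _ that(3)])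
      show "integrable lebesgue (\<lambda>x. indicator \<Omega> x *\<^sub>R f x)"
        using that(1) by (simp only: integrable_lebesgue_on_iff[OF \<Omega>])
      show "f' \<in> borel_measurable lebesgue" using that(2) by (simp add: measurable_completion)
    qed
    then show ?thesis using that(2) by (subst (asm) integrable_completion) auto
  qed
  have "borel_weak_gradient \<Omega> q' G'"
  proof
    show "q' \<in> borel_measurable borel" "G' \<in> borel_measurable borel" by (fact q'(1) G'm)+
    show "integrable lborel (\<lambda>x. (q' x)\<^sup>2)"
    proof (rule sq)
      show "integrable (lebesgue_on \<Omega>) (\<lambda>x. (norm (q x))\<^sup>2)" using q by (simp add: L2_def)
      show "(\<lambda>x. (q' x)\<^sup>2) \<in> borel_measurable borel" using q'(1) by measurable
      show "AE x in lebesgue. indicator \<Omega> x *\<^sub>R (norm (q x))\<^sup>2 = (q' x)\<^sup>2"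
        using aeq
      proof eventually_elim
        case (elim x)
        show ?case unfolding elim[symmetric] by (simp add: indicator_def)
      qed
    qed
    show "integrable lborel (\<lambda>x. (norm (G' x))\<^sup>2)"
    proof (rule sq)
      show "integrable (lebesgue_on \<Omega>) (\<lambda>x. (norm (G x))\<^sup>2)" using G by (simp add: L2_def)
      show "(\<lambda>x. (norm (G' x))\<^sup>2) \<in> borel_measurable borel" using G'm by measurable
      show "AE x in lebesgue. indicator \<Omega> x *\<^sub>R (norm (G x))\<^sup>2 = (norm (G' x))\<^sup>2"
        using aeG
      proof eventually_elim
        case (elim x)
        show ?case unfolding elim[symmetric] by (simp add: indicator_def)
      qed
    qed
    fix \<phi> :: "real^'n \<Rightarrow> real" and i assume \<phi>: "\<phi> \<in> test_functions \<Omega>"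
    have m: "\<phi> \<in> borel_measurable borel" "partial_deriv i \<phi> \<in> borel_measurable borel"
      using test_functions_continuous[OF \<phi>] test_functions_continuous[OF partial_deriv_test[OF \<phi>]]
      by (auto intro: borel_measurable_continuous_onI)
    have eq: "(\<integral>x. f' x * \<eta> x \<partial>lborel) = (\<integral>x. f x * \<eta> x \<partial>lebesgue_on \<Omega>)"
      if "f \<in> borel_measurable (lebesgue_on \<Omega>)" "f' \<in> borel_measurable borel" "\<eta> \<in> borel_measurable borel"
        "AE x in lebesgue. indicator \<Omega> x * f x = f' x" for f f' \<eta> :: "real^'n \<Rightarrow> real"
    proof -
      have mf: "(\<lambda>x. f' x * \<eta> x) \<in> borel_measurable borel" using that(2,3) by measurable
      have "(\<integral>x. f' x * \<eta> x \<partial>lborel) = (\<integral>x. f' x * \<eta> x \<partial>lebesgue)"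
        using mf by (intro integral_completion[symmetric]) simp
      also have "\<dots> = (\<integral>x. indicator \<Omega> x *\<^sub>R (f x * \<eta> x) \<partial>lebesgue)"
      proof (rule integral_cong_AE)
        show "(\<lambda>x. f' x * \<eta> x) \<in> borel_measurable lebesgue" using mf by (simp add: measurable_completion)
        have "(\<lambda>x. (indicator \<Omega> x * f x) * \<eta> x) \<in> borel_measurable lebesgue"
          using that(3) by (intro borel_measurable_times L2_indicator_measurable[OF \<Omega> that(1)]) (simp add: measurable_completion)
        then show "(\<lambda>x. indicator \<Omega> x *\<^sub>R (f x * \<eta> x)) \<in> borel_measurable lebesgue" by (simp add: mult.assoc)
        show "AE x in lebesgue. f' x * \<eta> x = indicator \<Omega> x *\<^sub>R (f x * \<eta> x)"
          using that(4) by eventually_elim (simp add: mult.assoc[symmetric])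
      qed
      also have "\<dots> = (\<integral>x. f x * \<eta> x \<partial>lebesgue_on \<Omega>)" by (rule integral_lebesgue_on_eq[OF \<Omega>, symmetric])
      finally show ?thesis .
    qed
    have aei: "AE x in lebesgue. indicator \<Omega> x * G x $ i = G' x $ i"
      using aeG by eventually_elim (simp add: vec_eq_iff)
    have "(\<integral>x. q' x * partial_deriv i \<phi> x \<partial>lborel) = l2_inner \<Omega> q (partial_deriv i \<phi>)"
      unfolding l2_inner_def inner_real_def using q q'(1) m(2) aeq by (intro eq) (simp_all add: L2_def)
    also have "\<dots> = - l2_inner \<Omega> (\<lambda>x. G x $ i) \<phi>" using w \<phi> by (simp add: has_weak_gradient_def)
    also have "l2_inner \<Omega> (\<lambda>x. G x $ i) \<phi> = (\<integral>x. G' x $ i * \<phi> x \<partial>lborel)"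
      unfolding l2_inner_def inner_real_def using G G'm m(1) aei
      by (intro eq[symmetric] borel_measurable_nth) (simp_all add: L2_def)
    finally show "(\<integral>x. q' x * partial_deriv i \<phi> x \<partial>lborel) = - (\<integral>x. G' x $ i * \<phi> x \<partial>lborel)" .
  qed
  then show thesis using aeq aeG by (rule that)
qed

text \<open>Moving from a point of the domain into the cone of directions \<open>v\<close> with
  \<open>v \<bullet> d < - L \<bar>v - (v \<bullet> d) d\<bar>\<close> stays below the graph.\<close>

lemma below_graph_cone:
  fixes d :: "'a::real_inner"
  assumes d: "norm d = 1" and lip: "L-lipschitz_on {z. z \<bullet> d = 0} g"
    and x: "x \<bullet> d < g (x - (x \<bullet> d) *\<^sub>R d)" and v: "v \<bullet> d \<le> - L * norm (v - (v \<bullet> d) *\<^sub>R d)"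
  shows "(x + v) \<bullet> d < g ((x + v) - ((x + v) \<bullet> d) *\<^sub>R d)"
proof -
  have dd: "d \<bullet> d = 1" using d by (simp add: dot_square_norm)
  have perp: "y - (y \<bullet> d) *\<^sub>R d \<in> {z. z \<bullet> d = 0}" for y by (simp add: inner_diff_left dd)
  have "\<bar>g (x - (x \<bullet> d) *\<^sub>R d) - g ((x + v) - ((x + v) \<bullet> d) *\<^sub>R d)\<bar>
      \<le> L * norm ((x - (x \<bullet> d) *\<^sub>R d) - ((x + v) - ((x + v) \<bullet> d) *\<^sub>R d))"
    using lipschitz_onD[OF lip perp[of x] perp[of "x + v"]] by (simp only: dist_norm real_norm_def)
  also have "(x - (x \<bullet> d) *\<^sub>R d) - ((x + v) - ((x + v) \<bullet> d) *\<^sub>R d) = - (v - (v \<bullet> d) *\<^sub>R d)"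
    by (simp add: inner_add_left scaleR_add_left)
  finally have "g (x - (x \<bullet> d) *\<^sub>R d) - g ((x + v) - ((x + v) \<bullet> d) *\<^sub>R d) \<le> L * norm (v - (v \<bullet> d) *\<^sub>R d)"
    by (simp add: abs_le_iff norm_minus_commute)
  then show ?thesis using x v by (simp add: inner_add_left)
qed

lemma norm_minus_projection_le:
  fixes d :: "'a::real_inner"
  assumes "norm d = 1"
  shows "norm (v - (v \<bullet> d) *\<^sub>R d) \<le> norm v"
proof (rule power2_le_imp_le)
  have dd: "d \<bullet> d = 1" using assms by (simp add: dot_square_norm)
  have "(norm (v - (v \<bullet> d) *\<^sub>R d))\<^sup>2 = (norm v)\<^sup>2 - (v \<bullet> d)\<^sup>2"
    unfolding power2_norm_eq_inner
    by (simp add: inner_diff_left inner_diff_right dd inner_commute[of d v] power2_eq_square)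
  then show "(norm (v - (v \<bullet> d) *\<^sub>R d))\<^sup>2 \<le> (norm v)\<^sup>2" by simp
qed simp

text \<open>Away from the boundary \<open>z = a\<close> serves. Near it, \<open>z\<close> lies at
  distance \<open>C * h\<close> from \<open>a\<close> against the chart direction, far enough for
  all vectors from points near \<open>a\<close> to points near \<open>z\<close> to lie in the cone
  of directions that stay below the graph. Compactness of the boundary makes the constants
  uniform.\<close>

lemma lipschitz_domain_patches:
  fixes \<Omega> :: "(real^'n) set"
  assumes \<Omega>: "open \<Omega>" "bounded \<Omega>" and lip: "lipschitz_boundary \<Omega>"
  obtains h0 \<Lambda> where "h0 > 0" "\<Lambda> \<ge> 1"
    "\<And>h a. 0 < h \<Longrightarrow> h \<le> h0 \<Longrightarrow> a \<in> closure \<Omega> \<Longrightarrow>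
       \<exists>z. \<forall>x\<in>\<Omega> \<inter> ball a (2 * h). \<forall>y\<in>ball z h. \<forall>s\<in>{0..1}.
         x + s *\<^sub>R (y - x) \<in> \<Omega> \<inter> ball a (\<Lambda> * h) \<and> norm (y - x) \<le> \<Lambda> * h"
proof -
  have "compact (frontier \<Omega>)" using \<Omega>(2) by (rule compact_frontier_bounded)
  define chart where "chart x d r L g \<longleftrightarrow> norm d = 1 \<and> r > 0 \<and> L-lipschitz_on {z. z \<bullet> d = 0} g \<and>
        \<Omega> \<inter> ball x r = {y \<in> ball x r. y \<bullet> d < g (y - (y \<bullet> d) *\<^sub>R d)}"
    for x d :: "real^'n" and r L and g :: "real^'n \<Rightarrow> real"
  have "\<forall>x\<in>frontier \<Omega>. \<exists>d r L g. chart x d r L g"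
    using lip unfolding lipschitz_boundary_def chart_def .
  then obtain d r L g where "\<And>x. x \<in> frontier \<Omega> \<Longrightarrow> chart x (d x) (r x) (L x) (g x)" by metis
  note chart = this[unfolded chart_def]
  \<comment> \<open>Covering with half radii leaves room for a ball of size comparable to
    \<open>h\<close> inside the full chart.\<close>
  obtain X where X: "X \<subseteq> frontier \<Omega>" "finite X" "frontier \<Omega> \<subseteq> (\<Union>x\<in>X. ball x (r x / 2))"
    using \<open>compact (frontier \<Omega>)\<close>
  proof (rule compactE_image[of "frontier \<Omega>" "frontier \<Omega>" "\<lambda>x. ball x (r x / 2)"])
    show "frontier \<Omega> \<subseteq> (\<Union>x\<in>frontier \<Omega>. ball x (r x / 2))" using chart by fastforce
  qed auto
  define M where "M = (\<Sum>x\<in>X. \<bar>L x\<bar>)"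
  have M: "L x \<le> M" if "x \<in> X" for x
    using member_le_sum[of x X "\<lambda>x. \<bar>L x\<bar>"] that X(2) by (simp add: M_def)
  have M0: "M \<ge> 0" unfolding M_def by (intro sum_nonneg) auto
  \<comment> \<open>The inserted 1 keeps the minimum meaningful if \<open>X\<close> is
    empty.\<close>
  define r0 where "r0 = Min (insert 1 (r ` X))"
  have r0: "r0 > 0" "\<And>x. x \<in> X \<Longrightarrow> r0 \<le> r x"
    using X chart by (auto simp: r0_def Min_gr_iff subset_iff)
  \<comment> \<open>The vector \<open>y - x\<close> differs from \<open>- (C * h)\<close> times the
    chart direction by at most \<open>3 * h\<close>. For slopes up to \<open>M\<close> the cone
    condition asks for \<open>3 * h - C * h \<le> - (3 * M * h)\<close>, which this value satisfies
    with room \<open>h\<close>.\<close>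
  define C where "C = 4 + 3 * M"
  \<comment> \<open>\<open>C + 3\<close> bounds the length of \<open>y - x\<close> relative to
    \<open>h\<close>. With the \<open>h0\<close> below, the radius \<open>\<Lambda> * h\<close> plus
    the distance \<open>3 * h\<close> to the boundary is at most a quarter of
    \<open>r0\<close>.\<close>
  define \<Lambda> where "\<Lambda> = C + 3"
  define h0 where "h0 = r0 / 4 / (C + 10)"
  have C: "C \<ge> 4" using M0 by (simp add: C_def)
  show thesis
  proof (rule that[of h0 \<Lambda>])
    show "h0 > 0" using r0 C by (simp add: h0_def)
    show "\<Lambda> \<ge> 1" using C by (simp add: \<Lambda>_def)
    fix h a assume h: "0 < h" "h \<le> h0" and a: "a \<in> closure \<Omega>"
    have hr: "(C + 10) * h \<le> r0 / 4"
    proof -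
      have "(C + 10) * h \<le> (C + 10) * h0" using h C by (intro mult_left_mono) auto
      also have "\<dots> = r0 / 4"
      proof -
        have "C + 10 \<noteq> 0" using C by linarith
        then show ?thesis unfolding h0_def by (metis nonzero_mult_div_cancel_left times_divide_eq_right)
      qed
      finally show ?thesis .
    qed
    have big: "2 * h < \<Lambda> * h" "3 * h \<le> \<Lambda> * h" using h C by (simp_all add: \<Lambda>_def)
    show "\<exists>z. \<forall>x\<in>\<Omega> \<inter> ball a (2 * h). \<forall>y\<in>ball z h. \<forall>s\<in>{0..1}.
         x + s *\<^sub>R (y - x) \<in> \<Omega> \<inter> ball a (\<Lambda> * h) \<and> norm (y - x) \<le> \<Lambda> * h"
    proof (cases "cball a (3 * h) \<subseteq> \<Omega>")
      case True
      show ?thesis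
      proof (intro exI[of _ a] ballI)
        fix x y and s :: real assume x: "x \<in> \<Omega> \<inter> ball a (2 * h)" and y: "y \<in> ball a h" and s: "s \<in> {0..1}"
        have "y \<in> ball a (2 * h)" using y h by simp
        then have "(1 - s) *\<^sub>R x + s *\<^sub>R y \<in> ball a (2 * h)"
          using x s by (intro convexD[OF convex_ball]) auto
        moreover have "(1 - s) *\<^sub>R x + s *\<^sub>R y = x + s *\<^sub>R (y - x)" by (simp add: algebra_simps)
        ultimately have *: "x + s *\<^sub>R (y - x) \<in> ball a (2 * h)" by simp
        have "norm (y - x) \<le> 3 * h"
          using x y norm_triangle_ineq4[of "y - a" "x - a"] by (simp add: dist_norm norm_minus_commute)
        moreover have "x + s *\<^sub>R (y - x) \<in> \<Omega>" using * True h by (auto simp: subset_iff)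
        ultimately show "x + s *\<^sub>R (y - x) \<in> \<Omega> \<inter> ball a (\<Lambda> * h) \<and> norm (y - x) \<le> \<Lambda> * h"
          using * big by auto
      qed
    next
      case False
      obtain z0 where z0: "z0 \<in> frontier \<Omega>" "norm (a - z0) \<le> 3 * h"
      proof (cases "a \<in> \<Omega>")
        case True
        then have "cball a (3 * h) \<inter> frontier \<Omega> \<noteq> {}"
        proof (intro connected_Int_frontier)
          have "a \<in> cball a (3 * h) \<inter> \<Omega>" using True h by simp
          then show "cball a (3 * h) \<inter> \<Omega> \<noteq> {}" by blast
        qed (use False in auto)
        then show ?thesis using that by (auto simp: dist_norm)
      next
        case F: False
        then have "a \<in> frontier \<Omega>" using a \<Omega>(1) by (simp add: frontier_def interior_open)
        then show ?thesis using h by (intro that[of a]) auto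
      qed
      obtain x1 where x1: "x1 \<in> X" "norm (z0 - x1) < r x1 / 2"
        using X(3) z0(1) by (auto simp: dist_norm norm_minus_commute)
      note ch = chart[OF subsetD[OF X(1) x1(1)]]
      define e where "e = d x1"
      have e: "norm e = 1" using ch by (simp add: e_def)
      define z where "z = a - (C * h) *\<^sub>R e"
      show ?thesis
      proof (intro exI[of _ z] ballI)
        fix x y and s :: real assume x: "x \<in> \<Omega> \<inter> ball a (2 * h)" and y: "y \<in> ball z h" and s: "s \<in> {0..1}"
        define u where "u = (y - z) - (x - a)"
        have u: "norm u \<le> 3 * h"
          using x y norm_triangle_ineq4[of "y - z" "x - a"] by (simp add: u_def dist_norm norm_minus_commute)
        have yx: "y - x = u - (C * h) *\<^sub>R e" by (simp add: u_def z_def)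
        have ee: "e \<bullet> e = 1" using e by (simp add: dot_square_norm)
        have yx_norm: "norm (y - x) \<le> \<Lambda> * h"
          using norm_triangle_ineq4[of u "(C * h) *\<^sub>R e"] u e h C by (simp add: yx \<Lambda>_def algebra_simps)
        have "norm (y - a) < (C + 1) * h"
          using norm_triangle_ineq[of "y - z" "z - a"] y e h C by (simp add: z_def dist_norm norm_minus_commute algebra_simps)
        moreover have "(C + 1) * h \<le> \<Lambda> * h" using h by (simp add: \<Lambda>_def)
        ultimately have "y \<in> ball a (\<Lambda> * h)" by (simp add: dist_norm norm_minus_commute)
        moreover have "x \<in> ball a (\<Lambda> * h)" using x big by auto
        ultimately have "(1 - s) *\<^sub>R x + s *\<^sub>R y \<in> ball a (\<Lambda> * h)"
          using s by (intro convexD[OF convex_ball]) auto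
        moreover have "(1 - s) *\<^sub>R x + s *\<^sub>R y = x + s *\<^sub>R (y - x)" by (simp add: algebra_simps)
        ultimately have in_ball: "x + s *\<^sub>R (y - x) \<in> ball a (\<Lambda> * h)" by simp
        have sub: "ball a (\<Lambda> * h) \<subseteq> ball x1 (r x1)"
        proof
          fix w assume "w \<in> ball a (\<Lambda> * h)"
          then have "norm (w - a) < \<Lambda> * h" by (simp add: dist_norm norm_minus_commute)
          then have "norm (w - x1) < \<Lambda> * h + 3 * h + r x1 / 2"
            using norm_triangle_ineq[of "w - a" "a - z0"] norm_triangle_ineq[of "w - z0" "z0 - x1"] z0(2) x1(2) by simp
          also have "\<Lambda> * h + 3 * h \<le> r0 / 4" using hr h by (simp add: \<Lambda>_def algebra_simps)
          finally show "w \<in> ball x1 (r x1)" using r0(1) r0(2)[OF x1(1)] by (simp add: dist_norm norm_minus_commute)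
        qed
        have x_ball: "x \<in> ball x1 (r x1)" using sub \<open>x \<in> ball a (\<Lambda> * h)\<close> by blast
        have x_below: "x \<bullet> e < g x1 (x - (x \<bullet> e) *\<^sub>R e)" using ch x x_ball unfolding e_def by blast
        define v where "v = s *\<^sub>R (y - x)"
        have perp: "v - (v \<bullet> e) *\<^sub>R e = s *\<^sub>R (u - (u \<bullet> e) *\<^sub>R e)"
          by (simp add: v_def yx inner_diff_left ee algebra_simps)
        have s0: "0 \<le> s" "s \<le> 1" using s by auto
        have L0: "0 \<le> L x1" using ch lipschitz_on_nonneg by blast
        have "v \<bullet> e = s * (u \<bullet> e - C * h)" by (simp add: v_def yx inner_diff_left ee)
        also have "\<dots> \<le> s * (3 * h - C * h)"
        proof (intro mult_left_mono s0 diff_right_mono)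
          have "u \<bullet> e \<le> norm u * norm e" by (rule norm_cauchy_schwarz)
          then show "u \<bullet> e \<le> 3 * h" using u e by simp
        qed
        also have "\<dots> \<le> s * (- (M * (3 * h)))"
          using s0 h by (intro mult_left_mono) (simp_all add: C_def algebra_simps)
        also have "\<dots> \<le> s * (- (L x1 * norm (u - (u \<bullet> e) *\<^sub>R e)))"
        proof (intro mult_left_mono s0)
          have "norm (u - (u \<bullet> e) *\<^sub>R e) \<le> 3 * h" using norm_minus_projection_le[OF e, of u] u by linarith
          then have "L x1 * norm (u - (u \<bullet> e) *\<^sub>R e) \<le> M * (3 * h)"
            using M[OF x1(1)] L0 by (intro mult_mono) auto
          then show "- (M * (3 * h)) \<le> - (L x1 * norm (u - (u \<bullet> e) *\<^sub>R e))" by simp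
        qed
        also have "\<dots> = - L x1 * norm (v - (v \<bullet> e) *\<^sub>R e)" using s0 unfolding perp by simp
        finally have v: "v \<bullet> e \<le> - L x1 * norm (v - (v \<bullet> e) *\<^sub>R e)" .
        have "(x + v) \<bullet> e < g x1 ((x + v) - ((x + v) \<bullet> e) *\<^sub>R e)"
          using ch e x_below v by (intro below_graph_cone[where L="L x1"]) (auto simp: e_def)
        moreover have "x + v \<in> ball x1 (r x1)" using in_ball sub by (auto simp: v_def)
        ultimately have "x + v \<in> \<Omega>" using ch unfolding e_def by blast
        then show "x + s *\<^sub>R (y - x) \<in> \<Omega> \<inter> ball a (\<Lambda> * h) \<and> norm (y - x) \<le> \<Lambda> * h"
          using in_ball yx_norm by (simp add: v_def)
      qed
    qed
  qed
qed

text \<open>The power of \<Lambda> is the volume ratio of balls of radii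
  \<open>\<Lambda> * h\<close> and \<open>h\<close>, and \<open>\<Lambda> * h\<close> bounds the
  segments. The constant \<open>c\<close> is the mean over the auxiliary ball, of which no closeness
  to \<open>a\<close> beyond the patch property is asked.\<close>

theorem Poincare_patch:
  fixes \<Omega> :: "(real^'n) set"
  assumes \<Omega>: "open \<Omega>" "bounded \<Omega>" and lip: "lipschitz_boundary \<Omega>"
  obtains h0 \<Lambda> where "h0 > 0" "\<Lambda> \<ge> 1"
    "\<And>h a q G. 0 < h \<Longrightarrow> h \<le> h0 \<Longrightarrow> a \<in> closure \<Omega> \<Longrightarrow> q \<in> L2 \<Omega> \<Longrightarrow> G \<in> L2 \<Omega> \<Longrightarrow> has_weak_gradient \<Omega> q G \<Longrightarrow>
       \<exists>c. (\<integral>x. indicator (cball a h) x * (q x - c)\<^sup>2 \<partial>lebesgue_on \<Omega>)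
         \<le> \<Lambda> ^ CARD('n) * (\<Lambda> * h)\<^sup>2 * (\<integral>x. indicator (ball a (\<Lambda> * h)) x * (norm (G x))\<^sup>2 \<partial>lebesgue_on \<Omega>)"
proof -
  obtain h0 \<Lambda> where h0: "h0 > 0" "\<Lambda> \<ge> 1"
    and patch: "\<And>h a. 0 < h \<Longrightarrow> h \<le> h0 \<Longrightarrow> a \<in> closure \<Omega> \<Longrightarrow>
       \<exists>z. \<forall>x\<in>\<Omega> \<inter> ball a (2 * h). \<forall>y\<in>ball z h. \<forall>s\<in>{0..1}.
         x + s *\<^sub>R (y - x) \<in> \<Omega> \<inter> ball a (\<Lambda> * h) \<and> norm (y - x) \<le> \<Lambda> * h"
    using lipschitz_domain_patches[OF assms] by blast
  show thesis
  proof (rule that[OF h0])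
    fix h a q G
    assume h: "0 < h" "h \<le> h0" and a: "a \<in> closure \<Omega>" and q: "q \<in> L2 \<Omega>" and G: "G \<in> L2 \<Omega>"
      and w: "has_weak_gradient \<Omega> q G"
    obtain z where "\<forall>x\<in>\<Omega> \<inter> ball a (2 * h). \<forall>y\<in>ball z h. \<forall>s\<in>{0..1}.
         x + s *\<^sub>R (y - x) \<in> \<Omega> \<inter> ball a (\<Lambda> * h) \<and> norm (y - x) \<le> \<Lambda> * h"
      using patch[OF h a] by blast
    then have z0: "x + s *\<^sub>R (y - x) \<in> \<Omega> \<inter> ball a (\<Lambda> * h) \<and> norm (y - x) \<le> \<Lambda> * h"
      if "x \<in> \<Omega> \<inter> ball a (2 * h)" "y \<in> ball z h" "0 \<le> s" "s \<le> 1" for x y s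
      using that by simp
    have z1: "x + s *\<^sub>R (y - x) \<in> \<Omega> \<inter> ball a (\<Lambda> * h)"
      if "x \<in> \<Omega> \<inter> ball a (2 * h)" "y \<in> ball z h" "0 \<le> s" "s \<le> 1" for x y s
      using z0[OF that] by blast
    have z2: "norm (y - x) \<le> \<Lambda> * h" if "x \<in> \<Omega> \<inter> ball a (2 * h)" "y \<in> ball z h" for x y
      using z0[OF that, of 0] by simp
    obtain q' G' where bw: "borel_weak_gradient \<Omega> q' G'"
      and aeq: "AE x in lebesgue. indicator \<Omega> x * q x = q' x" and aeG: "AE x in lebesgue. indicator \<Omega> x *\<^sub>R G x = G' x"
      using weak_gradient_borel[OF \<Omega>(1) q G w] by blast
    interpret borel_weak_gradient \<Omega> q' G' by (rule bw)
    \<comment> \<open>The open ball of radius \<open>2 * h\<close> contains \<open>cball a h\<close>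
      and provides the open set that \<open>Poincare_ball\<close> asks for.\<close>
    let ?D = "\<Omega> \<inter> ball a (2 * h)" and ?W = "\<Omega> \<inter> ball a (\<Lambda> * h)"
    define c where "c = (\<integral>y. indicator (ball z h) y * q' y \<partial>lborel) / measure lborel (ball z h)"
    have open_D: "open ?D" using \<Omega>(1) by auto
    have meas: "?D \<in> sets borel" "?W \<in> sets borel" using \<Omega>(1) by auto
    have mD: "(\<lambda>x. indicator ?D x * (q' x - c)\<^sup>2) \<in> borel_measurable borel"
      by (intro borel_measurable_times borel_measurable_indicator meas borel_measurable_power
          borel_measurable_diff q_meas borel_measurable_const)
    have mW: "(\<lambda>x. indicator ?W x * (norm (G' x))\<^sup>2) \<in> borel_measurable borel"
      by (intro borel_measurable_times borel_measurable_indicator meas borel_measurable_power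
          measurable_compose[OF G_meas borel_measurable_norm])
    have "(\<integral>x. indicator ?D x * (q' x - c)\<^sup>2 \<partial>lborel)
      \<le> measure lborel (cball (0 :: real^'n) (\<Lambda> * h)) / measure lborel (ball z h) * (\<Lambda> * h)\<^sup>2
        * (\<integral>x. indicator ?W x * (norm (G' x))\<^sup>2 \<partial>lborel)"
      unfolding c_def
    proof (rule Poincare_ball[OF open_D h(1) meas(2) _ z1 z2])
      show "?W \<subseteq> \<Omega>" by blast
      show "0 \<le> \<Lambda> * h" using h h0 by simp
    qed
    also have "measure lborel (cball (0 :: real^'n) (\<Lambda> * h)) / measure lborel (ball z h) = \<Lambda> ^ CARD('n)"
      using h h0 unit_ball_vol_pos[of "real CARD('n)"]
      by (simp add: content_cball content_ball power_mult_distrib less_imp_neq[THEN not_sym])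
    finally have main: "(\<integral>x. indicator ?D x * (q' x - c)\<^sup>2 \<partial>lborel)
      \<le> \<Lambda> ^ CARD('n) * (\<Lambda> * h)\<^sup>2 * (\<integral>x. indicator ?W x * (norm (G' x))\<^sup>2 \<partial>lborel)" .
    have int_D: "integrable lborel (\<lambda>x. indicator ?D x * (q' x - c)\<^sup>2)"
    proof (rule Bochner_Integration.integrable_bound)
      have "emeasure lborel ?D < \<infinity>"
        using \<Omega> by (intro emeasure_bounded_finite) (auto intro: bounded_subset)
      then show "integrable lborel (\<lambda>x. 2 * (q' x)\<^sup>2 + 2 * c\<^sup>2 * indicator ?D x)"
        using q_sq meas by (intro Bochner_Integration.integrable_add integrable_mult_right integrable_real_indicator) auto
      have "(s - t)\<^sup>2 \<le> 2 * s\<^sup>2 + 2 * t\<^sup>2" for s t :: real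
        using zero_le_power2[of "s + t"] by (simp add: power2_eq_square algebra_simps)
      then show "AE x in lborel. norm (indicator ?D x * (q' x - c)\<^sup>2) \<le> norm (2 * (q' x)\<^sup>2 + 2 * c\<^sup>2 * indicator ?D x)"
        by (intro AE_I2) (auto simp: indicator_def)
      show "(\<lambda>x. indicator ?D x * (q' x - c)\<^sup>2) \<in> borel_measurable lborel" using mD by simp
    qed
    have "(\<integral>x. indicator (cball a h) x * (q x - c)\<^sup>2 \<partial>lebesgue_on \<Omega>)
        = (\<integral>x. indicator \<Omega> x *\<^sub>R (indicator (cball a h) x * (q x - c)\<^sup>2) \<partial>lebesgue)"
      by (rule integral_lebesgue_on_eq[OF \<Omega>(1)])
    also have "\<dots> \<le> (\<integral>x. indicator ?D x * (q' x - c)\<^sup>2 \<partial>lebesgue)"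
    proof (rule integral_mono_AE')
      show "integrable lebesgue (\<lambda>x. indicator ?D x * (q' x - c)\<^sup>2)"
        using int_D mD by (subst integrable_completion) simp_all
      show "AE x in lebesgue. indicator \<Omega> x *\<^sub>R (indicator (cball a h) x * (q x - c)\<^sup>2) \<le> indicator ?D x * (q' x - c)\<^sup>2"
        using aeq
      proof eventually_elim
        case (elim x)
        show ?case unfolding elim[symmetric] using h(1) by (auto simp: indicator_def)
      qed
    qed auto
    also have "\<dots> = (\<integral>x. indicator ?D x * (q' x - c)\<^sup>2 \<partial>lborel)"
      using mD by (intro integral_completion) simp
    also note main
    also have "(\<integral>x. indicator ?W x * (norm (G' x))\<^sup>2 \<partial>lborel) = (\<integral>x. indicator ?W x * (norm (G' x))\<^sup>2 \<partial>lebesgue)"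
      using mW by (intro integral_completion[symmetric]) simp
    also have "\<dots> = (\<integral>x. indicator \<Omega> x *\<^sub>R (indicator (ball a (\<Lambda> * h)) x * (norm (G x))\<^sup>2) \<partial>lebesgue)"
    proof (rule integral_cong_AE)
      show "(\<lambda>x. indicator ?W x * (norm (G' x))\<^sup>2) \<in> borel_measurable lebesgue"
        using mW by (intro measurable_completion) simp
      have "(\<lambda>x. indicator (ball a (\<Lambda> * h)) x * (norm (G x))\<^sup>2) \<in> borel_measurable (lebesgue_on \<Omega>)"
      proof (rule borel_measurable_times)
        show "indicator (ball a (\<Lambda> * h)) \<in> borel_measurable (lebesgue_on \<Omega>)"
          by (intro measurable_restrict_space1 borel_measurable_indicator) simp
        show "(\<lambda>x. (norm (G x))\<^sup>2) \<in> borel_measurable (lebesgue_on \<Omega>)"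
          using G borel_measurable_integrable by (auto simp: L2_def)
      qed
      then show "(\<lambda>x. indicator \<Omega> x *\<^sub>R (indicator (ball a (\<Lambda> * h)) x * (norm (G x))\<^sup>2)) \<in> borel_measurable lebesgue"
        using L2_indicator_measurable[OF \<Omega>(1)] by simp
      show "AE x in lebesgue. indicator ?W x * (norm (G' x))\<^sup>2 = indicator \<Omega> x *\<^sub>R (indicator (ball a (\<Lambda> * h)) x * (norm (G x))\<^sup>2)"
        using aeG
      proof eventually_elim
        case (elim x)
        show ?case unfolding elim[symmetric] by (auto simp: indicator_def)
      qed
    qed
    also have "\<dots> = (\<integral>x. indicator (ball a (\<Lambda> * h)) x * (norm (G x))\<^sup>2 \<partial>lebesgue_on \<Omega>)"
      by (rule integral_lebesgue_on_eq[OF \<Omega>(1), symmetric])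
    finally show "\<exists>c. (\<integral>x. indicator (cball a h) x * (q x - c)\<^sup>2 \<partial>lebesgue_on \<Omega>)
         \<le> \<Lambda> ^ CARD('n) * (\<Lambda> * h)\<^sup>2 * (\<integral>x. indicator (ball a (\<Lambda> * h)) x * (norm (G x))\<^sup>2 \<partial>lebesgue_on \<Omega>)" by blast
  qed
qed

section \<open>The gradient of the L2 projection\<close>

text \<open>Measurability passes to almost everywhere equal functions because Lebesgue measure is
  complete. It is used for \<open>wgrad\<close>, which is known only up to null sets.\<close>

lemma borel_measurable_lebesgue_on_AE:
  fixes f g :: "real^'n \<Rightarrow> 'b::euclidean_space"
  assumes "open \<Omega>" "f \<in> borel_measurable (lebesgue_on \<Omega>)" "AE x in lebesgue_on \<Omega>. f x = g x"
  shows "g \<in> borel_measurable (lebesgue_on \<Omega>)"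
proof -
  have \<Omega>: "\<Omega> \<inter> space lebesgue \<in> sets lebesgue" using assms(1) by simp
  have "(\<lambda>x. indicator \<Omega> x *\<^sub>R f x) \<in> borel_measurable lebesgue"
    using assms(2) borel_measurable_restrict_space_iff[OF \<Omega>, of f] by simp
  moreover have "AE x in lebesgue. indicator \<Omega> x *\<^sub>R f x = indicator \<Omega> x *\<^sub>R g x"
    using assms(3)[unfolded AE_restrict_space_iff[OF \<Omega>]] by eventually_elim (auto simp: indicator_def)
  ultimately have "(\<lambda>x. indicator \<Omega> x *\<^sub>R g x) \<in> borel_measurable lebesgue"
    by (rule borel_measurable_AE)
  then show ?thesis using borel_measurable_restrict_space_iff[OF \<Omega>, of g] by simp
qed

lemma wgrad_H1:
  fixes \<Omega> :: "(real^'n) set"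
  assumes "open \<Omega>" "q \<in> H1 \<Omega>"
  shows "wgrad \<Omega> q \<in> L2 \<Omega>" "has_weak_gradient \<Omega> q (wgrad \<Omega> q)"
proof -
  obtain G where G: "G \<in> L2 \<Omega>" "has_weak_gradient \<Omega> q G" using assms(2) by (auto simp: H1_def)
  show "has_weak_gradient \<Omega> q (wgrad \<Omega> q)"
    unfolding wgrad_def by (rule someI[where P="has_weak_gradient \<Omega> q"]) (rule G)
  have ae: "AE x in lebesgue_on \<Omega>. wgrad \<Omega> q x = G x" by (rule wgrad_AE_eq[OF assms(1) G(2)])
  then have ae': "AE x in lebesgue_on \<Omega>. G x = wgrad \<Omega> q x" by eventually_elim simp
  have m: "wgrad \<Omega> q \<in> borel_measurable (lebesgue_on \<Omega>)"
    using G(1) by (intro borel_measurable_lebesgue_on_AE[OF assms(1) _ ae']) (simp add: L2_def)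
  have "integrable (lebesgue_on \<Omega>) (\<lambda>x. (norm (wgrad \<Omega> q x))\<^sup>2)"
  proof (rule integrable_cong_AE_imp)
    show "integrable (lebesgue_on \<Omega>) (\<lambda>x. (norm (G x))\<^sup>2)" using G(1) by (simp add: L2_def)
    show "(\<lambda>x. (norm (wgrad \<Omega> q x))\<^sup>2) \<in> borel_measurable (lebesgue_on \<Omega>)"
      by (intro borel_measurable_power measurable_compose[OF m borel_measurable_norm])
    show "AE x in lebesgue_on \<Omega>. (norm (G x))\<^sup>2 = (norm (wgrad \<Omega> q x))\<^sup>2"
      using ae' by eventually_elim simp
  qed
  with m show "wgrad \<Omega> q \<in> L2 \<Omega>" by (simp add: L2_def)
qed

lemma integrable_borel_indicator_mult:
  fixes f :: "real^'n \<Rightarrow> real"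
  assumes f: "integrable (lebesgue_on \<Omega>) f" and S: "S \<in> sets borel"
  shows "integrable (lebesgue_on \<Omega>) (\<lambda>x. indicator S x * f x)"
proof (rule Bochner_Integration.integrable_bound[OF f])
  have "indicat_real S \<in> borel_measurable (lebesgue_on \<Omega>)"
    using S by (intro measurable_restrict_space1 borel_measurable_indicator) simp
  then show "(\<lambda>x. indicator S x * f x) \<in> borel_measurable (lebesgue_on \<Omega>)"
    using borel_measurable_integrable[OF f] by (rule borel_measurable_times)
qed (auto simp: indicator_def)

lemma three_square: "(x + y + z)\<^sup>2 \<le> 3 * (x\<^sup>2 + y\<^sup>2 + z\<^sup>2)" for x y z :: real
proof -
  have "0 \<le> (x - y)\<^sup>2 + (y - z)\<^sup>2 + (x - z)\<^sup>2" by simp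
  then show ?thesis by (simp add: power2_eq_square algebra_simps)
qed

lemma two_square: "(x + y)\<^sup>2 \<le> 2 * (x\<^sup>2 + y\<^sup>2)" for x y :: real
  using zero_le_power2[of "x - y"] by (simp add: power2_eq_square algebra_simps)

definition mass_const :: "nat \<Rightarrow> real" where
  "mass_const n = real (n + 1) * (4 * 4 ^ n)"

lemma mass_const_nonneg: "mass_const n \<ge> 0"
  by (simp add: mass_const_def)

context fem
begin

lemma indicator_mesh_integrable: "K \<in> \<T> \<Longrightarrow> integrable (lebesgue_on \<Omega>) (indicat_real K)"
  using compact_mesh[of K]
  by (intro integrable_bounded_dom[where B=1] borel_measurable_indicator) (auto intro: borel_compact simp: indicator_def)

lemma AE_indicator_dom_on: "AE x in lebesgue_on \<Omega>. (\<Sum>K\<in>\<T>. indicat_real K x) = 1"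
proof -
  have "AE x in lebesgue. x \<in> \<Omega> \<longrightarrow> (\<Sum>K\<in>\<T>. indicat_real K x) = 1"
    using AE_indicator_dom
  proof eventually_elim
    case (elim x)
    then show ?case by (metis indicator_simps(1))
  qed
  then show ?thesis using open_dom by (subst AE_restrict_space_iff) auto
qed

lemma vol_eq_integral:
  assumes "K \<in> \<T>" shows "vol K = (\<integral>x. indicator K x \<partial>lebesgue_on \<Omega>)"
proof -
  have "(\<integral>x. indicat_real K x \<partial>lebesgue_on \<Omega>) = (\<integral>x. indicator \<Omega> x *\<^sub>R indicat_real K x \<partial>lebesgue)"
    by (rule integral_lebesgue_on_eq[OF open_dom])
  also have "\<dots> = (\<integral>x. indicat_real K x \<partial>lebesgue)"
  proof (rule integral_cong_AE)
    have K: "K \<in> sets lebesgue" using lmeasurable_mesh[OF assms] by (rule fmeasurableD)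
    show "(\<lambda>x. indicator \<Omega> x *\<^sub>R indicat_real K x) \<in> borel_measurable lebesgue"
      using K open_dom by (intro borel_measurable_scaleR borel_measurable_indicator) auto
    show "indicat_real K \<in> borel_measurable lebesgue" using K by (rule borel_measurable_indicator)
    show "AE x in lebesgue. indicator \<Omega> x *\<^sub>R indicat_real K x = indicat_real K x"
      using AE_completion[OF AE_interior]
    proof eventually_elim
      case (elim x)
      have "x \<in> \<Omega>" if "x \<in> K"
      proof -
        have "x \<in> closure \<Omega>" using that assms Union_mesh by blast
        then show ?thesis using elim interior_eq[of \<Omega>] open_dom by (auto simp: frontier_def)
      qed
      then show ?case by (auto simp: indicator_def)
    qed
  qed
  finally show ?thesis by (simp add: vol_def)
qed

lemma const_L2: "(\<lambda>x. c :: real) \<in> L2 \<Omega>"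
  unfolding L2_def using integrable_bounded_dom[of "\<lambda>x. (norm c)\<^sup>2" "(norm c)\<^sup>2"] by simp

lemma square_diff_const_integrable:
  fixes q :: "real^'n \<Rightarrow> real"
  assumes "q \<in> L2 \<Omega>"
  shows "integrable (lebesgue_on \<Omega>) (\<lambda>x. (q x - c)\<^sup>2)"
  using L2_add[OF assms const_L2[of "- c"]] by (simp add: L2_def)

end

section \<open>Comparison of the projection with local constants\<close>

context shaped_fem
begin

text \<open>The balls overlap and are counted with multiplicity; by the node count this costs only a
  bounded factor.\<close>

definition patch_error :: "(real^'n \<Rightarrow> real) \<Rightarrow> (real^'n \<Rightarrow> real) \<Rightarrow> real" where
  "patch_error q c = (\<Sum>a\<in>nodes \<T>. \<integral>x. indicator (cball a h) x * (q x - c a)\<^sup>2 \<partial>lebesgue_on \<Omega>)"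

lemma patch_error_integral:
  assumes q: "q \<in> L2 \<Omega>"
  shows "integrable (lebesgue_on \<Omega>) (\<lambda>x. \<Sum>a\<in>nodes \<T>. indicator (cball a h) x * (q x - c a)\<^sup>2)"
    and "patch_error q c = (\<integral>x. (\<Sum>a\<in>nodes \<T>. indicator (cball a h) x * (q x - c a)\<^sup>2) \<partial>lebesgue_on \<Omega>)"
proof -
  have i: "integrable (lebesgue_on \<Omega>) (\<lambda>x. indicator (cball a h) x * (q x - c a)\<^sup>2)" for a
    by (intro integrable_borel_indicator_mult square_diff_const_integrable[OF q]) simp
  show "integrable (lebesgue_on \<Omega>) (\<lambda>x. \<Sum>a\<in>nodes \<T>. indicator (cball a h) x * (q x - c a)\<^sup>2)"
    using i by (rule Bochner_Integration.integrable_sum)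
  show "patch_error q c = (\<integral>x. (\<Sum>a\<in>nodes \<T>. indicator (cball a h) x * (q x - c a)\<^sup>2) \<partial>lebesgue_on \<Omega>)"
    unfolding patch_error_def using i by (intro Bochner_Integration.integral_sum[symmetric])
qed

text \<open>At \<open>x\<close> the error is the convex combination of the numbers
  \<open>q x - I a\<close> under the nodal basis, and only nodes within distance \<open>h\<close>
  have weight.\<close>

lemma interpolant_error:
  assumes q: "q \<in> L2 \<Omega>" and I: "I \<in> X_h \<T>"
  shows "l2_inner \<Omega> (\<lambda>x. q x - I x) (\<lambda>x. q x - I x) \<le> patch_error q I"
  unfolding l2_inner_def patch_error_integral(2)[OF q]
proof (rule integral_mono_AE)
  have "(\<lambda>x. q x + (- 1) * I x) \<in> L2 \<Omega>"
    by (intro L2_add[OF q] X_h_L2 X_h_cmult I)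
  then show "integrable (lebesgue_on \<Omega>) (\<lambda>x. (q x - I x) \<bullet> (q x - I x))"
    using L2_inner_integrable[of "\<lambda>x. q x - I x" \<Omega> "\<lambda>x. q x - I x"] by simp
  show "integrable (lebesgue_on \<Omega>) (\<lambda>x. \<Sum>a\<in>nodes \<T>. indicator (cball a h) x * (q x - I a)\<^sup>2)"
    by (rule patch_error_integral(1)[OF q])
  show "AE x in lebesgue_on \<Omega>. (q x - I x) \<bullet> (q x - I x) \<le> (\<Sum>a\<in>nodes \<T>. indicator (cball a h) x * (q x - I a)\<^sup>2)"
  proof (rule AE_I2)
    fix x assume "x \<in> space (lebesgue_on \<Omega>)"
    then have "x \<in> \<Union>\<T>" using Union_mesh closure_subset by auto
    then obtain K where K: "K \<in> \<T>" "x \<in> K" by blast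
    let ?\<phi> = "\<lambda>a. nodal_basis \<T> a x"
    have "q x - I x = (\<Sum>a\<in>nodes \<T>. ?\<phi> a * (q x - I a))"
      using nodal_basis_sum(1)[OF K] X_h_expand[OF I, of x]
      by (simp add: algebra_simps sum_subtractf flip: sum_distrib_left)
    then have "(q x - I x)\<^sup>2 \<le> (\<Sum>a\<in>nodes \<T>. ?\<phi> a * (q x - I a)\<^sup>2)"
      using convex_combination_square[OF finite_nodes, of ?\<phi> "\<lambda>a. q x - I a"] nodal_basis_nonneg nodal_basis_sum(1)[OF K] by simp
    also have "\<dots> \<le> (\<Sum>a\<in>nodes \<T>. indicator (cball a h) x * (q x - I a)\<^sup>2)"
    proof (intro sum_mono mult_right_mono)
      fix a assume a: "a \<in> nodes \<T>"
      show "?\<phi> a \<le> indicator (cball a h) x"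
      proof (cases "?\<phi> a = 0")
        case False
        then have "x \<in> cball a h" using nodal_basis_support_cball[OF a] by (simp add: dist_norm norm_minus_commute[of a])
        then show ?thesis using nodal_basis_le_1[OF a] by simp
      qed simp
    qed simp
    finally show "(q x - I x) \<bullet> (q x - I x) \<le> (\<Sum>a\<in>nodes \<T>. indicator (cball a h) x * (q x - I a)\<^sup>2)"
      by (simp add: power2_eq_square)
  qed
qed

text \<open>Two nodal values of one simplex are compared through \<open>q x\<close> at the points
  \<open>x\<close> of that simplex, which lie in the balls around both nodes.\<close>

lemma osc_patch_error:
  assumes q: "q \<in> L2 \<Omega>"
  shows "osc c \<le> 4 * real (CARD('n) + 1) * patch_error q c"
proof -
  let ?n = "real (CARD('n) + 1)"
  let ?S = "\<lambda>x. \<Sum>a\<in>nodes \<T>. indicator (cball a h) x * (q x - c a)\<^sup>2"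
  let ?s = "\<lambda>K. \<Sum>a\<in>verts K. \<Sum>b\<in>verts K. (norm (c a - c b))\<^sup>2"
  have "osc c = (\<Sum>K\<in>\<T>. \<integral>x. indicator K x * ?s K \<partial>lebesgue_on \<Omega>)"
    unfolding osc_def by (intro sum.cong refl) (simp add: vol_eq_integral)
  also have "\<dots> = (\<integral>x. (\<Sum>K\<in>\<T>. indicator K x * ?s K) \<partial>lebesgue_on \<Omega>)"
    using indicator_mesh_integrable by (intro Bochner_Integration.integral_sum[symmetric] integrable_mult_left) auto
  also have "\<dots> \<le> (\<integral>x. (4 * ?n) * ?S x \<partial>lebesgue_on \<Omega>)"
  proof (rule integral_mono_AE)
    show "integrable (lebesgue_on \<Omega>) (\<lambda>x. \<Sum>K\<in>\<T>. indicator K x * ?s K)"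
      using indicator_mesh_integrable by (intro Bochner_Integration.integrable_sum integrable_mult_left) auto
    show "integrable (lebesgue_on \<Omega>) (\<lambda>x. (4 * ?n) * ?S x)"
      by (intro integrable_mult_right patch_error_integral(1)[OF q])
    show "AE x in lebesgue_on \<Omega>. (\<Sum>K\<in>\<T>. indicator K x * ?s K) \<le> (4 * ?n) * ?S x"
      using AE_indicator_dom_on
    proof eventually_elim
      case (elim x)
      have S0: "0 \<le> ?S x" by (intro sum_nonneg) auto
      have "?s K \<le> (4 * ?n) * ?S x" if K: "K \<in> \<T>" "x \<in> K" for K
      proof -
        have "(norm (c a - c b))\<^sup>2 \<le> 2 * (q x - c a)\<^sup>2 + 2 * (q x - c b)\<^sup>2" for a b
          using two_square[of "c a - q x" "q x - c b"] by (simp add: power2_commute[of "c a"])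
        then have "?s K \<le> (\<Sum>a\<in>verts K. \<Sum>b\<in>verts K. 2 * (q x - c a)\<^sup>2 + 2 * (q x - c b)\<^sup>2)"
          by (intro sum_mono)
        also have "\<dots> = 4 * ?n * (\<Sum>a\<in>verts K. (q x - c a)\<^sup>2)"
          using simplex_verts(3)[OF K(1)] by (simp add: sum.distrib algebra_simps flip: sum_distrib_left)
        also have "(\<Sum>a\<in>verts K. (q x - c a)\<^sup>2) = (\<Sum>a\<in>verts K. indicator (cball a h) x * (q x - c a)\<^sup>2)"
        proof (rule sum.cong[OF refl])
          fix a assume "a \<in> verts K"
          then have "x \<in> cball a h" using elem_subset_cball[OF K(1) verts_in] K(2) by blast
          then show "(q x - c a)\<^sup>2 = indicator (cball a h) x * (q x - c a)\<^sup>2" by simp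
        qed
        also have "\<dots> \<le> ?S x"
          using finite_nodes verts_node[OF K(1)] by (intro sum_mono2) auto
        finally show ?thesis by simp
      qed
      then have "(\<Sum>K\<in>\<T>. indicator K x * ?s K) \<le> (\<Sum>K\<in>\<T>. indicator K x * ((4 * ?n) * ?S x))"
        by (intro sum_mono) (simp add: indicator_def)
      also have "\<dots> = (4 * ?n) * ?S x" using elim by (simp flip: sum_distrib_right)
      finally show ?case .
    qed
  qed
  also have "\<dots> = 4 * ?n * patch_error q c" unfolding patch_error_integral(2)[OF q] by simp
  finally show ?thesis .
qed

lemma osc_node_sum:
  fixes x :: "real^'n \<Rightarrow> real"
  shows "(\<Sum>K\<in>\<T>. vol K * (\<Sum>a\<in>verts K. \<Sum>b\<in>verts K. (x a)\<^sup>2 + (x b)\<^sup>2)) = 2 * real (CARD('n) + 1) * (\<Sum>a\<in>nodes \<T>. node_mass a * (x a)\<^sup>2)"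
proof -
  have "(\<Sum>a\<in>verts K. \<Sum>b\<in>verts K. (x a)\<^sup>2 + (x b)\<^sup>2) = 2 * real (CARD('n) + 1) * (\<Sum>a\<in>verts K. (x a)\<^sup>2)" if "K \<in> \<T>" for K
    using simplex_verts(3)[OF that] by (simp add: sum.distrib algebra_simps flip: sum_distrib_left)
  then have "(\<Sum>K\<in>\<T>. vol K * (\<Sum>a\<in>verts K. \<Sum>b\<in>verts K. (x a)\<^sup>2 + (x b)\<^sup>2))
      = (\<Sum>K\<in>\<T>. 2 * real (CARD('n) + 1) * (vol K * (\<Sum>a\<in>verts K. (x a)\<^sup>2)))"
    by (intro sum.cong) auto
  also have "\<dots> = 2 * real (CARD('n) + 1) * (\<Sum>K\<in>\<T>. vol K * (\<Sum>a\<in>verts K. (x a)\<^sup>2))"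
    by (rule sum_distrib_left[symmetric])
  finally show ?thesis by (simp only: sum_verts_eq)
qed

text \<open>Let \<open>I\<close> interpolate the constants. By orthogonality the L2 norm of
  \<open>e = p - I\<close> is at most that of \<open>q - I\<close>. Oscillations of \<open>e\<close>
  are bounded by its nodal values and so by its L2 norm; no negative power of \<open>h\<close>
  appears, since \<open>osc\<close> already carries the factor h^2.\<close>

lemma projection_osc:
  assumes q: "q \<in> L2 \<Omega>" and p: "p \<in> X_h \<T>" and proj: "\<And>w. w \<in> X_h \<T> \<Longrightarrow> l2_inner \<Omega> w q = l2_inner \<Omega> w p"
  shows "osc p \<le> 6 * real (CARD('n) + 1) * (mass_const CARD('n) + 2) * patch_error q c"
proof -
  let ?n = "real (CARD('n) + 1)"
  obtain I where I: "I \<in> X_h \<T>" "\<And>a. a \<in> nodes \<T> \<Longrightarrow> I a = c a" using X_h_exists[of c] by blast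
  have pe: "patch_error q I = patch_error q c" unfolding patch_error_def using I(2) by simp
  have oscI: "osc I = osc c"
    unfolding osc_def using I(2) verts_node by (intro sum.cong refl arg_cong2[where f="(*)"]) auto
  define e where "e x = p x - I x" for x
  have e: "e \<in> X_h \<T>" using X_h_add[OF p X_h_cmult[OF I(1), of "-1"]] by (simp add: e_def[abs_def])
  have L2: "p \<in> L2 \<Omega>" "I \<in> L2 \<Omega>" "e \<in> L2 \<Omega>" using p I(1) e X_h_L2 by auto
  have r: "(\<lambda>x. q x - I x) \<in> L2 \<Omega>" using L2_add[OF q L2_cmult[OF L2(2), of "-1"]] by simp
  have "l2_inner \<Omega> e e = l2_inner \<Omega> p e - l2_inner \<Omega> I e"
    using l2_inner_diff_left[OF L2] by (simp add: e_def[abs_def])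
  also have "l2_inner \<Omega> p e = l2_inner \<Omega> q e" using proj[OF e] by (simp only: l2_inner_commute)
  also have "l2_inner \<Omega> q e - l2_inner \<Omega> I e = l2_inner \<Omega> (\<lambda>x. q x - I x) e"
    using l2_inner_diff_left[OF q L2(2,3)] by simp
  also have "\<dots> \<le> l2_norm \<Omega> (\<lambda>x. q x - I x) * l2_norm \<Omega> e"
    using l2_Cauchy_Schwarz[OF r L2(3)] by linarith
  finally have "l2_norm \<Omega> e * l2_norm \<Omega> e \<le> l2_norm \<Omega> (\<lambda>x. q x - I x) * l2_norm \<Omega> e"
    by (simp only: l2_norm_square[symmetric] power2_eq_square)
  then have "l2_norm \<Omega> e \<le> l2_norm \<Omega> (\<lambda>x. q x - I x)"
    using l2_norm_nonneg[of \<Omega> e] l2_norm_nonneg[of \<Omega> "\<lambda>x. q x - I x"]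
    by (cases "l2_norm \<Omega> e = 0") (auto simp: mult_le_cancel_right)
  then have "(l2_norm \<Omega> e)\<^sup>2 \<le> (l2_norm \<Omega> (\<lambda>x. q x - I x))\<^sup>2"
    by (intro power_mono l2_norm_nonneg)
  also have "\<dots> \<le> patch_error q I" unfolding l2_norm_square by (rule interpolant_error[OF q I(1)])
  finally have ee: "l2_inner \<Omega> e e \<le> patch_error q c" by (simp only: l2_norm_square pe)
  have "(\<Sum>a\<in>nodes \<T>. node_mass a * (e a)\<^sup>2) \<le> mass_const CARD('n) * l2_inner \<Omega> e e"
    using mass_lower[OF e] by (simp add: mass_const_def)
  also have "\<dots> \<le> mass_const CARD('n) * patch_error q c" using ee mass_const_nonneg by (rule mult_left_mono)
  finally have mass: "(\<Sum>a\<in>nodes \<T>. node_mass a * (e a)\<^sup>2) \<le> mass_const CARD('n) * patch_error q c" .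
  have "osc p \<le> (\<Sum>K\<in>\<T>. vol K * (\<Sum>a\<in>verts K. \<Sum>b\<in>verts K. 3 * ((e a)\<^sup>2 + (e b)\<^sup>2) + 3 * (norm (I a - I b))\<^sup>2))"
    unfolding osc_def
  proof (intro sum_mono mult_left_mono vol_nonneg)
    fix a b
    have "(norm (p a - p b))\<^sup>2 = (e a + (I a - I b) + - e b)\<^sup>2" by (simp add: e_def)
    also have "\<dots> \<le> 3 * ((e a)\<^sup>2 + (I a - I b)\<^sup>2 + (- e b)\<^sup>2)" by (rule three_square)
    finally show "(norm (p a - p b))\<^sup>2 \<le> 3 * ((e a)\<^sup>2 + (e b)\<^sup>2) + 3 * (norm (I a - I b))\<^sup>2" by simp
  qed
  also have "\<dots> = 3 * (\<Sum>K\<in>\<T>. vol K * (\<Sum>a\<in>verts K. \<Sum>b\<in>verts K. (e a)\<^sup>2 + (e b)\<^sup>2)) + 3 * osc I"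
    unfolding osc_def sum.distrib[of "\<lambda>b. 3 * _ b"] 
    by (simp add: sum.distrib sum_distrib_left algebra_simps)
  also have "\<dots> = 6 * ?n * (\<Sum>a\<in>nodes \<T>. node_mass a * (e a)\<^sup>2) + 3 * osc c"
    unfolding osc_node_sum oscI by simp
  also have "\<dots> \<le> 6 * ?n * (mass_const CARD('n) * patch_error q c) + 3 * (4 * ?n * patch_error q c)"
    using mass osc_patch_error[OF q, of c] by (intro add_mono mult_left_mono) auto
  also have "\<dots> = 6 * ?n * (mass_const CARD('n) + 2) * patch_error q c" by (simp add: algebra_simps)
  finally show ?thesis .
qed

text \<open>By the node count a point lies in boundedly many of the enlarged balls, so the local
  gradient integrals add up to a multiple of the global one.\<close>

lemma patch_error_le:
  assumes G: "G \<in> L2 \<Omega>" and \<Lambda>: "\<Lambda> \<ge> 0" and B: "B \<ge> 0"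
    and c: "\<And>a. a \<in> nodes \<T> \<Longrightarrow> (\<integral>x. indicator (cball a h) x * (q x - c a)\<^sup>2 \<partial>lebesgue_on \<Omega>)
         \<le> B * (\<integral>x. indicator (ball a (\<Lambda> * h)) x * (norm (G x))\<^sup>2 \<partial>lebesgue_on \<Omega>)"
  shows "patch_error q c \<le> B * (real (CARD('n) + 1) * ((\<Lambda> + 1) / \<rho>) ^ CARD('n)) * l2_inner \<Omega> G G"
proof -
  let ?P = "real (CARD('n) + 1) * ((\<Lambda> + 1) / \<rho>) ^ CARD('n)"
  have G2: "integrable (lebesgue_on \<Omega>) (\<lambda>x. (norm (G x))\<^sup>2)" using G by (simp add: L2_def)
  have i: "integrable (lebesgue_on \<Omega>) (\<lambda>x. indicator (ball a (\<Lambda> * h)) x * (norm (G x))\<^sup>2)" for a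
    by (intro integrable_borel_indicator_mult G2) simp
  have "patch_error q c \<le> (\<Sum>a\<in>nodes \<T>. B * (\<integral>x. indicator (ball a (\<Lambda> * h)) x * (norm (G x))\<^sup>2 \<partial>lebesgue_on \<Omega>))"
    unfolding patch_error_def by (intro sum_mono c)
  also have "\<dots> = B * (\<integral>x. (\<Sum>a\<in>nodes \<T>. indicator (ball a (\<Lambda> * h)) x * (norm (G x))\<^sup>2) \<partial>lebesgue_on \<Omega>)"
    using i by (simp add: Bochner_Integration.integral_sum sum_distrib_left)
  also have "\<dots> \<le> B * (\<integral>x. ?P * (norm (G x))\<^sup>2 \<partial>lebesgue_on \<Omega>)"
  proof (intro mult_left_mono integral_mono B)
    show "integrable (lebesgue_on \<Omega>) (\<lambda>x. \<Sum>a\<in>nodes \<T>. indicator (ball a (\<Lambda> * h)) x * (norm (G x))\<^sup>2)"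
      using i by (rule Bochner_Integration.integrable_sum)
    show "integrable (lebesgue_on \<Omega>) (\<lambda>x. ?P * (norm (G x))\<^sup>2)" using G2 by (rule integrable_mult_right)
    fix x
    have "(\<Sum>a\<in>nodes \<T>. indicat_real (ball a (\<Lambda> * h)) x) \<le> (\<Sum>a\<in>{a\<in>nodes \<T>. norm (a - x) \<le> \<Lambda> * h}. 1)"
      using finite_nodes
      by (subst sum.mono_neutral_right[of _ "{a\<in>nodes \<T>. norm (a - x) \<le> \<Lambda> * h}"])
         (auto simp: dist_norm indicator_def intro!: card_mono)
    also have "\<dots> \<le> ?P" using card_nodes_cball[OF \<Lambda>, of x] by simp
    finally have "(\<Sum>a\<in>nodes \<T>. indicat_real (ball a (\<Lambda> * h)) x) * (norm (G x))\<^sup>2 \<le> ?P * (norm (G x))\<^sup>2"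
      by (rule mult_right_mono) simp
    then show "(\<Sum>a\<in>nodes \<T>. indicator (ball a (\<Lambda> * h)) x * (norm (G x))\<^sup>2) \<le> ?P * (norm (G x))\<^sup>2"
      by (simp only: sum_distrib_right)
  qed
  also have "\<dots> = B * ?P * l2_inner \<Omega> G G" by (simp add: l2_inner_def power2_norm_eq_inner)
  finally show ?thesis .
qed

text \<open>A bound without gradients, for meshes too coarse for the Poincare patches.\<close>

lemma osc_bounded:
  fixes p :: "real^'n \<Rightarrow> real"
  assumes "\<And>a. a \<in> nodes \<T> \<Longrightarrow> \<bar>p a\<bar> \<le> m"
  shows "osc p \<le> measure lebesgue (closure \<Omega>) * (real (CARD('n) + 1))\<^sup>2 * (4 * m\<^sup>2)"
proof -
  let ?n = "real (CARD('n) + 1)"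
  have "osc p \<le> (\<Sum>K\<in>\<T>. vol K * (?n\<^sup>2 * (4 * m\<^sup>2)))"
    unfolding osc_def
  proof (intro sum_mono mult_left_mono vol_nonneg)
    fix K assume K: "K \<in> \<T>"
    have "(\<Sum>a\<in>verts K. \<Sum>b\<in>verts K. (norm (p a - p b))\<^sup>2) \<le> (\<Sum>a\<in>verts K. \<Sum>b\<in>verts K. 4 * m\<^sup>2)"
    proof (intro sum_mono)
      fix a b assume ab: "a \<in> verts K" "b \<in> verts K"
      have "\<bar>p a - p b\<bar> \<le> 2 * m"
        using assms[OF verts_node[OF K ab(1)]] assms[OF verts_node[OF K ab(2)]] by linarith
      then have "\<bar>p a - p b\<bar>\<^sup>2 \<le> (2 * m)\<^sup>2" by (intro power_mono) auto
      then show "(norm (p a - p b))\<^sup>2 \<le> 4 * m\<^sup>2" by (simp add: power_mult_distrib)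
    qed
    also have "\<dots> = ?n\<^sup>2 * (4 * m\<^sup>2)" using simplex_verts(3)[OF K] by (simp add: power2_eq_square)
    finally show "(\<Sum>a\<in>verts K. \<Sum>b\<in>verts K. (norm (p a - p b))\<^sup>2) \<le> ?n\<^sup>2 * (4 * m\<^sup>2)" .
  qed
  also have "\<dots> = (\<Sum>K\<in>{K\<in>\<T>. K \<subseteq> closure \<Omega>}. vol K) * (?n\<^sup>2 * (4 * m\<^sup>2))"
  proof -
    have "{K\<in>\<T>. K \<subseteq> closure \<Omega>} = \<T>" using Union_mesh by blast
    then show ?thesis by (simp only: sum_distrib_right)
  qed
  also have "\<dots> \<le> measure lebesgue (closure \<Omega>) * (?n\<^sup>2 * (4 * m\<^sup>2))"
    using bounded_dom by (intro mult_right_mono sum_vol_le) (auto intro!: lmeasurable_compact)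
  finally show ?thesis by (simp add: mult.assoc)
qed

text \<open>Discrete product rule: \<open>w a - w b\<close> splits into
  \<open>(p a - p b) *\<^sub>R u a\<close> and \<open>p b *\<^sub>R (u a - u b)\<close>.\<close>

lemma osc_product:
  fixes u w :: "real^'n \<Rightarrow> real^'n"
  assumes u: "\<And>a. a \<in> nodes \<T> \<Longrightarrow> norm (u a) \<le> 1" and m: "\<And>a. a \<in> nodes \<T> \<Longrightarrow> \<bar>p a\<bar> \<le> m"
    and w: "\<And>a. a \<in> nodes \<T> \<Longrightarrow> w a = p a *\<^sub>R u a"
  shows "osc w \<le> 2 * osc p + 2 * m\<^sup>2 * osc u"
proof -
  have "osc w \<le> (\<Sum>K\<in>\<T>. vol K * (\<Sum>a\<in>verts K. \<Sum>b\<in>verts K. 2 * (norm (p a - p b))\<^sup>2 + 2 * m\<^sup>2 * (norm (u a - u b))\<^sup>2))"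
    unfolding osc_def
  proof (intro sum_mono mult_left_mono vol_nonneg)
    fix K a b assume K: "K \<in> \<T>" and ab: "a \<in> verts K" "b \<in> verts K"
    have n: "a \<in> nodes \<T>" "b \<in> nodes \<T>" using verts_node[OF K] ab by auto
    have "w a - w b = (p a - p b) *\<^sub>R u a + p b *\<^sub>R (u a - u b)"
      using w n by (simp add: algebra_simps)
    then have "norm (w a - w b) \<le> \<bar>p a - p b\<bar> * norm (u a) + \<bar>p b\<bar> * norm (u a - u b)"
      by (metis norm_scaleR norm_triangle_ineq)
    also have "\<dots> \<le> \<bar>p a - p b\<bar> * 1 + m * norm (u a - u b)"
      using u[OF n(1)] m[OF n(2)] by (intro add_mono mult_mono) auto
    finally have "(norm (w a - w b))\<^sup>2 \<le> (\<bar>p a - p b\<bar> + m * norm (u a - u b))\<^sup>2"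
      by (intro power_mono) auto
    also have "\<dots> \<le> 2 * (\<bar>p a - p b\<bar>\<^sup>2 + (m * norm (u a - u b))\<^sup>2)" by (rule two_square)
    finally show "(norm (w a - w b))\<^sup>2 \<le> 2 * (norm (p a - p b))\<^sup>2 + 2 * m\<^sup>2 * (norm (u a - u b))\<^sup>2"
      by (simp add: power_mult_distrib)
  qed
  also have "\<dots> = 2 * osc p + 2 * m\<^sup>2 * osc u"
    unfolding osc_def by (simp add: sum.distrib sum_distrib_left algebra_simps)
  finally show ?thesis .
qed

end

section \<open>The scheme\<close>

lemma cross_axes_inner:
  fixes e :: "3 \<Rightarrow> 'n::finite" and v w y :: "real^'n"
  assumes "bij e"
  shows "cross_axes e v w \<bullet> y = cross3 (\<chi> j. v $ e j) (\<chi> j. w $ e j) \<bullet> (\<chi> j. y $ e j)"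
proof -
  let ?c = "cross3 (\<chi> j. v $ e j) (\<chi> j. w $ e j)"
  have "cross_axes e v w \<bullet> y = (\<Sum>i\<in>UNIV. ?c $ inv e i * y $ i)"
    by (simp add: cross_axes_def inner_vec_def)
  also have "\<dots> = (\<Sum>j\<in>UNIV. ?c $ inv e (e j) * y $ e j)"
    by (rule sum.reindex_bij_betw[OF assms, symmetric])
  also have "\<dots> = ?c \<bullet> (\<chi> j. y $ e j)"
    using assms by (simp add: inner_vec_def bij_is_inj)
  finally show ?thesis .
qed

lemma cross_axes_orthogonal:
  fixes e :: "3 \<Rightarrow> 'n::finite" and v w :: "real^'n"
  assumes "bij e"
  shows "cross_axes e v w \<bullet> v = 0" "cross_axes e v w \<bullet> w = 0"
  unfolding cross_axes_inner[OF assms] by (simp_all add: dot_cross_self)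

context mesh
begin

lemma U_h_diff_scaled:
  assumes "v \<in> U_h \<T>" "w \<in> U_h \<T>" shows "(\<lambda>x. v x + r *\<^sub>R w x) \<in> U_h \<T>"
  using X_h_add[OF U_h_nth[OF assms(1)] X_h_cmult[OF U_h_nth[OF assms(2)]]] by (simp add: U_h_def)

lemma U_h_scaleR: "v \<in> U_h \<T> \<Longrightarrow> (\<lambda>x. r *\<^sub>R v x) \<in> U_h \<T>"
  using X_h_cmult[OF U_h_nth] by (simp add: U_h_def)

lemma lumped_inner_zero:
  assumes "\<And>a. a \<in> nodes \<T> \<Longrightarrow> v a \<bullet> w a = 0"
  shows "lumped_inner \<Omega> \<T> v w = 0"
  using nodal_interp_zero[of "\<lambda>y. v y \<bullet> w y", OF assms] by (simp add: lumped_inner_def)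

lemma lumped_norm_square: "(lumped_norm \<Omega> \<T> v)\<^sup>2 = lumped_inner \<Omega> \<T> v v"
proof -
  have "0 \<le> lumped_inner \<Omega> \<T> v v"
    unfolding lumped_inner_def nodal_interp_def
    by (intro integral_nonneg_AE AE_I2 sum_nonneg) (simp add: nodal_basis_nonneg)
  then show ?thesis by (simp add: lumped_norm_def)
qed

end

section \<open>The gradient form of vector fields\<close>

context fem
begin

lemma wgrad_X_h_L2: "v \<in> X_h \<T> \<Longrightarrow> wgrad \<Omega> v \<in> L2 \<Omega>"
  using X_h_L2 pw_grad_L2 X_h_has_weak_gradient by (intro wgrad_H1(1)[OF open_dom]) (auto simp: H1_def)

text \<open>Built from the elementwise gradients, so that the algebra of the scheme is carried out
  on constants per simplex and not on the chosen representative in \<open>wgrad\<close>.\<close>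

definition grad_form :: "(real^'n \<Rightarrow> real^'n) \<Rightarrow> (real^'n \<Rightarrow> real^'n) \<Rightarrow> real" where
  "grad_form v w = (\<Sum>i\<in>UNIV. l2_inner \<Omega> (pw_grad (\<lambda>x. v x $ i)) (pw_grad (\<lambda>x. w x $ i)))"

lemma l2_inner_wgrad_vec:
  assumes "v \<in> U_h \<T>" "w \<in> U_h \<T>"
  shows "l2_inner \<Omega> (wgrad_vec \<Omega> v) (wgrad_vec \<Omega> w) = grad_form v w"
proof -
  note L = wgrad_X_h_L2[OF U_h_nth[OF assms(1)]] wgrad_X_h_L2[OF U_h_nth[OF assms(2)]]
  have "l2_inner \<Omega> (wgrad_vec \<Omega> v) (wgrad_vec \<Omega> w)
      = (\<integral>x. (\<Sum>i\<in>UNIV. wgrad \<Omega> (\<lambda>y. v y $ i) x \<bullet> wgrad \<Omega> (\<lambda>y. w y $ i) x) \<partial>lebesgue_on \<Omega>)"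
    by (simp add: l2_inner_def wgrad_vec_def inner_vec_def)
  also have "\<dots> = (\<Sum>i\<in>UNIV. l2_inner \<Omega> (wgrad \<Omega> (\<lambda>y. v y $ i)) (wgrad \<Omega> (\<lambda>y. w y $ i)))"
    unfolding l2_inner_def by (intro Bochner_Integration.integral_sum L2_inner_integrable L)
  also have "\<dots> = grad_form v w"
    unfolding grad_form_def
  proof (rule sum.cong[OF refl])
    fix i
    show "l2_inner \<Omega> (wgrad \<Omega> (\<lambda>y. v y $ i)) (wgrad \<Omega> (\<lambda>y. w y $ i)) = l2_inner \<Omega> (pw_grad (\<lambda>x. v x $ i)) (pw_grad (\<lambda>x. w x $ i))"
    proof (rule l2_inner_cong_AE)
      show "wgrad \<Omega> (\<lambda>y. v y $ i) \<in> borel_measurable (lebesgue_on \<Omega>)" "wgrad \<Omega> (\<lambda>y. w y $ i) \<in> borel_measurable (lebesgue_on \<Omega>)"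
        using L by (simp_all add: L2_def)
      show "pw_grad (\<lambda>y. v y $ i) \<in> borel_measurable (lebesgue_on \<Omega>)" "pw_grad (\<lambda>y. w y $ i) \<in> borel_measurable (lebesgue_on \<Omega>)"
        using pw_grad_L2[of "\<lambda>y. v y $ i"] pw_grad_L2[of "\<lambda>y. w y $ i"] by (simp_all add: L2_def)
    qed (intro wgrad_X_h U_h_nth assms)+
  qed
  finally show ?thesis .
qed

lemma l2_norm_wgrad_vec: "v \<in> U_h \<T> \<Longrightarrow> (l2_norm \<Omega> (wgrad_vec \<Omega> v))\<^sup>2 = grad_form v v"
  by (simp add: l2_norm_square l2_inner_wgrad_vec)

text \<open>Cauchy-Schwarz in each component, then once more for the vectors of component
  norms.\<close>

lemma grad_form_Cauchy_Schwarz: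
  assumes "v \<in> U_h \<T>" "w \<in> U_h \<T>"
  shows "\<bar>grad_form v w\<bar> \<le> l2_norm \<Omega> (wgrad_vec \<Omega> v) * l2_norm \<Omega> (wgrad_vec \<Omega> w)"
proof -
  let ?g = "\<lambda>v i. l2_norm \<Omega> (pw_grad (\<lambda>x. v x $ i))"
  have L: "l2_norm \<Omega> (wgrad_vec \<Omega> v) = L2_set (?g v) UNIV" if "v \<in> U_h \<T>" for v
  proof -
    have "l2_norm \<Omega> (wgrad_vec \<Omega> v) = sqrt (grad_form v v)"
      by (simp add: l2_norm_def l2_inner_wgrad_vec that)
    then show ?thesis by (simp add: L2_set_def l2_norm_square grad_form_def)
  qed
  have "\<bar>grad_form v w\<bar> \<le> (\<Sum>i\<in>UNIV. \<bar>?g v i\<bar> * \<bar>?g w i\<bar>)"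
    unfolding grad_form_def
    using l2_Cauchy_Schwarz[OF pw_grad_L2 pw_grad_L2]
    by (intro order_trans[OF sum_abs] sum_mono) (simp add: l2_norm_nonneg)
  also have "\<dots> \<le> L2_set (?g v) UNIV * L2_set (?g w) UNIV" by (rule L2_set_mult_ineq)
  finally show ?thesis by (simp add: L assms)
qed

end

context shaped_fem
begin

text \<open>From the centre of the inscribed ball one can move within \<open>K\<close> in the
  direction of the difference of two slopes.\<close>

lemma elem_grad_unique:
  assumes v: "v \<in> X_h \<T>" and K: "K \<in> \<T>" and b: "\<And>x. x \<in> K \<Longrightarrow> v x = b \<bullet> x + c"
  shows "elem_grad v K = b"
proof (rule ccontr)
  assume ne: "elem_grad v K \<noteq> b"
  define d where "d = elem_grad v K - b"
  have d: "d \<noteq> 0" using ne by (simp add: d_def)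
  obtain z where z: "cball z (\<rho> * h) \<subseteq> K" using inball[OF K] by blast
  define y where "y = z + (\<rho> * h / norm d) *\<^sub>R d"
  have zy: "z \<in> K" "y \<in> K" using z h_pos \<rho>_pos d by (auto simp: y_def dist_norm subset_iff)
  have "elem_grad v K \<bullet> (y - z) = b \<bullet> (y - z)"
    using elem_grad_diff[OF v K zy(2,1)] b zy by (simp add: inner_diff_right)
  then have "d \<bullet> (y - z) = 0" by (simp add: d_def inner_diff_left)
  then show False using d h_pos \<rho>_pos by (simp add: y_def)
qed

lemma elem_grad_lin:
  assumes "v \<in> X_h \<T>" "w \<in> X_h \<T>" "K \<in> \<T>"
  shows "elem_grad (\<lambda>x. v x + r * w x) K = elem_grad v K + r *\<^sub>R elem_grad w K"
proof -
  obtain c where c: "\<And>x. x \<in> K \<Longrightarrow> v x = elem_grad v K \<bullet> x + c" using elem_grad[OF assms(1,3)] by blast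
  obtain c' where c': "\<And>x. x \<in> K \<Longrightarrow> w x = elem_grad w K \<bullet> x + c'" using elem_grad[OF assms(2,3)] by blast
  show ?thesis
    by (rule elem_grad_unique[OF X_h_add[OF assms(1) X_h_cmult[OF assms(2)]] assms(3), where c="c + r * c'"])
       (simp add: c c' inner_add_left algebra_simps)
qed

lemma grad_form_expand:
  assumes v: "v \<in> U_h \<T>" and w: "w \<in> U_h \<T>"
  shows "grad_form (\<lambda>x. v x + r *\<^sub>R w x) (\<lambda>x. v x + r *\<^sub>R w x)
    = grad_form v v + 2 * r * grad_form v w + r\<^sup>2 * grad_form w w"
proof -
  have "l2_inner \<Omega> (pw_grad (\<lambda>x. (v x + r *\<^sub>R w x) $ i)) (pw_grad (\<lambda>x. (v x + r *\<^sub>R w x) $ i))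
     = l2_inner \<Omega> (pw_grad (\<lambda>x. v x $ i)) (pw_grad (\<lambda>x. v x $ i))
       + 2 * r * l2_inner \<Omega> (pw_grad (\<lambda>x. v x $ i)) (pw_grad (\<lambda>x. w x $ i))
       + r\<^sup>2 * l2_inner \<Omega> (pw_grad (\<lambda>x. w x $ i)) (pw_grad (\<lambda>x. w x $ i))" for i
  proof -
    let ?a = "\<lambda>K. elem_grad (\<lambda>x. v x $ i) K" and ?b = "\<lambda>K. elem_grad (\<lambda>x. w x $ i) K"
    have "(\<Sum>K\<in>\<T>. vol K * (elem_grad (\<lambda>x. (v x + r *\<^sub>R w x) $ i) K \<bullet> elem_grad (\<lambda>x. (v x + r *\<^sub>R w x) $ i) K))
        = (\<Sum>K\<in>\<T>. vol K * (?a K \<bullet> ?a K) + 2 * r * (vol K * (?a K \<bullet> ?b K)) + r\<^sup>2 * (vol K * (?b K \<bullet> ?b K)))"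
    proof (rule sum.cong[OF refl])
      fix K assume K: "K \<in> \<T>"
      have eg: "elem_grad (\<lambda>x. (v x + r *\<^sub>R w x) $ i) K = ?a K + r *\<^sub>R ?b K"
        using elem_grad_lin[OF U_h_nth[OF v] U_h_nth[OF w] K, of i r i] by simp
      show "vol K * (elem_grad (\<lambda>x. (v x + r *\<^sub>R w x) $ i) K \<bullet> elem_grad (\<lambda>x. (v x + r *\<^sub>R w x) $ i) K)
        = vol K * (?a K \<bullet> ?a K) + 2 * r * (vol K * (?a K \<bullet> ?b K)) + r\<^sup>2 * (vol K * (?b K \<bullet> ?b K))"
        unfolding eg by (simp add: inner_add_left inner_add_right inner_commute[of "?b K" "?a K"] power2_eq_square algebra_simps)
    qed
    then show ?thesis
      unfolding l2_inner_pw_grad by (simp add: sum.distrib sum_distrib_left)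
  qed
  then show ?thesis
    unfolding grad_form_def by (simp add: sum.distrib sum_distrib_left)
qed

lemma osc_vec:
  fixes w :: "real^'n \<Rightarrow> real^'n"
  shows "osc w = (\<Sum>i\<in>UNIV. osc (\<lambda>x. w x $ i))"
proof -
  have "osc w = (\<Sum>K\<in>\<T>. \<Sum>a\<in>verts K. \<Sum>b\<in>verts K. \<Sum>i\<in>UNIV. vol K * (w a $ i - w b $ i)\<^sup>2)"
    unfolding osc_def vec_sum_norm_square by (simp add: sum_distrib_left)
  also have "\<dots> = (\<Sum>K\<in>\<T>. \<Sum>i\<in>UNIV. \<Sum>a\<in>verts K. \<Sum>b\<in>verts K. vol K * (w a $ i - w b $ i)\<^sup>2)"
    by (intro sum.cong refl) (simp add: sum.swap[of _ "verts _" UNIV])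
  also have "\<dots> = (\<Sum>i\<in>UNIV. \<Sum>K\<in>\<T>. \<Sum>a\<in>verts K. \<Sum>b\<in>verts K. vol K * (w a $ i - w b $ i)\<^sup>2)"
    by (rule sum.swap)
  finally show ?thesis by (simp add: osc_def sum_distrib_left)
qed

lemma grad_form_le_osc:
  assumes "w \<in> U_h \<T>" shows "grad_form w w \<le> (1 / (2 * \<rho> * h))\<^sup>2 * osc w"
  unfolding grad_form_def osc_vec sum_distrib_left
  using grad_le_osc[OF U_h_nth[OF assms]] by (intro sum_mono)

lemma osc_le_grad_form:
  assumes "w \<in> U_h \<T>" shows "osc w \<le> (real (CARD('n) + 1) * h)\<^sup>2 * grad_form w w"
  unfolding grad_form_def osc_vec sum_distrib_left
  using osc_le_grad[OF U_h_nth[OF assms]] by (intro sum_mono)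

lemma node_mass_pos: "a \<in> nodes \<T> \<Longrightarrow> node_mass a > 0"
  using node_mass_lower[of a] \<rho>_pos h_pos by (intro less_le_trans[OF _ node_mass_lower]) auto

text \<open>The mass matrix is positive definite. This turns the second equation of the scheme into
  a pointwise identity at the nodes.\<close>

lemma X_h_zero_at_nodes:
  assumes P: "P \<in> X_h \<T>" "l2_inner \<Omega> P P = 0" and a: "a \<in> nodes \<T>"
  shows "P a = 0"
proof (rule ccontr)
  assume "P a \<noteq> 0"
  then have "0 < node_mass a * (P a)\<^sup>2" using node_mass_pos[OF a] by simp
  also have "\<dots> \<le> (\<Sum>a\<in>nodes \<T>. node_mass a * (P a)\<^sup>2)"
    using a finite_nodes node_mass_pos by (intro member_le_sum) (auto simp: less_imp_le)
  also have "\<dots> \<le> 0" using mass_lower[OF P(1)] P(2) by simp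
  finally show False by simp
qed

text \<open>At every node the increment is orthogonal to the old value, so the multiplier term, the
  cross product term and, when testing with multiples of the old value, also the time derivative
  drop out.\<close>

lemma scheme_step:
  fixes u0 u1 :: "real^'n \<Rightarrow> real^'n" and \<gamma> \<alpha> k :: real
  defines "\<delta> \<equiv> \<lambda>x. (u1 x - u0 x) /\<^sub>R k"
  assumes u: "u0 \<in> U_h \<T>" "u1 \<in> U_h \<T>" and k: "k > 0" and \<gamma>: "\<gamma> > 0" and \<alpha>: "\<alpha> = 0 \<or> bij e"
    and eq1: "\<And>w. w \<in> U_h \<T> \<Longrightarrow> lumped_inner \<Omega> \<T> \<delta> w
           + \<gamma> * l2_inner \<Omega> (wgrad_vec \<Omega> u1) (wgrad_vec \<Omega> w)
           + \<gamma> * l2_inner \<Omega> q (nodal_interp \<T> (\<lambda>x. normalized u0 x \<bullet> w x))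
           + \<alpha> * lumped_inner \<Omega> \<T> (\<lambda>x. cross_axes e (u0 x) (\<delta> x)) w = 0"
    and eq2: "\<And>p. p \<in> X_h \<T> \<Longrightarrow> l2_inner \<Omega> (nodal_interp \<T> (\<lambda>x. u0 x \<bullet> \<delta> x)) p = 0"
  shows scheme_orthogonal: "\<And>a. a \<in> nodes \<T> \<Longrightarrow> u0 a \<bullet> \<delta> a = 0"
    and scheme_energy: "k * ((lumped_norm \<Omega> \<T> \<delta>)\<^sup>2 + \<gamma> * k / 2 * (l2_norm \<Omega> (wgrad_vec \<Omega> \<delta>))\<^sup>2)
        + \<gamma> / 2 * (l2_norm \<Omega> (wgrad_vec \<Omega> u1))\<^sup>2 = \<gamma> / 2 * (l2_norm \<Omega> (wgrad_vec \<Omega> u0))\<^sup>2"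
    and scheme_multiplier: "\<And>p. p \<in> X_h \<T> \<Longrightarrow> (\<And>a. a \<in> nodes \<T> \<Longrightarrow> u0 a \<noteq> 0) \<Longrightarrow>
        l2_inner \<Omega> q p = - grad_form u1 (nodal_interp \<T> (\<lambda>x. p x *\<^sub>R normalized u0 x))"
    and scheme_norm_mono: "\<And>a. a \<in> nodes \<T> \<Longrightarrow> norm (u0 a) \<le> norm (u1 a)"
proof -
  have \<delta>: "\<delta> \<in> U_h \<T>"
  proof -
    have "(\<lambda>x. (1 / k) *\<^sub>R (u1 x + (- 1) *\<^sub>R u0 x)) \<in> U_h \<T>" by (intro U_h_scaleR U_h_diff_scaled u)
    then show ?thesis by (simp add: \<delta>_def inverse_eq_divide)
  qed
  \<comment> \<open>The scheme takes the gradient at the new time, so the old value is expanded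
    around the new one; the quadratic term of this expansion is the numerical dissipation.\<close>
  have u0_eq: "u0 = (\<lambda>x. u1 x + (- k) *\<^sub>R \<delta> x)" using k by (auto simp: \<delta>_def fun_eq_iff)
  show orth: "u0 a \<bullet> \<delta> a = 0" if a: "a \<in> nodes \<T>" for a
    using X_h_zero_at_nodes[OF nodal_interp_X_h eq2[OF nodal_interp_X_h] a]
    by (simp add: nodal_interp_node[OF a])
  \<comment> \<open>The cross product is orthogonal to both of its factors, hence to every nodal
    test value in their span.\<close>
  have cross: "\<alpha> * lumped_inner \<Omega> \<T> (\<lambda>x. cross_axes e (u0 x) (\<delta> x)) w = 0"
    if lc: "\<And>a. a \<in> nodes \<T> \<Longrightarrow> \<exists>r s. w a = r *\<^sub>R u0 a + s *\<^sub>R \<delta> a" for w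
  proof (cases "\<alpha> = 0")
    case False
    then have e: "bij e" using \<alpha> by simp
    have "lumped_inner \<Omega> \<T> (\<lambda>x. cross_axes e (u0 x) (\<delta> x)) w = 0"
    proof (rule lumped_inner_zero)
      fix a assume "a \<in> nodes \<T>"
      then obtain r s where "w a = r *\<^sub>R u0 a + s *\<^sub>R \<delta> a" using lc by blast
      then show "cross_axes e (u0 a) (\<delta> a) \<bullet> w a = 0" by (simp add: inner_add_right cross_axes_orthogonal[OF e])
    qed
    then show ?thesis by simp
  qed simp
  have c1: "\<alpha> * lumped_inner \<Omega> \<T> (\<lambda>x. cross_axes e (u0 x) (\<delta> x)) \<delta> = 0"
    by (rule cross) (rule exI[of _ 0], rule exI[of _ 1], simp)
  have "nodal_interp \<T> (\<lambda>x. normalized u0 x \<bullet> \<delta> x) = (\<lambda>x. 0)"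
    using orth by (intro nodal_interp_zero) (simp add: normalized_def)
  then have q0: "l2_inner \<Omega> q (nodal_interp \<T> (\<lambda>x. normalized u0 x \<bullet> \<delta> x)) = 0" by (simp add: l2_inner_def)
  have main: "(lumped_norm \<Omega> \<T> \<delta>)\<^sup>2 + \<gamma> * grad_form u1 \<delta> = 0"
    using eq1[OF \<delta>] c1 q0 by (simp add: lumped_norm_square l2_inner_wgrad_vec[OF u(2) \<delta>])
  have ex: "grad_form u0 u0 = grad_form u1 u1 - 2 * k * grad_form u1 \<delta> + k\<^sup>2 * grad_form \<delta> \<delta>"
    using grad_form_expand[OF u(2) \<delta>, of "- k"] u0_eq by simp
  have "\<gamma> / 2 * grad_form u0 u0 = \<gamma> / 2 * grad_form u1 u1 - k * (\<gamma> * grad_form u1 \<delta>) + \<gamma> * k\<^sup>2 / 2 * grad_form \<delta> \<delta>"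
    unfolding ex by (simp add: algebra_simps)
  also have "\<gamma> * grad_form u1 \<delta> = - (lumped_norm \<Omega> \<T> \<delta>)\<^sup>2" using main by linarith
  finally show "k * ((lumped_norm \<Omega> \<T> \<delta>)\<^sup>2 + \<gamma> * k / 2 * (l2_norm \<Omega> (wgrad_vec \<Omega> \<delta>))\<^sup>2)
        + \<gamma> / 2 * (l2_norm \<Omega> (wgrad_vec \<Omega> u1))\<^sup>2 = \<gamma> / 2 * (l2_norm \<Omega> (wgrad_vec \<Omega> u0))\<^sup>2"
    unfolding l2_norm_wgrad_vec[OF u(1)] l2_norm_wgrad_vec[OF u(2)] l2_norm_wgrad_vec[OF \<delta>]
    by (simp add: power2_eq_square algebra_simps)
  show "l2_inner \<Omega> q p = - grad_form u1 (nodal_interp \<T> (\<lambda>x. p x *\<^sub>R normalized u0 x))"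
    if p: "p \<in> X_h \<T>" and nz: "\<And>a. a \<in> nodes \<T> \<Longrightarrow> u0 a \<noteq> 0" for p
  proof -
    let ?w = "nodal_interp \<T> (\<lambda>x. p x *\<^sub>R normalized u0 x)"
    have w: "?w \<in> U_h \<T>" by (rule nodal_interp_U_h)
    have wa: "?w a = (p a / norm (u0 a)) *\<^sub>R u0 a" if "a \<in> nodes \<T>" for a
      using nodal_interp_node[OF that] by (simp add: normalized_def divide_inverse)
    have l0: "lumped_inner \<Omega> \<T> \<delta> ?w = 0"
      using orth wa by (intro lumped_inner_zero) (simp add: inner_commute)
    have c0: "\<alpha> * lumped_inner \<Omega> \<T> (\<lambda>x. cross_axes e (u0 x) (\<delta> x)) ?w = 0"
      using wa by (intro cross) (metis add.right_neutral scale_zero_left)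
    \<comment> \<open>Where the old value is nonzero its normalization is a unit vector, so the
      product recovers \<open>p\<close> at each node.\<close>
    have "nodal_interp \<T> (\<lambda>x. normalized u0 x \<bullet> ?w x) = nodal_interp \<T> p"
    proof (rule nodal_interp_cong)
      fix a assume a: "a \<in> nodes \<T>"
      show "normalized u0 a \<bullet> ?w a = p a"
        unfolding wa[OF a] unfolding normalized_def
        using nz[OF a] by (simp add: dot_square_norm power2_eq_square)
    qed
    then have ip: "nodal_interp \<T> (\<lambda>x. normalized u0 x \<bullet> ?w x) = p" by (simp add: nodal_interp_id[OF p])
    have "\<gamma> * (grad_form u1 ?w + l2_inner \<Omega> q p) = 0"
      using eq1[OF w] l0 c0 ip by (simp add: l2_inner_wgrad_vec[OF u(2) w] algebra_simps)
    then show ?thesis using \<gamma> by simp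
  qed
  show "norm (u0 a) \<le> norm (u1 a)" if a: "a \<in> nodes \<T>" for a
  proof (rule power2_le_imp_le)
    have "u1 a = u0 a + k *\<^sub>R \<delta> a" using k by (simp add: \<delta>_def)
    then have "(norm (u1 a))\<^sup>2 = (norm (u0 a))\<^sup>2 + (norm (k *\<^sub>R \<delta> a))\<^sup>2"
      using norm_add_Pythagorean[of "u0 a" "k *\<^sub>R \<delta> a"] orth[OF a] by (simp only: orthogonal_def inner_scaleR_right mult_zero_right)
    then show "(norm (u0 a))\<^sup>2 \<le> (norm (u1 a))\<^sup>2" by simp
  qed simp
qed

end

text \<open>The factor of \<open>projection_osc\<close>, the Poincare constant with h^2 taken out,
  and the overlap factor of \<open>patch_error_le\<close>.\<close>

definition smooth_const :: "nat \<Rightarrow> real \<Rightarrow> real \<Rightarrow> real" where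
  "smooth_const n \<rho> \<Lambda> = 6 * real (n + 1) * (mass_const n + 2) * (\<Lambda> ^ n * \<Lambda>\<^sup>2 * (real (n + 1) * ((\<Lambda> + 1) / \<rho>) ^ n))"

text \<open>This comes from \<open>osc_bounded\<close>; dividing by \<open>h0\<^sup>2\<close> leaves
  room for the factor h^2 when \<open>h > h0\<close>. \<open>V\<close> stands for the volume of the
  closed domain.\<close>

definition coarse_const :: "nat \<Rightarrow> real \<Rightarrow> real \<Rightarrow> real \<Rightarrow> real" where
  "coarse_const n \<rho> V h0 = V * (real (n + 1))\<^sup>2 * (4 * (proj_const n \<rho>)\<^sup>2) / h0\<^sup>2"

text \<open>The denominator is what remains of
  \<open>(1 / (2 * \<rho> * h))\<^sup>2 * (2 * h\<^sup>2)\<close>, the inverse estimate times the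
  scale of \<open>osc\<close>.\<close>

definition multiplier_const :: "nat \<Rightarrow> real \<Rightarrow> real \<Rightarrow> real \<Rightarrow> real \<Rightarrow> real" where
  "multiplier_const n \<rho> \<Lambda> V h0 = sqrt ((smooth_const n \<rho> \<Lambda> + coarse_const n \<rho> V h0
     + (proj_const n \<rho> * real (n + 1))\<^sup>2) / (2 * \<rho>\<^sup>2))"

context shaped_fem
begin

text \<open>A single bound of order h^2 for all meshes: Poincare patches if
  \<open>h \<le> h0\<close>, otherwise the maximum norm bound and
  \<open>h0\<^sup>2 \<le> h\<^sup>2\<close>.\<close>

lemma projection_osc_total:
  assumes q: "q \<in> L2 \<Omega>" and G: "G \<in> L2 \<Omega>" and w: "has_weak_gradient \<Omega> q G"
    and p: "p \<in> X_h \<T>" and proj: "\<And>w. w \<in> X_h \<T> \<Longrightarrow> l2_inner \<Omega> w q = l2_inner \<Omega> w p"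
    and pb: "\<And>a. a \<in> nodes \<T> \<Longrightarrow> \<bar>p a\<bar> \<le> proj_const CARD('n) \<rho> * Y"
    and h0: "h0 > 0" "\<Lambda> \<ge> 1"
    and poin: "\<And>a. h \<le> h0 \<Longrightarrow> a \<in> closure \<Omega> \<Longrightarrow> \<exists>c. (\<integral>x. indicator (cball a h) x * (q x - c)\<^sup>2 \<partial>lebesgue_on \<Omega>)
         \<le> \<Lambda> ^ CARD('n) * (\<Lambda> * h)\<^sup>2 * (\<integral>x. indicator (ball a (\<Lambda> * h)) x * (norm (G x))\<^sup>2 \<partial>lebesgue_on \<Omega>)"
  shows "osc p \<le> h\<^sup>2 * (smooth_const CARD('n) \<rho> \<Lambda> * l2_inner \<Omega> G G
     + coarse_const CARD('n) \<rho> (measure lebesgue (closure \<Omega>)) h0 * Y\<^sup>2)"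
proof -
  let ?S = "smooth_const CARD('n) \<rho> \<Lambda>" and ?V = "measure lebesgue (closure \<Omega>)"
  let ?C = "coarse_const CARD('n) \<rho> ?V h0"
  have S0: "0 \<le> ?S" using h0 \<rho>_pos mass_const_nonneg[of "CARD('n)"] by (simp add: smooth_const_def)
  have C0: "0 \<le> ?C" by (simp add: coarse_const_def)
  show ?thesis
  proof (cases "h \<le> h0")
    case True
    have "a \<in> closure \<Omega>" if "a \<in> nodes \<T>" for a
      using that verts_in Union_mesh by (auto simp: nodes_eq)
    then have "\<forall>a\<in>nodes \<T>. \<exists>c. (\<integral>x. indicator (cball a h) x * (q x - c)\<^sup>2 \<partial>lebesgue_on \<Omega>)
         \<le> \<Lambda> ^ CARD('n) * (\<Lambda> * h)\<^sup>2 * (\<integral>x. indicator (ball a (\<Lambda> * h)) x * (norm (G x))\<^sup>2 \<partial>lebesgue_on \<Omega>)"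
      using poin[OF True] by blast
    from bchoice[OF this] obtain c where c: "\<And>a. a \<in> nodes \<T> \<Longrightarrow> (\<integral>x. indicator (cball a h) x * (q x - c a)\<^sup>2 \<partial>lebesgue_on \<Omega>)
         \<le> \<Lambda> ^ CARD('n) * (\<Lambda> * h)\<^sup>2 * (\<integral>x. indicator (ball a (\<Lambda> * h)) x * (norm (G x))\<^sup>2 \<partial>lebesgue_on \<Omega>)"
      by blast
    have "patch_error q c \<le> \<Lambda> ^ CARD('n) * (\<Lambda> * h)\<^sup>2 * (real (CARD('n) + 1) * ((\<Lambda> + 1) / \<rho>) ^ CARD('n)) * l2_inner \<Omega> G G"
      using h0 by (intro patch_error_le[OF G] c) auto
    then have "6 * real (CARD('n) + 1) * (mass_const CARD('n) + 2) * patch_error q c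
        \<le> 6 * real (CARD('n) + 1) * (mass_const CARD('n) + 2) *
          (\<Lambda> ^ CARD('n) * (\<Lambda> * h)\<^sup>2 * (real (CARD('n) + 1) * ((\<Lambda> + 1) / \<rho>) ^ CARD('n)) * l2_inner \<Omega> G G)"
      using mass_const_nonneg[of "CARD('n)"] by (intro mult_left_mono) auto
    also have "\<dots> = h\<^sup>2 * (?S * l2_inner \<Omega> G G)" by (simp add: smooth_const_def power_mult_distrib mult_ac)
    also have "\<dots> \<le> h\<^sup>2 * (?S * l2_inner \<Omega> G G + ?C * Y\<^sup>2)" using C0 by (intro mult_left_mono) auto
    finally show ?thesis using projection_osc[OF q p proj, of c] by linarith
  next
    case False
    have "osc p \<le> ?V * (real (CARD('n) + 1))\<^sup>2 * (4 * (proj_const CARD('n) \<rho> * Y)\<^sup>2)"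
      by (rule osc_bounded[OF pb])
    also have "\<dots> = h0\<^sup>2 * (?C * Y\<^sup>2)" using h0 by (simp add: coarse_const_def power_mult_distrib)
    also have "\<dots> \<le> h\<^sup>2 * (?C * Y\<^sup>2)"
      using False h0 C0 by (intro mult_right_mono power_mono mult_nonneg_nonneg) auto
    also have "\<dots> \<le> h\<^sup>2 * (?S * l2_inner \<Omega> G G + ?C * Y\<^sup>2)"
      using S0 l2_inner_nonneg[of \<Omega> G] by (intro mult_left_mono) auto
    finally show ?thesis .
  qed
qed

text \<open>In the discrete product rule the oscillation of \<open>p\<close> meets vectors of length
  at most 1, that of \<open>u\<close> meets the maximum of \<open>p\<close>. Returning from
  oscillations to gradients cancels h^2.\<close>

lemma test_gradient_bound:
  fixes u :: "real^'n \<Rightarrow> real^'n"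
  assumes u: "\<And>a. a \<in> nodes \<T> \<Longrightarrow> norm (u a) \<le> 1"
    and p: "osc p \<le> h\<^sup>2 * (S * l2_inner \<Omega> G G + C * Y\<^sup>2)" and SC: "0 \<le> S" "0 \<le> C" and Y: "0 \<le> Y"
    and pb: "\<And>a. a \<in> nodes \<T> \<Longrightarrow> \<bar>p a\<bar> \<le> P * Y"
  shows "l2_norm \<Omega> (wgrad_vec \<Omega> (nodal_interp \<T> (\<lambda>x. p x *\<^sub>R u x)))
    \<le> sqrt ((S + C + (P * real (CARD('n) + 1))\<^sup>2) / (2 * \<rho>\<^sup>2)) * (l2_norm \<Omega> G + Y) * (1 + l2_norm \<Omega> (wgrad_vec \<Omega> (nodal_interp \<T> u)))"
proof -
  let ?w = "nodal_interp \<T> (\<lambda>x. p x *\<^sub>R u x)" and ?u = "nodal_interp \<T> u"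
  let ?n = "real (CARD('n) + 1)"
  define g where "g = l2_norm \<Omega> G"
  define s where "s = l2_norm \<Omega> (wgrad_vec \<Omega> ?u)"
  have g0: "0 \<le> g" "0 \<le> s" by (simp_all add: g_def s_def l2_norm_nonneg)
  have "osc ?w \<le> 2 * osc p + 2 * (P * Y)\<^sup>2 * osc ?u"
    using u pb by (intro osc_product) (auto simp: nodal_interp_node)
  also have "\<dots> \<le> 2 * (h\<^sup>2 * (S * g\<^sup>2 + C * Y\<^sup>2)) + 2 * (P * Y)\<^sup>2 * ((?n * h)\<^sup>2 * s\<^sup>2)"
    using p osc_le_grad_form[OF nodal_interp_U_h, of u]
    unfolding g_def s_def l2_norm_square l2_norm_wgrad_vec[OF nodal_interp_U_h, unfolded l2_norm_square, symmetric]
    by (intro add_mono mult_left_mono) (simp_all add: l2_inner_wgrad_vec nodal_interp_U_h)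
  also have "\<dots> = 2 * h\<^sup>2 * (S * g\<^sup>2 + C * Y\<^sup>2 + (P * ?n)\<^sup>2 * (Y\<^sup>2 * s\<^sup>2))"
  proof -
    have "2 * (h\<^sup>2 * (S * g\<^sup>2 + C * Y\<^sup>2)) + 2 * (P * Y)\<^sup>2 * ((n * h)\<^sup>2 * s\<^sup>2)
        = 2 * h\<^sup>2 * (S * g\<^sup>2 + C * Y\<^sup>2 + (P * n)\<^sup>2 * (Y\<^sup>2 * s\<^sup>2))" for n :: real
      by (simp add: power_mult_distrib algebra_simps)
    then show ?thesis .
  qed
  also have "\<dots> \<le> 2 * h\<^sup>2 * ((S + C + (P * ?n)\<^sup>2) * ((g + Y) * (1 + s))\<^sup>2)"
  proof (rule mult_left_mono)
    define X where "X = ((g + Y) * (1 + s))\<^sup>2"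
    have "g * 1 \<le> (g + Y) * (1 + s)" "Y * 1 \<le> (g + Y) * (1 + s)" "Y * s \<le> (g + Y) * (1 + s)"
      using g0 Y by (intro mult_mono; simp)+
    then have "(g * 1)\<^sup>2 \<le> X" "(Y * 1)\<^sup>2 \<le> X" "(Y * s)\<^sup>2 \<le> X"
      unfolding X_def using g0 Y by (intro power_mono; simp)+
    then have "S * g\<^sup>2 \<le> S * X" "C * Y\<^sup>2 \<le> C * X" "(P * ?n)\<^sup>2 * (Y\<^sup>2 * s\<^sup>2) \<le> (P * ?n)\<^sup>2 * X"
      using SC by (auto intro!: mult_left_mono simp: power_mult_distrib)
    then show "S * g\<^sup>2 + C * Y\<^sup>2 + (P * ?n)\<^sup>2 * (Y\<^sup>2 * s\<^sup>2) \<le> (S + C + (P * ?n)\<^sup>2) * ((g + Y) * (1 + s))\<^sup>2"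
      unfolding X_def[symmetric] by (simp add: distrib_right)
  qed simp
  finally have o: "osc ?w \<le> 2 * h\<^sup>2 * ((S + C + (P * ?n)\<^sup>2) * ((g + Y) * (1 + s))\<^sup>2)" .
  have "(l2_norm \<Omega> (wgrad_vec \<Omega> ?w))\<^sup>2 \<le> (1 / (2 * \<rho> * h))\<^sup>2 * osc ?w"
    unfolding l2_norm_wgrad_vec[OF nodal_interp_U_h] by (rule grad_form_le_osc[OF nodal_interp_U_h])
  also have "\<dots> \<le> (1 / (2 * \<rho> * h))\<^sup>2 * (2 * h\<^sup>2 * ((S + C + (P * ?n)\<^sup>2) * ((g + Y) * (1 + s))\<^sup>2))"
    using o by (intro mult_left_mono) auto
  also have "\<dots> = (S + C + (P * ?n)\<^sup>2) / (2 * \<rho>\<^sup>2) * ((g + Y) * (1 + s))\<^sup>2"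
    using h_pos \<rho>_pos by (simp add: power_divide power_mult_distrib)
  finally have "sqrt ((l2_norm \<Omega> (wgrad_vec \<Omega> ?w))\<^sup>2) \<le> sqrt ((S + C + (P * ?n)\<^sup>2) / (2 * \<rho>\<^sup>2) * ((g + Y) * (1 + s))\<^sup>2)"
    by (rule real_sqrt_le_mono)
  also have "\<dots> = sqrt ((S + C + (P * ?n)\<^sup>2) / (2 * \<rho>\<^sup>2)) * ((g + Y) * (1 + s))"
    using g0 Y by (simp only: real_sqrt_mult real_sqrt_abs) simp
  finally show ?thesis by (simp add: g_def s_def l2_norm_nonneg mult.assoc)
qed

end

text \<open>Membership in \<open>Linf\<close> makes the essential supremum finite, and excluding
  functions that vanish almost everywhere makes it positive, so the passage from
  \<open>ereal\<close> to \<open>real\<close> loses nothing.\<close>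

lemma Linf_bound:
  assumes q: "q \<in> Linf \<Omega>" and nz: "\<not> (AE x in lebesgue_on \<Omega>. q x = 0)"
  shows "AE x in lebesgue_on \<Omega>. \<bar>q x\<bar> \<le> linf_norm \<Omega> q" "linf_norm \<Omega> q > 0"
proof -
  let ?E = "esssup (lebesgue_on \<Omega>) (\<lambda>x. ereal \<bar>q x\<bar>)"
  have ae: "AE x in lebesgue_on \<Omega>. ereal \<bar>q x\<bar> \<le> ?E" by (rule esssup_AE)
  have "?E > 0"
  proof (rule ccontr)
    assume "\<not> ?E > 0"
    have "AE x in lebesgue_on \<Omega>. q x = 0"
      using ae
    proof eventually_elim
      case (elim x)
      then have "ereal \<bar>q x\<bar> \<le> 0" using \<open>\<not> ?E > 0\<close> by (meson not_le order_trans linorder_not_less)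
      then show ?case by simp
    qed
    with nz show False by blast
  qed
  moreover have "?E < \<infinity>" using q by (simp add: Linf_def)
  ultimately obtain y where y: "?E = ereal y" "y > 0" by (cases ?E) auto
  then have ln: "linf_norm \<Omega> q = y" by (simp add: linf_norm_def)
  show "linf_norm \<Omega> q > 0" using y ln by simp
  show "AE x in lebesgue_on \<Omega>. \<bar>q x\<bar> \<le> linf_norm \<Omega> q"
    using ae unfolding y(1) ln by simp
qed


section \<open>Induction over the time steps and the dual norm\<close>

context shaped_fem
begin

text \<open>Energy and nodal lengths share one induction. Lengths start at 1 and never decrease, so
  the old values stay away from zero and satisfy the hypothesis in
  \<open>gradient_decreasing\<close>.\<close>

lemma scheme_solution_invariants:
  fixes u :: "nat \<Rightarrow> real^'n \<Rightarrow> real^'n"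
  assumes sol: "scheme_solution \<Omega> \<T> e \<gamma> \<alpha> k N u q" and k: "k > 0" and \<gamma>: "\<gamma> > 0" and \<alpha>: "\<alpha> = 0 \<or> bij e"
    and u0: "u 0 \<in> U_h \<T>" "\<And>a. a \<in> nodes \<T> \<Longrightarrow> norm (u 0 a) = 1" and n: "n \<le> N"
  shows "u n \<in> U_h \<T> \<and> (\<forall>a\<in>nodes \<T>. 1 \<le> norm (u n a)) \<and>
     (\<Sum>i<n. k * ((lumped_norm \<Omega> \<T> (delta_t k u (i + 1)))\<^sup>2
        + \<gamma> * k / 2 * (l2_norm \<Omega> (wgrad_vec \<Omega> (delta_t k u (i + 1))))\<^sup>2))
     + \<gamma> / 2 * (l2_norm \<Omega> (wgrad_vec \<Omega> (u n)))\<^sup>2 = \<gamma> / 2 * (l2_norm \<Omega> (wgrad_vec \<Omega> (u 0)))\<^sup>2"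
  using n
proof (induction n)
  case 0
  then show ?case using u0 by simp
next
  case (Suc n)
  then have IH: "u n \<in> U_h \<T>" "\<And>a. a \<in> nodes \<T> \<Longrightarrow> 1 \<le> norm (u n a)" and n: "n < N" by auto
  have d: "delta_t k u (n + 1) = (\<lambda>x. (u (n + 1) x - u n x) /\<^sub>R k)" by (simp add: delta_t_def fun_eq_iff)
  have u1: "u (n + 1) \<in> U_h \<T>" using sol n by (simp add: scheme_solution_def)
  note eqs = sol[unfolded scheme_solution_def, rule_format, OF n, THEN conjunct2, THEN conjunct2]
  have eq1: "lumped_inner \<Omega> \<T> (\<lambda>x. (u (n + 1) x - u n x) /\<^sub>R k) w
           + \<gamma> * l2_inner \<Omega> (wgrad_vec \<Omega> (u (n + 1))) (wgrad_vec \<Omega> w)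
           + \<gamma> * l2_inner \<Omega> (q (n + 1)) (nodal_interp \<T> (\<lambda>x. normalized (u n) x \<bullet> w x))
           + \<alpha> * lumped_inner \<Omega> \<T> (\<lambda>x. cross_axes e (u n x) ((u (n + 1) x - u n x) /\<^sub>R k)) w = 0"
    if "w \<in> U_h \<T>" for w
    using eqs that unfolding d by blast
  have eq2: "l2_inner \<Omega> (nodal_interp \<T> (\<lambda>x. u n x \<bullet> ((u (n + 1) x - u n x) /\<^sub>R k))) p = 0"
    if "p \<in> X_h \<T>" for p
    using eqs that unfolding d by blast
  have "1 \<le> norm (u (n + 1) a)" if "a \<in> nodes \<T>" for a
    using scheme_norm_mono[OF IH(1) u1 k \<gamma> \<alpha> eq1 eq2 that] IH(2)[OF that] by linarith
  moreover have "k * ((lumped_norm \<Omega> \<T> (delta_t k u (n + 1)))\<^sup>2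
        + \<gamma> * k / 2 * (l2_norm \<Omega> (wgrad_vec \<Omega> (delta_t k u (n + 1))))\<^sup>2)
        + \<gamma> / 2 * (l2_norm \<Omega> (wgrad_vec \<Omega> (u (n + 1))))\<^sup>2 = \<gamma> / 2 * (l2_norm \<Omega> (wgrad_vec \<Omega> (u n)))\<^sup>2"
    unfolding d by (rule scheme_energy[OF IH(1) u1 k \<gamma> \<alpha> eq1 eq2])
  ultimately show ?case using Suc u1 by simp
qed

lemma scheme_gradient_bound:
  fixes u :: "nat \<Rightarrow> real^'n \<Rightarrow> real^'n"
  assumes "scheme_solution \<Omega> \<T> e \<gamma> \<alpha> k N u q" "k > 0" and \<gamma>: "\<gamma> > 0" and "\<alpha> = 0 \<or> bij e"
    and "u 0 \<in> U_h \<T>" "\<And>a. a \<in> nodes \<T> \<Longrightarrow> norm (u 0 a) = 1" "n \<le> N"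
  shows "l2_norm \<Omega> (wgrad_vec \<Omega> (u n)) \<le> l2_norm \<Omega> (wgrad_vec \<Omega> (u 0))"
proof -
  have "0 \<le> (\<Sum>i<n. k * ((lumped_norm \<Omega> \<T> (delta_t k u (i + 1)))\<^sup>2
        + \<gamma> * k / 2 * (l2_norm \<Omega> (wgrad_vec \<Omega> (delta_t k u (i + 1))))\<^sup>2))"
    using assms(2) \<gamma> by (intro sum_nonneg) auto
  then have "\<gamma> / 2 * (l2_norm \<Omega> (wgrad_vec \<Omega> (u n)))\<^sup>2 \<le> \<gamma> / 2 * (l2_norm \<Omega> (wgrad_vec \<Omega> (u 0)))\<^sup>2"
    using scheme_solution_invariants[OF assms] by linarith
  then have "(l2_norm \<Omega> (wgrad_vec \<Omega> (u n)))\<^sup>2 \<le> (l2_norm \<Omega> (wgrad_vec \<Omega> (u 0)))\<^sup>2"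
    using \<gamma> by simp
  then show ?thesis by (rule power2_le_imp_le) (rule l2_norm_nonneg)
qed

text \<open>For each admissible \<open>r\<close> the pairing passes to the projection
  \<open>p\<close> and then to the gradients of the new value and the test field. The latter is
  bounded by a multiple of the denominator of the quotient, which therefore cancels.\<close>

lemma dual_norm_bound:
  fixes u :: "nat \<Rightarrow> real^'n \<Rightarrow> real^'n"
  assumes sol: "scheme_solution \<Omega> \<T> e \<gamma> \<alpha> k N u q" and k: "k > 0" and \<gamma>: "\<gamma> > 0" and \<alpha>: "\<alpha> = 0 \<or> bij e"
    and u0: "u 0 \<in> U_h \<T>" "\<And>a. a \<in> nodes \<T> \<Longrightarrow> norm (u 0 a) = 1" and n: "n < N"
    and decr: "gradient_decreasing \<Omega> \<T>"
    and h0: "h0 > 0" "\<Lambda> \<ge> 1"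
    and poin: "\<And>a q G. h \<le> h0 \<Longrightarrow> a \<in> closure \<Omega> \<Longrightarrow> q \<in> L2 \<Omega> \<Longrightarrow> G \<in> L2 \<Omega> \<Longrightarrow> has_weak_gradient \<Omega> q G \<Longrightarrow>
       \<exists>c. (\<integral>x. indicator (cball a h) x * (q x - c)\<^sup>2 \<partial>lebesgue_on \<Omega>)
         \<le> \<Lambda> ^ CARD('n) * (\<Lambda> * h)\<^sup>2 * (\<integral>x. indicator (ball a (\<Lambda> * h)) x * (norm (G x))\<^sup>2 \<partial>lebesgue_on \<Omega>)"
  shows "dual_norm \<Omega> (q (n + 1)) \<le> ereal (multiplier_const CARD('n) \<rho> \<Lambda> (measure lebesgue (closure \<Omega>)) h0
     * (1 + l2_norm \<Omega> (wgrad_vec \<Omega> (u 0))) * l2_norm \<Omega> (wgrad_vec \<Omega> (u 0)))"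
  unfolding dual_norm_def
proof (rule SUP_least)
  let ?C = "multiplier_const CARD('n) \<rho> \<Lambda> (measure lebesgue (closure \<Omega>)) h0"
  let ?E = "l2_norm \<Omega> (wgrad_vec \<Omega> (u 0))"
  fix r assume "r \<in> {q \<in> H1 \<Omega> \<inter> Linf \<Omega>. \<not> (AE x in lebesgue_on \<Omega>. q x = 0)}"
  then have r: "r \<in> H1 \<Omega>" "r \<in> Linf \<Omega>" "\<not> (AE x in lebesgue_on \<Omega>. r x = 0)" by auto
  define Y where "Y = linf_norm \<Omega> r"
  define G where "G = wgrad \<Omega> r"
  have rY: "AE x in lebesgue_on \<Omega>. \<bar>r x\<bar> \<le> Y" "Y > 0" using Linf_bound[OF r(2,3)] by (simp_all add: Y_def)
  have r2: "r \<in> L2 \<Omega>" using r(1) by (simp add: H1_def)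
  have G: "G \<in> L2 \<Omega>" "has_weak_gradient \<Omega> r G" using wgrad_H1[OF open_dom r(1)] by (simp_all add: G_def)
  obtain p where p: "p \<in> X_h \<T>" "\<And>w. w \<in> X_h \<T> \<Longrightarrow> l2_inner \<Omega> w r = l2_inner \<Omega> w p"
    "\<And>a. a \<in> nodes \<T> \<Longrightarrow> \<bar>p a\<bar> \<le> proj_const CARD('n) \<rho> * Y"
    using L2_projection_bounded[OF r2 rY(1)] rY(2) by (meson less_imp_le)
  have osc: "osc p \<le> h\<^sup>2 * (smooth_const CARD('n) \<rho> \<Lambda> * l2_inner \<Omega> G G
     + coarse_const CARD('n) \<rho> (measure lebesgue (closure \<Omega>)) h0 * Y\<^sup>2)"
    by (rule projection_osc_total[OF r2 G p h0 poin[OF _ _ r2 G]])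
  have inv: "u n \<in> U_h \<T>" "\<And>a. a \<in> nodes \<T> \<Longrightarrow> 1 \<le> norm (u n a)"
    using scheme_solution_invariants[OF sol k \<gamma> \<alpha> u0, of n] n by auto
  have u1: "u (n + 1) \<in> U_h \<T>" and q1: "q (n + 1) \<in> X_h \<T>" using sol n by (simp_all add: scheme_solution_def)
  have grad: "l2_norm \<Omega> (wgrad_vec \<Omega> (u m)) \<le> ?E" if "m \<le> N" for m
    by (rule scheme_gradient_bound[OF sol k \<gamma> \<alpha> u0 that])
  let ?un = "normalized (u n)"
  let ?w = "nodal_interp \<T> (\<lambda>x. p x *\<^sub>R ?un x)"
  \<comment> \<open>\<open>gradient_decreasing\<close> compares with \<open>u n\<close>, whose
    gradient the energy bounds by the initial one.\<close>
  have decr_n: "l2_norm \<Omega> (wgrad_vec \<Omega> (nodal_interp \<T> ?un)) \<le> ?E"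
    using decr inv grad[of n] n unfolding gradient_decreasing_def by fastforce
  have d: "delta_t k u (n + 1) = (\<lambda>x. (u (n + 1) x - u n x) /\<^sub>R k)" by (simp add: delta_t_def fun_eq_iff)
  note eqs = sol[unfolded scheme_solution_def, rule_format, OF n, THEN conjunct2, THEN conjunct2]
  have mult: "l2_inner \<Omega> (q (n + 1)) p = - grad_form (u (n + 1)) ?w"
  proof (rule scheme_multiplier[OF inv(1) u1 k \<gamma> \<alpha> _ _ p(1)])
    show "lumped_inner \<Omega> \<T> (\<lambda>x. (u (n + 1) x - u n x) /\<^sub>R k) w
           + \<gamma> * l2_inner \<Omega> (wgrad_vec \<Omega> (u (n + 1))) (wgrad_vec \<Omega> w)
           + \<gamma> * l2_inner \<Omega> (q (n + 1)) (nodal_interp \<T> (\<lambda>x. normalized (u n) x \<bullet> w x))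
           + \<alpha> * lumped_inner \<Omega> \<T> (\<lambda>x. cross_axes e (u n x) ((u (n + 1) x - u n x) /\<^sub>R k)) w = 0"
      if "w \<in> U_h \<T>" for w using eqs that unfolding d by blast
    show "l2_inner \<Omega> (nodal_interp \<T> (\<lambda>x. u n x \<bullet> ((u (n + 1) x - u n x) /\<^sub>R k))) p = 0"
      if "p \<in> X_h \<T>" for p using eqs that unfolding d by blast
    show "u n a \<noteq> 0" if "a \<in> nodes \<T>" for a using inv(2)[OF that] by auto
  qed
  have w_bound: "l2_norm \<Omega> (wgrad_vec \<Omega> ?w) \<le> ?C * (l2_norm \<Omega> G + Y) * (1 + l2_norm \<Omega> (wgrad_vec \<Omega> (nodal_interp \<T> ?un)))"
    unfolding multiplier_const_def
  proof (rule test_gradient_bound[OF _ osc])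
    show "norm (?un a) \<le> 1" for a by (cases "u n a = 0") (simp_all add: normalized_def)
    show "0 \<le> smooth_const CARD('n) \<rho> \<Lambda>"
      using h0 \<rho>_pos mass_const_nonneg[of "CARD('n)"] by (simp add: smooth_const_def)
    show "0 \<le> coarse_const CARD('n) \<rho> (measure lebesgue (closure \<Omega>)) h0" by (simp add: coarse_const_def)
  qed (use rY p in auto)
  have C0: "0 \<le> ?C"
    unfolding multiplier_const_def smooth_const_def coarse_const_def
    using h0 \<rho>_pos mass_const_nonneg[of "CARD('n)"]
    by (intro real_sqrt_ge_zero divide_nonneg_nonneg add_nonneg_nonneg mult_nonneg_nonneg) auto
  have GY: "0 < l2_norm \<Omega> G + Y" using l2_norm_nonneg[of \<Omega> G] rY(2) by linarith
  have "l2_inner \<Omega> (q (n + 1)) r = l2_inner \<Omega> (q (n + 1)) p" by (rule p(2)[OF q1])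
  also have "\<dots> \<le> \<bar>grad_form (u (n + 1)) ?w\<bar>" unfolding mult by simp
  also have "\<dots> \<le> l2_norm \<Omega> (wgrad_vec \<Omega> (u (n + 1))) * l2_norm \<Omega> (wgrad_vec \<Omega> ?w)"
    by (rule grad_form_Cauchy_Schwarz[OF u1 nodal_interp_U_h])
  also have "\<dots> \<le> ?E * (?C * (l2_norm \<Omega> G + Y) * (1 + ?E))"
  proof (rule mult_mono)
    show "l2_norm \<Omega> (wgrad_vec \<Omega> (u (n + 1))) \<le> ?E" using grad[of "n + 1"] n by simp
    show "l2_norm \<Omega> (wgrad_vec \<Omega> ?w) \<le> ?C * (l2_norm \<Omega> G + Y) * (1 + ?E)"
      using C0 GY by (intro order_trans[OF w_bound] mult_left_mono add_left_mono decr_n) simp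
  qed (simp_all add: l2_norm_nonneg)
  finally have "l2_inner \<Omega> (q (n + 1)) r \<le> (?C * (1 + ?E) * ?E) * (l2_norm \<Omega> G + Y)" by (simp only: mult_ac)
  then have "l2_inner \<Omega> (q (n + 1)) r / (l2_norm \<Omega> G + Y) \<le> ?C * (1 + ?E) * ?E"
    using GY by (simp add: pos_divide_le_eq)
  then show "ereal (l2_inner \<Omega> (q (n + 1)) r / (l2_norm \<Omega> (wgrad \<Omega> r) + linf_norm \<Omega> r)) \<le> ereal (?C * (1 + ?E) * ?E)"
    by (simp add: G_def Y_def)
qed

end

section \<open>From the geometric hypotheses to uniform constants\<close>

lemma polyhedral_boundary_negligible:
  assumes "polyhedral_boundary \<Omega>" shows "negligible (frontier (\<Omega> :: (real^'n) set))"
proof -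
  obtain F where F: "finite F" "\<And>P. P \<in> F \<Longrightarrow> polytope P \<and> aff_dim P = int CARD('n) - 1" "frontier \<Omega> = \<Union>F"
    using assms unfolding polyhedral_boundary_def by blast
  have "negligible P" if "P \<in> F" for P
  proof -
    \<comment> \<open>A facet has dimension one less than the space; a convex set with empty
      interior is a null set.\<close>
    have "interior P = {}" using F(2)[OF that] by (intro low_dim_interior) simp
    then show ?thesis using F(2)[OF that] polytope_imp_convex negligible_convex_interior by blast
  qed
  then show ?thesis using F(1,3) by (simp add: negligible_Union)
qed

text \<open>Shape regularity and quasi-uniformity combine to
  \<open>c * h \<le> \<sigma> * in_diameter K\<close> on every simplex of every mesh.\<close>

lemma mesh_family_shaped:
  fixes \<Omega> :: "(real^'n) set"
  assumes \<Omega>: "open \<Omega>" "bounded \<Omega>" "negligible (frontier \<Omega>)"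
    and fam: "mesh_family \<Omega> \<H> \<T>" and sr: "shape_regular \<H> \<T>" and qu: "quasi_uniform \<H> \<T>"
  obtains \<rho> where "\<rho> > 0" "\<And>h. h \<in> \<H> \<Longrightarrow> shaped_fem \<Omega> (\<T> h) h \<rho>"
proof -
  obtain \<sigma> where \<sigma>: "\<sigma> > 0" "\<And>h K. h \<in> \<H> \<Longrightarrow> K \<in> \<T> h \<Longrightarrow> diameter K \<le> \<sigma> * in_diameter K"
    using sr unfolding shape_regular_def by blast
  obtain c where c: "c > 0" "\<And>h K. h \<in> \<H> \<Longrightarrow> K \<in> \<T> h \<Longrightarrow> c * h \<le> diameter K"
    using qu unfolding quasi_uniform_def by blast
  \<comment> \<open>Half of the radius \<open>c / (2 * \<sigma>)\<close> suggested by the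
    inequalities: strictness is what produces an actual ball below the supremum in
    \<open>in_diameter\<close>.\<close>
  define \<rho> where "\<rho> = c / (4 * \<sigma>)"
  have \<rho>: "\<rho> > 0" using c \<sigma> by (simp add: \<rho>_def)
  have "shaped_fem \<Omega> (\<T> h) h \<rho>" if h: "h \<in> \<H>" for h
  proof -
    have h_pos: "h > 0" and m: "is_mesh \<Omega> (\<T> h)" and hmax: "h = Max (diameter ` \<T> h)"
      using fam h unfolding mesh_family_def by auto
    interpret mesh \<Omega> "\<T> h" by standard (rule m)
    show ?thesis
    proof
      show "open \<Omega>" "bounded \<Omega>" "negligible (frontier \<Omega>)" by (fact \<Omega>)+
      show "h > 0" "\<rho> > 0" by (fact h_pos \<rho>)+
      fix K assume K: "K \<in> \<T> h"
      show "norm (x - y) \<le> h" if "x \<in> K" "y \<in> K" for x y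
      proof -
        have "dist x y \<le> diameter K"
          using that compact_imp_bounded[OF compact_mesh[OF K]] by (intro diameter_bounded_bound)
        also have "\<dots> \<le> Max (diameter ` \<T> h)" using K finite_mesh by (intro Max_ge) auto
        finally show ?thesis using hmax by (simp add: dist_norm)
      qed
      let ?X = "{2 * r | r x. r \<ge> 0 \<and> cball x r \<subseteq> K}"
      obtain x0 where "x0 \<in> K" using verts_nonempty[OF K] verts_subset by blast
      \<comment> \<open>A ball of radius zero shows that the supremum is over a nonempty
        set.\<close>
      then have "cball x0 0 \<subseteq> K" by simp
      then have ne: "?X \<noteq> {}" by blast
      have "c * h \<le> \<sigma> * in_diameter K" using \<sigma>(2)[OF h K] c(2)[OF h K] by linarith
      moreover have "\<sigma> * (2 * \<rho> * h) < c * h"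
        using \<sigma> c h_pos by (simp add: \<rho>_def)
      ultimately have "\<sigma> * (2 * \<rho> * h) < \<sigma> * in_diameter K" by linarith
      then have "2 * \<rho> * h < Sup ?X" using \<sigma>(1) by (simp add: in_diameter_def)
      then obtain y where "y \<in> ?X" "2 * \<rho> * h < y" using less_cSupE[OF _ ne] by blast
      then obtain r x where "cball x r \<subseteq> K" "\<rho> * h < r" by auto
      then show "\<exists>z. cball z (\<rho> * h) \<subseteq> K" by (meson less_imp_le order_trans subset_cball)
    qed
  qed
  with \<rho> that show thesis by blast
qed

theorem theorem5p1:
  fixes \<Omega> :: "(real^'n) set"
    and \<H> :: "real set"
    and \<T> :: "real \<Rightarrow> (real^'n) set set"
    and e :: "3 \<Rightarrow> 'n"
    and \<gamma> \<alpha> T :: real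
    and u0 :: "real^'n \<Rightarrow> real^'n"
  assumes "CARD('n) = 2 \<or> CARD('n) = 3"
    and "CARD('n) = 3 \<Longrightarrow> bij e"
    and "polyhedral_lipschitz_domain \<Omega>"
    and "mesh_family \<Omega> \<H> \<T>"
    and "shape_regular \<H> \<T>"
    and "quasi_uniform \<H> \<T>"
    and "\<And>h. h \<in> \<H> \<Longrightarrow> gradient_decreasing \<Omega> (\<T> h)"
    and "\<gamma> > 0"
    and "\<alpha> \<ge> 0"
    and "CARD('n) = 2 \<Longrightarrow> \<alpha> = 0"
    and "u0 \<in> H1_vec \<Omega>"
    and "AE x in lebesgue_on \<Omega>. norm (u0 x) = 1"
    and "T > 0"
  shows "\<exists>C>0. \<forall>h\<in>\<H>. \<forall>N\<ge>1. \<forall>k u q.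
           k = T / real N \<longrightarrow>
           u 0 \<in> U_h (\<T> h) \<longrightarrow>
           (\<forall>a\<in>nodes (\<T> h). norm (u 0 a) = 1) \<longrightarrow>
           l2_norm \<Omega> (wgrad_vec \<Omega> (u 0)) \<le> l2_norm \<Omega> (wgrad_vec \<Omega> u0) \<longrightarrow>
           scheme_solution \<Omega> (\<T> h) e \<gamma> \<alpha> k N u q \<longrightarrow>
             (\<forall>m<N.
               (\<Sum>n=0..m. k * ((lumped_norm \<Omega> (\<T> h) (delta_t k u (n + 1)))\<^sup>2
                  + \<gamma> * k / 2 * (l2_norm \<Omega> (wgrad_vec \<Omega> (delta_t k u (n + 1))))\<^sup>2))
               + \<gamma> / 2 * (l2_norm \<Omega> (wgrad_vec \<Omega> (u (m + 1))))\<^sup>2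
               = \<gamma> / 2 * (l2_norm \<Omega> (wgrad_vec \<Omega> (u 0)))\<^sup>2)
             \<and> Max ((\<lambda>n. dual_norm \<Omega> (q n)) ` {1..N})
                 \<le> ereal (C * (1 + l2_norm \<Omega> (wgrad_vec \<Omega> (u 0))) * l2_norm \<Omega> (wgrad_vec \<Omega> (u 0)))"
proof -
  have dom: "open \<Omega>" "bounded \<Omega>" "lipschitz_boundary \<Omega>" "polyhedral_boundary \<Omega>"
    using assms(3) by (auto simp: polyhedral_lipschitz_domain_def)
  obtain \<rho> where \<rho>: "\<rho> > 0" "\<And>h. h \<in> \<H> \<Longrightarrow> shaped_fem \<Omega> (\<T> h) h \<rho>"
    using mesh_family_shaped[OF dom(1,2) polyhedral_boundary_negligible[OF dom(4)] assms(4-6)] by blast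
  obtain h0 \<Lambda> where h0: "h0 > 0" "\<Lambda> \<ge> 1"
    and poin: "\<And>h a q G. 0 < h \<Longrightarrow> h \<le> h0 \<Longrightarrow> a \<in> closure \<Omega> \<Longrightarrow> q \<in> L2 \<Omega> \<Longrightarrow> G \<in> L2 \<Omega> \<Longrightarrow> has_weak_gradient \<Omega> q G \<Longrightarrow>
       \<exists>c. (\<integral>x. indicator (cball a h) x * (q x - c)\<^sup>2 \<partial>lebesgue_on \<Omega>)
         \<le> \<Lambda> ^ CARD('n) * (\<Lambda> * h)\<^sup>2 * (\<integral>x. indicator (ball a (\<Lambda> * h)) x * (norm (G x))\<^sup>2 \<partial>lebesgue_on \<Omega>)"
    using Poincare_patch[OF dom(1-3)] by blast
  \<comment> \<open>Dimension two forces \<open>\<alpha> = 0\<close>, dimension three makes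
    \<open>e\<close> a bijection.\<close>
  have \<alpha>: "\<alpha> = 0 \<or> bij e" using assms(1,2,10) by blast
  \<comment> \<open>Adding 1 secures positivity. All ingredients are fixed before the mesh size, the
    number of time steps and the solution.\<close>
  define C where "C = \<bar>multiplier_const CARD('n) \<rho> \<Lambda> (measure lebesgue (closure \<Omega>)) h0\<bar> + 1"
  show ?thesis
  proof (rule exI[of _ C], intro conjI ballI allI impI)
    show "C > 0" by (simp add: C_def add_nonneg_pos)
    fix h N k and u :: "nat \<Rightarrow> real^'n \<Rightarrow> real^'n" and q
    assume h: "h \<in> \<H>" and N: "(1::nat) \<le> N" and k: "k = T / real N" and u0: "u 0 \<in> U_h (\<T> h)"
      and u0n: "\<forall>a\<in>nodes (\<T> h). norm (u 0 a) = 1"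
      and sol: "scheme_solution \<Omega> (\<T> h) e \<gamma> \<alpha> k N u q"
    interpret shaped_fem \<Omega> "\<T> h" h \<rho> by (rule \<rho>(2)[OF h])
    have k_pos: "k > 0" using assms(13) N k by simp
    note inv = scheme_solution_invariants[OF sol k_pos assms(8) \<alpha> u0 u0n[rule_format]]
    {
      fix m assume m: "m < N"
      \<comment> \<open>The sum up to \<open>m\<close> has \<open>m + 1\<close> terms, so the
        invariant is read off at time index \<open>Suc m\<close>.\<close>
      have "{0..m} = {..<Suc m}" by auto
      then show "(\<Sum>n=0..m. k * ((lumped_norm \<Omega> (\<T> h) (delta_t k u (n + 1)))\<^sup>2
                  + \<gamma> * k / 2 * (l2_norm \<Omega> (wgrad_vec \<Omega> (delta_t k u (n + 1))))\<^sup>2))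
               + \<gamma> / 2 * (l2_norm \<Omega> (wgrad_vec \<Omega> (u (m + 1))))\<^sup>2
               = \<gamma> / 2 * (l2_norm \<Omega> (wgrad_vec \<Omega> (u 0)))\<^sup>2"
        using inv[of "Suc m"] m by simp
    }
    let ?E = "l2_norm \<Omega> (wgrad_vec \<Omega> (u 0))"
    have "dual_norm \<Omega> (q n) \<le> ereal (C * (1 + ?E) * ?E)" if n: "n \<in> {1..N}" for n
    proof -
      \<comment> \<open>Multipliers are indexed from 1; the one at \<open>n' + 1\<close> belongs to
        the step with old value \<open>u n'\<close>.\<close>
      obtain n' where n': "n = n' + 1" "n' < N" using n by (cases n) auto
      have "dual_norm \<Omega> (q (n' + 1)) \<le> ereal (multiplier_const CARD('n) \<rho> \<Lambda> (measure lebesgue (closure \<Omega>)) h0 * (1 + ?E) * ?E)"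
        by (rule dual_norm_bound[OF sol k_pos assms(8) \<alpha> u0 u0n[rule_format] n'(2) assms(7)[OF h] h0 poin[OF h_pos]])
      also have "\<dots> \<le> ereal (C * (1 + ?E) * ?E)"
      proof -
        have "multiplier_const CARD('n) \<rho> \<Lambda> (measure lebesgue (closure \<Omega>)) h0 \<le> C" by (simp add: C_def)
        then show ?thesis
          unfolding ereal_less_eq(3) using l2_norm_nonneg[of \<Omega> "wgrad_vec \<Omega> (u 0)"]
          by (intro mult_right_mono) auto
      qed
      finally show ?thesis by (simp only: n'(1))
    qed
    then show "Max ((\<lambda>n. dual_norm \<Omega> (q n)) ` {1..N}) \<le> ereal (C * (1 + ?E) * ?E)"
      using N by (subst Max_le_iff) auto
  qed
qed

end
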